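(* Let $\mathbf{k}$ be a field, $n\ge 1$, and $R$ a commutative $\mathbf{k}$-algebra. There is a natural explicit bijection (the assignment $(\mathfrak m_\bullet)\mapsto r$ written out in the context) between $\mathcal{M}_\infty(\mathcal{A}_n\otimes R)$ and the set of equivalence classes of formal skew-symmetric solutions $r^{x_1x_2}_{y_1y_2}$ of the general associative Yang--Baxter equation of the following type: $x_1,x_2,y_1,y_2$ are formal variables, $$r^{x_1x_2}_{y_1y_2}\in \mathrm{Mat}_n(\mathbf{k})\otimes \mathrm{Mat}_n(\mathbf{k})\otimes R[[x_1,x_2,y_1,y_2]][(x_2-x_1)^{-1}(y_2-y_1)^{-1}]$$ has the form $$r^{x_1x_2}_{y_1y_2}\equiv \frac{\mathrm{id}\otimes \mathrm{id}}{x_2-x_1}+\frac{\mathrm{P}}{y_1-y_2}\quad \mathrm{mod}\ \ \mathrm{Mat}_n(\mathbf{k})\otimes \mathrm{Mat}_n(\mathbf{k})\otimes R[[x_1,x_2,y_1,y_2]],$$ it satisfies the skew-symmetry condition $(r^{x_1x_2}_{y_1y_2})^{21}=-r^{x_2x_1}_{y_2y_1}$, and it satisfies the general AYBE $$(r^{x_2x_1}_{y_2y_3})^{12}(r^{x_1x_3}_{y_1y_3})^{13}-(r^{x_1x_3}_{y_1y_2})^{23}(r^{x_2x_3}_{y_2y_3})^{12}+(r^{x_2x_3}_{y_1y_3})^{13}(r^{x_1x_2}_{y_1y_2})^{23}=0$$ in $\mathrm{Mat}_n(\mathbf{k})^{\otimes 3}\otimes R[[x_1,x_2,x_3,y_1,y_2,y_3]][\Delta^{-1}]$,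 where $\Delta=\prod_{i<j}(x_j-x_i)(y_j-y_i)$. Two such solutions $r,\tilde r$ are equivalent if $$\tilde r^{x_1x_2}_{y_1y_2}=(\varphi^{x_1}_{y_2}\otimes\varphi^{x_2}_{y_1})\, r^{x_1x_2}_{y_1y_2}\,(\varphi^{x_2}_{y_2}\otimes\varphi^{x_1}_{y_1})^{-1}$$ for some $\varphi^x_y\in \mathrm{Mat}_n(R)[[x,y]]$ with $\varphi^x_y\equiv\mathrm{Id}$ modulo the ideal $(x,y)$. Moreover, considering the more general equivalences, in which the constant term of $\varphi^x_y$ is only required to be an invertible matrix in $\mathrm{Mat}_n(R)$, corresponds under this bijection to considering general cyclic $A_\infty$-equivalences (with $\mathfrak f^1$ not necessarily the identity) of the cyclic $A_\infty$-structures.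
   Context: **The category $\mathcal{A}=\mathcal{A}_n$.** It has two objects $X,Y$ and free graded $\mathbb{Z}$-modules of morphisms $\mathrm{Hom}(X,Y)=\mathrm{Hom}^0(X,Y)=\bigoplus_{\alpha=1}^n\mathbb{Z}\theta_\alpha$, $\mathrm{Hom}(Y,X)=\mathrm{Hom}^1(Y,X)=\bigoplus_{\alpha=1}^n\mathbb{Z}\eta_\alpha$, $\mathrm{Hom}^0(X,X)=\mathbb{Z}\,\mathrm{id}_X$, $\mathrm{Hom}^1(X,X)=\mathbb{Z}\xi_X$, $\mathrm{Hom}^0(Y,Y)=\mathbb{Z}\,\mathrm{id}_Y$, $\mathrm{Hom}^1(Y,Y)=\mathbb{Z}\xi_Y$ (other components zero). Compositions are read from right to left. The product $\mathfrak m_2$ is: $\mathfrak m_2(a,\mathrm{id})=a$, $\mathfrak m_2(\mathrm{id},a)=(-1)^{|a|}a$ for $\mathrm{id}=\mathrm{id}_X,\mathrm{id}_Y$ whenever composable, $\mathfrak m_2(\eta_\alpha,\theta_\beta)=\delta_{\alpha\beta}\xi_X$, $\mathfrak m_2(\theta_\alpha,\eta_\beta)=-\delta_{\alpha\beta}\xi_Y$; all other $\mathfrak m_2$-products of basis elements are zero. The pairing is $\langle\eta_\alpha,\theta_\beta\rangle=-\langle\theta_\beta,\eta_\alpha\rangle=\delta_{\alpha\beta}$, $\langle\xi_X,\mathrm{id}_X\rangle=-\langle\mathrm{id}_X,\xi_X\rangle=1$, $\langle\xi_Y,\mathrm{id}_Y\rangle=-\langle\mathrm{id}_Y,\xi_Y\rangle=1$.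 **$A_\infty$-conventions.** An $A_\infty$-structure consists of operations $\mathfrak m_k$ of degree $2-k$ with $$\sum_{m,l}(-1)^{|a_1|+\dots+|a_l|-l}\,\mathfrak m_{d-m+1}(a_d,\dots,a_{l+m+1},\mathfrak m_m(a_{l+m},\dots,a_{l+1}),a_l,\dots,a_1)=0 .$$ It is minimal if $\mathfrak m_1=0$, and strictly unital if $\mathfrak m_2(a,\mathrm{id})=a$ and $\mathfrak m_2(\mathrm{id},a)=(-1)^{|a|}a$ for $\mathrm{id}=\mathrm{id}_X,\mathrm{id}_Y$ whenever composable, and $\mathfrak m_k$ ($k\neq 2$) vanishes when one argument is $\mathrm{id}_X$ or $\mathrm{id}_Y$. It is cyclic (with respect to the pairing $\langle\ ,\ \rangle$) if $$\langle a_{k+1},\mathfrak m_k(a_k,\dots,a_1)\rangle=(-1)^{(|a_{k+1}|-1)(|a_1|+\dots+|a_k|-k)}\langle a_k,\mathfrak m_k(a_{k-1},\dots,a_1,a_{k+1})\rangle .$$ All $A_\infty$-structures on $\mathcal{A}\otimes R$ considered are $R$-multilinear and have as $\mathfrak m_2$ the $R$-bilinear extension of the product of $\mathcal{A}$, i.e. $\mathfrak m_2(a,\mathrm{id})=a$, $\mathfrak m_2(\mathrm{id},a)=(-1)^{|a|}a$, $\mathfrak m_2(\eta_\alpha,\theta_\beta)=\delta_{\alpha\beta}\xi_X$, $\mathfrak m_2(\theta_\alpha,\eta_\beta)=-\delta_{\alpha\beta}\xi_Y$, and all other $\mathfrak m_2$-products of basis elements zero. An $A_\infty$-functor $\mathfrak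 f=(\mathfrak f^k)_{k\ge1}$ from $(\mathfrak m_\bullet)$ to $(\mathfrak m'_\bullet)$ satisfies $\sum_{r}\sum_{s_1+\dots+s_r=d}\mathfrak m'_r(\mathfrak f^{s_r}(a_d,\dots),\dots,\mathfrak f^{s_1}(\dots,a_1))=\sum_{m,l}(-1)^{|a_1|+\dots+|a_l|-l}\mathfrak f^{d-m+1}(a_d,\dots,\mathfrak m_m(a_{l+m},\dots,a_{l+1}),a_l,\dots,a_1)$; functors between strictly unital structures are strictly unital, and here they are the identity on objects. It is cyclic if $\langle\mathfrak f^1(a_2),\mathfrak f^1(a_1)\rangle=\langle a_2,a_1\rangle$ and $\sum_{k+l=N}\langle\mathfrak f^l(a_N,\dots,a_{k+1}),\mathfrak f^k(a_k,\dots,a_1)\rangle=0$ for every $N\ge3$ and all composable sequences. An equivalence is one with $\mathfrak f^1$ invertible; it is called strict if $\mathfrak f^1=\mathrm{id}$. $\mathcal{M}_\infty(\mathcal{A}\otimes R)$ is the set of cyclic, strictly unital, minimal $A_\infty$-structures on $\mathcal{A}\otimes R$ (with $\mathfrak m_2$ the $R$-bilinear extension of the product $\mathfrak m_2$ of $\mathcal{A}$) modulo strict cyclic $A_\infty$-equivalence. **Tensor notation.** $(e_{ij})$ is the standard basis of $\mathrm{Mat}_n(\mathbf{k})$, $e_{ij}\mathbf e_k=\delta_{jk}\mathbf e_i$; $\mathrm{P}=\sum_{i,j}e_{ij}\otimes e_{ji}$ is the transposition operator $\mathrm P(x\otimes y)=y\otimes x$. For $r\in\mathrm{Mat}_n\otimes\mathrm{Mat}_n$,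 $r^{21}$ is obtained by exchanging the tensor factors, and $r^{ij}\in\mathrm{Mat}_n^{\otimes3}$ is $r$ placed in the factors $i,j$. In expressions such as $r^{x_2x_1}_{y_2y_3}$ the formal variables are substituted accordingly. **The explicit assignment.** To an $A_\infty$-structure $(\mathfrak m_\bullet)$ one associates $$r^{x_1x_2}_{y_1y_2}=\frac{\mathrm{id}\otimes\mathrm{id}}{x_2-x_1}+\frac{\mathrm P}{y_1-y_2}+\sum_{\alpha,\alpha',\beta,\beta'}\ \sum_{a,b,c,d\ge0}x_1^a y_1^b x_2^c y_2^d\,\big\langle\mathfrak m_{3+a+b+c+d}(\xi_Y^{d},\theta_{\alpha'},\xi_X^{c},\eta_\beta,\xi_Y^{b},\theta_\alpha,\xi_X^{a}),\eta_{\beta'}\big\rangle\; e_{\beta'\alpha'}\otimes e_{\beta\alpha},$$ where $\xi^{a}$ means $\xi$ inserted $a$ times. (This is the dualized triple Massey product of $X_1\to Y_1\to X_2\to Y_2$ for the twisted objects $X_i=(X,x_i\xi_X)$, $Y_i=(Y,y_i\xi_Y)$.) *)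

theory Defs
  imports "HOL-Analysis.Analysis"
begin

section \<open>Formal power series in finitely many variables\<close>

text \<open>Series in the variables indexed by a finite type, as coefficient functions on exponents.\<close>

typedef ('v, 'r) mps = "UNIV :: (('v \<Rightarrow> nat) \<Rightarrow> 'r) set"
  morphisms coef Mps by simp

setup_lifting type_definition_mps

lemma mps_eqI: "(\<And>e. coef f e = coef g e) \<Longrightarrow> f = g"
  by (metis coef_inject ext)

lemma finite_below: "finite {a :: 'v::finite \<Rightarrow> nat. a \<le> e}"
proof -
  have "{a :: 'v \<Rightarrow> nat. a \<le> e} \<subseteq> PiE UNIV (\<lambda>v. {..e v})"
    by (auto simp: le_fun_def)
  then show ?thesis
    using finite_PiE[of UNIV "\<lambda>v::'v. {..e v}"] finite_subset by auto
qed

instantiation mps :: (finite, comm_ring_1) comm_ring_1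
begin

lift_definition zero_mps :: "('a, 'b) mps" is "\<lambda>e. 0" .

lift_definition one_mps :: "('a, 'b) mps" is "\<lambda>e. if e = (\<lambda>v. 0) then 1 else 0" .

lift_definition plus_mps :: "('a, 'b) mps \<Rightarrow> ('a, 'b) mps \<Rightarrow> ('a, 'b) mps"
  is "\<lambda>f g e. f e + g e" .

lift_definition uminus_mps :: "('a, 'b) mps \<Rightarrow> ('a, 'b) mps" is "\<lambda>f e. - f e" .

lift_definition minus_mps :: "('a, 'b) mps \<Rightarrow> ('a, 'b) mps \<Rightarrow> ('a, 'b) mps"
  is "\<lambda>f g e. f e - g e" .

lift_definition times_mps :: "('a, 'b) mps \<Rightarrow> ('a, 'b) mps \<Rightarrow> ('a, 'b) mps"
  is "\<lambda>f g e. \<Sum>a | a \<le> e. f a * g (\<lambda>v. e v - a v)" .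

instance
proof
  fix f g h :: "('a, 'b) mps"
  show "f * g * h = f * (g * h)"
  proof (rule mps_eqI)
    fix e :: "'a \<Rightarrow> nat"
    let ?A = "SIGMA a : {a. a \<le> e}. {b. b \<le> a}"
    let ?B = "SIGMA a : {a. a \<le> e}. {b. b \<le> (\<lambda>v. e v - a v)}"
    have "coef (f * g * h) e =
        (\<Sum>(a, b) \<in> ?A. coef f b * coef g (\<lambda>v. a v - b v) * coef h (\<lambda>v. e v - a v))"
      by (simp add: times_mps.rep_eq sum_distrib_right sum.Sigma finite_below)
    also have "\<dots> = (\<Sum>(a, b) \<in> ?B.
        coef f a * (coef g b * coef h (\<lambda>v. e v - a v - b v)))"
    proof (rule sum.reindex_bij_witness[of _ "\<lambda>(a, b). (\<lambda>v. a v + b v, a)"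
            "\<lambda>(a, b). (b, \<lambda>v. a v - b v)"], goal_cases)
      case (2 p)
      then show ?case
        by (auto simp: le_fun_def) (meson diff_le_mono order_trans)+
    next
      case (4 p)
      then show ?case
        by (auto simp: le_fun_def) (metis add.commute le_diff_conv2)
    qed (auto simp: le_fun_def fun_eq_iff mult.assoc)
    also have "\<dots> = coef (f * (g * h)) e"
      by (simp add: times_mps.rep_eq sum_distrib_left sum.Sigma finite_below)
    finally show "coef (f * g * h) e = coef (f * (g * h)) e" .
  qed
  show "f * g = g * f"
  proof (rule mps_eqI)
    fix e :: "'a \<Rightarrow> nat"
    show "coef (f * g) e = coef (g * f) e"
      unfolding times_mps.rep_eq
      by (rule sum.reindex_bij_witness[of _ "\<lambda>a v. e v - a v" "\<lambda>a v. e v - a v"])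
         (auto simp: le_fun_def mult.commute)
  qed
  show "1 * f = f"
  proof (rule mps_eqI)
    fix e :: "'a \<Rightarrow> nat"
    have "coef (1 * f) e = (\<Sum>a | a \<le> e. if a = (\<lambda>v. 0) then coef f e else 0)"
      unfolding times_mps.rep_eq one_mps.rep_eq by (rule sum.cong) auto
    also have "\<dots> = coef f e"
      by (simp only: sum.delta[OF finite_below]) (simp add: le_fun_def)
    finally show "coef (1 * f) e = coef f e" .
  qed
  show "(f + g) * h = f * h + g * h"
    by (rule mps_eqI)
       (simp add: times_mps.rep_eq plus_mps.rep_eq distrib_right sum.distrib)
  show "(0 :: ('a, 'b) mps) \<noteq> 1"
  proof
    assume "(0 :: ('a, 'b) mps) = 1"
    then have "coef (0 :: ('a, 'b) mps) (\<lambda>v. 0) = coef 1 (\<lambda>v. 0)" by simp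
    then show False by (simp add: zero_mps.rep_eq one_mps.rep_eq)
  qed
qed (transfer; simp add: algebra_simps)+

end

lift_definition mvar :: "'v \<Rightarrow> ('v, 'r::comm_ring_1) mps"
  is "\<lambda>v e. if e = (\<lambda>w. if w = v then 1 else 0) then 1 else 0" .

text \<open>Renaming of variables along \<open>\<rho>\<close>; this is substitution when \<open>\<rho>\<close> is injective.\<close>

lift_definition ren :: "('v \<Rightarrow> 'w) \<Rightarrow> ('v, 'r::comm_ring_1) mps \<Rightarrow> ('w, 'r) mps"
  is "\<lambda>\<rho> f e. if \<forall>w. w \<notin> range \<rho> \<longrightarrow> e w = 0 then f (e \<circ> \<rho>) else 0" .

lemma coef_mvar_mult:
  fixes f :: "('v::finite, 'r::comm_ring_1) mps"
  shows "coef (mvar v * f) e = (if e v = 0 then 0 else coef f (e(v := e v - 1)))"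
proof -
  let ?d = "\<lambda>w. if w = v then 1 else (0::nat)"
  have "coef (mvar v * f) e =
      (\<Sum>a | a \<le> e. if a = ?d then coef f (\<lambda>w. e w - ?d w) else 0)"
    unfolding times_mps.rep_eq mvar.rep_eq by (rule sum.cong) auto
  also have "\<dots> = (if ?d \<le> e then coef f (\<lambda>w. e w - ?d w) else 0)"
    by (simp only: sum.delta[OF finite_below] mem_Collect_eq)
  also have "?d \<le> e \<longleftrightarrow> e v \<noteq> 0"
    by (auto simp: le_fun_def)
  also have "(\<lambda>w. e w - ?d w) = e(v := e v - 1)"
    by auto
  finally show ?thesis by simp
qed

lemma mvar_diff_cancel:
  fixes f :: "('v::finite, 'r::comm_ring_1) mps"
  assumes "v \<noteq> w" and "(mvar v - mvar w) * f = 0"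
  shows "f = 0"
proof -
  have eq: "coef (mvar v * f) e = coef (mvar w * f) e" for e
    using assms(2) by (simp add: left_diff_distrib)
  have "coef f e = 0" if "e w = k" for e k
    using that
  proof (induction k arbitrary: e)
    case 0
    then show ?case
      using eq[of "e(v := Suc (e v))"] assms(1) by (simp add: coef_mvar_mult)
  next
    case (Suc k)
    have "coef f e = coef f (e(v := Suc (e v), w := k))"
      using eq[of "e(v := Suc (e v))"] assms(1) Suc.prems by (simp add: coef_mvar_mult)
    also have "\<dots> = 0"
      by (rule Suc.IH) simp
    finally show ?case .
  qed
  then show ?thesis
    by (intro mps_eqI) (simp add: zero_mps.rep_eq)
qed

lemma ren_mult:
  fixes f g :: "('v::finite, 'r::comm_ring_1) mps" and \<rho> :: "'v \<Rightarrow> 'w::finite"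
  assumes inj: "inj \<rho>"
  shows "ren \<rho> (f * g) = ren \<rho> f * ren \<rho> g"
proof (rule mps_eqI)
  fix e :: "'w \<Rightarrow> nat"
  show "coef (ren \<rho> (f * g)) e = coef (ren \<rho> f * ren \<rho> g) e"
  proof (cases "\<forall>w. w \<notin> range \<rho> \<longrightarrow> e w = 0")
    case True
    have below: "b w = 0" if "b \<le> e" "w \<notin> range \<rho>" for b w
      using that True by (metis le_fun_def le_zero_eq)
    have "(\<Sum>a | a \<le> e \<circ> \<rho>. coef f a * coef g (\<lambda>v. (e \<circ> \<rho>) v - a v)) =
        (\<Sum>b | b \<le> e. coef f (b \<circ> \<rho>) * coef g (\<lambda>v. e (\<rho> v) - b (\<rho> v)))"
      by (rule sum.reindex_bij_witness[of _ "\<lambda>b. b \<circ> \<rho>"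
            "\<lambda>a w. if w \<in> range \<rho> then a (inv \<rho> w) else 0"])
         (use inj below in \<open>auto simp: le_fun_def fun_eq_iff inv_f_f comp_def\<close>)
    also have "\<dots> = coef (ren \<rho> f * ren \<rho> g) e"
      unfolding times_mps.rep_eq
    proof (rule sum.cong)
      fix b
      assume "b \<in> {b. b \<le> e}"
      then have "coef (ren \<rho> f) b = coef f (b \<circ> \<rho>)"
        using below by (simp add: ren.rep_eq)
      moreover have "coef (ren \<rho> g) (\<lambda>w. e w - b w) = coef g (\<lambda>v. e (\<rho> v) - b (\<rho> v))"
        using True by (simp add: ren.rep_eq comp_def)
      ultimately show "coef f (b \<circ> \<rho>) * coef g (\<lambda>v. e (\<rho> v) - b (\<rho> v)) =
          coef (ren \<rho> f) b * coef (ren \<rho> g) (\<lambda>w. e w - b w)"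
        by simp
    qed simp
    finally show ?thesis
      using True by (simp add: ren.rep_eq times_mps.rep_eq)
  next
    case False
    then obtain w where w: "w \<notin> range \<rho>" "e w \<noteq> 0" by blast
    have "coef (ren \<rho> f) b * coef (ren \<rho> g) (\<lambda>w. e w - b w) = 0" for b
      using w by (cases "b w = 0") (auto simp: ren.rep_eq)
    then have "coef (ren \<rho> f * ren \<rho> g) e = 0"
      unfolding times_mps.rep_eq by simp
    moreover have "coef (ren \<rho> (f * g)) e = 0"
      using False unfolding ren.rep_eq by (rule if_not_P)
    ultimately show ?thesis by simp
  qed
qed

lemma ren_add: "ren \<rho> (f + g) = ren \<rho> f + ren \<rho> g"
  for f g :: "('v::finite, 'r::comm_ring_1) mps" and \<rho> :: "'v \<Rightarrow> 'w::finite"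
  by (rule mps_eqI) (auto simp: ren.rep_eq plus_mps.rep_eq)

lemma ren_diff: "ren \<rho> (f - g) = ren \<rho> f - ren \<rho> g"
  for f g :: "('v::finite, 'r::comm_ring_1) mps" and \<rho> :: "'v \<Rightarrow> 'w::finite"
  by (rule mps_eqI) (auto simp: ren.rep_eq minus_mps.rep_eq)

lemma ren_one: "ren \<rho> 1 = (1 :: ('w, 'r) mps)"
  for \<rho> :: "'v::finite \<Rightarrow> 'w::finite" and u :: "'r::comm_ring_1"
proof (rule mps_eqI)
  fix e :: "'w \<Rightarrow> nat"
  show "coef (ren \<rho> 1) e = coef (1 :: ('w, 'r) mps) e"
    by (auto simp: ren.rep_eq one_mps.rep_eq fun_eq_iff) (metis rangeE)
qed

lemma ren_mvar:
  fixes \<rho> :: "'v::finite \<Rightarrow> 'w::finite"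
  assumes "inj \<rho>"
  shows "ren \<rho> (mvar v) = (mvar (\<rho> v) :: ('w, 'r::comm_ring_1) mps)"
proof (rule mps_eqI)
  fix e :: "'w \<Rightarrow> nat"
  have "(\<forall>w. w \<notin> range \<rho> \<longrightarrow> e w = 0) \<and> e \<circ> \<rho> = (\<lambda>u. if u = v then 1 else 0) \<longleftrightarrow>
      e = (\<lambda>w. if w = \<rho> v then 1 else 0)" (is "?L = ?R")
  proof
    assume L: ?L
    show ?R
    proof
      fix w
      show "e w = (if w = \<rho> v then 1 else 0)"
        using L assms by (cases "w \<in> range \<rho>") (auto simp: fun_eq_iff inj_eq)
    qed
  qed (use assms in \<open>auto simp: fun_eq_iff inj_eq\<close>)
  then show "coef (ren \<rho> (mvar v)) e = coef (mvar (\<rho> v) :: ('w, 'r) mps) e"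
    by (auto simp: ren.rep_eq mvar.rep_eq)
qed

lifting_forget mps.lifting

section \<open>The localization of \<open>R[[x_i, y_i]]\<close> at all \<open>x_j - x_i\<close> and \<open>y_j - y_i\<close>\<close>

text \<open>The index type \<open>'i\<close> lists the pairs \<open>(x_i, y_i)\<close>; it is \<open>1\<close>, \<open>2\<close> or \<open>3\<close> below.\<close>

abbreviation xv :: "'i \<Rightarrow> ('i + 'i, 'r::comm_ring_1) mps" where
  "xv i \<equiv> mvar (Inl i)"

abbreviation yv :: "'i \<Rightarrow> ('i + 'i, 'r::comm_ring_1) mps" where
  "yv i \<equiv> mvar (Inr i)"

text \<open>
  Inverting all the differences is the same as inverting
  \<open>\<Delta> = \<Prod>\<^sub>i\<^sub><\<^sub>j (x_j - x_i) (y_j - y_i)\<close>.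
\<close>

inductive_set denoms :: "('i::finite + 'i, 'r::comm_ring_1) mps set" where
  one: "1 \<in> denoms"
| xdiff: "d \<in> denoms \<Longrightarrow> i \<noteq> j \<Longrightarrow> d * (xv i - xv j) \<in> denoms"
| ydiff: "d \<in> denoms \<Longrightarrow> i \<noteq> j \<Longrightarrow> d * (yv i - yv j) \<in> denoms"

lemma denoms_mult:
  assumes "d \<in> denoms" "d' \<in> denoms"
  shows "d * d' \<in> denoms"
  using assms(2)
  by (induction d' rule: denoms.induct)
     (use assms(1) in \<open>auto simp flip: mult.assoc intro: denoms.intros\<close>)

lemma denoms_cancel: "d \<in> denoms \<Longrightarrow> d * f = 0 \<Longrightarrow> f = 0"
proof (induction d arbitrary: f rule: denoms.induct)
  case (xdiff d i j)
  then have "(xv i - xv j) * f = 0" by (metis mult.assoc)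
  then show ?case using mvar_diff_cancel[of "Inl i" "Inl j" f] xdiff.hyps by simp
next
  case (ydiff d i j)
  then have "(yv i - yv j) * f = 0" by (metis mult.assoc)
  then show ?case using mvar_diff_cancel[of "Inr i" "Inr j" f] ydiff.hyps by simp
qed simp

lemma denoms_ren:
  fixes \<sigma> \<tau> :: "'i::finite \<Rightarrow> 'j::finite"
  assumes "inj \<sigma>" "inj \<tau>" "d \<in> denoms"
  shows "ren (map_sum \<sigma> \<tau>) d \<in> denoms"
proof -
  have inj: "inj (map_sum \<sigma> \<tau>)"
    using assms(1,2) by (rule sum.inj_map)
  show ?thesis
    using assms(3)
    by (induction d rule: denoms.induct)
       (use assms(1,2) in \<open>auto simp: ren_one ren_mult[OF inj] ren_diff ren_mvar[OF inj]
          inj_eq intro!: denoms.intros\<close>)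
qed

definition mero_rel ::
    "('i::finite + 'i, 'r::comm_ring_1) mps \<times> ('i + 'i, 'r) mps \<Rightarrow>
     ('i + 'i, 'r) mps \<times> ('i + 'i, 'r) mps \<Rightarrow> bool" where
  "mero_rel p q \<longleftrightarrow>
     snd p \<in> denoms \<and> snd q \<in> denoms \<and> fst p * snd q = fst q * snd p"

lemma part_equivp_mero_rel: "part_equivp mero_rel"
proof (rule part_equivpI)
  show "\<exists>p. mero_rel p p"
    by (rule exI[of _ "(0, 1)"]) (simp add: mero_rel_def denoms.one)
  show "symp mero_rel"
    by (auto simp: symp_def mero_rel_def)
  show "transp mero_rel"
  proof (rule transpI, unfold split_paired_all)
    fix a b a' b' a'' b'' :: "('i::finite + 'i, 'r::comm_ring_1) mps"
    assume A: "mero_rel (a, b) (a', b')" and B: "mero_rel (a', b') (a'', b'')"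
    have "b' * (a * b'') = b'' * (a * b')" by (simp add: ac_simps)
    also have "\<dots> = b'' * (a' * b)" using A by (simp add: mero_rel_def)
    also have "\<dots> = b * (a' * b'')" by (simp add: ac_simps)
    also have "\<dots> = b * (a'' * b')" using B by (simp add: mero_rel_def)
    finally have "b' * (a * b'' - a'' * b) = 0" by (simp add: algebra_simps)
    then have "a * b'' = a'' * b"
      using denoms_cancel[of b'] B by (fastforce simp: mero_rel_def)
    then show "mero_rel (a, b) (a'', b'')"
      using A B by (simp add: mero_rel_def)
  qed
qed

quotient_type (overloaded) ('i, 'r) mero =
    "('i::finite + 'i, 'r::comm_ring_1) mps \<times> ('i + 'i, 'r) mps" / partial: mero_rel
  by (rule part_equivp_mero_rel)

text \<open>The fraction \<open>a / d\<close>, for \<open>d\<close> in \<open>denoms\<close>.\<close>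

lift_definition frac_of ::
    "('i::finite + 'i, 'r::comm_ring_1) mps \<Rightarrow> ('i + 'i, 'r) mps \<Rightarrow> ('i, 'r) mero"
  is "\<lambda>a d. if d \<in> denoms then (a, d) else (0, 1)"
  by (simp add: mero_rel_def denoms.one)

lemma mero_cases [cases type: mero]:
  obtains a d where "q = frac_of a d" "d \<in> denoms"
proof transfer
  fix q :: "('a + 'a, 'b) mps \<times> ('a + 'a, 'b) mps" and thesis
  assume q: "mero_rel q q"
    and *: "\<And>a d. mero_rel q (if d \<in> denoms then (a, d) else (0, 1)) \<Longrightarrow> d \<in> denoms \<Longrightarrow> thesis"
  from q have "snd q \<in> denoms" by (simp add: mero_rel_def)
  with q *[of "snd q" "fst q"] show thesis by simp
qed

lemma eq_frac_of:
  "d \<in> denoms \<Longrightarrow> d' \<in> denoms \<Longrightarrow> frac_of a d = frac_of a' d' \<longleftrightarrow> a * d' = a' * d"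
  by transfer (simp add: mero_rel_def)

instantiation mero :: (finite, comm_ring_1) comm_ring_1
begin

lift_definition zero_mero :: "('a, 'b) mero" is "(0, 1)"
  by (simp add: mero_rel_def denoms.one)

lift_definition one_mero :: "('a, 'b) mero" is "(1, 1)"
  by (simp add: mero_rel_def denoms.one)

lift_definition plus_mero :: "('a, 'b) mero \<Rightarrow> ('a, 'b) mero \<Rightarrow> ('a, 'b) mero"
  is "\<lambda>p q. (fst p * snd q + fst q * snd p, snd p * snd q)"
proof -
  fix p p' q q' :: "('a + 'a, 'b) mps \<times> ('a + 'a, 'b) mps"
  assume A: "mero_rel p p'" "mero_rel q q'"
  have "(fst p * snd q + fst q * snd p) * (snd p' * snd q') =
      (fst p * snd p') * (snd q * snd q') + (fst q * snd q') * (snd p * snd p')"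
    by (simp add: algebra_simps)
  also have "\<dots> = (fst p' * snd p) * (snd q * snd q') + (fst q' * snd q) * (snd p * snd p')"
    using A by (simp add: mero_rel_def)
  also have "\<dots> = (fst p' * snd q' + fst q' * snd p') * (snd p * snd q)"
    by (simp add: algebra_simps)
  finally show "mero_rel (fst p * snd q + fst q * snd p, snd p * snd q)
      (fst p' * snd q' + fst q' * snd p', snd p' * snd q')"
    using A by (simp add: mero_rel_def denoms_mult)
qed

lift_definition uminus_mero :: "('a, 'b) mero \<Rightarrow> ('a, 'b) mero"
  is "\<lambda>p. (- fst p, snd p)"
  by (simp add: mero_rel_def)

definition minus_mero :: "('a, 'b) mero \<Rightarrow> ('a, 'b) mero \<Rightarrow> ('a, 'b) mero" where
  "minus_mero p q = p + - q"

lift_definition times_mero :: "('a, 'b) mero \<Rightarrow> ('a, 'b) mero \<Rightarrow> ('a, 'b) mero"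
  is "\<lambda>p q. (fst p * fst q, snd p * snd q)"
proof -
  fix p p' q q' :: "('a + 'a, 'b) mps \<times> ('a + 'a, 'b) mps"
  assume A: "mero_rel p p'" "mero_rel q q'"
  have "fst p * fst q * (snd p' * snd q') = (fst p * snd p') * (fst q * snd q')"
    by (simp add: ac_simps)
  also have "\<dots> = (fst p' * snd p) * (fst q' * snd q)"
    using A by (simp add: mero_rel_def)
  also have "\<dots> = fst p' * fst q' * (snd p * snd q)"
    by (simp add: ac_simps)
  finally show "mero_rel (fst p * fst q, snd p * snd q) (fst p' * fst q', snd p' * snd q')"
    using A unfolding mero_rel_def fst_conv snd_conv by (blast intro: denoms_mult)
qed

lemma zero_mero_frac: "0 = frac_of 0 1"
  by transfer (simp add: mero_rel_def denoms.one)

lemma one_mero_frac: "1 = frac_of 1 1"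
  by transfer (simp add: mero_rel_def denoms.one)

lemma add_frac_of:
  "d \<in> denoms \<Longrightarrow> d' \<in> denoms \<Longrightarrow>
    frac_of a d + frac_of a' d' = frac_of (a * d' + a' * d) (d * d')"
  by transfer (simp add: mero_rel_def denoms_mult)

lemma uminus_frac_of: "d \<in> denoms \<Longrightarrow> - frac_of a d = frac_of (- a) d"
  by transfer (simp add: mero_rel_def)

lemma mult_frac_of:
  "d \<in> denoms \<Longrightarrow> d' \<in> denoms \<Longrightarrow> frac_of a d * frac_of a' d' = frac_of (a * a') (d * d')"
  by transfer (simp add: mero_rel_def denoms_mult)

instance
proof
  fix p q s :: "('a, 'b) mero"
  show "p * q * s = p * (q * s)"
    by (cases p, cases q, cases s) (simp add: mult_frac_of denoms_mult ac_simps)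
  show "p * q = q * p"
    by (cases p, cases q) (simp add: mult_frac_of ac_simps)
  show "1 * p = p"
    by (cases p) (simp add: one_mero_frac mult_frac_of denoms.one)
  show "p + q + s = p + (q + s)"
    by (cases p, cases q, cases s) (simp add: add_frac_of denoms_mult algebra_simps)
  show "p + q = q + p"
    by (cases p, cases q) (simp add: add_frac_of algebra_simps)
  show "0 + p = p"
    by (cases p) (simp add: zero_mero_frac add_frac_of denoms.one)
  show "- p + p = 0"
    by (cases p)
       (simp add: zero_mero_frac add_frac_of uminus_frac_of eq_frac_of denoms.one denoms_mult)
  show "p - q = p + - q"
    by (simp add: minus_mero_def)
  show "(p + q) * s = p * s + q * s"
    by (cases p, cases q, cases s)
       (simp add: add_frac_of mult_frac_of eq_frac_of denoms_mult algebra_simps)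
  show "(0 :: ('a, 'b) mero) \<noteq> 1"
    by (simp add: zero_mero_frac one_mero_frac eq_frac_of denoms.one)
qed

end

definition of_mps :: "('i::finite + 'i, 'r::comm_ring_1) mps \<Rightarrow> ('i, 'r) mero" where
  "of_mps f = frac_of f 1"

text \<open>
  The substitution \<open>x_i \<mapsto> x_(\<sigma> i)\<close>, \<open>y_i \<mapsto> y_(\<tau> i)\<close> for injective \<open>\<sigma>\<close>, \<open>\<tau>\<close>; the
  other case is a dummy value.
\<close>

lift_definition subst_mero ::
    "('i::finite \<Rightarrow> 'j::finite) \<Rightarrow> ('i \<Rightarrow> 'j) \<Rightarrow> ('i, 'r::comm_ring_1) mero \<Rightarrow> ('j, 'r) mero"
  is "\<lambda>\<sigma> \<tau> q. if inj \<sigma> \<and> inj \<tau>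
        then (ren (map_sum \<sigma> \<tau>) (fst q), ren (map_sum \<sigma> \<tau>) (snd q)) else (0, 1)"
proof -
  fix \<sigma> \<tau> :: "'i \<Rightarrow> 'j" and p q :: "('i + 'i, 'r) mps \<times> ('i + 'i, 'r) mps"
  assume A: "mero_rel p q"
  show "mero_rel
      (if inj \<sigma> \<and> inj \<tau>
        then (ren (map_sum \<sigma> \<tau>) (fst p), ren (map_sum \<sigma> \<tau>) (snd p)) else (0, 1))
      (if inj \<sigma> \<and> inj \<tau>
        then (ren (map_sum \<sigma> \<tau>) (fst q), ren (map_sum \<sigma> \<tau>) (snd q)) else (0, 1))"
  proof (cases "inj \<sigma> \<and> inj \<tau>")
    case True
    then have inj: "inj (map_sum \<sigma> \<tau>)"
      by (simp add: sum.inj_map)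
    show ?thesis
      using A True by (simp add: mero_rel_def denoms_ren flip: ren_mult[OF inj])
  next
    case False
    then show ?thesis
      by (simp only: if_False) (simp add: mero_rel_def denoms.one)
  qed
qed

section \<open>Tensor notation\<close>

text \<open>
  For a \<open>\<^bold>k\<close>-algebra \<open>S\<close>, the algebra \<open>Mat_n(\<^bold>k) \<otimes> Mat_n(\<^bold>k) \<otimes> S\<close> is the algebra of matrices
  over \<open>S\<close> with rows and columns indexed by pairs: the coefficient of
  \<open>e_ij \<otimes> e_kl\<close> is the entry in row \<open>(i, k)\<close> and column \<open>(j, l)\<close>.  Likewise for three factors.
\<close>

type_synonym ('n, 's) mat2 = "'s ^ ('n \<times> 'n) ^ ('n \<times> 'n)"
type_synonym ('n, 's) mat3 = "'s ^ ('n \<times> 'n \<times> 'n) ^ ('n \<times> 'n \<times> 'n)"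

definition unit_mat :: "'n \<Rightarrow> 'n \<Rightarrow> 's::comm_ring_1 ^ 'n ^ 'n" where
  "unit_mat i j = (\<chi> a b. if a = i \<and> b = j then 1 else 0)"

definition tensor_mat :: "'s::comm_ring_1 ^ 'n ^ 'n \<Rightarrow> 's ^ 'n ^ 'n \<Rightarrow> ('n, 's) mat2" where
  "tensor_mat A B = (\<chi> p q. A $ fst p $ fst q * B $ snd p $ snd q)"

definition perm_P :: "('n::finite, 's::comm_ring_1) mat2" where
  "perm_P = (\<Sum>i\<in>UNIV. \<Sum>j\<in>UNIV. tensor_mat (unit_mat i j) (unit_mat j i))"

definition flip21 :: "('n::finite, 's) mat2 \<Rightarrow> ('n, 's) mat2" where
  "flip21 r = (\<chi> p q. r $ (snd p, fst p) $ (snd q, fst q))"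

definition place12 :: "('n::finite, 's::comm_ring_1) mat2 \<Rightarrow> ('n, 's) mat3" where
  "place12 r = vec_lambda (\<lambda>(i1, i2, i3). vec_lambda (\<lambda>(j1, j2, j3).
     if i3 = j3 then r $ (i1, i2) $ (j1, j2) else 0))"

definition place13 :: "('n::finite, 's::comm_ring_1) mat2 \<Rightarrow> ('n, 's) mat3" where
  "place13 r = vec_lambda (\<lambda>(i1, i2, i3). vec_lambda (\<lambda>(j1, j2, j3).
     if i2 = j2 then r $ (i1, i3) $ (j1, j3) else 0))"

definition place23 :: "('n::finite, 's::comm_ring_1) mat2 \<Rightarrow> ('n, 's) mat3" where
  "place23 r = vec_lambda (\<lambda>(i1, i2, i3). vec_lambda (\<lambda>(j1, j2, j3).
     if i1 = j1 then r $ (i2, i3) $ (j2, j3) else 0))"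

section \<open>The general associative Yang--Baxter equation\<close>

text \<open>\<open>at_vars r a b c d\<close> is \<open>r\<close> with \<open>x_1, x_2, y_1, y_2\<close> replaced by \<open>x_a, x_b, y_c, y_d\<close>.\<close>

definition at_vars ::
    "('n::finite, (2, 'r::comm_ring_1) mero) mat2 \<Rightarrow> 'j::finite \<Rightarrow> 'j \<Rightarrow> 'j \<Rightarrow> 'j \<Rightarrow>
     ('n, ('j, 'r) mero) mat2" where
  "at_vars r a b c d =
     (\<chi> p q. subst_mero (\<lambda>i. if i = 1 then a else b) (\<lambda>i. if i = 1 then c else d) (r $ p $ q))"

definition polar_part :: "('n::finite, (2, 'r::comm_ring_1) mero) mat2" where
  "polar_part = (\<chi> p q. mat 1 $ p $ q * frac_of 1 (xv 2 - xv 1)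
                      + perm_P $ p $ q * frac_of 1 (yv 1 - yv 2))"

definition has_polar_form :: "('n::finite, (2, 'r::comm_ring_1) mero) mat2 \<Rightarrow> bool" where
  "has_polar_form r \<longleftrightarrow> (\<forall>p q. (r - polar_part) $ p $ q \<in> range of_mps)"

definition skew_symmetric :: "('n::finite, (2, 'r::comm_ring_1) mero) mat2 \<Rightarrow> bool" where
  "skew_symmetric r \<longleftrightarrow> flip21 r = - at_vars r 2 1 2 1"

definition general_AYBE :: "('n::finite, (2, 'r::comm_ring_1) mero) mat2 \<Rightarrow> bool" where
  "general_AYBE r \<longleftrightarrow>
     place12 (at_vars r 2 1 2 3) ** place13 (at_vars r 1 3 1 3)
     - place23 (at_vars r 1 3 1 2) ** place12 (at_vars r 2 3 2 3)
     + place13 (at_vars r 2 3 1 3) ** place23 (at_vars r 1 2 1 2)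
     = (0 :: ('n, (3, 'r) mero) mat3)"

definition AYBE_solutions :: "('n::finite, (2, 'r::comm_ring_1) mero) mat2 set" where
  "AYBE_solutions = {r. has_polar_form r \<and> skew_symmetric r \<and> general_AYBE r}"

text \<open>Elements \<open>\<phi>\<close> of \<open>Mat_n(R)[[x, y]]\<close>, and \<open>\<phi>\<close> evaluated at the variables \<open>x_i\<close>, \<open>y_j\<close>.\<close>

type_synonym ('n, 'r) gauge = "(1 + 1, 'r) mps ^ 'n ^ 'n"

definition gauge_at ::
    "('n::finite, 'r::comm_ring_1) gauge \<Rightarrow> 2 \<Rightarrow> 2 \<Rightarrow> (2, 'r) mero ^ 'n ^ 'n" where
  "gauge_at \<phi> i j = (\<chi> a b. of_mps (ren (map_sum (\<lambda>_. i) (\<lambda>_. j)) (\<phi> $ a $ b)))"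

definition gauge_transform ::
    "('n::finite, 'r::comm_ring_1) gauge \<Rightarrow> ('n, (2, 'r) mero) mat2 \<Rightarrow>
     ('n, (2, 'r) mero) mat2" where
  "gauge_transform \<phi> r =
     tensor_mat (gauge_at \<phi> 1 2) (gauge_at \<phi> 2 1) ** r
     ** matrix_inv (tensor_mat (gauge_at \<phi> 2 2) (gauge_at \<phi> 1 1))"

definition gauge_constant_term :: "('n::finite, 'r::comm_ring_1) gauge \<Rightarrow> 'r ^ 'n ^ 'n" where
  "gauge_constant_term \<phi> = (\<chi> a b. coef (\<phi> $ a $ b) (\<lambda>_. 0))"

text \<open>\<open>\<phi> \<equiv> Id\<close> modulo the ideal \<open>(x, y)\<close>.\<close>

definition gauge_strict :: "('n::finite, 'r::comm_ring_1) gauge \<Rightarrow> bool" where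
  "gauge_strict \<phi> \<longleftrightarrow>
     (\<forall>a b. \<exists>f g. \<phi> $ a $ b = mat 1 $ a $ b + xv 1 * f + yv 1 * g)"

definition AYBE_strict_equiv ::
    "(('n::finite, (2, 'r::comm_ring_1) mero) mat2 \<times> ('n, (2, 'r) mero) mat2) set" where
  "AYBE_strict_equiv = {(r, r'). r \<in> AYBE_solutions \<and> r' \<in> AYBE_solutions \<and>
     (\<exists>\<phi>. gauge_strict \<phi> \<and> r' = gauge_transform \<phi> r)}"

definition AYBE_general_equiv ::
    "(('n::finite, (2, 'r::comm_ring_1) mero) mat2 \<times> ('n, (2, 'r) mero) mat2) set" where
  "AYBE_general_equiv = {(r, r'). r \<in> AYBE_solutions \<and> r' \<in> AYBE_solutions \<and>
     (\<exists>\<phi>. invertible (gauge_constant_term \<phi>) \<and> r' = gauge_transform \<phi> r)}"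

section \<open>The category \<open>\<A>_n \<otimes> R\<close>\<close>

datatype obj = ObX | ObY

datatype 'n gen = Id obj | Xi obj | Theta 'n | Eta 'n

instance gen :: (finite) finite
proof
  have "Z \<in> {ObX, ObY}" for Z
    by (cases Z) auto
  then have "g \<in> Id ` {ObX, ObY} \<union> Xi ` {ObX, ObY} \<union> range Theta \<union> range Eta"
    for g :: "'a gen"
    by (cases g) blast+
  then have "UNIV \<subseteq> Id ` {ObX, ObY} \<union> Xi ` {ObX, ObY} \<union> range Theta \<union> range (Eta :: 'a \<Rightarrow> _)"
    by blast
  then show "finite (UNIV :: 'a gen set)"
    by (rule finite_subset) simp
qed

fun src :: "'n gen \<Rightarrow> obj" where
  "src (Id Z) = Z" | "src (Xi Z) = Z" | "src (Theta _) = ObX" | "src (Eta _) = ObY"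

fun tgt :: "'n gen \<Rightarrow> obj" where
  "tgt (Id Z) = Z" | "tgt (Xi Z) = Z" | "tgt (Theta _) = ObY" | "tgt (Eta _) = ObX"

fun deg :: "'n gen \<Rightarrow> nat" where
  "deg (Id _) = 0" | "deg (Xi _) = 1" | "deg (Theta _) = 0" | "deg (Eta _) = 1"

text \<open>
  A morphism is an element of the direct sum of all \<open>Hom\<close>-modules, a free \<open>R\<close>-module on the
  generators.  A family of multilinear operations in all arities is a function on lists, where
  the operands are in the order of composition, \<open>[a_d, \<dots>, a_1]\<close>.  The operations are extended
  by zero to non-composable sequences of generators; this makes them determined by their values
  on composable ones.  Since everything is multilinear, identities involving degrees are imposed
  on sequences of generators.
\<close>

type_synonym ('n, 'r) mor = "'r ^ 'n gen"
type_synonym ('n, 'r) ops = "('n, 'r) mor list \<Rightarrow> ('n, 'r) mor"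

definition bas :: "'n gen \<Rightarrow> ('n::finite, 'r::comm_ring_1) mor" where
  "bas g = axis g 1"

definition composable :: "'n gen list \<Rightarrow> bool" where
  "composable gs \<longleftrightarrow> gs \<noteq> [] \<and> successively (\<lambda>g h. src g = tgt h) gs"

definition cyc_composable :: "'n gen list \<Rightarrow> bool" where
  "cyc_composable gs \<longleftrightarrow> composable gs \<and> src (last gs) = tgt (hd gs)"

text \<open>Congruent modulo 2 to \<open>|a_l| + \<dots> + |a_1| - l\<close>.\<close>

definition red_deg :: "'n gen list \<Rightarrow> nat" where
  "red_deg gs = sum_list (map deg gs) + length gs"

definition multilinear_ops :: "('n::finite, 'r::comm_ring_1) ops \<Rightarrow> bool" where
  "multilinear_ops F \<longleftrightarrow>
     (\<forall>us vs a b c. F (us @ (c *s a + b) # vs) = c *s F (us @ a # vs) + F (us @ b # vs))"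

text \<open>Multilinear operations with the \<open>k\<close>-ary one of degree \<open>e - k\<close>.\<close>

definition graded_ops :: "int \<Rightarrow> ('n::finite, 'r::comm_ring_1) ops \<Rightarrow> bool" where
  "graded_ops e F \<longleftrightarrow> multilinear_ops F \<and>
     (\<forall>gs. \<not> composable gs \<longrightarrow> F (map bas gs) = 0) \<and>
     (\<forall>gs h. composable gs \<longrightarrow> F (map bas gs) $ h \<noteq> 0 \<longrightarrow>
        src h = src (last gs) \<and> tgt h = tgt (hd gs) \<and>
        int (deg h) = (\<Sum>g\<leftarrow>gs. int (deg g)) + e - int (length gs))"

fun comp_bas :: "'n gen \<Rightarrow> 'n gen \<Rightarrow> ('n::finite, 'r::comm_ring_1) mor" where
  "comp_bas a (Id Z) = (if src a = Z then bas a else 0)"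
| "comp_bas (Id Z) b = (if tgt b = Z then (-1) ^ deg b *s bas b else 0)"
| "comp_bas (Eta \<alpha>) (Theta \<beta>) = (if \<alpha> = \<beta> then bas (Xi ObX) else 0)"
| "comp_bas (Theta \<alpha>) (Eta \<beta>) = (if \<alpha> = \<beta> then - bas (Xi ObY) else 0)"
| "comp_bas _ _ = 0"

fun pairing_bas :: "'n gen \<Rightarrow> 'n gen \<Rightarrow> 'r::comm_ring_1" where
  "pairing_bas (Eta \<alpha>) (Theta \<beta>) = (if \<alpha> = \<beta> then 1 else 0)"
| "pairing_bas (Theta \<beta>) (Eta \<alpha>) = (if \<alpha> = \<beta> then -1 else 0)"
| "pairing_bas (Xi Z) (Id W) = (if Z = W then 1 else 0)"
| "pairing_bas (Id W) (Xi Z) = (if Z = W then -1 else 0)"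
| "pairing_bas _ _ = 0"

definition pairing :: "('n::finite, 'r::comm_ring_1) mor \<Rightarrow> ('n, 'r) mor \<Rightarrow> 'r" where
  "pairing a b = (\<Sum>g\<in>UNIV. \<Sum>h\<in>UNIV. a $ g * b $ h * pairing_bas g h)"

section \<open>Cyclic \<open>A\<^sub>\<infinity>\<close>-structures\<close>

text \<open>
  The sum over \<open>m\<close>, \<open>l\<close> of
  \<open>\<plusminus> F (a_d, \<dots>, a_(l+m+1), M (a_(l+m), \<dots>, a_(l+1)), a_l, \<dots>, a_1)\<close>.
\<close>

definition insertion_sum ::
    "('n::finite, 'r::comm_ring_1) ops \<Rightarrow> ('n, 'r) ops \<Rightarrow> 'n gen list \<Rightarrow> ('n, 'r) mor" where
  "insertion_sum F M gs = (let d = length gs; as = map bas gs in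
     \<Sum>m = 1..d. \<Sum>l = 0..d - m. (-1) ^ red_deg (drop (d - l) gs) *s
       F (take (d - m - l) as @ M (take m (drop (d - m - l) as)) # drop (d - l) as))"

definition ainf_relations :: "('n::finite, 'r::comm_ring_1) ops \<Rightarrow> bool" where
  "ainf_relations M \<longleftrightarrow> (\<forall>gs. composable gs \<longrightarrow> insertion_sum M M gs = 0)"

definition minimal_ops :: "('n::finite, 'r::comm_ring_1) ops \<Rightarrow> bool" where
  "minimal_ops M \<longleftrightarrow> (\<forall>a. M [a] = 0)"

definition extends_product :: "('n::finite, 'r::comm_ring_1) ops \<Rightarrow> bool" where
  "extends_product M \<longleftrightarrow> (\<forall>g h. M [bas g, bas h] = comp_bas g h)"

text \<open>The conditions on \<open>\<mm>\<^sub>2\<close> in strict unitality are contained in \<open>extends_product\<close>.\<close>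

definition strictly_unital_ops :: "('n::finite, 'r::comm_ring_1) ops \<Rightarrow> bool" where
  "strictly_unital_ops M \<longleftrightarrow>
     (\<forall>as Z. length as \<noteq> 2 \<and> bas (Id Z) \<in> set as \<longrightarrow> M as = 0)"

definition cyclic_ops :: "('n::finite, 'r::comm_ring_1) ops \<Rightarrow> bool" where
  "cyclic_ops M \<longleftrightarrow> (\<forall>c b gs. cyc_composable (c # b # gs) \<longrightarrow>
     pairing (bas c) (M (map bas (b # gs))) =
     (-1) ^ ((deg c + 1) * red_deg (b # gs)) * pairing (bas b) (M (map bas (gs @ [c]))))"

definition ainf_structures :: "('n::finite, 'r::comm_ring_1) ops set" where
  "ainf_structures = {M. graded_ops 2 M \<and> ainf_relations M \<and> minimal_ops M \<and>
     extends_product M \<and> strictly_unital_ops M \<and> cyclic_ops M}"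

section \<open>Cyclic \<open>A\<^sub>\<infinity>\<close>-equivalences\<close>

lemma finite_blocks: "finite {bs. concat bs = gs \<and> [] \<notin> set bs}"
proof (rule finite_subset)
  let ?B = "{b. set b \<subseteq> set gs \<and> length b \<le> length gs}"
  show "finite {bs. set bs \<subseteq> ?B \<and> length bs \<le> length gs}"
    by (rule finite_lists_length_le, rule finite_lists_length_le, rule finite_set)
  show "{bs. concat bs = gs \<and> [] \<notin> set bs} \<subseteq>
      {bs. set bs \<subseteq> ?B \<and> length bs \<le> length gs}"
  proof
    fix bs
    assume "bs \<in> {bs. concat bs = gs \<and> [] \<notin> set bs}"
    then have gs: "gs = concat bs" and ne: "[] \<notin> set bs"
      by auto
    have "length bs \<le> length gs"
      unfolding gs using ne
    proof (induction bs)
      case (Cons b bs)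
      then show ?case by (cases b) auto
    qed simp
    moreover have "length b \<le> length gs" if "b \<in> set bs" for b
      unfolding gs length_concat using that by (intro member_le_sum_list) simp_all
    moreover have "set b \<subseteq> set gs" if "b \<in> set bs" for b
      unfolding gs using that by auto
    ultimately show "bs \<in> {bs. set bs \<subseteq> ?B \<and> length bs \<le> length gs}"
      by (simp add: subset_iff)
  qed
qed

definition functor_relations ::
    "('n::finite, 'r::comm_ring_1) ops \<Rightarrow> ('n, 'r) ops \<Rightarrow> ('n, 'r) ops \<Rightarrow> bool" where
  "functor_relations M M' F \<longleftrightarrow> (\<forall>gs. composable gs \<longrightarrow>
     (\<Sum>bs | concat bs = gs \<and> [] \<notin> set bs. M' (map (\<lambda>b. F (map bas b)) bs)) =
     insertion_sum F M gs)"

definition unital_functor :: "('n::finite, 'r::comm_ring_1) ops \<Rightarrow> bool" where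
  "unital_functor F \<longleftrightarrow> (\<forall>Z. F [bas (Id Z)] = bas (Id Z)) \<and>
     (\<forall>as Z. length as \<ge> 2 \<and> bas (Id Z) \<in> set as \<longrightarrow> F as = 0)"

definition cyclic_functor :: "('n::finite, 'r::comm_ring_1) ops \<Rightarrow> bool" where
  "cyclic_functor F \<longleftrightarrow>
     (\<forall>a b. pairing (F [a]) (F [b]) = pairing a b) \<and>
     (\<forall>gs. cyc_composable gs \<and> length gs \<ge> 3 \<longrightarrow>
        (\<Sum>l = 1..length gs - 1.
           pairing (F (map bas (take l gs))) (F (map bas (drop l gs)))) = 0)"

definition cyclic_equivalence ::
    "('n::finite, 'r::comm_ring_1) ops \<Rightarrow> ('n, 'r) ops \<Rightarrow> ('n, 'r) ops \<Rightarrow> bool" where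
  "cyclic_equivalence M M' F \<longleftrightarrow> graded_ops 1 F \<and> functor_relations M M' F \<and>
     unital_functor F \<and> cyclic_functor F \<and> bij (\<lambda>a. F [a])"

definition ainf_equiv :: "(('n::finite, 'r::comm_ring_1) ops \<times> ('n, 'r) ops) set" where
  "ainf_equiv = {(M, M'). M \<in> ainf_structures \<and> M' \<in> ainf_structures \<and>
     (\<exists>F. cyclic_equivalence M M' F)}"

definition ainf_strict_equiv :: "(('n::finite, 'r::comm_ring_1) ops \<times> ('n, 'r) ops) set" where
  "ainf_strict_equiv = {(M, M'). M \<in> ainf_structures \<and> M' \<in> ainf_structures \<and>
     (\<exists>F. cyclic_equivalence M M' F \<and> (\<forall>a. F [a] = a))}"

section \<open>The explicit assignment\<close>

definition massey_word ::
    "nat \<Rightarrow> nat \<Rightarrow> nat \<Rightarrow> nat \<Rightarrow> 'n \<Rightarrow> 'n \<Rightarrow> 'n \<Rightarrow> 'n gen list" where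
  "massey_word a b c d \<alpha> \<beta> \<alpha>' =
     replicate d (Xi ObY) @ [Theta \<alpha>'] @ replicate c (Xi ObX) @ [Eta \<beta>] @
     replicate b (Xi ObY) @ [Theta \<alpha>] @ replicate a (Xi ObX)"

text \<open>
  The exponents of \<open>x_1, y_1, x_2, y_2\<close> are the multiplicities \<open>a, b, c, d\<close>; the resulting series is
  the coefficient of \<open>e_(\<beta>'\<alpha>') \<otimes> e_(\<beta>\<alpha>)\<close>.
\<close>

definition massey_series ::
    "('n::finite, 'r::comm_ring_1) ops \<Rightarrow> 'n \<Rightarrow> 'n \<Rightarrow> 'n \<Rightarrow> 'n \<Rightarrow> (2 + 2, 'r) mps" where
  "massey_series M \<alpha> \<beta> \<alpha>' \<beta>' = Mps (\<lambda>e. pairing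
     (M (map bas (massey_word (e (Inl 1)) (e (Inr 1)) (e (Inl 2)) (e (Inr 2)) \<alpha> \<beta> \<alpha>')))
     (bas (Eta \<beta>')))"

definition massey_r ::
    "('n::finite, 'r::comm_ring_1) ops \<Rightarrow> ('n, (2, 'r) mero) mat2" where
  "massey_r M = polar_part + vec_lambda (\<lambda>(\<beta>', \<beta>). vec_lambda (\<lambda>(\<alpha>', \<alpha>).
     of_mps (massey_series M \<alpha> \<beta> \<alpha>' \<beta>')))"

end

theory Submission
  imports Defs
begin

text \<open>
  Strict unitality, the grading and cyclicity leave only the products on the words
  \<open>\<xi>\<^sub>Y\<^bsup>d\<^esup> \<theta> \<xi>\<^sub>X\<^bsup>c\<^esup> \<eta> \<xi>\<^sub>Y\<^bsup>b\<^esup> \<theta> \<xi>\<^sub>X\<^bsup>a\<^esup>\<close>, subject to the relation coming from half a turn of the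
  cyclic word with a further \<open>\<eta>\<close>; this is skew-symmetry.  The \<open>A\<^sub>\<infinity>\<close>-relations can be rotated cyclically,
  so that only those on words with the letters \<open>\<theta> \<eta> \<theta> \<eta> \<theta>\<close> (up to runs of \<open>\<xi>\<close>) remain.  Their generating
  function is the AYBE with the poles cancelled: the products \<open>\<mm>\<^sub>2(\<eta>, \<theta>)\<close>, \<open>\<mm>\<^sub>2(\<theta>, \<eta>)\<close> insert one more
  \<open>\<xi>\<close>, which gives the divided differences produced by the polar part.

  In the same way, a cyclic functor is determined by its values on \<open>\<xi>\<^sub>Y\<^bsup>b\<^esup> \<theta> \<xi>\<^sub>X\<^bsup>a\<^esup>\<close>, the coefficients of a
  matrix of series \<open>\<phi>\<close>.  Cyclicity says that its values on the words with one \<open>\<eta>\<close> are the transposed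
  inverse of \<open>\<phi>\<close>, and determines the multiples of the identities that it takes as values on the words
  with one \<open>\<theta>\<close> and one \<open>\<eta>\<close>.  The functor equations are again invariant under rotation, and those on
  the words \<open>\<theta> \<eta> \<theta>\<close> say that \<open>\<phi>\<close> transforms one solution into the other.
\<close>

text \<open>The assignment is shown to be a bijection between structures and solutions themselves,
  before anything is divided out. Both A-infinity equivalences are then pullbacks of gauge
  equivalences, so symmetry and transitivity come from the gauge group and no functor is composed or
  inverted. Relations are tested by pairing with a generator, which turns a relation on a word into
  a scalar attached to a cyclic word. In reduced degrees |a| - 1, eta and xi count 0, theta and the
  identities -1. So an identity-free word of total -k has exactly k thetas: this leaves one letter
  pattern for the structure constants and functor equations, with k = 2, and one for the A-infinity
  relations, with k = 3. The coefficients of the A-infinity identities belong to power series, while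
  r has poles over a ring R that may have zero divisors. Each pole is cancelled against a difference
  of two substitutions; differences of variables are not zero divisors, so nothing is lost. The
  functor equations rotate only modulo equations on shorter words, which forces an induction on
  length.\<close>

definition shape :: "'n gen \<Rightarrow> obj \<times> obj \<times> int" where
  "shape g = (src g, tgt g, int (deg g) - 1)"

text \<open>The total reduced degree, an integer because theta and the identities count -1.
  \<open>red_deg\<close> adds the length instead of subtracting it and agrees with this only in
  parity; the exact value is needed to count thetas.\<close>

definition sdeg :: "'n gen list \<Rightarrow> int" where
  "sdeg gs = (\<Sum>g\<leftarrow>gs. int (deg g) - 1)"

lemma sdeg_simps [simp]:
  "sdeg [] = 0" "sdeg (g # gs) = int (deg g) - 1 + sdeg gs" "sdeg (us @ vs) = sdeg us + sdeg vs"
  "sdeg (replicate k (Xi Z)) = 0"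
  by (auto simp: sdeg_def sum_list_replicate)

lemma even_red_deg: "even (red_deg gs) \<longleftrightarrow> even (sdeg gs)"
  by (induction gs) (auto simp: red_deg_def)

lemma sum_deg_eq_sdeg: "(\<Sum>g\<leftarrow>gs. int (deg g)) = sdeg gs + int (length gs)"
  by (induction gs) auto

definition psgn :: "int \<Rightarrow> 'r::comm_ring_1" where
  "psgn p = (if even p then 1 else - 1)"

text \<open>The Koszul sign (-1)^(p q) for moving a block of reduced degree p past one of reduced
  degree q. Cyclicity is invariance under rotation up to this sign.\<close>

definition ksgn :: "int \<Rightarrow> int \<Rightarrow> 'r::comm_ring_1" where
  "ksgn p q = (if odd p \<and> odd q then - 1 else 1)"

lemma power_red_deg: "(- 1) ^ red_deg gs = (psgn (sdeg gs) :: 'r::comm_ring_1)"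
  by (simp add: psgn_def flip: even_red_deg)

lemma ksgn_square [simp]: "ksgn p q * (ksgn p q * x) = (x :: 'r::comm_ring_1)"
  by (simp add: ksgn_def)

section \<open>Signs, multilinear operations and cyclic words\<close>

section \<open>Multilinear and homogeneous operations\<close>

text \<open>Multilinearity for scalar functions of lists, so that components of operations, pairings
  and rotated functionals are expanded by one set of rules.\<close>

definition mlin :: "(('n::finite, 'r::comm_ring_1) mor list \<Rightarrow> 'r) \<Rightarrow> bool" where
  "mlin A \<longleftrightarrow>
     (\<forall>us vs a b c. A (us @ (c *s a + b) # vs) = c * A (us @ a # vs) + A (us @ b # vs))"

lemma multilinear_ops_iff: "multilinear_ops F \<longleftrightarrow> (\<forall>h. mlin (\<lambda>as. F as $ h))"
  unfolding multilinear_ops_def mlin_def by (simp add: vec_eq_iff) blast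

lemma mlin_lin: "mlin A \<Longrightarrow> A (us @ (c *s a + b) # vs) = c * A (us @ a # vs) + A (us @ b # vs)"
  by (simp add: mlin_def)

lemma mlin_add: "mlin A \<Longrightarrow> A (us @ (a + b) # vs) = A (us @ a # vs) + A (us @ b # vs)"
  using mlin_lin[of A us 1 a b vs] by simp

lemma mlin_zero: "mlin A \<Longrightarrow> A (us @ 0 # vs) = 0"
  using mlin_lin[of A us 1 0 0 vs] by simp

lemma mlin_scale: "mlin A \<Longrightarrow> A (us @ (c *s a) # vs) = c * A (us @ a # vs)"
  using mlin_lin[of A us c a 0 vs] mlin_zero[of A us vs] by simp

lemma mlin_sum: "mlin A \<Longrightarrow> A (us @ (\<Sum>i\<in>I. f i) # vs) = (\<Sum>i\<in>I. A (us @ f i # vs))"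
  by (induction I rule: infinite_finite_induct) (auto simp: mlin_zero mlin_add)

lemma bas_expansion: "(\<Sum>g\<in>UNIV. a $ g *s bas g) = (a :: ('n::finite, 'r::comm_ring_1) mor)"
  unfolding bas_def by (rule basis_expansion)

lemma mlin_bas: "mlin A \<Longrightarrow> A (us @ a # vs) = (\<Sum>g\<in>UNIV. a $ g * A (us @ bas g # vs))"
  by (subst bas_expansion[of a, symmetric]) (simp only: mlin_sum mlin_scale)

lemma mlin_Cons: "mlin A \<Longrightarrow> mlin (\<lambda>as. A (a # as))"
  using mlin_lin[of A "a # _"] by (auto simp: mlin_def)

lemma bas_nth [simp]: "bas g $ h = (if h = g then 1 else 0)"
  by (simp add: bas_def axis_def)

lemma bas_inject [simp]: "bas g = (bas h :: ('n::finite, 'r::comm_ring_1) mor) \<longleftrightarrow> g = h"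
  by (metis bas_nth zero_neq_one)

lemma multilinear_mlin: "multilinear_ops F \<Longrightarrow> mlin (\<lambda>as. F as $ h)"
  by (simp add: multilinear_ops_iff)

lemma multilinear_zero: "multilinear_ops F \<Longrightarrow> F (us @ 0 # vs) = 0"
  by (simp add: vec_eq_iff mlin_zero[OF multilinear_mlin[of F]])

lemma multilinear_scale: "multilinear_ops F \<Longrightarrow> F (us @ (c *s a) # vs) = c *s F (us @ a # vs)"
  by (simp add: vec_eq_iff mlin_scale[OF multilinear_mlin[of F]])

lemma multilinear_sum:
  "multilinear_ops F \<Longrightarrow> F (us @ (\<Sum>i\<in>I. f i) # vs) = (\<Sum>i\<in>I. F (us @ f i # vs))"
  by (simp add: vec_eq_iff mlin_sum[OF multilinear_mlin[of F]])

definition homog :: "('n::finite, 'r::comm_ring_1) mor \<Rightarrow> obj \<times> obj \<times> int \<Rightarrow> bool" where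
  "homog a \<sigma> \<longleftrightarrow> (\<forall>h. a $ h \<noteq> 0 \<longrightarrow> shape h = \<sigma>)"

text \<open>The shape of a value of an operation that shifts the total reduced degree by k: k = 1
  for the products, k = 0 for the components of a functor. Operands stand in the order of
  composition, so the source comes from the last one and the target from the first.\<close>

definition tot_shape :: "int \<Rightarrow> (obj \<times> obj \<times> int) list \<Rightarrow> obj \<times> obj \<times> int" where
  "tot_shape k ss = (fst (last ss), fst (snd (hd ss)), sum_list (map (snd \<circ> snd) ss) + k)"

lemma sum_list_shape [simp]: "sum_list (map (snd \<circ> snd) (map shape gs)) = sdeg gs"
  "sum_list (map (snd \<circ> snd \<circ> shape) gs) = sdeg gs"
  by (simp_all add: shape_def sdeg_def comp_def)

lemma homog_bas [simp]: "homog (bas g) (shape g)"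
  by (simp add: homog_def)

lemma homog_map_bas [simp]: "list_all2 homog (map bas gs) (map shape gs)"
  by (simp add: list_all2_conv_all_nth)

text \<open>Expanding a homogeneous argument in the basis involves only generators of its shape, and
  the factor k may depend on the shapes alone. This carries signed identities from generators to
  arguments that are values of inner operations.\<close>

lemma mlin_homog_eq:
  fixes A :: "(('n::finite, 'r::comm_ring_1) mor list \<Rightarrow> 'r)"
  assumes "mlin A" "mlin B" "list_all2 homog as ss"
    and "\<And>hs. map shape hs = ss \<Longrightarrow> A (map bas hs) = k * B (map bas hs)"
  shows "A as = k * B as"
  using assms(3,1,2,4)
proof (induction as ss arbitrary: A B rule: list_all2_induct)
  case Nil
  then show ?case using Nil(3)[of "[]"] by simp
next
  case (Cons a as s ss)
  have "a $ g * A (bas g # as) = k * (a $ g * B (bas g # as))" for g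
  proof (cases "a $ g = 0")
    case False
    then have s: "shape g = s" using Cons.hyps by (simp add: homog_def)
    have "A (bas g # as) = k * B (bas g # as)"
      by (rule Cons.IH[OF mlin_Cons[OF Cons.prems(1)] mlin_Cons[OF Cons.prems(2)]])
         (use Cons.prems(3)[of "g # _"] s in auto)
    then show ?thesis by simp
  qed simp
  then have "(\<Sum>g\<in>UNIV. a $ g * A (bas g # as)) = k * (\<Sum>g\<in>UNIV. a $ g * B (bas g # as))"
    by (simp add: sum_distrib_left)
  then show ?case
    using mlin_bas[OF Cons.prems(1), of "[]" a as] mlin_bas[OF Cons.prems(2), of "[]" a as] by simp
qed

lemma graded_multilinear: "graded_ops e F \<Longrightarrow> multilinear_ops F"
  by (simp add: graded_ops_def)

lemma graded_Nil [simp]: "graded_ops e F \<Longrightarrow> F [] = 0"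
  unfolding graded_ops_def composable_def by (metis list.map_disc_iff)

lemma graded_noncomposable: "graded_ops e F \<Longrightarrow> \<not> composable gs \<Longrightarrow> F (map bas gs) = 0"
  by (simp add: graded_ops_def)

lemma graded_homog_bas:
  assumes "graded_ops e F" "gs \<noteq> []"
  shows "homog (F (map bas gs)) (tot_shape (e - 1) (map shape gs))"
  unfolding homog_def
proof (intro allI impI)
  fix h assume h: "F (map bas gs) $ h \<noteq> 0"
  then have "composable gs" using assms graded_noncomposable by fastforce
  then have "src h = src (last gs) \<and> tgt h = tgt (hd gs) \<and>
      int (deg h) = (\<Sum>g\<leftarrow>gs. int (deg g)) + e - int (length gs)"
    using assms h unfolding graded_ops_def by blast
  then show "shape h = tot_shape (e - 1) (map shape gs)"
    using assms(2) by (simp add: tot_shape_def shape_def hd_map last_map sum_deg_eq_sdeg)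
qed

lemma graded_homog:
  fixes F :: "('n::finite, 'r::comm_ring_1) ops"
  assumes "graded_ops e F" "list_all2 homog as ss" "as \<noteq> []"
  shows "homog (F as) (tot_shape (e - 1) ss)"
  unfolding homog_def
proof (intro allI impI, rule ccontr)
  fix h assume h: "F as $ h \<noteq> 0" and ne: "shape h \<noteq> tot_shape (e - 1) ss"
  have ml: "mlin (\<lambda>as. F as $ h)"
    using assms(1) by (simp add: graded_ops_def multilinear_ops_iff)
  \<comment> \<open>The transfer is used with factor 0: on generators of these shapes the component
    at h vanishes.\<close>
  have "F as $ h = 0 * F as $ h"
  proof (rule mlin_homog_eq[OF ml ml assms(2)])
    fix hs :: "'n gen list" assume hs: "map shape hs = ss"
    then have "hs \<noteq> []" using assms(2,3) by auto
    then show "F (map bas hs) $ h = 0 * F (map bas hs) $ h"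
      using graded_homog_bas[OF assms(1), of hs] hs ne by (auto simp: homog_def)
  qed
  then show False using h by simp
qed

section \<open>The pairing and cyclic rotation\<close>

fun dual :: "'n gen \<Rightarrow> 'n gen" where
  "dual (Id Z) = Xi Z" | "dual (Xi Z) = Id Z" | "dual (Theta i) = Eta i" | "dual (Eta i) = Theta i"

lemma dual_simps [simp]: "dual (dual g) = g" "src (dual g) = tgt g" "tgt (dual g) = src g"
  "deg (dual g) = 1 - deg g"
  by (cases g; simp)+

lemma deg_le [simp]: "deg g \<le> 1"
  by (cases g) auto

lemma pairing_bas_eq: "pairing_bas g h = (if h = dual g then psgn (int (deg g) - 1) else 0)"
  by (cases g; cases h) (auto simp: psgn_def)

lemma pairing_bas_left: "pairing (bas g) a = psgn (int (deg g) - 1) * a $ dual g"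
proof -
  have "pairing (bas g) a = (\<Sum>g'\<in>UNIV. if g' = g then \<Sum>h\<in>UNIV. a $ h * pairing_bas g h else 0)"
    unfolding pairing_def by (rule sum.cong) auto
  also have "\<dots> = (\<Sum>h\<in>UNIV. if h = dual g then a $ h * psgn (int (deg g) - 1) else 0)"
    by (simp add: pairing_bas_eq if_distrib cong: if_cong)
  finally show ?thesis by (simp add: mult.commute)
qed

lemma pairing_bas_bas [simp]: "pairing (bas g) (bas h) = pairing_bas g h"
  by (auto simp: pairing_bas_left pairing_bas_eq)

lemma pairing_antisym: "pairing a b = - pairing b (a :: ('n::finite, 'r::comm_ring_1) mor)"
proof -
  have "pairing_bas g h = - (pairing_bas h g :: 'r)" for g h :: "'n gen"
    by (cases g; cases h) auto
  then have "a $ g * b $ h * pairing_bas g h = - (b $ h * a $ g * pairing_bas h g)" for g h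
    by (metis mult.commute mult_minus_right)
  then have "pairing a b = (\<Sum>g\<in>UNIV. \<Sum>h\<in>UNIV. - (b $ h * a $ g * pairing_bas h g))"
    unfolding pairing_def by simp
  also have "\<dots> = - pairing b a"
    unfolding pairing_def by (subst sum.swap) (simp add: sum_negf)
  finally show ?thesis .
qed

lemma pairing_simps [simp]:
  "pairing a (b + c) = pairing a b + pairing a c"
  "pairing a (k *s b) = k * pairing a b"
  "pairing a 0 = 0"
  "pairing (b + c) a = pairing b a + pairing c a"
  "pairing (k *s b) a = k * pairing b a"
  "pairing 0 a = 0"
  "pairing a (- b) = - pairing a b"
  "pairing (- b) a = - pairing b a"
  "pairing a (b - c) = pairing a b - pairing a c"
  by (simp_all add: pairing_def algebra_simps sum.distrib sum_distrib_left sum_negf sum_subtractf)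

lemma pairing_sum_right: "pairing a (\<Sum>i\<in>I. f i) = (\<Sum>i\<in>I. pairing a (f i))"
  by (induction I rule: infinite_finite_induct) auto

lemma pairing_sum_left: "pairing (\<Sum>i\<in>I. f i) a = (\<Sum>i\<in>I. pairing (f i) a)"
  by (induction I rule: infinite_finite_induct) auto

lemma pairing_nondeg: "(\<And>c. pairing (bas c) a = 0) \<Longrightarrow> a = (0 :: ('n::finite, 'r::comm_ring_1) mor)"
proof -
  assume *: "\<And>c. pairing (bas c) a = 0"
  have "a $ h = 0" for h
    using *[of "dual h"] by (auto simp: pairing_bas_left psgn_def split: if_splits)
  then show ?thesis by (simp add: vec_eq_iff)
qed

text \<open>The degrees of dual generators add up to 1, hence their reduced degrees to -1. The
  parity arguments in the rotations rest on this.\<close>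

lemma pairing_homog:
  fixes a :: "('n::finite, 'r::comm_ring_1) mor"
  assumes "homog a (s, t, p)" "homog b (s', t', p')" "pairing a b \<noteq> 0"
  shows "s = t' \<and> t = s' \<and> p + p' = - 1"
proof -
  obtain g where "(\<Sum>h\<in>UNIV. a $ g * b $ h * pairing_bas g h) \<noteq> 0"
    using assms(3) unfolding pairing_def by (meson sum.neutral)
  then obtain h where h: "a $ g * b $ h * pairing_bas g h \<noteq> 0"
    by (meson sum.neutral)
  then have "a $ g \<noteq> 0" "b $ h \<noteq> 0" "pairing_bas g h \<noteq> (0 :: 'r)"
    by auto
  then have "shape g = (s, t, p)" "shape h = (s', t', p')" "h = dual g"
    using assms(1,2) by (auto simp: homog_def pairing_bas_eq split: if_splits)
  then show ?thesis
    by (cases g) (auto simp: shape_def)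
qed

text \<open>The cyclic functional <c, M(as)> of a whole word. Cyclicity of M becomes invariance of
  this functional under rotation up to a Koszul sign, and every structure constant is one of its
  values up to sign.\<close>

fun pot :: "('n::finite, 'r::comm_ring_1) ops \<Rightarrow> ('n, 'r) mor list \<Rightarrow> 'r" where
  "pot M [] = 0"
| "pot M (c # as) = pairing c (M as)"

lemma mlin_pot:
  assumes "multilinear_ops M"
  shows "mlin (pot M)"
  unfolding mlin_def
proof (intro allI)
  fix us vs a b c
  show "pot M (us @ (c *s a + b) # vs) = c * pot M (us @ a # vs) + pot M (us @ b # vs)"
    using assms unfolding multilinear_ops_def by (cases us) auto
qed

lemma mlin_rotate1:
  assumes "mlin A"
  shows "mlin (\<lambda>as. A (rotate1 as))"
  unfolding mlin_def
proof (intro allI)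
  fix us vs a b c
  show "A (rotate1 (us @ (c *s a + b) # vs)) =
      c * A (rotate1 (us @ a # vs)) + A (rotate1 (us @ b # vs))"
    using mlin_lin[OF assms, of vs c a b "[]"] mlin_lin[OF assms, of "tl us" c a b "vs @ [hd us]"]
    by (cases us) auto
qed

lemma cyc_composable_rotate:
  "cyc_composable (b # gs @ [c]) \<longleftrightarrow> cyc_composable (c # b # gs)"
  by (cases gs) (auto simp: cyc_composable_def composable_def successively_append_iff successively_Cons)

text \<open>Either the operation vanishes because its word is not composable, or source and target
  of its value do not fit the first letter. With this the rotation rule needs no assumption of
  composability.\<close>

lemma pot_noncyc:
  assumes "graded_ops e M" "length w \<ge> 2" "\<not> cyc_composable w"
  shows "pot M (map bas w) = 0"
proof (rule ccontr)
  assume *: "pot M (map bas w) \<noteq> 0"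
  obtain c v where w: "w = c # v" "v \<noteq> []"
    using assms(2) by (cases w; cases "tl w") auto
  have *: "pairing (bas c) (M (map bas v)) \<noteq> 0" using * w by simp
  then have "composable v" using graded_noncomposable[OF assms(1), of v] by (cases "composable v") auto
  moreover have "src c = tgt (hd v) \<and> tgt c = src (last v)"
    using pairing_homog[OF homog_bas[of c, unfolded shape_def]
        graded_homog_bas[OF assms(1) w(2), unfolded tot_shape_def] *] w(2)
    by (simp add: hd_map last_map shape_def)
  ultimately show False
    using assms(3) w by (auto simp: cyc_composable_def composable_def successively_Cons)
qed

text \<open>\<open>cyclic_ops\<close> speaks of generators only; homogeneous entries are needed
  because one of them will be the value of an inner operation.\<close>

lemma pot_rotate:
  fixes M :: "('n::finite, 'r::comm_ring_1) ops"
  assumes "graded_ops 2 M" "cyclic_ops M" "list_all2 homog as ss" "length as \<ge> 2"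
  shows "pot M as =
    ksgn (snd (snd (hd ss))) (sum_list (map (snd \<circ> snd) (tl ss))) * pot M (rotate1 as)"
proof (rule mlin_homog_eq[OF _ _ assms(3)])
  show ml: "mlin (pot M)" using assms(1) by (intro mlin_pot graded_multilinear)
  show "mlin (\<lambda>as. pot M (rotate1 as))" by (intro mlin_rotate1 ml)
  fix hs :: "'n gen list" assume hs: "map shape hs = ss"
  have "length hs \<ge> 2" using assms(3,4) hs by (auto dest: list_all2_lengthD)
  then obtain c b gs where w: "hs = c # b # gs"
    by (cases hs; cases "tl hs") auto
  have rot: "rotate1 (map bas hs) = map bas (b # gs @ [c])" by (simp add: w)
  show "pot M (map bas hs) = ksgn (snd (snd (hd ss))) (sum_list (map (snd \<circ> snd) (tl ss))) *
      pot M (rotate1 (map bas hs))"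
  proof (cases "cyc_composable hs")
    case True
    have sg: "(- 1) ^ ((deg c + 1) * red_deg (b # gs)) =
        (ksgn (int (deg c) - 1) (sdeg (b # gs)) :: 'r)"
      using even_red_deg[of "b # gs"] by (auto simp: ksgn_def)
    have "pot M (map bas hs) = ksgn (int (deg c) - 1) (sdeg (b # gs)) *
        pot M (map bas (b # gs @ [c]))"
      using assms(2) True unfolding cyclic_ops_def sg[symmetric] w by simp
    moreover have "snd (snd (hd ss)) = int (deg c) - 1"
      "sum_list (map (snd \<circ> snd) (tl ss)) = sdeg (b # gs)"
      by (simp_all add: hs[symmetric] w shape_def sdeg_def comp_def)
    ultimately show ?thesis unfolding rot by simp
  next
    case False
    then show ?thesis
      using pot_noncyc[OF assms(1), of hs] pot_noncyc[OF assms(1), of "b # gs @ [c]"]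
      by (simp add: rot w cyc_composable_rotate)
  qed
qed

section \<open>Sums over the splittings of a word\<close>

text \<open>The sum over all cuts of a word into two pieces, either of which may be empty. Nested
  uses enumerate cuts into three pieces, and the recursive form makes rearrangements of such sums
  plain inductions.\<close>

fun ssum :: "('a list \<Rightarrow> 'a list \<Rightarrow> 'b::comm_monoid_add) \<Rightarrow> 'a list \<Rightarrow> 'b" where
  "ssum f [] = f [] []"
| "ssum f (x # xs) = f [] (x # xs) + ssum (\<lambda>u v. f (x # u) v) xs"

lemma ssum_cong: "(\<And>u v. u @ v = w \<Longrightarrow> f u v = g u v) \<Longrightarrow> ssum f w = ssum g w"
proof (induction w arbitrary: f g)
  case (Cons x w)
  have "ssum (\<lambda>u. f (x # u)) w = ssum (\<lambda>u. g (x # u)) w"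
    by (rule Cons.IH) (rule Cons.prems, simp)
  moreover have "f [] (x # w) = g [] (x # w)"
    by (rule Cons.prems) simp
  ultimately show ?case by simp
qed simp

lemma ssum_snoc: "ssum f (w @ [x]) = ssum (\<lambda>u v. f u (v @ [x])) w + f (w @ [x]) []"
  by (induction w arbitrary: f) (auto simp: add.assoc)

lemma ssum_add: "ssum (\<lambda>u v. f u v + g u v) w = ssum f w + ssum g w"
  by (induction w arbitrary: f g) (auto simp: algebra_simps)

lemma ssum_zero [simp]: "ssum (\<lambda>u v. 0) w = 0"
  by (induction w) auto

lemma ssum_neutral: "(\<And>u v. u @ v = w \<Longrightarrow> f u v = 0) \<Longrightarrow> ssum f w = 0"
  using ssum_cong[of w f "\<lambda>u v. 0"] by simp

lemma ssum_mult: "ssum (\<lambda>u v. c * f u v) w = (c :: 'r::comm_ring_1) * ssum f w"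
  by (induction w arbitrary: f) (auto simp: algebra_simps)

lemma ssum_hom: "(\<And>x y. H (x + y) = H x + H y) \<Longrightarrow> H (ssum f w) = ssum (\<lambda>u v. H (f u v)) w"
  by (induction w arbitrary: f) auto

text \<open>Both sides run over all cuts into three pieces; they differ only in which cut is made
  first.\<close>

lemma ssum_assoc:
  "ssum (\<lambda>u r. ssum (\<lambda>z v. f u z v) r) w = ssum (\<lambda>r v. ssum (\<lambda>u z. f u z v) r) w"
  by (induction w arbitrary: f) (auto simp: ssum_add add.assoc)

lemma ssum_conv_sum: "ssum f w = (\<Sum>i\<le>length w. f (take i w) (drop i w))"
proof (induction w arbitrary: f)
  case (Cons x xs)
  have "(\<Sum>i\<le>Suc (length xs). f (take i (x # xs)) (drop i (x # xs))) =
      f [] (x # xs) + (\<Sum>i\<le>length xs. f (x # take i xs) (drop i xs))"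
    by (subst sum.atMost_Suc_shift) simp
  then show ?case by (simp add: Cons)
qed simp

text \<open>A cut falls inside the leading run, up to the place just before g, or behind g. Repeated
  use gives one ordinary sum per run of a word.\<close>

lemma ssum_run:
  "ssum f (replicate d x @ g # w) =
    (\<Sum>i\<le>d. f (replicate i x) (replicate (d - i) x @ g # w)) +
    ssum (\<lambda>u v. f (replicate d x @ g # u) v) w"
proof (induction d arbitrary: f)
  case (Suc d)
  have "(\<Sum>i\<le>Suc d. f (replicate i x) (replicate (Suc d - i) x @ g # w)) =
      f [] (x # replicate d x @ g # w) +
      (\<Sum>i\<le>d. f (x # replicate i x) (replicate (d - i) x @ g # w))"
    by (subst sum.atMost_Suc_shift) simp
  then show ?case by (simp add: Suc add.assoc)
qed simp

lemma ssum_replicate: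
  "ssum f (replicate d x) = (\<Sum>i\<le>d. f (replicate i x) (replicate (d - i) x))"
  by (simp add: ssum_conv_sum min_def)

text \<open>The lengths (m, l) are replaced by the cut into p, z, q: z is the operand of the inner
  operation, m its length and l the length of q. The empty z is excluded because the defining sum
  starts at m = 1.\<close>

lemma insertion_sum_ssum:
  "insertion_sum F M gs = ssum (\<lambda>p r. ssum (\<lambda>z q. if z = [] then 0 else
     psgn (sdeg q) *s F (map bas p @ M (map bas z) # map bas q)) r) gs"
proof -
  define d where "d = length gs"
  define T where "T p z q = (if z = [] then 0 else
     psgn (sdeg q) *s F (map bas p @ M (map bas z) # map bas q))" for p z q
  have "insertion_sum F M gs = (\<Sum>(m, l)\<in>(SIGMA m:{1..d}. {0..d - m}).
      T (take (d - m - l) gs) (take m (drop (d - m - l) gs)) (drop (d - l) gs))"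
    unfolding insertion_sum_def Let_def d_def[symmetric] sum.Sigma[OF finite_atLeastAtMost ballI[OF finite_atLeastAtMost]]
    by (rule sum.cong) (auto simp: T_def power_red_deg take_map drop_map d_def)
  also have "\<dots> = (\<Sum>(i, m)\<in>(SIGMA i:{..d}. {1..d - i}).
      T (take i gs) (take m (drop i gs)) (drop (i + m) gs))"
    by (rule sum.reindex_bij_witness[of _ "\<lambda>(i, m). (m, d - m - i)" "\<lambda>(m, l). (d - m - l, m)"]) auto
  also have "\<dots> = (\<Sum>i\<le>d. \<Sum>m=1..d - i. T (take i gs) (take m (drop i gs)) (drop (i + m) gs))"
    by (simp add: sum.Sigma)
  also have "\<dots> = (\<Sum>i\<le>d. \<Sum>m\<le>d - i. T (take i gs) (take m (drop i gs)) (drop (i + m) gs))"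
    by (intro sum.cong refl sum.mono_neutral_left) (auto simp: T_def)
  also have "\<dots> = ssum (\<lambda>p r. ssum (T p) r) gs"
    by (simp add: ssum_conv_sum d_def add.commute)
  finally show ?thesis unfolding T_def[abs_def] .
qed

lemma insertion_sum_ssum':
  assumes "multilinear_ops F" "M [] = 0"
  shows "insertion_sum F M gs = ssum (\<lambda>p r. ssum (\<lambda>z q.
     psgn (sdeg q) *s F (map bas p @ M (map bas z) # map bas q)) r) gs"
  unfolding insertion_sum_ssum
  by (intro ssum_cong) (auto simp: assms multilinear_zero)

section \<open>Words and their rotations\<close>

definition no_id :: "'n gen list \<Rightarrow> bool" where
  "no_id w \<longleftrightarrow> (\<forall>Z. Id Z \<notin> set w)"

lemma no_id_simps [simp]: "no_id []" "no_id (Xi Z # w) = no_id w" "no_id (Theta i # w) = no_id w"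
  "no_id (Eta i # w) = no_id w" "\<not> no_id (Id Z # w)" "no_id (u @ v) \<longleftrightarrow> no_id u \<and> no_id v"
  "no_id (replicate k (Xi Z))"
  by (auto simp: no_id_def)

lemma sdeg_nonpos: "sdeg w \<le> 0"
proof (induction w)
  case (Cons g w)
  then show ?case using deg_le[of g] by simp
qed simp

lemma composable_Cons: "composable (g # w) \<longleftrightarrow> w = [] \<or> composable w \<and> src g = tgt (hd w)"
  by (auto simp: composable_def successively_Cons)

text \<open>Without identities the only endomorphism of Z among the letters is xi. Read from the
  target end, the word is therefore a run of xi, followed, unless it ends there, by a letter that
  leaves Z.\<close>

lemma run_split:
  assumes "composable w" "no_id w" "tgt (hd w) = Z"
  obtains (run) d where "w = replicate d (Xi Z)" "src (last w) = Z"
  | (letter) d g v where "w = replicate d (Xi Z) @ g # v" "tgt g = Z" "src g \<noteq> Z" "no_id (g # v)"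
      "v = [] \<or> composable v \<and> tgt (hd v) = src g" "src (last w) = (if v = [] then src g else src (last v))"
  using assms
proof (induction w arbitrary: thesis)
  case Nil
  then show ?case by (simp add: composable_def)
next
  case (Cons g w)
  consider "g = Xi Z" | "src g \<noteq> Z"
    using Cons.prems(4,5) by (cases g; cases Z) auto
  then show ?case
  proof cases
    case 1
    show ?thesis
    proof (cases "w = []")
      case True
      then show ?thesis using Cons.prems(1)[of 1] 1 by simp
    next
      case False
      then have w: "composable w" "no_id w" "tgt (hd w) = Z"
        using Cons.prems 1 by (auto simp: composable_Cons)
      show ?thesis
      proof (rule Cons.IH[OF _ _ w], goal_cases)
        case (1 d)
        then show ?thesis using Cons.prems(1)[of "Suc d"] \<open>g = Xi Z\<close> False by simp
      next
        case (2 d g' v)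
        then show ?thesis using Cons.prems(2)[of "Suc d" g' v] \<open>g = Xi Z\<close> False by simp
      qed
    qed
  next
    case 2
    then show ?thesis
      using Cons.prems(2)[of 0 g w] Cons.prems(3-5) by (auto simp: composable_Cons)
  qed
qed

text \<open>Read from the target end, Y can be left only by a theta and X only by an eta. Peeling
  off one of each gives the recursion behind the classifications by degree.\<close>

lemma word_YX:
  assumes "composable w" "no_id w" "tgt (hd w) = ObY" "src (last w) = ObX"
  obtains (one) d i a where "w = replicate d (Xi ObY) @ Theta i # replicate a (Xi ObX)"
  | (more) d i c j v where "w = replicate d (Xi ObY) @ Theta i # replicate c (Xi ObX) @ Eta j # v"
      "composable v" "no_id v" "tgt (hd v) = ObY" "src (last v) = ObX"
  using assms(1-3)
proof (cases rule: run_split)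
  case (run d)
  then show ?thesis using assms(4) by simp
next
  case (letter d g v)
  then obtain i where g: "g = Theta i" using assms(4)
    by (cases g) auto
  show ?thesis
  proof (cases "v = []")
    case True
    then show ?thesis using one[of d i 0] letter g by simp
  next
    case False
    then have v: "composable v" "no_id v" "tgt (hd v) = ObX" "src (last v) = ObX"
      using letter g assms(4) by auto
    from v(1-3) show ?thesis
    proof (cases rule: run_split)
      case (run a)
      then show ?thesis using one[of d i a] letter g by simp
    next
      case 2: (letter c g' v')
      then obtain j where g': "g' = Eta j" by (cases g') auto
      show ?thesis
        using more[of d i c j v'] letter(1) g 2 g' v(4) by (auto split: if_splits)
    qed
  qed
qed

lemma word_YX_sdeg:
  assumes "composable w" "no_id w" "tgt (hd w) = ObY" "src (last w) = ObX"
  shows "sdeg w \<le> - 1"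
  using assms
proof (cases rule: word_YX)
  case (more d i c j v)
  then show ?thesis using sdeg_nonpos[of v] by simp
qed simp

text \<open>Eta and xi have reduced degree 0, so -2 counts two thetas.\<close>

lemma word_YX_2:
  assumes "composable w" "no_id w" "tgt (hd w) = ObY" "src (last w) = ObX" "sdeg w = - 2"
  obtains a b c d i j k where "w = massey_word a b c d i j k"
  using assms(1-4)
proof (cases rule: word_YX)
  case (one d i a)
  then show ?thesis using assms(5) by simp
next
  case (more d k c j v)
  from more(2-5) show ?thesis
  proof (cases rule: word_YX)
    case (one b i a)
    then show ?thesis using that[of a b c d i j k] more by (simp add: massey_word_def)
  next
    case 2: (more b i a l v')
    then show ?thesis using word_YX_sdeg[of v'] more assms(5) by simp
  qed
qed

text \<open>The word along X_1, Y_1, X_2, Y_2, X_3, Y_3; the indices follow the path and so increase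
  from right to left. A further eta closes it to the cyclic words that carry the A-infinity
  relations.\<close>

definition massey5 where
  "massey5 a1 b1 a2 b2 a3 b3 i1 j1 i2 j2 i3 =
     replicate b3 (Xi ObY) @ Theta i3 # replicate a3 (Xi ObX) @ Eta j2 # massey_word a1 b1 a2 b2 i1 j1 i2"

lemma word_YX_3:
  assumes "composable w" "no_id w" "tgt (hd w) = ObY" "src (last w) = ObX" "sdeg w = - 3"
  obtains a1 b1 a2 b2 a3 b3 i1 j1 i2 j2 i3 where "w = massey5 a1 b1 a2 b2 a3 b3 i1 j1 i2 j2 i3"
  using assms(1-4)
proof (cases rule: word_YX)
  case (one d i a)
  then show ?thesis using assms(5) by simp
next
  case (more d k c j v)
  then have "sdeg v = - 2" using assms(5) by simp
  then show ?thesis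
    using word_YX_2[OF more(2-5)] that more(1) unfolding massey5_def by metis
qed

lemma rotate_append:
  assumes rot: "\<And>c b gs. Z (b # gs @ [c]) \<Longrightarrow> Z (c # b # gs)"
  shows "Z (vs @ us) \<Longrightarrow> Z (us @ vs)"
proof (induction us arbitrary: vs)
  case (Cons c us)
  then have *: "Z (us @ vs @ [c])" by simp
  show ?case
  proof (cases "us @ vs")
    case Nil
    then show ?thesis using Cons.prems by simp
  next
    case (Cons b gs)
    have "Z ((us @ vs) @ [c])" using * by simp
    then have "Z (c # b # gs)" unfolding Cons by (intro rot) simp
    then show ?thesis using Cons by simp
  qed
qed simp

text \<open>Only eta has target X and source Y, so from target X the object Y is never reached.
  Consequently a cyclic word that contains a theta also contains an eta.\<close>

lemma no_eta_X:
  assumes "composable w" "no_id w" "\<forall>i. Eta i \<notin> set w" "tgt (hd w) = ObX"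
  shows "src (last w) = ObX"
  using assms(1,2,4)
proof (cases rule: run_split)
  case (letter d g v)
  then show ?thesis using assms(3) by (cases g) auto
qed simp

text \<open>A rotation-stable property of cyclic words has to be checked only on words that start
  with an eta. The negative total -k excludes words made of xi alone, a theta forces an eta, and a
  word with an identity is rotated until the identity stands first, where \<open>ident\<close>
  applies.\<close>

lemma rotation_principle:
  fixes Z :: "'n gen list \<Rightarrow> bool"
  assumes rot: "\<And>c b gs. Z (b # gs @ [c]) \<Longrightarrow> Z (c # b # gs)"
    and ident: "\<And>Y gs. gs \<noteq> [] \<Longrightarrow> Z (Id Y # gs)"
    and cyc: "\<And>w. \<not> cyc_composable w \<Longrightarrow> Z w"
    and deg: "\<And>w. length w \<ge> 2 \<Longrightarrow> sdeg w \<noteq> - k \<Longrightarrow> Z w"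
    and main: "\<And>i w. composable w \<Longrightarrow> no_id w \<Longrightarrow> tgt (hd w) = ObY \<Longrightarrow> src (last w) = ObX \<Longrightarrow>
      sdeg w = - k \<Longrightarrow> Z (Eta i # w)"
    and "k \<ge> 1" "length w \<ge> 2"
  shows "Z w"
proof -
  have rotate: "Z (vs @ us) \<Longrightarrow> Z (us @ vs)" for us vs
    by (rule rotate_append[of Z, OF rot])
  have zc: "cyc_composable (vs @ us)" if "cyc_composable (us @ vs)" for us vs :: "'n gen list"
  proof -
    have "cyc_composable (us @ vs) \<longrightarrow> cyc_composable (vs @ us)"
      by (rule rotate_append[of "\<lambda>w. cyc_composable (us @ vs) \<longrightarrow> cyc_composable w"])
         (auto simp: cyc_composable_rotate)
    then show ?thesis using that by simp
  qed
  show ?thesis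
  proof (cases "cyc_composable w \<and> sdeg w = - k")
    case False
    then show ?thesis using cyc deg assms(7) by blast
  next
    case True
    show ?thesis
    proof (cases "no_id w")
      case False
      then obtain Y us vs where w: "w = us @ Id Y # vs"
        by (meson no_id_def split_list)
      have "Z ((Id Y # vs) @ us)"
        using ident[of "vs @ us" Y] assms(7) w by (cases "vs @ us = []") auto
      from rotate[OF this] w show ?thesis by simp
    next
      case nid: True
      have "\<exists>i. Eta i \<in> set w"
      proof (rule ccontr)
        assume ne: "\<nexists>i. Eta i \<in> set w"
        have "\<exists>i. Theta i \<in> set w"
        proof (rule ccontr)
          assume nt: "\<nexists>i. Theta i \<in> set w"
          have "\<forall>g\<in>set w. \<exists>Z. g = Xi Z"
            using ne nt nid by (metis gen.exhaust no_id_def)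
          then have "sdeg w = 0" unfolding sdeg_def by (induction w) auto
          then show False using True assms(6) by simp
        qed
        then obtain i us vs where w: "w = us @ Theta i # vs" by (meson split_list)
        let ?v = "vs @ us"
        have v: "?v \<noteq> []" using w assms(7) by auto
        have "cyc_composable ((Theta i # vs) @ us)"
          by (rule zc) (use True w in simp)
        then have "composable ?v" "tgt (hd ?v) = ObX" "src (last ?v) = ObY"
          using v by (auto simp: cyc_composable_def composable_Cons split: if_splits)
        moreover have "no_id ?v" "\<forall>i. Eta i \<notin> set ?v"
          using nid ne w by (auto simp: no_id_def)
        ultimately show False using no_eta_X[of ?v] by simp
      qed
      then obtain i us vs where w: "w = us @ Eta i # vs" by (meson split_list)
      let ?v = "vs @ us"
      have v: "?v \<noteq> []" using w assms(7) by auto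
      have "cyc_composable ((Eta i # vs) @ us)"
        by (rule zc) (use True w in simp)
      then have "composable ?v" "tgt (hd ?v) = ObY" "src (last ?v) = ObX"
        using v by (auto simp: cyc_composable_def composable_Cons split: if_splits)
      then have "Z ((Eta i # vs) @ us)"
        using main[of ?v i] True nid w by auto
      from rotate[OF this] w show ?thesis by simp
    qed
  qed
qed

section \<open>Rotation of the A-infinity relations and of the functor equations\<close>

section \<open>Rotating the \<open>A\<^sub>\<infinity>\<close>-relations\<close>

lemma list_all2_homog_mid:
  "homog a \<sigma> \<Longrightarrow> list_all2 homog (map bas p @ a # map bas q) (map shape p @ \<sigma> # map shape q)"
  by (intro list_all2_appendI) auto

lemma tot_shape_nest:
  "z \<noteq> [] \<Longrightarrow> tot_shape k (map shape p @ tot_shape l (map shape z) # map shape q) =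
    tot_shape (k + l) (map shape (p @ z @ q))"
  by (cases p; cases q rule: rev_cases) (auto simp: tot_shape_def hd_append last_map)

lemma insertion_homog:
  assumes "graded_ops e F" "graded_ops e' M"
  shows "homog (insertion_sum F M gs) (tot_shape (e + e' - 2) (map shape gs))"
  unfolding homog_def
proof (intro allI impI, rule ccontr)
  fix h
  assume h: "insertion_sum F M gs $ h \<noteq> 0" and ne: "shape h \<noteq> tot_shape (e + e' - 2) (map shape gs)"
  have "(if z = [] then 0 else psgn (sdeg q) *s F (map bas p @ M (map bas z) # map bas q)) $ h = 0"
    if "p @ z @ q = gs" for p z q
  proof (cases "z = []")
    case False
    have "homog (F (map bas p @ M (map bas z) # map bas q))
        (tot_shape (e - 1) (map shape p @ tot_shape (e' - 1) (map shape z) # map shape q))"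
      by (rule graded_homog[OF assms(1)])
         (auto intro!: list_all2_homog_mid graded_homog_bas[OF assms(2)] False)
    then have "F (map bas p @ M (map bas z) # map bas q) $ h = 0"
      using ne that unfolding homog_def tot_shape_nest[OF False] by (auto simp: algebra_simps)
    then show ?thesis using False by simp
  qed simp
  then have "insertion_sum F M gs $ h = 0"
    unfolding insertion_sum_ssum
    by (subst ssum_hom[of "\<lambda>x. x $ h"], simp, intro ssum_neutral,
        subst ssum_hom[of "\<lambda>x. x $ h"], simp, intro ssum_neutral) blast
  then show False using h by simp
qed

lemma pairing_ssum: "pairing a (ssum f w) = ssum (\<lambda>u v. pairing a (f u v)) w"
  by (rule ssum_hom) simp

text \<open>The inner operation shifts its block by 1, so moving c past it costs an extra (-1)^c.
  That is exactly the change of the A-infinity sign once c stands behind the inner block.\<close>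

lemma sign_shift:
  "psgn q * ksgn c (b + (p + (z + 1 + q))) = ksgn c (b + p + z + q) * (psgn (q + c) :: 'r::comm_ring_1)"
  by (auto simp: psgn_def ksgn_def)

text \<open>For the terms in which the inner operation contains the first letter b. The factor -1 is
  the antisymmetry of the pairing; the odd total makes the remaining signs agree.\<close>

lemma sign_flip:
  assumes "q + c + b + z = k" "odd k"
  shows "psgn q * (ksgn c (b + z + 1 + q) * - 1) =
    (ksgn c (b + (z + q)) * ksgn (q + (c + 1)) (b + z) :: 'r::comm_ring_1)"
proof -
  have "odd (q + c + b + z)" using assms by simp
  then show ?thesis
    by (cases "even q"; cases "even c"; cases "even b"; cases "even z") (simp_all add: psgn_def ksgn_def)
qed

text \<open>Terms whose inner operation avoids b match the terms on the other side whose inner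
  operation avoids c, by rotating the outer operation. The remaining ones are <c, M(M(b, z), q)>;
  two rotations and the antisymmetry of the pairing turn them into <b, M(z, M(q, c))>.\<close>

lemma insertion_rotate:
  fixes M :: "('n::finite, 'r::comm_ring_1) ops"
  assumes gr: "graded_ops 2 M" and cyc: "cyclic_ops M"
  shows "pairing (bas c) (insertion_sum M M (b # gs)) =
    ksgn (int (deg c) - 1) (sdeg (b # gs)) * pairing (bas b) (insertion_sum M M (gs @ [c]))"
proof -
  define t where "t c p z q = psgn (sdeg q) * pairing (bas c) (M (map bas p @ M (map bas z) # map bas q))"
    for c p z q
  define K :: 'r where "K = ksgn (int (deg c) - 1) (sdeg (b # gs))"
  have ml: "multilinear_ops M" using gr by (rule graded_multilinear)
  have t0 [simp]: "t c p [] q = 0" for c p q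
    using graded_Nil[OF gr] multilinear_zero[OF ml] by (simp add: t_def)
  have ins: "pairing (bas c) (insertion_sum M M w) = ssum (\<lambda>p r. ssum (t c p) r) w" for c w
    unfolding insertion_sum_ssum'[where M = M, OF ml graded_Nil[OF gr]] pairing_ssum t_def[abs_def] by simp
  have hM: "homog (M (map bas z)) (tot_shape 1 (map shape z))" if "z \<noteq> []" for z
    using graded_homog_bas[OF gr that] by simp
  have E1: "t c (b # p) z q = K * t b p z (q @ [c])" if "p @ z @ q = gs" for p z q
  proof (cases "z = []")
    case False
    let ?x = "pot M (bas b # map bas p @ M (map bas z) # map bas q @ [bas c])"
    have 1: "pot M (bas c # bas b # map bas p @ M (map bas z) # map bas q) =
        ksgn (int (deg c) - 1) (int (deg b) - 1 + (sdeg p + (sdeg z + 1 + sdeg q))) * ?x"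
      using pot_rotate[OF gr cyc, of "map bas (c # b # p) @ M (map bas z) # map bas q"
          "map shape (c # b # p) @ tot_shape 1 (map shape z) # map shape q"]
        list_all2_homog_mid[OF hM[OF False], of "c # b # p" q]
      by (simp add: tot_shape_def shape_def sdeg_def comp_def)
    have "t c (b # p) z q = psgn (sdeg q) *
        ksgn (int (deg c) - 1) (int (deg b) - 1 + (sdeg p + (sdeg z + 1 + sdeg q))) * ?x"
      using 1 by (simp add: t_def mult.assoc)
    also have "\<dots> = K * psgn (sdeg q + (int (deg c) - 1)) * ?x"
      unfolding sign_shift by (simp add: K_def that[symmetric] algebra_simps)
    also have "\<dots> = K * t b p z (q @ [c])"
      by (simp add: t_def mult.assoc)
    finally show ?thesis .
  qed simp
  have E2: "t c [] (b # z) q = K * t b z (q @ [c]) []" if "z @ q = gs" for z q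
  proof -
    let ?u = "M (map bas (b # z))" and ?v = "M (map bas (q @ [c]))"
    have hu: "homog ?u (tot_shape 1 (map shape (b # z)))"
      and hv: "homog ?v (tot_shape 1 (map shape (q @ [c])))"
      by (rule hM; simp)+
    have 1: "pot M (bas c # ?u # map bas q) =
        ksgn (int (deg c) - 1) (int (deg b) - 1 + sdeg z + 1 + sdeg q) * pairing ?u ?v"
      using pot_rotate[OF gr cyc, of "map bas [c] @ ?u # map bas q"
          "map shape [c] @ tot_shape 1 (map shape (b # z)) # map shape q"] list_all2_homog_mid[OF hu, of "[c]" q]
      by (simp add: tot_shape_def shape_def sdeg_def comp_def)
    have 2: "pairing ?v ?u = ksgn (sdeg q + int (deg c)) (int (deg b) - 1 + sdeg z) *
        pot M (bas b # map bas z @ [?v])"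
      using pot_rotate[OF gr cyc, of "map bas [] @ ?v # map bas (b # z)"
          "map shape [] @ tot_shape 1 (map shape (q @ [c])) # map shape (b # z)"]
        list_all2_homog_mid[OF hv, of "[]" "b # z"]
      by (simp add: tot_shape_def shape_def sdeg_def comp_def algebra_simps)
    have 3: "pot M (bas b # map bas z @ [?v]) =
        ksgn (sdeg q + int (deg c)) (int (deg b) - 1 + sdeg z) * pairing ?v ?u"
      unfolding 2 by simp
    show ?thesis
    \<comment> \<open>The sign identity needs the total degree that only a nonzero pairing
      guarantees.\<close>
    proof (cases "pairing ?v ?u = 0")
      case True
      then have "pairing ?u ?v = 0" by (metis pairing_antisym neg_equal_0_iff_equal)
      then show ?thesis using 1 3 True by (simp add: t_def)
    next
      case False
      have par: "sdeg (q @ [c]) + 1 + (sdeg (b # z) + 1) = - 1"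
        using pairing_homog[OF hv[unfolded tot_shape_def] hu[unfolded tot_shape_def] False]
        by (simp add: sdeg_def shape_def comp_def)
      have sg: "psgn (sdeg q) * (ksgn (int (deg c) - 1) (int (deg b) - 1 + sdeg z + 1 + sdeg q) * - 1) =
          K * ksgn (sdeg q + int (deg c)) (int (deg b) - 1 + sdeg z)"
        using sign_flip[of "sdeg q" "int (deg c) - 1" "int (deg b) - 1" "sdeg z" "- 3"] par
        by (simp add: K_def that[symmetric] add.commute)
      have "t c [] (b # z) q = psgn (sdeg q) * pot M (bas c # ?u # map bas q)"
        by (simp add: t_def)
      also have "\<dots> = psgn (sdeg q) *
          (ksgn (int (deg c) - 1) (int (deg b) - 1 + sdeg z + 1 + sdeg q) * - 1) * pairing ?v ?u"
        unfolding 1 using pairing_antisym[of ?u ?v] by simp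
      also have "\<dots> = K * pot M (bas b # map bas z @ [?v])"
        unfolding sg 3 by (simp add: mult.assoc)
      also have "\<dots> = K * t b z (q @ [c]) []"
        by (simp add: t_def psgn_def)
      finally show ?thesis .
    qed
  qed
  have "pairing (bas c) (insertion_sum M M (b # gs)) =
      ssum (\<lambda>z q. t c [] (b # z) q) gs + ssum (\<lambda>p r. ssum (\<lambda>z q. t c (b # p) z q) r) gs"
    by (simp add: ins)
  also have "\<dots> = ssum (\<lambda>z q. K * t b z (q @ [c]) []) gs +
      ssum (\<lambda>p r. ssum (\<lambda>z q. K * t b p z (q @ [c])) r) gs"
    by (intro arg_cong2[of _ _ _ _ "(+)"] ssum_cong E1 E2) auto
  also have "\<dots> = K * (ssum (\<lambda>p r. ssum (\<lambda>z q. t b p z (q @ [c])) r) gs +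
      ssum (\<lambda>z q. t b z (q @ [c]) []) gs)"
    by (simp add: ssum_mult algebra_simps)
  also have "\<dots> = K * ssum (\<lambda>p r. ssum (t b p) r) (gs @ [c])"
    by (simp add: ssum_snoc ssum_add)
  finally show ?thesis by (simp add: ins K_def)
qed

text \<open>Rotation moves the identity among the at least three arguments of the operation, where
  strict unitality makes the value 0.\<close>

lemma pairing_Id_ge3:
  assumes "graded_ops 2 M" "cyclic_ops M" "strictly_unital_ops M"
    "list_all2 homog as ss" "length as \<ge> 3"
  shows "pairing (bas (Id Z)) (M as) = 0"
proof -
  have "pot M (bas (Id Z) # as) = ksgn (- 1) (sum_list (map (snd \<circ> snd) ss)) * pot M (as @ [bas (Id Z)])"
    using pot_rotate[OF assms(1,2), of "bas (Id Z) # as" "shape (Id Z) # ss"] assms(4,5)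
      homog_bas[of "Id Z"]
    by (simp add: shape_def)
  moreover obtain a as' where "as = a # as'" using assms(5) by (cases as) auto
  ultimately show ?thesis
    using assms(3)[unfolded strictly_unital_ops_def, rule_format, of "as' @ [bas (Id Z)]" Z] assms(5)
    by simp
qed

lemma pairing_Id_comp: "tgt g = Z \<Longrightarrow> pairing (bas (Id Z)) (comp_bas g h) = - pairing_bas g h"
  by (cases g; cases h) (auto simp: pairing_bas_left psgn_def)

text \<open>The exceptional arity: the xi-coefficient of a product is the pairing of its factors.
  The target of a is fixed because pairing with the identity of Z sees only the xi at Z.\<close>

lemma pairing_Id_2:
  fixes M :: "('n::finite, 'r::comm_ring_1) ops"
  assumes "multilinear_ops M" "extends_product M" "homog a (s, Z, p)"
  shows "pairing (bas (Id Z)) (M [a, b]) = - pairing a b"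
proof -
  have ml: "mlin (\<lambda>as. pairing (bas (Id Z)) (M as))"
    using assms(1) unfolding mlin_def multilinear_ops_def by simp
  have "pairing (bas (Id Z)) (M [a, b]) =
      (\<Sum>g\<in>UNIV. a $ g * (\<Sum>h\<in>UNIV. b $ h * pairing (bas (Id Z)) (comp_bas g h)))"
    using mlin_bas[OF ml, of "[]" a "[b]"] mlin_bas[OF ml, of "[bas _]" b "[]"] assms(2)
    by (simp add: extends_product_def)
  also have "\<dots> = (\<Sum>g\<in>UNIV. a $ g * (\<Sum>h\<in>UNIV. b $ h * - pairing_bas g h))"
  proof (intro sum.cong refl)
    fix g
    show "a $ g * (\<Sum>h\<in>UNIV. b $ h * pairing (bas (Id Z)) (comp_bas g h)) =
        a $ g * (\<Sum>h\<in>UNIV. b $ h * - pairing_bas g h)"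
    proof (cases "a $ g = 0")
      case False
      then have "tgt g = Z" using assms(3) by (auto simp: homog_def shape_def)
      then show ?thesis by (simp add: pairing_Id_comp)
    qed simp
  qed
  also have "\<dots> = - pairing a b"
    by (simp add: pairing_def sum_distrib_left sum_negf mult.assoc)
  finally show ?thesis .
qed

text \<open>Paired with an identity the outer operation must be binary, so the inner one takes all
  letters but the first or all letters but the last. These two terms are rotations of each other
  with opposite signs.\<close>

lemma insertion_Id:
  fixes M :: "('n::finite, 'r::comm_ring_1) ops"
  assumes gr: "graded_ops 2 M" and cyc: "cyclic_ops M" and un: "strictly_unital_ops M"
    and mi: "minimal_ops M" and ex: "extends_product M" and Z: "Z = tgt (hd gs)"
  shows "pairing (bas (Id Z)) (insertion_sum M M gs) = 0"
proof -
  have ml: "multilinear_ops M" using gr by (rule graded_multilinear)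
  define t where "t p z q = psgn (sdeg q) *
      pairing (bas (Id Z)) (M (map bas p @ M (map bas z) # map bas q))" for p z q
  have t0 [simp]: "t p [] q = 0" for p q
    using graded_Nil[OF gr] multilinear_zero[OF ml] by (simp add: t_def)
  have ins: "pairing (bas (Id Z)) (insertion_sum M M w) = ssum (\<lambda>p r. ssum (t p) r) w" for w
    unfolding insertion_sum_ssum'[where M = M, OF ml graded_Nil[OF gr]] pairing_ssum t_def[abs_def] by simp
  have hM: "homog (M (map bas z)) (tot_shape 1 (map shape z))" if "z \<noteq> []" for z
    using graded_homog_bas[OF gr that] by simp
  have tt: "t p z q = 0" if "length p + length q \<noteq> 1" for p z q
  proof (cases "z = []")
    case False
    show ?thesis
    proof (cases "length p + length q = 0")
      case True
      then show ?thesis using mi by (simp add: t_def minimal_ops_def)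
    next
      case F: False
      show ?thesis
        using pairing_Id_ge3[OF gr cyc un list_all2_homog_mid[OF hM[OF False], of p q]] that F
        by (simp add: t_def)
    qed
  qed simp
  consider "gs = []" | a where "gs = [a]" | a r c where "gs = a # r @ [c]"
    by (cases gs; cases "tl gs" rule: rev_cases) auto
  then show ?thesis
  proof cases
    case (3 a r c)
    have 1: "ssum (\<lambda>p r. ssum (t p) r) gs = ssum (t []) gs + ssum (t [a]) (r @ [c])"
    proof -
      have "ssum (\<lambda>p r. ssum (t (a # p)) r) (r @ [c]) = ssum (t [a]) (r @ [c])"
      proof (cases "r @ [c]")
        case (Cons b u)
        have "ssum (\<lambda>p r. ssum (t (a # b # p)) r) u = 0"
          by (intro ssum_neutral tt) simp
        then show ?thesis unfolding Cons by simp
      qed simp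
      then show ?thesis by (simp add: 3)
    qed
    have 2: "ssum (t [a]) (r @ [c]) = t [a] (r @ [c]) []"
      unfolding ssum_snoc using ssum_neutral[of r "\<lambda>z q. t [a] z (q @ [c])"] tt by simp
    have 3: "ssum (t []) gs = t [] (a # r) [c]"
    proof -
      obtain u b where u: "a # r = u @ [b]" by (cases "a # r" rule: rev_cases) auto
      have gs: "gs = (u @ [b]) @ [c]" using 3 u by simp
      have "ssum (t []) gs = ssum (\<lambda>z q. t [] z (q @ [b, c])) u + t [] (u @ [b]) [c] + t [] gs []"
        unfolding gs by (subst ssum_snoc, subst ssum_snoc) simp
      also have "ssum (\<lambda>z q. t [] z (q @ [b, c])) u = 0"
        by (intro ssum_neutral tt) simp
      finally show ?thesis using tt[of "[]" "[]" gs] u by simp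
    qed
    let ?P = "pairing (bas a) (M (map bas (r @ [c])))"
    have 4: "t [a] (r @ [c]) [] = - ?P"
      unfolding t_def
      using pairing_Id_2[OF ml ex, of "bas a" "src a" Z "int (deg a) - 1"] Z \<open>gs = a # r @ [c]\<close>
        homog_bas[of a]
      by (simp add: psgn_def shape_def)
    have "t [] (a # r) [c] = - psgn (int (deg c) - 1) * pairing (M (map bas (a # r))) (bas c)"
      unfolding t_def
      using pairing_Id_2[OF ml ex, of "M (map bas (a # r))" _ Z _ "bas c"] Z \<open>gs = a # r @ [c]\<close>
        hM[of "a # r"]
      by (simp add: psgn_def tot_shape_def shape_def)
    also have "\<dots> = psgn (int (deg c) - 1) * pot M (bas c # map bas (a # r))"
      using pairing_antisym[of "M (map bas (a # r))" "bas c"] by simp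
    also have "pot M (bas c # map bas (a # r)) = ksgn (int (deg c) - 1) (sdeg (a # r)) * ?P"
      using pot_rotate[OF gr cyc homog_map_bas, of "c # a # r"]
      by (simp add: shape_def sdeg_def comp_def)
    finally have 5: "t [] (a # r) [c] = psgn (int (deg c) - 1) * ksgn (int (deg c) - 1) (sdeg (a # r)) * ?P"
      by (simp add: mult.assoc)
    show ?thesis
    proof (cases "?P = 0")
      case True
      then show ?thesis using ins[of gs] 1 2 3 4 5 by simp
    next
      case False
      have "int (deg a) - 1 + (sdeg (r @ [c]) + 1) = - 1"
        using pairing_homog[OF homog_bas[of a, unfolded shape_def] hM[of "r @ [c]", unfolded tot_shape_def]] False
        by (simp add: sdeg_def shape_def comp_def)
      then have "psgn (int (deg c) - 1) * ksgn (int (deg c) - 1) (sdeg (a # r)) = (1 :: 'r)"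
        by (simp add: psgn_def ksgn_def) presburger
      then show ?thesis using ins[of gs] 1 2 3 4 5 by simp
    qed
  qed (use tt graded_Nil[OF gr] in \<open>simp_all add: ins\<close>)
qed

lemma composable_massey5: "composable (massey5 a1 b1 a2 b2 a3 b3 i1 j1 i2 j2 i3)"
proof -
  have run: "composable (replicate k (Xi Z) @ g # v)" if "tgt g = Z" "v = [] \<or> composable v \<and> src g = tgt (hd v)"
    for k Z v and g :: "'n gen"
    using that by (induction k) (auto simp: composable_Cons, auto simp: hd_append composable_def)
  have runs: "replicate a (Xi Z) = [] \<or> composable (replicate a (Xi Z)) \<and> Z = tgt (hd (replicate a (Xi Z)))"
    for a Z
    by (induction a) (auto simp: composable_Cons)
  have hd_run: "tgt g = Z \<Longrightarrow> tgt (hd (replicate k (Xi Z) @ g # v)) = Z" for k Z v and g :: "'n gen"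
    by (cases k) auto
  have "composable (replicate b1 (Xi ObY) @ Theta i1 # replicate a1 (Xi ObX))"
    by (rule run) (use runs[of a1 ObX] in auto)
  then have "composable (replicate a2 (Xi ObX) @ Eta j1 # replicate b1 (Xi ObY) @ Theta i1 # replicate a1 (Xi ObX))"
    by (intro run) (simp_all add: hd_run)
  then have "composable (massey_word a1 b1 a2 b2 i1 j1 i2)"
    unfolding massey_word_def append_Cons append_Nil by (intro run) (simp_all add: hd_run)
  then have "composable (replicate a3 (Xi ObX) @ Eta j2 # massey_word a1 b1 a2 b2 i1 j1 i2)"
    by (intro run) (simp_all add: hd_run massey_word_def)
  then show ?thesis
    unfolding massey5_def by (intro run) (simp_all add: hd_run)
qed

text \<open>A composite of two products shifts the reduced degree by 2 and the pairing requires -1,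
  so a relation can be nonzero only on cyclic words of total -3, that is, with three thetas.\<close>

theorem ainf_relations_iff:
  fixes M :: "('n::finite, 'r::comm_ring_1) ops"
  assumes gr: "graded_ops 2 M" and cyc: "cyclic_ops M" and un: "strictly_unital_ops M"
    and mi: "minimal_ops M" and ex: "extends_product M"
  shows "ainf_relations M \<longleftrightarrow> (\<forall>a1 b1 a2 b2 a3 b3 i1 j1 i2 j2 i3 j3.
    pairing (bas (Eta j3)) (insertion_sum M M (massey5 a1 b1 a2 b2 a3 b3 i1 j1 i2 j2 i3)) = 0)"
proof
  assume "ainf_relations M"
  then show "\<forall>a1 b1 a2 b2 a3 b3 i1 j1 i2 j2 i3 j3.
    pairing (bas (Eta j3)) (insertion_sum M M (massey5 a1 b1 a2 b2 a3 b3 i1 j1 i2 j2 i3)) = 0"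
    by (simp add: ainf_relations_def composable_massey5)
next
  assume main: "\<forall>a1 b1 a2 b2 a3 b3 i1 j1 i2 j2 i3 j3.
    pairing (bas (Eta j3)) (insertion_sum M M (massey5 a1 b1 a2 b2 a3 b3 i1 j1 i2 j2 i3)) = 0"
  \<comment> \<open>Cyclic composability is built in because \<open>insertion_Id\<close> needs the
    identity to sit at the target of the remaining word.\<close>
  define Z where "Z w \<longleftrightarrow> (cyc_composable w \<longrightarrow> pairing (bas (hd w)) (insertion_sum M M (tl w)) = 0)"
    for w
  have pz: "cyc_composable (c # v) \<and> sdeg (c # v) = - 3"
    if "pairing (bas c) (insertion_sum M M v) \<noteq> 0" "composable v" for c v
    using pairing_homog[OF homog_bas[of c, unfolded shape_def]
        insertion_homog[OF gr gr, of v, unfolded tot_shape_def] that(1)] that(2)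
    by (auto simp: cyc_composable_def composable_def successively_Cons hd_map last_map shape_def
        sdeg_def comp_def)
  have Z: "Z w" if "length w \<ge> 2" for w
  proof (rule rotation_principle[of Z 3])
    show "Z (c # b # gs)" if "Z (b # gs @ [c])" for c b gs
      using that by (simp add: Z_def cyc_composable_rotate insertion_rotate[OF gr cyc])
    show "Z (Id Y # gs)" if "gs \<noteq> []" for Y gs
      using insertion_Id[OF gr cyc un mi ex] that
      by (auto simp: Z_def cyc_composable_def composable_Cons)
    show "Z w" if len: "length w \<ge> 2" and sd: "sdeg w \<noteq> - 3" for w
    proof -
      obtain c v where w: "w = c # v" using len by (cases w) auto
      show ?thesis
        using pz[of c v] len sd w by (auto simp: Z_def cyc_composable_def composable_Cons)
    qed
    show "Z (Eta i # w)" if w: "composable w" "no_id w" "tgt (hd w) = ObY" "src (last w) = ObX"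
      and sd: "sdeg w = - 3" for i w
    proof -
      obtain a1 b1 a2 b2 a3 b3 i1 j1 i2 j2 i3 where "w = massey5 a1 b1 a2 b2 a3 b3 i1 j1 i2 j2 i3"
        using word_YX_3[OF w sd] .
      then show ?thesis using main by (simp add: Z_def)
    qed
  qed (use that in \<open>auto simp: Z_def\<close>)
  show "ainf_relations M"
    unfolding ainf_relations_def
  proof (intro allI impI pairing_nondeg)
    fix gs :: "'n gen list" and c
    assume gs: "composable gs"
    show "pairing (bas c) (insertion_sum M M gs) = 0"
      using Z[of "c # gs"] pz[of c gs] gs by (cases gs) (auto simp: Z_def composable_def)
  qed
qed

section \<open>Sums over block decompositions\<close>

definition bsum :: "('a list list \<Rightarrow> 'b::comm_monoid_add) \<Rightarrow> 'a list \<Rightarrow> 'b" where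
  "bsum K w = (\<Sum>bs | concat bs = w \<and> [] \<notin> set bs. K bs)"

lemma bsum_Nil [simp]:
  fixes K :: "'a list list \<Rightarrow> 'b::comm_monoid_add"
  shows "bsum K [] = K []"
proof -
  have *: "concat bs = [] \<and> [] \<notin> set bs \<longleftrightarrow> bs = []" for bs :: "'a list list"
    by (cases bs) auto
  show ?thesis unfolding bsum_def * by simp
qed

lemma finite_blocks': "finite {bs. concat bs = w \<and> [] \<notin> set bs}" for w :: "'a list"
proof -
  have "finite {bs. set bs \<subseteq> {b. set b \<subseteq> set w \<and> length b \<le> length w} \<and> length bs \<le> length w}"
    by (intro finite_lists_length_le) simp
  moreover have "length bs \<le> length (concat bs) \<and> (\<forall>b\<in>set bs. length b \<le> length (concat bs))"
    if "[] \<notin> set bs" for bs :: "'a list list"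
    using that
  proof (induction bs)
    case (Cons b bs)
    then show ?case by (cases b) auto
  qed simp
  ultimately show ?thesis
    by (elim finite_subset[rotated]) auto
qed

lemma bsum_cong:
  "(\<And>bs. concat bs = w \<Longrightarrow> [] \<notin> set bs \<Longrightarrow> K bs = K' bs) \<Longrightarrow> bsum K w = bsum K' w"
  unfolding bsum_def by (rule sum.cong) auto

text \<open>Here the first block is split off, in \<open>bsum_snoc\<close> the last one. Comparing
  the two is how the left side of the functor equations is rotated.\<close>

lemma bsum_Cons:
  assumes "w \<noteq> []"
  shows "bsum K w = ssum (\<lambda>u v. if u = [] then 0 else bsum (\<lambda>bs. K (u # bs)) v) w"
proof -
  let ?B = "\<lambda>w. {bs. concat bs = w \<and> [] \<notin> set bs}"
  have "ssum (\<lambda>u v. if u = [] then 0 else bsum (\<lambda>bs. K (u # bs)) v) w =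
      (\<Sum>i=1..length w. \<Sum>bs\<in>?B (drop i w). K (take i w # bs))"
    unfolding ssum_conv_sum bsum_def
    by (rule sum.mono_neutral_cong_right) (use assms in auto)
  also have "\<dots> = (\<Sum>(i, bs)\<in>(SIGMA i:{1..length w}. ?B (drop i w)). K (take i w # bs))"
    by (rule sum.Sigma) (auto simp: finite_blocks')
  also have "\<dots> = (\<Sum>bs\<in>?B w. K bs)"
  proof (rule sum.reindex_bij_witness[of _ "\<lambda>bs. (length (hd bs), tl bs)" "\<lambda>(i, bs). take i w # bs"],
      goal_cases)
    case (4 bs)
    then show ?case using assms by (cases bs; cases "hd bs") auto
  next
    case (3 bs)
    then show ?case using assms by (cases bs) auto
  qed (use assms in \<open>auto simp: min_def\<close>)
  finally show ?thesis by (simp add: bsum_def)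
qed

lemma bsum_snoc:
  assumes "w \<noteq> []"
  shows "bsum K w = ssum (\<lambda>u v. if v = [] then 0 else bsum (\<lambda>bs. K (bs @ [v])) u) w"
proof -
  let ?B = "\<lambda>w. {bs. concat bs = w \<and> [] \<notin> set bs}"
  have "ssum (\<lambda>u v. if v = [] then 0 else bsum (\<lambda>bs. K (bs @ [v])) u) w =
      (\<Sum>i<length w. \<Sum>bs\<in>?B (take i w). K (bs @ [drop i w]))"
    unfolding ssum_conv_sum bsum_def
    by (rule sum.mono_neutral_cong_right) (use assms in auto)
  also have "\<dots> = (\<Sum>(i, bs)\<in>(SIGMA i:{..<length w}. ?B (take i w)). K (bs @ [drop i w]))"
    by (rule sum.Sigma) (auto simp: finite_blocks')
  also have "\<dots> = (\<Sum>bs\<in>?B w. K bs)"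
  proof (rule sum.reindex_bij_witness[of _ "\<lambda>bs. (length (concat (butlast bs)), butlast bs)"
        "\<lambda>(i, bs). bs @ [drop i w]"], goal_cases)
    case (1 p)
    then show ?case by (cases p) auto
  next
    case (3 bs)
    then show ?case using assms by (cases bs rule: rev_cases) auto
  next
    case (4 bs)
    then show ?case using assms by (cases bs rule: rev_cases) auto
  qed (use assms in \<open>auto split: prod.splits\<close>)
  finally show ?thesis by (simp add: bsum_def)
qed

lemma bsum_hom: "(\<And>x y. H (x + y) = H x + H y) \<Longrightarrow> H 0 = 0 \<Longrightarrow> H (bsum K w) = bsum (\<lambda>bs. H (K bs)) w"
  unfolding bsum_def by (rule sum_comp_morphism[of H, unfolded comp_def, symmetric]) auto

lemma bsum_zero [simp]: "bsum (\<lambda>bs. 0) w = 0"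
  by (simp add: bsum_def)

lemma bsum_mult: "bsum (\<lambda>bs. c * K bs) w = (c :: 'r::comm_ring_1) * bsum K w"
  unfolding bsum_def by (simp add: sum_distrib_left)

lemma ssum_left:
  assumes "\<And>u v. u @ v = w \<Longrightarrow> u \<noteq> [] \<Longrightarrow> f u v = 0"
  shows "ssum f w = f [] w"
proof (cases w)
  case (Cons x xs)
  have "ssum (\<lambda>u. f (x # u)) xs = 0"
    by (rule ssum_neutral) (use assms Cons in simp)
  then show ?thesis by (simp add: Cons)
qed simp

lemma ssum_right:
  assumes "\<And>u v. u @ v = w \<Longrightarrow> v \<noteq> [] \<Longrightarrow> f u v = 0"
  shows "ssum f w = f w []"
proof (cases w rule: rev_cases)
  case (snoc xs x)
  have "ssum (\<lambda>u v. f u (v @ [x])) xs = 0"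
    by (rule ssum_neutral) (use assms snoc in simp)
  then show ?thesis by (simp add: snoc ssum_snoc)
qed simp

lemma bsum_one: "w \<noteq> [] \<Longrightarrow> bsum (\<lambda>bs. if length bs = 1 then g (hd bs) else 0) w = g w"
proof -
  assume w: "w \<noteq> []"
  have "bsum (\<lambda>bs. if bs = [] then g u else 0) v = 0" if "v \<noteq> []" for u v
  proof -
    have "bsum (\<lambda>bs. if bs = [] then g u else 0) v = bsum (\<lambda>bs. 0) v"
      by (rule bsum_cong) (use that in auto)
    then show ?thesis by simp
  qed
  then have "ssum (\<lambda>u v. if u = [] then 0 else bsum (\<lambda>bs. if bs = [] then g u else 0) v) w = g w"
    by (subst ssum_right) (auto simp: w)
  then show ?thesis
    unfolding bsum_Cons[OF w] by (simp cong: if_cong)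
qed

lemma bsum_two:
  assumes "\<And>v. g [] v = 0" "\<And>u. g u [] = 0"
  shows "bsum (\<lambda>bs. if length bs = 2 then g (bs ! 0) (bs ! 1) else 0) w = ssum g w"
proof (cases "w = []")
  case False
  have *: "bsum (\<lambda>bs. if length bs = Suc 0 then g u (bs ! 0) else 0) v = g u v" for u v
  proof (cases "v = []")
    case F: False
    have "bsum (\<lambda>bs. if length bs = Suc 0 then g u (bs ! 0) else 0) v =
        bsum (\<lambda>bs. if length bs = 1 then g u (hd bs) else 0) v"
      by (rule bsum_cong) (auto simp: length_Suc_conv)
    then show ?thesis using bsum_one[OF F, of "g u"] by simp
  qed (simp add: assms)
  show ?thesis
    unfolding bsum_Cons[OF False]
    by (rule ssum_cong) (simp add: * assms numeral_2_eq_2 cong: if_cong)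
qed (simp add: assms)

lemma ssum_append:
  "ssum f (us @ x # vs) = ssum (\<lambda>u v. f u (v @ x # vs)) us + ssum (\<lambda>u v. f (us @ x # u) v) vs"
  by (induction us arbitrary: f) (auto simp: add.assoc)

lemma ssum_map: "ssum f (map h w) = ssum (\<lambda>u v. f (map h u) (map h v)) w"
  by (induction w arbitrary: f) auto

lemma ssum_swap: "ssum (\<lambda>u v. ssum (\<lambda>z q. g u v z q) r) w = ssum (\<lambda>z q. ssum (\<lambda>u v. g u v z q) w) r"
  by (induction w arbitrary: g) (auto simp: ssum_add)

lemma mlin_zero_all:
  assumes "mlin A" "\<And>gs. length gs = length as \<Longrightarrow> A (map bas gs) = 0"
  shows "A as = 0"
  using assms
proof (induction as arbitrary: A)
  case Nil
  then show ?case using Nil(2)[of "[]"] by simp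
next
  case (Cons a as)
  have "A (bas g # as) = 0" for g
    by (rule Cons.IH[OF mlin_Cons[OF Cons.prems(1)]]) (use Cons.prems(2)[of "g # _"] in simp)
  then show ?case using mlin_bas[OF Cons.prems(1), of "[]" a as] by simp
qed

section \<open>The functor equations are cyclically invariant\<close>

definition functor_defect ::
    "('n::finite, 'r::comm_ring_1) ops \<Rightarrow> ('n, 'r) ops \<Rightarrow> ('n, 'r) ops \<Rightarrow> 'n gen list \<Rightarrow> ('n, 'r) mor" where
  "functor_defect M M' F gs =
     bsum (\<lambda>bs. M' (map (\<lambda>b. F (map bas b)) bs)) gs - insertion_sum F M gs"

lemma functor_relations_iff_defect:
  "functor_relations M M' F \<longleftrightarrow> (\<forall>gs. composable gs \<longrightarrow> functor_defect M M' F gs = 0)"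
  by (simp add: functor_relations_def functor_defect_def bsum_def)

locale pre_structure =
  fixes M :: "('n::finite, 'r::comm_ring_1) ops"
  assumes gr: "graded_ops 2 M" and cyc: "cyclic_ops M" and un: "strictly_unital_ops M"
    and mi: "minimal_ops M" and ex: "extends_product M"

lemma ainf_structures_iff: "M \<in> ainf_structures \<longleftrightarrow> pre_structure M \<and> ainf_relations M"
  by (auto simp: ainf_structures_def pre_structure_def)

text \<open>A cyclic equivalence without its functor equations, between structures without their
  A-infinity relations, so that these equations can be analysed inside. Surjectivity keeps testing
  against values of F faithful and yields half of the invertibility of the gauge matrix.\<close>

locale cyclic_map = M: pre_structure M + M': pre_structure M' for M M' :: "('n::finite, 'r::comm_ring_1) ops" +
  fixes F :: "('n, 'r) ops"
  assumes Fgr: "graded_ops 1 F" and Fun: "unital_functor F" and Fcyc: "cyclic_functor F"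
    and Fsurj: "surj (\<lambda>a. F [a])"
begin

lemma F_Nil [simp]: "F [] = 0"
  by (rule graded_Nil[OF Fgr])

lemma F_homog: "w \<noteq> [] \<Longrightarrow> homog (F (map bas w)) (tot_shape 0 (map shape w))"
  using graded_homog_bas[OF Fgr] by simp

lemma M_homog: "w \<noteq> [] \<Longrightarrow> homog (M (map bas w)) (tot_shape 1 (map shape w))"
  using graded_homog_bas[OF M.gr] by simp

lemma Fml: "multilinear_ops F"
  using Fgr by (rule graded_multilinear)

lemma F_pairing: "pairing (F [a]) (F [b]) = pairing a b"
  using Fcyc by (simp add: cyclic_functor_def)

text \<open>Compared with the definition, the two cuts with an empty piece are added, which
  contribute 0, and the words that are not cyclically composable, where every term vanishes.\<close>

lemma F_cyclic_bas:
  assumes "length w \<ge> 3"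
  shows "ssum (\<lambda>u v. pairing (F u) (F v)) (map bas w) = 0"
proof (cases "cyc_composable w")
  case True
  have "ssum (\<lambda>u v. pairing (F u) (F v)) (map bas w) =
      (\<Sum>l\<le>length w. pairing (F (map bas (take l w))) (F (map bas (drop l w))))"
    by (simp add: ssum_conv_sum take_map drop_map)
  also have "\<dots> = (\<Sum>l = 1..length w - 1. pairing (F (map bas (take l w))) (F (map bas (drop l w))))"
  proof (rule sum.mono_neutral_right)
    show "\<forall>i\<in>{..length w} - {1..length w - 1}. pairing (F (map bas (take i w))) (F (map bas (drop i w))) = 0"
    proof
      fix i assume "i \<in> {..length w} - {1..length w - 1}"
      then have "i = 0 \<or> i = length w" by auto
      then show "pairing (F (map bas (take i w))) (F (map bas (drop i w))) = 0" by auto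
    qed
  qed auto
  also have "\<dots> = 0"
    using Fcyc True assms by (simp add: cyclic_functor_def)
  finally show ?thesis .
next
  case False
  show ?thesis
    unfolding ssum_map
  proof (rule ssum_neutral, rule ccontr)
    fix u v assume w: "u @ v = w" and *: "pairing (F (map bas u)) (F (map bas v)) \<noteq> 0"
    then have ne: "u \<noteq> []" "v \<noteq> []" by auto
    have c: "composable u" "composable v"
      by (rule ccontr, use * graded_noncomposable[OF Fgr, of u] graded_noncomposable[OF Fgr, of v] in simp)+
    have "src (last u) = tgt (hd v) \<and> tgt (hd u) = src (last v)"
      using pairing_homog[OF F_homog[OF ne(1), unfolded tot_shape_def]
          F_homog[OF ne(2), unfolded tot_shape_def] *] ne
      by (simp add: hd_map last_map shape_def)
    then have "cyc_composable (u @ v)"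
      using c ne by (simp add: cyc_composable_def composable_def successively_append_iff)
    then show False using w False by simp
  qed
qed

text \<open>Arbitrary entries are needed because one of them will be the value of an inner
  product.\<close>

lemma F_cyclic:
  assumes "length as \<ge> 3"
  shows "ssum (\<lambda>u v. pairing (F u) (F v)) as = 0"
proof (rule mlin_zero_all)
  show "mlin (ssum (\<lambda>u v. pairing (F u) (F v)))"
    unfolding mlin_def
  proof (intro allI)
    fix us vs :: "('n, 'r) mor list" and a b c
    have F: "F (u @ (c *s a + b) # v) = c *s F (u @ a # v) + F (u @ b # v)" for u v
      using Fml by (simp add: multilinear_ops_def)
    show "ssum (\<lambda>u v. pairing (F u) (F v)) (us @ (c *s a + b) # vs) =
        c * ssum (\<lambda>u v. pairing (F u) (F v)) (us @ a # vs) +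
        ssum (\<lambda>u v. pairing (F u) (F v)) (us @ b # vs)"
      unfolding ssum_append using F[of _ "_ @ _"] F[of "_ @ _"]
      by (simp add: F ssum_add ssum_mult distrib_left)
  qed
  show "ssum (\<lambda>u v. pairing (F u) (F v)) (map bas gs) = 0" if "length gs = length as" for gs
    using F_cyclic_bas that assms by simp
qed

definition L :: "'n gen list \<Rightarrow> ('n, 'r) mor" where
  "L gs = bsum (\<lambda>bs. M' (map (\<lambda>b. F (map bas b)) bs)) gs"

abbreviation I :: "'n gen list \<Rightarrow> ('n, 'r) mor" where
  "I \<equiv> insertion_sum F M"

abbreviation D :: "'n gen list \<Rightarrow> ('n, 'r) mor" where
  "D \<equiv> functor_defect M M' F"

lemma D_eq: "D w = L w - I w"
  by (simp add: functor_defect_def L_def)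

lemma L_Nil [simp]: "L [] = 0"
  using graded_Nil[OF M'.gr] by (simp add: L_def)

lemma I_Nil [simp]: "I [] = 0"
  by (simp add: insertion_sum_def)

lemma blocks_homog:
  assumes "[] \<notin> set bs"
  shows "list_all2 homog (map (\<lambda>b. F (map bas b)) bs) (map (\<lambda>b. tot_shape 0 (map shape b)) bs)"
    and "sum_list (map (snd \<circ> snd) (map (\<lambda>b. tot_shape 0 (map shape b)) bs)) = sdeg (concat bs)"
proof -
  show "list_all2 homog (map (\<lambda>b. F (map bas b)) bs) (map (\<lambda>b. tot_shape 0 (map shape b)) bs)"
    using assms by (induction bs) (auto intro!: F_homog)
  show "sum_list (map (snd \<circ> snd) (map (\<lambda>b. tot_shape 0 (map shape b)) bs)) = sdeg (concat bs)"
    by (induction bs) (auto simp: tot_shape_def)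
qed

text \<open>Both sides sum \<open>pot M'\<close> over the block decompositions of w: on the left the
  first block is split off, on the right the last block, which is then rotated to the front.\<close>

lemma L_rotate:
  "ssum (\<lambda>u v. pairing (F (map bas u)) (L v)) w =
   ssum (\<lambda>u v. ksgn (sdeg v) (sdeg u) * pairing (F (map bas v)) (L u)) w"
proof (cases "w = []")
  case False
  let ?Fb = "\<lambda>b. F (map bas b)"
  have pL: "pairing a (L v) = bsum (\<lambda>bs. pairing a (M' (map ?Fb bs))) v" for a v
    unfolding L_def by (rule bsum_hom) simp_all
  have "ssum (\<lambda>u v. pairing (F (map bas u)) (L v)) w = bsum (\<lambda>bs. pot M' (map ?Fb bs)) w"
    unfolding bsum_Cons[OF False] by (rule ssum_cong) (auto simp: pL)
  also have "\<dots> = ssum (\<lambda>u v. ksgn (sdeg v) (sdeg u) * pairing (F (map bas v)) (L u)) w"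
    unfolding bsum_snoc[OF False]
  proof (rule ssum_cong)
    fix u v assume "u @ v = w"
    show "(if v = [] then 0 else bsum (\<lambda>bs. pot M' (map ?Fb (bs @ [v]))) u) =
        ksgn (sdeg v) (sdeg u) * pairing (F (map bas v)) (L u)"
    proof (cases "v = []")
      case v: False
      have "bsum (\<lambda>bs. pot M' (map ?Fb (bs @ [v]))) u =
          bsum (\<lambda>bs. ksgn (sdeg v) (sdeg u) * pairing (F (map bas v)) (M' (map ?Fb bs))) u"
      proof (rule bsum_cong)
        fix bs assume bs: "concat bs = u" "[] \<notin> set bs"
        show "pot M' (map ?Fb (bs @ [v])) =
            ksgn (sdeg v) (sdeg u) * pairing (F (map bas v)) (M' (map ?Fb bs))"
        proof (cases "bs = []")
          case True
          then show ?thesis using graded_Nil[OF M'.gr] by simp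
        next
          case bsne: False
          have "pot M' (?Fb v # map ?Fb bs) =
              ksgn (sdeg v) (sdeg u) * pot M' (map ?Fb bs @ [?Fb v])"
            using pot_rotate[OF M'.gr M'.cyc, of "?Fb v # map ?Fb bs"
                "tot_shape 0 (map shape v) # map (\<lambda>b. tot_shape 0 (map shape b)) bs"]
              blocks_homog[OF bs(2)] F_homog[OF v] bsne
            by (cases bs) (simp_all add: tot_shape_def bs(1)[symmetric])
          then show ?thesis by simp
        qed
      qed
      then show ?thesis using v by (simp add: bsum_mult pL)
    qed simp
  qed
  finally show ?thesis .
qed simp

text \<open>For a fixed inner block z, cyclicity of F on the entries p, M z, q exchanges the cuts of
  p with the cuts of q. For only two entries this fails, since there the pairing is preserved
  instead; the exceptional terms are \<open>pot M (map bas w)\<close> and its negative.\<close>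

lemma I_rotate:
  assumes "length w \<ge> 2"
  shows "ssum (\<lambda>u v. pairing (F (map bas u)) (I v)) w =
   ssum (\<lambda>u v. ksgn (sdeg v) (sdeg u) * pairing (F (map bas v)) (I u)) w"
proof -
  define x where "x = pot M (map bas w)"
  define f where "f u p z q = pairing (F (map bas u)) (F (map bas p @ M (map bas z) # map bas q))"
    for u p z q
  have pI: "c * pairing (F (map bas u)) (I v) =
      ssum (\<lambda>p r. ssum (\<lambda>z q. c * (psgn (sdeg q) * f u p z q)) r) v" for c u v
    unfolding insertion_sum_ssum'[where M = M, OF Fml graded_Nil[OF M.gr]] pairing_ssum f_def
    by (simp add: ssum_mult)
  define P where "P p z q = psgn (sdeg q) * ssum (\<lambda>p1 p2. f p1 p2 z q) p" for p z q
  define Q where "Q p z q = ssum (\<lambda>q1 q2. ksgn (sdeg q2) (sdeg (p @ z @ q1)) * (psgn (sdeg q1) * f q2 p z q1)) q"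
    for p z q
  have "ssum (\<lambda>u v. pairing (F (map bas u)) (I v)) w =
      ssum (\<lambda>u v. ssum (\<lambda>p r. ssum (\<lambda>z q. psgn (sdeg q) * f u p z q) r) v) w"
    using pI[of 1] by simp
  also have "\<dots> = ssum (\<lambda>p r. ssum (\<lambda>u p. ssum (\<lambda>z q. psgn (sdeg q) * f u p z q) r) p) w"
    by (rule ssum_assoc)
  also have "\<dots> = ssum (\<lambda>p r. ssum (\<lambda>z q. P p z q) r) w"
    by (subst ssum_swap) (simp add: P_def[abs_def] ssum_mult)
  \<comment> \<open>The corrections x and -x belong to a single letter before, respectively behind,
    the inner block.\<close>
  also have "\<dots> = ssum (\<lambda>p r. ssum (\<lambda>z q. Q p z q +
      ((if length p = 1 \<and> q = [] then x else 0) + (if p = [] \<and> length q = 1 then - x else 0))) r) w"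
  proof (intro ssum_cong)
    fix p r z q assume "p @ r = w" "z @ q = r"
    then have w: "p @ z @ q = w" by simp
    have f0: "f [] p z q = 0" for p z q by (simp add: f_def)
    consider "z = []" | "z \<noteq> []" "p = []" "q = []" | a where "z \<noteq> []" "p = [a]" "q = []"
      | a where "z \<noteq> []" "p = []" "q = [a]" | "z \<noteq> []" "length p + length q \<ge> 2"
      by (cases p; cases q; cases "tl p"; cases "tl q") auto
    then show "P p z q = Q p z q +
      ((if length p = 1 \<and> q = [] then x else 0) + (if p = [] \<and> length q = 1 then - x else 0))"
    proof cases
      case 1
      then have "f u p z q = 0" for u p q
        using multilinear_zero[OF Fml] graded_Nil[OF M.gr] by (simp add: f_def)
      then show ?thesis using 1 w assms by (auto simp: P_def Q_def)
    next
      case 2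
      then show ?thesis by (simp add: P_def Q_def f0)
    next
      case (3 a)
      then show ?thesis
        using w by (simp add: P_def Q_def f0 psgn_def x_def w[symmetric]) (simp add: f_def F_pairing)
    next
      case (4 a)
      have "pot M (map bas (a # z)) = ksgn (int (deg a) - 1) (sdeg z) * x"
        using pot_rotate[OF M.gr M.cyc homog_map_bas, of "a # z"] 4 w
        by (cases z) (simp_all add: x_def w[symmetric] shape_def sdeg_def comp_def)
      then show ?thesis
        using 4 by (simp add: P_def Q_def f0 psgn_def) (simp add: f_def F_pairing)
    next
      case 5
      let ?m = "M (map bas z)"
      have "ssum (\<lambda>u v. pairing (F u) (F v)) (map bas p @ ?m # map bas q) = 0"
        by (rule F_cyclic) (use 5 in simp)
      then have "ssum (\<lambda>p1 p2. f p1 p2 z q) p =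
          - ssum (\<lambda>q1 q2. pairing (F (map bas p @ ?m # map bas q1)) (F (map bas q2))) q"
        by (simp add: ssum_append ssum_map f_def eq_neg_iff_add_eq_0)
      also have "\<dots> = ssum (\<lambda>q1 q2. f q2 p z q1) q"
        unfolding f_def by (subst ssum_hom[of uminus], simp, intro ssum_cong pairing_antisym[symmetric])
      finally have "P p z q = ssum (\<lambda>q1 q2. psgn (sdeg q) * f q2 p z q1) q"
        by (simp add: P_def ssum_mult)
      also have "\<dots> = Q p z q"
        unfolding Q_def
      proof (rule ssum_cong)
        fix q1 q2 assume q: "q1 @ q2 = q"
        show "psgn (sdeg q) * f q2 p z q1 =
            ksgn (sdeg q2) (sdeg (p @ z @ q1)) * (psgn (sdeg q1) * f q2 p z q1)"
        proof (cases "f q2 p z q1 = 0")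
          case False
          then have "q2 \<noteq> []" by (auto simp: f0)
          have "homog (F (map bas p @ ?m # map bas q1))
              (tot_shape 0 (map shape p @ tot_shape 1 (map shape z) # map shape q1))"
            using graded_homog[OF Fgr list_all2_homog_mid[OF M_homog[OF 5(1)], of p q1]] by simp
          then have h: "homog (F (map bas p @ ?m # map bas q1)) (tot_shape 1 (map shape (p @ z @ q1)))"
            unfolding tot_shape_nest[OF 5(1)] by simp
          have "sdeg q2 + (sdeg (p @ z @ q1) + 1) = - 1"
            using pairing_homog[OF F_homog[OF \<open>q2 \<noteq> []\<close>, unfolded tot_shape_def]
                h[unfolded tot_shape_def]] False
            by (simp add: f_def sdeg_def comp_def shape_def)
          then have "even (sdeg q2 + sdeg (p @ z @ q1))" by presburger
          then have "psgn (sdeg q) = (ksgn (sdeg q2) (sdeg (p @ z @ q1)) * psgn (sdeg q1) :: 'r)"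
            unfolding q[symmetric] sdeg_simps(3)
            by (cases "even (sdeg q2)"; cases "even (sdeg q1)")
               (simp_all add: psgn_def ksgn_def)
          then show ?thesis by (simp add: mult.assoc)
        qed simp
      qed
      finally show ?thesis using 5 by auto
    qed
  qed
  also have "\<dots> = ssum (\<lambda>p r. ssum (\<lambda>z q. Q p z q) r) w +
      (ssum (\<lambda>p r. ssum (\<lambda>z q. if length p = 1 \<and> q = [] then x else 0) r) w +
       ssum (\<lambda>p r. ssum (\<lambda>z q. if p = [] \<and> length q = 1 then - x else 0) r) w)"
    by (simp only: ssum_add)
  also have "ssum (\<lambda>p r. ssum (\<lambda>z q. if length p = 1 \<and> q = [] then x else 0) r) w = x"
  proof -
    obtain a v where w: "w = a # v" using assms by (cases w) auto
    have "ssum (\<lambda>z q. if length p = 1 \<and> q = [] then x else 0) r = (if length p = 1 then x else 0)" for p r :: "'n gen list"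
      by (subst ssum_right) auto
    then have "ssum (\<lambda>p r. ssum (\<lambda>z q. if length p = 1 \<and> q = [] then x else 0) r) w =
        ssum (\<lambda>p r. if length p = 1 then x else 0) w" by simp
    also have "\<dots> = x" unfolding w ssum.simps by (subst ssum_left) auto
    finally show ?thesis .
  qed
  also have "ssum (\<lambda>p r. ssum (\<lambda>z q. if p = [] \<and> length q = 1 then - x else 0) r) w = - x"
  proof -
    obtain a v where w: "w = v @ [a]" using assms by (cases w rule: rev_cases) auto
    have "ssum (\<lambda>p r. ssum (\<lambda>z q. if p = [] \<and> length q = 1 then - x else 0) r) w =
        ssum (\<lambda>z q. if length q = 1 then - x else 0) w"
      by (subst ssum_left) auto
    also have "\<dots> = - x" unfolding w ssum_snoc by (subst ssum_right) auto
    finally show ?thesis .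
  qed
  also have "ssum (\<lambda>p r. ssum (\<lambda>z q. Q p z q) r) w =
      ssum (\<lambda>u v. ksgn (sdeg v) (sdeg u) * pairing (F (map bas v)) (I u)) w"
  proof -
    define H where "H p r v = ssum (\<lambda>z q. ksgn (sdeg v) (sdeg (p @ r)) * (psgn (sdeg q) * f v p z q)) r" for p r v
    have "ssum (\<lambda>u v. ksgn (sdeg v) (sdeg u) * pairing (F (map bas v)) (I u)) w =
        ssum (\<lambda>u v. ssum (\<lambda>p r. H p r v) u) w"
      unfolding pI H_def by (intro ssum_cong) auto
    also have "\<dots> = ssum (\<lambda>p r'. ssum (\<lambda>r v. H p r v) r') w"
      by (rule ssum_assoc[symmetric])
    also have "\<dots> = ssum (\<lambda>p r. ssum (\<lambda>z q. Q p z q) r) w"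
    proof (rule ssum_cong)
      fix p r'
      have "ssum (\<lambda>r v. H p r v) r' =
          ssum (\<lambda>r v. ssum (\<lambda>z q. ksgn (sdeg v) (sdeg (p @ z @ q)) * (psgn (sdeg q) * f v p z q)) r) r'"
        unfolding H_def by (intro ssum_cong) auto
      also have "\<dots> = ssum (\<lambda>z q. Q p z q) r'"
        unfolding Q_def by (rule ssum_assoc[symmetric])
      finally show "ssum (\<lambda>r v. H p r v) r' = ssum (\<lambda>z q. Q p z q) r'" .
    qed
    finally show ?thesis by simp
  qed
  finally show ?thesis by simp
qed

lemma D_rotate:
  assumes "length w \<ge> 2"
  shows "ssum (\<lambda>u v. pairing (F (map bas u)) (D v)) w =
   ssum (\<lambda>u v. ksgn (sdeg v) (sdeg u) * pairing (F (map bas v)) (D u)) w"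
proof -
  have "ssum (\<lambda>u v. pairing (F (map bas u)) (D v)) w + ssum (\<lambda>u v. pairing (F (map bas u)) (I v)) w =
      ssum (\<lambda>u v. pairing (F (map bas u)) (L v)) w"
    unfolding ssum_add[symmetric] by (rule ssum_cong) (simp add: D_eq)
  also have "\<dots> = ssum (\<lambda>u v. ksgn (sdeg v) (sdeg u) * pairing (F (map bas v)) (L u)) w"
    by (rule L_rotate)
  also have "\<dots> = ssum (\<lambda>u v. ksgn (sdeg v) (sdeg u) * pairing (F (map bas v)) (D u)) w +
      ssum (\<lambda>u v. ksgn (sdeg v) (sdeg u) * pairing (F (map bas v)) (I u)) w"
    unfolding ssum_add[symmetric] by (rule ssum_cong) (simp add: D_eq algebra_simps)
  also have "ssum (\<lambda>u v. ksgn (sdeg v) (sdeg u) * pairing (F (map bas v)) (I u)) w =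
      ssum (\<lambda>u v. pairing (F (map bas u)) (I v)) w"
    by (rule I_rotate[OF assms, symmetric])
  finally show ?thesis by (rule add_right_imp_eq)
qed

lemma L_homog: "w \<noteq> [] \<Longrightarrow> homog (L w) (tot_shape 1 (map shape w))"
  unfolding homog_def
proof (intro allI impI, rule ccontr)
  fix h assume w: "w \<noteq> []" and h: "L w $ h \<noteq> 0" and ne: "shape h \<noteq> tot_shape 1 (map shape w)"
  have "M' (map (\<lambda>b. F (map bas b)) bs) $ h = 0" if "concat bs = w" "[] \<notin> set bs" for bs
  proof -
    have bs: "bs \<noteq> []" using that w by auto
    have "homog (M' (map (\<lambda>b. F (map bas b)) bs)) (tot_shape 1 (map (\<lambda>b. tot_shape 0 (map shape b)) bs))"
      using graded_homog[OF M'.gr blocks_homog(1)[OF that(2)]] bs by simp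
    moreover have "tot_shape 1 (map (\<lambda>b. tot_shape 0 (map shape b)) bs) = tot_shape 1 (map shape w)"
    proof -
      have "hd (map shape w) = hd (map shape (hd bs))" "last (map shape w) = last (map shape (last bs))"
      proof -
        note cb = that
        obtain c cs where "bs = c # cs" "c \<noteq> []" using bs cb(2) by (cases bs) auto
        then show "hd (map shape w) = hd (map shape (hd bs))" using that(1) by (auto simp: hd_append)
        obtain c cs where "bs = cs @ [c]" "c \<noteq> []" using bs cb(2) by (cases bs rule: rev_cases) auto
        then show "last (map shape w) = last (map shape (last bs))" using that(1) by (auto simp: last_append)
      qed
      moreover have "sum_list (map (snd \<circ> snd) (map (\<lambda>b. tot_shape 0 (map shape b)) bs)) = sdeg w"
        using blocks_homog(2)[OF that(2)] that(1) by simp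
      ultimately show ?thesis
        using bs by (simp add: tot_shape_def hd_map last_map del: map_map)
    qed
    ultimately show ?thesis using ne by (auto simp: homog_def)
  qed
  then have "L w $ h = 0"
    unfolding L_def by (subst bsum_hom[of "\<lambda>x. x $ h"]) (auto simp: bsum_def)
  then show False using h by simp
qed

lemma D_homog: "w \<noteq> [] \<Longrightarrow> homog (D w) (tot_shape 1 (map shape w))"
  unfolding homog_def
proof (intro allI impI)
  fix h assume w: "w \<noteq> []" and "D w $ h \<noteq> 0"
  then have "L w $ h \<noteq> 0 \<or> I w $ h \<noteq> 0" by (auto simp: D_eq)
  then show "shape h = tot_shape 1 (map shape w)"
    using L_homog[OF w] insertion_homog[OF Fgr M.gr, of w] by (auto simp: homog_def)
qed

lemma F1_homog: "homog (F [bas c]) (src c, tgt c, int (deg c) - 1)"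
  using F_homog[of "[c]"] by (simp add: tot_shape_def shape_def)

lemma F_Id: "F [bas (Id Z)] = bas (Id Z)"
  using Fun by (simp add: unital_functor_def)

lemma F_unital: "length as \<ge> 2 \<Longrightarrow> bas (Id Z) \<in> set as \<Longrightarrow> F as = 0"
  using Fun unfolding unital_functor_def by blast

text \<open>In the cyclicity relation for a word that starts with the identity, unitality kills
  every cut but the one right behind it.\<close>

lemma pairing_Id_F:
  assumes "length as \<ge> 2"
  shows "pairing (bas (Id Z)) (F as) = 0"
proof -
  have "ssum (\<lambda>u v. pairing (F u) (F v)) (bas (Id Z) # as) = 0"
    by (rule F_cyclic) (use assms in simp)
  moreover have "ssum (\<lambda>u v. pairing (F (bas (Id Z) # u)) (F v)) as = pairing (F [bas (Id Z)]) (F as)"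
    by (rule ssum_left) (auto simp: F_unital[of "bas (Id Z) # _" Z] Suc_le_eq)
  ultimately show ?thesis by (simp add: F_Id)
qed

text \<open>Against an identity only binary products survive, so only decompositions into two blocks
  remain.\<close>

lemma pairing_Id_L:
  assumes "Z = tgt (hd gs)"
  shows "pairing (bas (Id Z)) (L gs) = - ssum (\<lambda>u v. pairing (F u) (F v)) (map bas gs)"
proof -
  let ?Fb = "\<lambda>b. F (map bas b)"
  have "pairing (bas (Id Z)) (L gs) = bsum (\<lambda>bs. pairing (bas (Id Z)) (M' (map ?Fb bs))) gs"
    unfolding L_def by (rule bsum_hom) simp_all
  also have "\<dots> = bsum (\<lambda>bs. if length bs = 2 then - pairing (?Fb (bs ! 0)) (?Fb (bs ! 1)) else 0) gs"
  proof (rule bsum_cong)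
    fix bs assume bs: "concat bs = gs" "[] \<notin> set bs"
    consider "bs = []" | b where "bs = [b]" | u v where "bs = [u, v]" | "length bs \<ge> 3"
      by (cases bs; cases "tl bs"; cases "tl (tl bs)") auto
    then show "pairing (bas (Id Z)) (M' (map ?Fb bs)) =
        (if length bs = 2 then - pairing (?Fb (bs ! 0)) (?Fb (bs ! 1)) else 0)"
    proof cases
      case (3 u v)
      then have "u \<noteq> []" "Z = tgt (hd u)" using bs assms by auto
      then show ?thesis
        using pairing_Id_2[OF graded_multilinear[OF M'.gr] M'.ex, of "?Fb u" _ Z] F_homog[of u] 3
        by (simp add: tot_shape_def hd_map shape_def)
    next
      case 4
      then show ?thesis
        using pairing_Id_ge3[OF M'.gr M'.cyc M'.un blocks_homog(1)[OF bs(2)]] by simp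
    qed (use graded_Nil[OF M'.gr] M'.mi in \<open>auto simp: minimal_ops_def\<close>)
  qed
  also have "\<dots> = ssum (\<lambda>u v. - pairing (?Fb u) (?Fb v)) gs"
    by (rule bsum_two) auto
  finally show ?thesis by (simp add: ssum_map ssum_hom[of uminus])
qed

lemma pairing_Id_I:
  "pairing (bas (Id Z)) (I gs) = pairing (bas (Id Z)) (M (map bas gs))"
proof -
  have "pairing (bas (Id Z)) (I gs) = ssum (\<lambda>p r. ssum (\<lambda>z q. psgn (sdeg q) *
      pairing (bas (Id Z)) (F (map bas p @ M (map bas z) # map bas q))) r) gs"
    unfolding insertion_sum_ssum'[where M = M, OF Fml graded_Nil[OF M.gr]] pairing_ssum by simp
  also have "\<dots> = ssum (\<lambda>z q. psgn (sdeg q) *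
      pairing (bas (Id Z)) (F (map bas [] @ M (map bas z) # map bas q))) gs"
    by (rule ssum_left, rule ssum_neutral) (simp add: pairing_Id_F Suc_le_eq)
  also have "\<dots> = pairing (F [bas (Id Z)]) (F [M (map bas gs)])"
    by (subst ssum_right) (auto simp: pairing_Id_F Suc_le_eq psgn_def F_Id)
  finally show ?thesis by (simp add: F_pairing)
qed

text \<open>For three or more letters the sum over two blocks vanishes by cyclicity of F and the
  product of M by unitality. For two letters both sides are the pairing of the letters, which F
  preserves.\<close>

lemma D_Id:
  assumes "Z = tgt (hd gs)" "gs \<noteq> []"
  shows "pairing (bas (Id Z)) (D gs) = 0"
proof -
  have D: "pairing (bas (Id Z)) (D gs) = - ssum (\<lambda>u v. pairing (F u) (F v)) (map bas gs) -
      pairing (bas (Id Z)) (M (map bas gs))"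
    by (simp add: D_eq pairing_Id_L[OF assms(1)] pairing_Id_I)
  consider a where "gs = [a]" | a b where "gs = [a, b]" | "length gs \<ge> 3"
    using assms(2) by (cases gs; cases "tl gs"; cases "tl (tl gs)") auto
  then show ?thesis
  proof cases
    case (1 a)
    show ?thesis unfolding D
      using 1 M.mi by (simp add: minimal_ops_def)
  next
    case (2 a b)
    have "homog (bas a) (src a, Z, int (deg a) - 1)"
      using homog_bas[of a] assms(1) 2 by (simp add: shape_def)
    then have "pairing (bas (Id Z)) (M [bas a, bas b]) = - pairing (bas a) (bas b)"
      by (rule pairing_Id_2[OF graded_multilinear[OF M.gr] M.ex])
    then show ?thesis using D unfolding 2 by (simp add: F_pairing del: pairing_bas_bas)
  next
    case 3
    show ?thesis unfolding D
      using 3 F_cyclic_bas[OF 3] pairing_Id_ge3[OF M.gr M.cyc M.un homog_map_bas, of gs Z]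
      by simp
  qed
qed

lemma pairing_F_nondeg:
  assumes "\<And>c. pairing (F [bas c]) a = 0"
  shows "a = 0"
proof (rule pairing_nondeg)
  fix c
  obtain b where b: "bas c = F [b]" using Fsurj[unfolded surj_def] by blast
  have ml: "mlin (\<lambda>as. pairing (F as) a)"
    using Fml unfolding mlin_def multilinear_ops_def by simp
  show "pairing (bas c) a = 0"
    unfolding b using mlin_bas[OF ml, of "[]" b "[]"] assms by simp
qed

text \<open>Induction on the length. In the rotation identity every term except the two extreme ones
  contains the defect of a shorter word, so the extreme terms are exchanged up to sign and the
  rotation principle applies with k = 2. The test vectors are values of F because the rotation
  identity produces them.\<close>

theorem functor_relations_iff:
  "functor_relations M M' F \<longleftrightarrow>
   (\<forall>a b c d i j k l. pairing (F [bas (Eta l)]) (D (massey_word a b c d i j k)) = 0)"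
proof
  assume "functor_relations M M' F"
  moreover have "composable (massey_word a b c d i j k)" for a b c d and i j k :: 'n
    using composable_massey5[of a b c d 0 0 i j k j i] by (simp add: massey5_def composable_Cons massey_word_def)
  ultimately show "\<forall>a b c d i j k l. pairing (F [bas (Eta l)]) (D (massey_word a b c d i j k)) = 0"
    by (simp add: functor_relations_iff_defect)
next
  assume main: "\<forall>a b c d i j k l. pairing (F [bas (Eta l)]) (D (massey_word a b c d i j k)) = 0"
  have pz: "cyc_composable (c # v) \<and> sdeg (c # v) = - 2"
    if "pairing (F [bas c]) (D v) \<noteq> 0" "composable v" for c v
  proof -
    have v: "v \<noteq> []" using that(2) by (auto simp: composable_def)
    show ?thesis
      using pairing_homog[OF F1_homog[of c]
          D_homog[OF v, unfolded tot_shape_def]] that v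
      by (auto simp: cyc_composable_def composable_def successively_Cons hd_map last_map shape_def
          sdeg_def comp_def)
  qed
  have "D gs = 0" if "composable gs" for gs
    using that
  proof (induction "length gs" arbitrary: gs rule: less_induct)
    case (less gs)
    \<comment> \<open>The length is fixed, since only the defects of words shorter than gs are known
      to vanish.\<close>
    define Z where "Z w \<longleftrightarrow> (cyc_composable w \<longrightarrow> length w = Suc (length gs) \<longrightarrow>
      pairing (F [bas (hd w)]) (D (tl w)) = 0)" for w
    have Z: "Z w" if "length w \<ge> 2" for w
    proof (rule rotation_principle[of Z 2])
      fix c b v
      assume Zr: "Z (b # v @ [c])"
      show "Z (c # b # v)"
        unfolding Z_def
      proof (intro impI)
        assume cc: "cyc_composable (c # b # v)" and len: "length (c # b # v) = Suc (length gs)"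
        let ?w = "b # v @ [c]"
        have cw: "cyc_composable ?w" using cc by (simp add: cyc_composable_rotate)
        have sub: "composable y" if "x @ y @ z = ?w" "y \<noteq> []" for x y z
        proof -
          have "successively (\<lambda>g h. src g = tgt h) (x @ y @ z)"
            using cw unfolding that(1) by (simp add: cyc_composable_def composable_def)
          then show ?thesis using that(2) by (simp add: composable_def successively_append_iff)
        qed
        have D0: "D y = 0" if "x @ y @ z = ?w" "length y < length gs" for x y z
        proof (cases "y = []")
          case True
          then show ?thesis by (simp add: D_eq)
        next
          case False
          then show ?thesis using less.hyps that sub by blast
        qed
        have "ssum (\<lambda>x y. pairing (F (map bas x)) (D y)) ?w =
            pairing (F (map bas [])) (D ?w) + ssum (\<lambda>x y. pairing (F (map bas (b # x))) (D y)) (v @ [c])"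
          by simp
        also have "ssum (\<lambda>x y. pairing (F (map bas (b # x))) (D y)) (v @ [c]) =
            pairing (F (map bas [b])) (D (v @ [c]))"
        proof (rule ssum_left)
          fix x y assume *: "x @ y = v @ [c]" "x \<noteq> []"
          have "length (x @ y) = length gs" unfolding *(1) using len by simp
          moreover have "length x > 0" using *(2) by simp
          ultimately have "length y < length gs" unfolding length_append by linarith
          then have "D y = 0"
            by (intro D0[of "b # x" y "[]"]) (use * in auto)
          then show "pairing (F (map bas (b # x))) (D y) = 0" by simp
        qed
        finally have 1: "ssum (\<lambda>x y. pairing (F (map bas x)) (D y)) ?w = pairing (F [bas b]) (D (v @ [c]))"
          by simp
        have "ssum (\<lambda>x y. ksgn (sdeg y) (sdeg x) * pairing (F (map bas y)) (D x)) ?w =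
            ssum (\<lambda>x y. ksgn (sdeg (y @ [c])) (sdeg x) * pairing (F (map bas (y @ [c]))) (D x)) (b # v)"
          using ssum_snoc[of "\<lambda>x y. ksgn (sdeg y) (sdeg x) * pairing (F (map bas y)) (D x)" "b # v" c]
          by simp
        also have "\<dots> = ksgn (sdeg ([] @ [c])) (sdeg (b # v)) * pairing (F (map bas ([] @ [c]))) (D (b # v))"
        proof (rule ssum_right)
          fix x y assume *: "x @ y = b # v" "y \<noteq> []"
          have "length (x @ y) = length gs" unfolding *(1) using len by simp
          moreover have "length y > 0" using *(2) by simp
          ultimately have "length x < length gs" unfolding length_append by linarith
          then have "D x = 0"
            by (intro D0[of "[]" x "y @ [c]"]) (use *(1)[symmetric] in auto)
          then show "ksgn (sdeg (y @ [c])) (sdeg x) * pairing (F (map bas (y @ [c]))) (D x) = 0" by simp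
        qed
        finally have "pairing (F [bas b]) (D (v @ [c])) =
            ksgn (int (deg c) - 1) (sdeg (b # v)) * pairing (F [bas c]) (D (b # v))"
          using 1 D_rotate[of ?w] by simp
        moreover have "pairing (F [bas b]) (D (v @ [c])) = 0"
          using Zr cw len by (simp add: Z_def)
        ultimately show "pairing (F [bas (hd (c # b # v))]) (D (tl (c # b # v))) = 0"
          using ksgn_square[of "int (deg c) - 1" "sdeg (b # v)" "pairing (F [bas c]) (D (b # v))"] by simp
      qed
    next
      fix Y v assume "v \<noteq> ([] :: 'n gen list)"
      then show "Z (Id Y # v)"
        using D_Id[of Y v] by (auto simp: Z_def cyc_composable_def composable_Cons F_Id)
    next
      fix w :: "'n gen list" assume len: "length w \<ge> 2" and sd: "sdeg w \<noteq> - 2"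
      obtain c v where w: "w = c # v" using len by (cases w) auto
      show "Z w"
        using pz[of c v] len sd w by (auto simp: Z_def cyc_composable_def composable_Cons)
    next
      fix i and w :: "'n gen list"
      assume w: "composable w" "no_id w" "tgt (hd w) = ObY" "src (last w) = ObX" "sdeg w = - 2"
      obtain a b c d i1 j k where "w = massey_word a b c d i1 j k"
        using word_YX_2[OF w] .
      then show "Z (Eta i # w)" using main by (simp add: Z_def)
    qed (use that in \<open>auto simp: Z_def\<close>)
    show ?case
    proof (rule pairing_F_nondeg)
      fix c
      show "pairing (F [bas c]) (D gs) = 0"
        using Z[of "c # gs"] pz[of c gs] less.prems by (cases gs) (auto simp: Z_def composable_def)
    qed
  qed
  then show "functor_relations M M' F"
    by (simp add: functor_relations_iff_defect)
qed

end

section \<open>Series with poles, the Yang-Baxter equation and the gauge group\<close>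

section \<open>Power series and the localization\<close>

lemma coef_simps [simp]:
  "coef (0 :: ('v::finite, 'r::comm_ring_1) mps) e = 0"
  "coef (f + g) e = coef f e + coef (g :: ('v, 'r) mps) e"
  "coef (f - g) e = coef f e - coef (g :: ('v, 'r) mps) e"
  "coef (- f) e = - coef (f :: ('v, 'r) mps) e"
  "coef (Mps h) e = h e"
  by (simp_all add: zero_mps.rep_eq plus_mps.rep_eq minus_mps.rep_eq uminus_mps.rep_eq Mps_inverse)

lemma coef_sum [simp]:
  "coef (\<Sum>i\<in>I. f i) e = (\<Sum>i\<in>I. coef (f i :: ('v::finite, 'r::comm_ring_1) mps) e)"
  by (induction I rule: infinite_finite_induct) auto

lemma mps_eq_iff: "f = g \<longleftrightarrow> (\<forall>e. coef f e = coef g e)"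
  using mps_eqI by blast

lemma ren_zero [simp]: "ren \<rho> (0 :: ('v::finite, 'r::comm_ring_1) mps) = (0 :: ('w::finite, 'r) mps)"
  by (rule mps_eqI) (simp add: ren.rep_eq)

lemma ren_uminus:
  fixes f :: "('v::finite, 'r::comm_ring_1) mps" and \<rho> :: "'v \<Rightarrow> 'w::finite"
  shows "ren \<rho> (- f) = - ren \<rho> f"
  using ren_diff[of \<rho> 0 f] by simp

lemma ren_sum:
  fixes f :: "'i \<Rightarrow> ('v::finite, 'r::comm_ring_1) mps" and \<rho> :: "'v \<Rightarrow> 'w::finite"
  shows "ren \<rho> (\<Sum>i\<in>I. f i) = (\<Sum>i\<in>I. ren \<rho> (f i))"
  by (induction I rule: infinite_finite_induct) (auto simp: ren_add)

lemma ren_id [simp]: "ren id f = (f :: ('v::finite, 'r::comm_ring_1) mps)"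
  by (rule mps_eqI) (simp add: ren.rep_eq)

lemma ren_ren:
  fixes \<sigma> :: "'u::finite \<Rightarrow> 'v::finite" and \<rho> :: "'v \<Rightarrow> 'w::finite" and f :: "('u, 'r::comm_ring_1) mps"
  assumes "inj \<rho>"
  shows "ren \<rho> (ren \<sigma> f) = ren (\<rho> \<circ> \<sigma>) f"
proof (rule mps_eqI)
  fix e :: "'w \<Rightarrow> nat"
  have "(\<forall>w. w \<notin> range \<rho> \<longrightarrow> e w = 0) \<and> (\<forall>v. v \<notin> range \<sigma> \<longrightarrow> (e \<circ> \<rho>) v = 0) \<longleftrightarrow>
      (\<forall>w. w \<notin> range (\<rho> \<circ> \<sigma>) \<longrightarrow> e w = 0)" (is "?A \<and> ?B \<longleftrightarrow> ?C")
  proof (intro iffI conjI allI impI)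
    fix w assume "?A \<and> ?B" "w \<notin> range (\<rho> \<circ> \<sigma>)"
    then show "e w = 0" by (cases "w \<in> range \<rho>") (auto simp: image_iff inj_eq[OF assms])
  next
    fix v assume C: ?C and "v \<notin> range \<sigma>"
    then have "\<rho> v \<notin> range (\<rho> \<circ> \<sigma>)" using assms by (auto simp: inj_eq)
    then show "(e \<circ> \<rho>) v = 0" using C by simp
  qed auto
  then show "coef (ren \<rho> (ren \<sigma> f)) e = coef (ren (\<rho> \<circ> \<sigma>) f) e"
    by (auto simp: ren.rep_eq comp_assoc)
qed

text \<open>A monomial of the product dictates how every variable other than the shared p and q is
  distributed between the factors, so only the exponents of these two are summed. The products in
  the Yang-Baxter and gauge equations all share two variables.\<close>

lemma coef_ren_mult:
  fixes f :: "('u::finite, 'r::comm_ring_1) mps" and g :: "('v::finite, 'r) mps"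
    and \<rho> :: "'u \<Rightarrow> 'w::finite" and \<rho>' :: "'v \<Rightarrow> 'w"
  assumes "range \<rho> \<union> range \<rho>' = UNIV" "range \<rho> \<inter> range \<rho>' = {p, q}" "p \<noteq> q"
  shows "coef (ren \<rho> f * ren \<rho>' g) e = (\<Sum>i\<le>e p. \<Sum>j\<le>e q.
    coef f (e(p := i, q := j) \<circ> \<rho>) * coef g (e(p := e p - i, q := e q - j) \<circ> \<rho>'))"
proof -
  \<comment> \<open>The exponent of the first factor: i and j at the shared variables, everything at
    the variables it owns alone, nothing elsewhere.\<close>
  define A where "A = (\<lambda>(i, j) w. if w = p then i else if w = q then j else if w \<in> range \<rho> then e w else 0)"
  let ?T = "\<lambda>a. coef (ren \<rho> f) a * coef (ren \<rho>' g) (\<lambda>v. e v - a v)"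
  have "coef (ren \<rho> f * ren \<rho>' g) e = (\<Sum>a\<in>{a. a \<le> e}. ?T a)"
    by (simp add: times_mps.rep_eq)
  also have "\<dots> = (\<Sum>a\<in>A ` ({..e p} \<times> {..e q}). ?T a)"
  proof (rule sum.mono_neutral_right)
    show "finite {a. a \<le> e}" by (rule finite_below)
    show "A ` ({..e p} \<times> {..e q}) \<subseteq> {a. a \<le> e}"
      by (auto simp: A_def le_fun_def)
    show "\<forall>a\<in>{a. a \<le> e} - A ` ({..e p} \<times> {..e q}). ?T a = 0"
    proof
      fix a assume a: "a \<in> {a. a \<le> e} - A ` ({..e p} \<times> {..e q})"
      show "?T a = 0"
      proof (rule ccontr)
        assume "?T a \<noteq> 0"
        then have "coef (ren \<rho> f) a \<noteq> 0" "coef (ren \<rho>' g) (\<lambda>v. e v - a v) \<noteq> 0" by auto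
        then have 1: "\<forall>w. w \<notin> range \<rho> \<longrightarrow> a w = 0" and 2: "\<forall>w. w \<notin> range \<rho>' \<longrightarrow> e w - a w = 0"
          by (auto simp: ren.rep_eq split: if_splits)
        have "a = A (a p, a q)"
        proof
          fix w
          show "a w = A (a p, a q) w"
          proof (cases "w = p \<or> w = q")
            case False
            then have "w \<in> range \<rho> \<longleftrightarrow> w \<notin> range \<rho>'" using assms(1,2) by blast
            moreover have "a w \<le> e w" using a by (simp add: le_fun_def)
            ultimately show ?thesis using 1 2 False by (auto simp: A_def)
          qed (auto simp: A_def)
        qed
        moreover have "(a p, a q) \<in> {..e p} \<times> {..e q}" using a by (simp add: le_fun_def)
        ultimately show False using a by blast
      qed
    qed
  qed
  also have "\<dots> = (\<Sum>ij\<in>{..e p} \<times> {..e q}. ?T (A ij))"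
  proof (rule sum.reindex[unfolded comp_def])
    have "i = i' \<and> j = j'" if "A (i, j) = A (i', j')" for i j i' j'
      using fun_cong[OF that, of p] fun_cong[OF that, of q] assms(3) by (simp add: A_def)
    then show "inj_on A ({..e p} \<times> {..e q})" by (auto simp: inj_on_def)
  qed
  also have "\<dots> = (\<Sum>(i, j)\<in>{..e p} \<times> {..e q}.
      coef f (e(p := i, q := j) \<circ> \<rho>) * coef g (e(p := e p - i, q := e q - j) \<circ> \<rho>'))"
  proof (rule sum.cong[OF refl])
    fix x assume "x \<in> {..e p} \<times> {..e q}"
    obtain i j where x: "x = (i, j)" by (cases x)
    have "p \<in> range \<rho>" "q \<in> range \<rho>" "p \<in> range \<rho>'" "q \<in> range \<rho>'" using assms(2) by blast+
    then have 1: "\<forall>w. w \<notin> range \<rho> \<longrightarrow> A (i, j) w = 0"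
      by (auto simp: A_def)
    have 2: "\<forall>w. w \<notin> range \<rho>' \<longrightarrow> e w - A (i, j) w = 0"
      using \<open>p \<in> range \<rho>'\<close> \<open>q \<in> range \<rho>'\<close> assms(1) by (auto simp: A_def)
    have 3: "A (i, j) \<circ> \<rho> = e(p := i, q := j) \<circ> \<rho>"
      using assms(3) by (auto simp: A_def fun_eq_iff)
    have 4: "(\<lambda>v. e v - A (i, j) v) \<circ> \<rho>' = e(p := e p - i, q := e q - j) \<circ> \<rho>'"
    proof
      fix v
      have "\<rho>' v = p \<or> \<rho>' v = q \<or> \<rho>' v \<notin> range \<rho>" using assms(2) by blast
      then show "((\<lambda>v. e v - A (i, j) v) \<circ> \<rho>') v = (e(p := e p - i, q := e q - j) \<circ> \<rho>') v"
        using assms(3) by (auto simp: A_def)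
    qed
    show "?T (A x) = (case x of (i, j) \<Rightarrow>
        coef f (e(p := i, q := j) \<circ> \<rho>) * coef g (e(p := e p - i, q := e q - j) \<circ> \<rho>'))"
      unfolding x prod.case using 1 2 by (simp add: ren.rep_eq 3 4)
  qed
  also have "\<dots> = (\<Sum>i\<le>e p. \<Sum>j\<le>e q.
    coef f (e(p := i, q := j) \<circ> \<rho>) * coef g (e(p := e p - i, q := e q - j) \<circ> \<rho>'))"
    by (simp add: sum.cartesian_product)
  finally show ?thesis .
qed

text \<open>
  The quotient of the difference of \<open>f\<close> in the variables \<open>\<rho>\<close> and \<open>f\<close> in the variables
  \<open>\<rho>(v := q)\<close> by \<open>\<rho> v - q\<close>.
\<close>

definition ddiff :: "('v \<Rightarrow> 'w) \<Rightarrow> 'v \<Rightarrow> 'w \<Rightarrow> ('v, 'r::comm_ring_1) mps \<Rightarrow> ('w, 'r) mps" where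
  "ddiff \<rho> v q f = Mps (\<lambda>e. if \<forall>w. w \<notin> insert q (range \<rho>) \<longrightarrow> e w = 0
     then coef f ((e \<circ> \<rho>)(v := Suc (e (\<rho> v) + e q))) else 0)"

text \<open>Monomial by monomial this is (s^n - t^n) / (s - t), the sum of all monomials of degree n
  - 1 in s and t; the lost degree is the \<open>Suc\<close> in the definition.\<close>

lemma ddiff_mult:
  fixes f :: "('v::finite, 'r::comm_ring_1) mps" and \<rho> :: "'v \<Rightarrow> 'w::finite"
  assumes "inj \<rho>" "q \<notin> range \<rho>"
  shows "(mvar (\<rho> v) - mvar q) * ddiff \<rho> v q f = ren \<rho> f - ren (\<rho>(v := q)) f"
proof (rule mps_eqI)
  fix e :: "'w \<Rightarrow> nat"
  let ?p = "\<rho> v"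
  have pq: "?p \<noteq> q" using assms(2) by auto
  have rng: "range (\<rho>(v := q)) = insert q (range \<rho> - {?p})"
    using assms(1) by (auto simp: inj_def fun_upd_def image_iff)
  have c1: "(e(?p := n)) \<circ> \<rho> = (e \<circ> \<rho>)(v := n)" for n
    using assms(1) by (auto simp: fun_eq_iff inj_eq)
  have c2: "(e(q := n)) \<circ> \<rho> = e \<circ> \<rho>" for n
    using assms(2) by (auto simp: fun_eq_iff)
  have c3: "e \<circ> \<rho>(v := q) = (e \<circ> \<rho>)(v := e q)"
    by auto
  define S where "S \<longleftrightarrow> (\<forall>w. w \<notin> insert q (range \<rho>) \<longrightarrow> e w = 0)"
  have s1: "(\<forall>w. w \<notin> insert q (range \<rho>) \<longrightarrow> (e(?p := n)) w = 0) \<longleftrightarrow> S" for n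
    by (auto simp: S_def)
  have s2: "(\<forall>w. w \<notin> insert q (range \<rho>) \<longrightarrow> (e(q := n)) w = 0) \<longleftrightarrow> S" for n
    by (auto simp: S_def)
  have s3: "(\<forall>w. w \<notin> range \<rho> \<longrightarrow> e w = 0) \<longleftrightarrow> S \<and> e q = 0"
    using assms(2) unfolding S_def by (metis insert_iff)
  have s4: "(\<forall>w. w \<notin> range (\<rho>(v := q)) \<longrightarrow> e w = 0) \<longleftrightarrow> S \<and> e ?p = 0"
    unfolding rng using pq by (auto simp: S_def)
  have L: "coef ((mvar ?p - mvar q) * ddiff \<rho> v q f) e =
      (if e ?p = 0 then 0 else if S then coef f ((e \<circ> \<rho>)(v := e ?p + e q)) else 0) -
      (if e q = 0 then 0 else if S then coef f ((e \<circ> \<rho>)(v := e ?p + e q)) else 0)"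
    unfolding left_diff_distrib coef_simps coef_mvar_mult ddiff_def s1 s2 c1 c2
    using pq by simp
  have R: "coef (ren \<rho> f - ren (\<rho>(v := q)) f) e =
      (if S \<and> e q = 0 then coef f (e \<circ> \<rho>) else 0) -
      (if S \<and> e ?p = 0 then coef f ((e \<circ> \<rho>)(v := e q)) else 0)"
    unfolding coef_simps ren.rep_eq s3 s4 c3 by (rule refl)
  have triv: "(e \<circ> \<rho>)(v := e ?p) = e \<circ> \<rho>" by auto
  show "coef ((mvar ?p - mvar q) * ddiff \<rho> v q f) e = coef (ren \<rho> f - ren (\<rho>(v := q)) f) e"
    unfolding L R using triv by auto
qed

lemma of_mps_hom:
  fixes f g :: "('i::finite + 'i, 'r::comm_ring_1) mps"
  shows "of_mps (f + g) = of_mps f + of_mps g" "of_mps (f * g) = of_mps f * of_mps g"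
    "of_mps (- f) = - of_mps f" "of_mps (f - g) = of_mps f - of_mps g"
    "of_mps 0 = (0 :: ('i, 'r) mero)" "of_mps 1 = (1 :: ('i, 'r) mero)"
proof -
  show u: "of_mps (- f) = - of_mps f" for f :: "('i + 'i, 'r) mps"
    by (simp add: of_mps_def uminus_frac_of denoms.one)
  show a: "of_mps (f + g) = of_mps f + of_mps g" for f g :: "('i + 'i, 'r) mps"
    by (simp add: of_mps_def add_frac_of denoms.one)
  show "of_mps (f - g) = of_mps f - of_mps g"
    using a[of f "- g"] u[of g] by simp
qed (simp_all add: of_mps_def mult_frac_of denoms.one zero_mero_frac one_mero_frac)

lemma of_mps_sum: "of_mps (\<Sum>i\<in>I. f i) = (\<Sum>i\<in>I. of_mps (f i :: ('i::finite + 'i, 'r::comm_ring_1) mps))"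
  by (induction I rule: infinite_finite_induct) (auto simp: of_mps_hom)

lemma of_mps_inject [simp]:
  "of_mps f = of_mps g \<longleftrightarrow> f = (g :: ('i::finite + 'i, 'r::comm_ring_1) mps)"
  by (simp add: of_mps_def eq_frac_of denoms.one)

lemma of_mps_eq_0 [simp]: "of_mps f = 0 \<longleftrightarrow> f = (0 :: ('i::finite + 'i, 'r::comm_ring_1) mps)"
  using of_mps_inject[of f 0] unfolding of_mps_hom .

lemma subst_frac:
  assumes "inj \<sigma>" "inj \<tau>" "d \<in> denoms"
  shows "subst_mero \<sigma> \<tau> (frac_of a d) = frac_of (ren (map_sum \<sigma> \<tau>) a) (ren (map_sum \<sigma> \<tau>) d)"
  using assms
  by transfer (simp add: mero_rel_def denoms_ren)

lemma subst_of_mps: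
  assumes "inj \<sigma>" "inj \<tau>"
  shows "subst_mero \<sigma> \<tau> (of_mps a) = of_mps (ren (map_sum \<sigma> \<tau>) a)"
  using assms by (simp add: of_mps_def subst_frac denoms.one ren_one)

lemma subst_mero_hom:
  fixes \<sigma> \<tau> :: "'i::finite \<Rightarrow> 'j::finite" and p q :: "('i, 'r::comm_ring_1) mero"
  assumes "inj \<sigma>" "inj \<tau>"
  shows "subst_mero \<sigma> \<tau> (p + q) = subst_mero \<sigma> \<tau> p + subst_mero \<sigma> \<tau> q"
    "subst_mero \<sigma> \<tau> (p * q) = subst_mero \<sigma> \<tau> p * subst_mero \<sigma> \<tau> q"
    "subst_mero \<sigma> \<tau> 0 = (0 :: ('j, 'r) mero)" "subst_mero \<sigma> \<tau> 1 = (1 :: ('j, 'r) mero)"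
proof -
  have inj: "inj (map_sum \<sigma> \<tau>)" using assms by (rule sum.inj_map)
  note [simp] = subst_frac[OF assms] denoms_ren[OF assms] ren_mult[OF inj] ren_add ren_one
    denoms.one denoms_mult
  show "subst_mero \<sigma> \<tau> (p + q) = subst_mero \<sigma> \<tau> p + subst_mero \<sigma> \<tau> q"
    by (cases p, cases q) (simp add: add_frac_of)
  show "subst_mero \<sigma> \<tau> (p * q) = subst_mero \<sigma> \<tau> p * subst_mero \<sigma> \<tau> q"
    by (cases p, cases q) (simp add: mult_frac_of)
  show "subst_mero \<sigma> \<tau> 0 = (0 :: ('j, 'r) mero)" by (simp add: zero_mero_frac)
  show "subst_mero \<sigma> \<tau> 1 = (1 :: ('j, 'r) mero)" by (simp add: one_mero_frac)
qed

definition xinv :: "'i::finite \<Rightarrow> 'i \<Rightarrow> ('i, 'r::comm_ring_1) mero" where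
  "xinv i j = frac_of 1 (xv i - xv j)"

definition yinv :: "'i::finite \<Rightarrow> 'i \<Rightarrow> ('i, 'r::comm_ring_1) mero" where
  "yinv i j = frac_of 1 (yv i - yv j)"

lemma denoms_diff: "i \<noteq> j \<Longrightarrow> xv i - xv j \<in> denoms" "i \<noteq> j \<Longrightarrow> yv i - yv j \<in> denoms"
  using denoms.xdiff[OF denoms.one, of i j] denoms.ydiff[OF denoms.one, of i j] by simp_all

lemma frac_inverse: "d \<in> denoms \<Longrightarrow> of_mps d * frac_of 1 d = 1"
  by (simp add: of_mps_def mult_frac_of denoms.one one_mero_frac eq_frac_of)

lemma inv_mult:
  "i \<noteq> j \<Longrightarrow> of_mps (xv i - xv j) * xinv i j = (1 :: ('i::finite, 'r::comm_ring_1) mero)"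
  "i \<noteq> j \<Longrightarrow> of_mps (yv i - yv j) * yinv i j = (1 :: ('i, 'r) mero)"
  unfolding xinv_def yinv_def by (intro frac_inverse denoms_diff; assumption)+

lemma inverse_swap:
  fixes d :: "'a::comm_ring_1"
  assumes "d * x = 1" "(- d) * y = 1"
  shows "y = - x"
proof -
  have "y = (d * x) * y" using assms by simp
  also have "\<dots> = - (x * ((- d) * y))" by (simp add: algebra_simps)
  also have "\<dots> = - x" unfolding assms(2) by simp
  finally show ?thesis .
qed

lemma inv_swap:
  assumes "i \<noteq> j"
  shows "xinv j i = - (xinv i j :: ('i::finite, 'r::comm_ring_1) mero)"
    "yinv j i = - (yinv i j :: ('i, 'r) mero)"
proof -
  have "- of_mps (xv i - xv j) = (of_mps (xv j - xv i) :: ('i, 'r) mero)"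
    "- of_mps (yv i - yv j) = (of_mps (yv j - yv i) :: ('i, 'r) mero)"
    by (simp_all flip: of_mps_hom)
  then have "- of_mps (xv i - xv j) * xinv j i = (1 :: ('i, 'r) mero)"
    "- of_mps (yv i - yv j) * yinv j i = (1 :: ('i, 'r) mero)"
    using inv_mult[of j i, where 'r = 'r] assms by auto
  from inverse_swap[OF inv_mult(1)[OF assms] this(1)] inverse_swap[OF inv_mult(2)[OF assms] this(2)]
  show "xinv j i = - (xinv i j :: ('i, 'r) mero)" "yinv j i = - (yinv i j :: ('i, 'r) mero)" .
qed

text \<open>The sum of 1/(ab), 1/(bc) and 1/(ca) is (a + b + c)/(abc). It makes the products of two
  poles drop out of the AYBE.\<close>

lemma arnold_aux:
  fixes a b c :: "'a::comm_ring_1"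
  assumes "a * x = 1" "b * y = 1" "c * z = 1" "a + b + c = 0"
  shows "x * y + y * z + z * x = 0"
proof -
  have "x * y + y * z + z * x = x * y * (c * z) + y * z * (a * x) + z * x * (b * y)"
    using assms by simp
  also have "\<dots> = x * y * z * (a + b + c)" by (simp add: algebra_simps)
  finally show ?thesis using assms(4) by simp
qed

lemma arnold:
  assumes "i \<noteq> j" "j \<noteq> k" "k \<noteq> i"
  shows "xinv i j * xinv j k + xinv j k * xinv k i + xinv k i * xinv i j = (0 :: ('i::finite, 'r::comm_ring_1) mero)"
    "yinv i j * yinv j k + yinv j k * yinv k i + yinv k i * yinv i j = (0 :: ('i, 'r) mero)"
  by (rule arnold_aux[OF inv_mult(1) inv_mult(1) inv_mult(1)], (rule assms)+, simp flip: of_mps_hom,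
      rule arnold_aux[OF inv_mult(2) inv_mult(2) inv_mult(2)], (rule assms)+, simp flip: of_mps_hom)

lemma inv_ddiff_aux:
  fixes a :: "'a::comm_ring_1"
  assumes "a * x = 1" "a * d = b"
  shows "x * b = d"
proof -
  have "x * b = (a * x) * d" unfolding assms(2)[symmetric] by (simp add: algebra_simps)
  then show ?thesis using assms by simp
qed

text \<open>A pole times the matching difference of two substitutions is a power series. Together
  with \<open>arnold\<close> this removes all poles from the AYBE.\<close>

lemma inv_ddiff:
  fixes f :: "('v::finite, 'r::comm_ring_1) mps" and \<rho> :: "'v \<Rightarrow> 'i::finite + 'i"
  assumes "inj \<rho>"
  shows "\<rho> v = Inl i \<Longrightarrow> Inl j \<notin> range \<rho> \<Longrightarrow>
      xinv i j * (of_mps (ren \<rho> f) - of_mps (ren (\<rho>(v := Inl j)) f)) = of_mps (ddiff \<rho> v (Inl j) f)"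
    and "\<rho> v = Inr i \<Longrightarrow> Inr j \<notin> range \<rho> \<Longrightarrow>
      yinv i j * (of_mps (ren \<rho> f) - of_mps (ren (\<rho>(v := Inr j)) f)) = of_mps (ddiff \<rho> v (Inr j) f)"
proof -
  show "xinv i j * (of_mps (ren \<rho> f) - of_mps (ren (\<rho>(v := Inl j)) f)) = of_mps (ddiff \<rho> v (Inl j) f)"
    if v: "\<rho> v = Inl i" "Inl j \<notin> range \<rho>"
  proof (rule inv_ddiff_aux[OF inv_mult(1)])
    show "i \<noteq> j" using v by (metis rangeI)
    show "of_mps (xv i - xv j) * of_mps (ddiff \<rho> v (Inl j) f) =
        of_mps (ren \<rho> f) - of_mps (ren (\<rho>(v := Inl j)) f)"
      using ddiff_mult[OF assms v(2), of v f] v(1) by (simp flip: of_mps_hom)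
  qed
  show "yinv i j * (of_mps (ren \<rho> f) - of_mps (ren (\<rho>(v := Inr j)) f)) = of_mps (ddiff \<rho> v (Inr j) f)"
    if v: "\<rho> v = Inr i" "Inr j \<notin> range \<rho>"
  proof (rule inv_ddiff_aux[OF inv_mult(2)])
    show "i \<noteq> j" using v by (metis rangeI)
    show "of_mps (yv i - yv j) * of_mps (ddiff \<rho> v (Inr j) f) =
        of_mps (ren \<rho> f) - of_mps (ren (\<rho>(v := Inr j)) f)"
      using ddiff_mult[OF assms v(2), of v f] v(1) by (simp flip: of_mps_hom)
  qed
qed

section \<open>The Yang--Baxter equation without denominators\<close>

definition vars4 :: "'j \<Rightarrow> 'j \<Rightarrow> 'j \<Rightarrow> 'j \<Rightarrow> 2 + 2 \<Rightarrow> 'j + 'j" where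
  "vars4 a b c d = map_sum (\<lambda>i. if i = 1 then a else b) (\<lambda>i. if i = 1 then c else d)"

definition kd :: "'a \<Rightarrow> 'a \<Rightarrow> 'b::comm_ring_1" where
  "kd i j = (if i = j then 1 else 0)"

lemma inj_if2: "a \<noteq> b \<Longrightarrow> inj (\<lambda>i::2. if i = 1 then a else b)"
  unfolding inj_def by (metis exhaust_2)

lemma inj_vars4: "a \<noteq> b \<Longrightarrow> c \<noteq> d \<Longrightarrow> inj (vars4 a b c d)"
  unfolding vars4_def by (intro sum.inj_map inj_if2)

lemma vars4_simps [simp]:
  "vars4 a b c d (Inl 1) = Inl a" "vars4 a b c d (Inl 2) = Inl b"
  "vars4 a b c d (Inr 1) = Inr c" "vars4 a b c d (Inr 2) = Inr d"
  by (simp_all add: vars4_def)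

lemma UNIV_22: "(UNIV :: (2 + 2) set) = {Inl 1, Inl 2, Inr 1, Inr 2}"
proof -
  have "v \<in> {Inl 1, Inl 2, Inr 1, Inr 2}" for v :: "2 + 2"
    using exhaust_2[of "projl v"] exhaust_2[of "projr v"] by (cases v) auto
  then show ?thesis by blast
qed

lemma all_22: "(\<forall>v :: 2 + 2. P v) \<longleftrightarrow> P (Inl 1) \<and> P (Inl 2) \<and> P (Inr 1) \<and> P (Inr 2)"
proof -
  have "(\<forall>v :: 2 + 2. P v) \<longleftrightarrow> (\<forall>v\<in>UNIV. P v)" by simp
  then show ?thesis unfolding UNIV_22 by simp
qed

lemma range_vars4: "range (vars4 a b c d) = {Inl a, Inl b, Inr c, Inr d}"
  by (simp add: UNIV_22)

lemma vars4_upd: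
  "(vars4 a b c d)(Inl 1 := Inl e) = vars4 e b c d" "(vars4 a b c d)(Inl 2 := Inl e) = vars4 a e c d"
  "(vars4 a b c d)(Inr 1 := Inr e) = vars4 a b e d" "(vars4 a b c d)(Inr 2 := Inr e) = vars4 a b c e"
  by (simp_all add: fun_eq_iff all_22)

lemma kd_sum:
  fixes f :: "'n::finite \<Rightarrow> 'a::comm_ring_1"
  shows "(\<Sum>p\<in>UNIV. kd i p * f p) = f i" "(\<Sum>p\<in>UNIV. f p * kd p i) = f i"
proof -
  have "kd i p * f p = (if p = i then f i else 0)" "f p * kd p i = (if p = i then f i else 0)" for p
    by (auto simp: kd_def)
  then show "(\<Sum>p\<in>UNIV. kd i p * f p) = f i" "(\<Sum>p\<in>UNIV. f p * kd p i) = f i"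
    by simp_all
qed

lemma perm_P_entry: "(perm_P :: ('n::finite, 's::comm_ring_1) mat2) $ (i, k) $ (j, l) = kd i l * kd k j"
proof -
  have "tensor_mat (unit_mat a b) (unit_mat b a) $ (i, k) $ (j, l) =
      kd i a * (kd j b * (kd i l * kd k j) :: 's)" for a b
    by (auto simp: tensor_mat_def unit_mat_def kd_def)
  then show ?thesis by (simp add: perm_P_def kd_sum flip: sum_distrib_left)
qed

lemma mat_1_entry: "(mat 1 :: ('n::finite, 's::comm_ring_1) mat2) $ (i, k) $ (j, l) = kd i j * kd k l"
  by (simp add: mat_def kd_def)

lemma polar_part_entry:
  "(polar_part :: ('n::finite, (2, 'r::comm_ring_1) mero) mat2) $ (i, k) $ (j, l) =
    kd i j * kd k l * xinv 2 1 + kd i l * kd k j * yinv 1 2"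
  by (simp add: polar_part_def perm_P_entry mat_1_entry xinv_def yinv_def)

lemma subst_inv:
  assumes "a \<noteq> b" "c \<noteq> d"
  shows "subst_mero (\<lambda>i::2. if i = 1 then a else b) (\<lambda>i. if i = 1 then c else d) (xinv 2 1) = xinv b a"
    "subst_mero (\<lambda>i::2. if i = 1 then a else b) (\<lambda>i. if i = 1 then c else d) (yinv 1 2) = yinv c d"
  using inj_vars4[OF assms] assms
  by (simp_all add: xinv_def yinv_def subst_frac inj_if2 denoms_diff ren_one ren_diff ren_mvar
      flip: vars4_def)

text \<open>The series \<open>s i j k l\<close> is the coefficient of the tensor product of e_ij and
  e_kl, which the matrix stores in row (i, k) and column (j, l).\<close>

definition regular_part :: "('n \<Rightarrow> 'n \<Rightarrow> 'n \<Rightarrow> 'n \<Rightarrow> (2 + 2, 'r::comm_ring_1) mps) \<Rightarrow> ('n::finite, (2, 'r) mero) mat2" where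
  "regular_part s = (\<chi> p q. of_mps (s (fst p) (fst q) (snd p) (snd q)))"

lemma regular_part_entry: "regular_part s $ (i, k) $ (j, l) = of_mps (s i j k l)"
  by (simp add: regular_part_def)

lemma at_vars_entry:
  assumes "a \<noteq> b" "c \<noteq> d"
  shows "at_vars (polar_part + regular_part s) a b c d $ (i, k) $ (j, l) =
    kd i j * (kd k l * xinv b a) + kd i l * (kd k j * yinv c d) + of_mps (ren (vars4 a b c d) (s i j k l))"
proof -
  note [simp] = subst_mero_hom[OF inj_if2[OF assms(1)] inj_if2[OF assms(2)]] subst_inv[OF assms]
    subst_of_mps[OF inj_if2[OF assms(1)] inj_if2[OF assms(2)]]
  show ?thesis
    unfolding at_vars_def
    by (simp add: polar_part_entry regular_part_def vars4_def kd_def)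
qed

lemma has_polar_form_iff: "has_polar_form r \<longleftrightarrow> (\<exists>s. r = polar_part + regular_part s)"
proof
  assume "has_polar_form r"
  then have "\<exists>f. (r - polar_part) $ p $ q = of_mps f" for p q
    unfolding has_polar_form_def by blast
  then obtain f where f: "(r - polar_part) $ p $ q = of_mps (f p q)" for p q by metis
  have "r = polar_part + regular_part (\<lambda>i j k l. f (i, k) (j, l))"
    using f by (simp add: vec_eq_iff regular_part_def) (metis diff_add_cancel add.commute)
  then show "\<exists>s. r = polar_part + regular_part s" by blast
qed (auto simp: has_polar_form_def regular_part_def)

lemma regular_part_inject: "polar_part + regular_part s = polar_part + regular_part s' \<longleftrightarrow> s = s'"
  by (auto simp: regular_part_def vec_eq_iff fun_eq_iff)

text \<open>The polar part is skew-symmetric by itself, so the condition concerns only the regular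
  part.\<close>

lemma polar_skew:
  "skew_symmetric (polar_part + regular_part s) \<longleftrightarrow>
    (\<forall>i j k l. s k l i j = - ren (vars4 2 1 2 1) (s i j k l))"
proof -
  have "skew_symmetric (polar_part + regular_part s) \<longleftrightarrow> (\<forall>i j k l.
      (polar_part + regular_part s) $ (k, i) $ (l, j) =
      - at_vars (polar_part + regular_part s) 2 1 2 1 $ (i, k) $ (j, l))"
    unfolding skew_symmetric_def flip21_def by (simp add: vec_eq_iff) blast
  also have "\<dots> \<longleftrightarrow> (\<forall>i j k l. of_mps (s k l i j) = of_mps (- ren (vars4 2 1 2 1) (s i j k l)))"
    by (simp add: at_vars_entry polar_part_entry inv_swap[of 1 2] regular_part_entry of_mps_hom)
  finally show ?thesis by (simp only: of_mps_inject)
qed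

lemma skew_vars4:
  assumes "\<forall>i j k l. s k l i j = - ren (vars4 2 1 2 1) (s i j k l)" "a \<noteq> b" "c \<noteq> d"
  shows "ren (vars4 a b c d) (s k l i j) = - ren (vars4 b a d c) (s i j k l)"
proof -
  have "vars4 a b c d \<circ> vars4 2 1 2 1 = vars4 b a d c"
    by (simp add: fun_eq_iff all_22)
  then show ?thesis
    using ren_ren[OF inj_vars4[OF assms(2,3)], of "vars4 2 1 2 1" "s i j k l"]
    by (subst assms(1)[rule_format]) (simp add: ren_uminus)
qed

lemma polar_product:
  fixes f g :: "'n::finite \<Rightarrow> 'a::comm_ring_1"
  shows "(\<Sum>p\<in>UNIV. (kd i p * \<alpha> + kd i' p * \<beta> + f p) * (kd p j * \<gamma> + kd p j' * \<delta> + g p)) =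
    kd i j * \<alpha> * \<gamma> + kd i j' * \<alpha> * \<delta> + \<alpha> * g i + kd i' j * \<beta> * \<gamma> + kd i' j' * \<beta> * \<delta> + \<beta> * g i' +
    \<gamma> * f j + \<delta> * f j' + (\<Sum>p\<in>UNIV. f p * g p)"
proof -
  have "(\<Sum>p\<in>UNIV. (kd i p * \<alpha> + kd i' p * \<beta> + f p) * (kd p j * \<gamma> + kd p j' * \<delta> + g p)) =
    (\<Sum>p\<in>UNIV. kd i p * (\<alpha> * (kd p j * \<gamma> + kd p j' * \<delta> + g p))) +
    (\<Sum>p\<in>UNIV. kd i' p * (\<beta> * (kd p j * \<gamma> + kd p j' * \<delta> + g p))) +
    (\<Sum>p\<in>UNIV. (\<gamma> * f p) * kd p j) + (\<Sum>p\<in>UNIV. (\<delta> * f p) * kd p j') + (\<Sum>p\<in>UNIV. f p * g p)"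
    by (simp add: algebra_simps flip: sum.distrib)
  then show ?thesis unfolding kd_sum by (simp add: algebra_simps)
qed

lemma sum_triple:
  fixes f :: "'n::finite \<times> 'n \<times> 'n \<Rightarrow> 'a::comm_monoid_add"
  shows "(\<Sum>k\<in>UNIV. f k) = (\<Sum>k1\<in>UNIV. \<Sum>k2\<in>UNIV. \<Sum>k3\<in>UNIV. f (k1, k2, k3))"
  unfolding UNIV_Times_UNIV[symmetric] sum.cartesian_product by (simp add: split_def)

text \<open>Of the three contracted indices two are pinned by the tensor factors on which a matrix
  acts as the identity.\<close>

lemma place_products:
  fixes A B :: "('n::finite, 's::comm_ring_1) mat2"
  shows "(place12 A ** place13 B) $ (i1, i2, i3) $ (j1, j2, j3) =
      (\<Sum>p\<in>UNIV. A $ (i1, i2) $ (p, j2) * B $ (p, i3) $ (j1, j3))"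
    and "(place23 A ** place12 B) $ (i1, i2, i3) $ (j1, j2, j3) =
      (\<Sum>p\<in>UNIV. A $ (i2, i3) $ (p, j3) * B $ (i1, p) $ (j1, j2))"
    and "(place13 A ** place23 B) $ (i1, i2, i3) $ (j1, j2, j3) =
      (\<Sum>p\<in>UNIV. A $ (i1, i3) $ (j1, p) * B $ (i2, p) $ (j2, j3))"
proof -
  note [simp] = matrix_matrix_mult_def sum_triple
  have "place12 A $ (i1, i2, i3) $ (k1, k2, k3) * place13 B $ (k1, k2, k3) $ (j1, j2, j3) =
      kd i3 k3 * (A $ (i1, i2) $ (k1, k2) * B $ (k1, k3) $ (j1, j3) * kd k2 j2)" for k1 k2 k3
    by (simp add: place12_def place13_def kd_def)
  then show "(place12 A ** place13 B) $ (i1, i2, i3) $ (j1, j2, j3) =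
      (\<Sum>p\<in>UNIV. A $ (i1, i2) $ (p, j2) * B $ (p, i3) $ (j1, j3))"
    by (simp add: kd_sum)
  have "place23 A $ (i1, i2, i3) $ (k1, k2, k3) * place12 B $ (k1, k2, k3) $ (j1, j2, j3) =
      kd i1 k1 * (A $ (i2, i3) $ (k2, k3) * B $ (k1, k2) $ (j1, j2) * kd k3 j3)" for k1 k2 k3
    by (simp add: place12_def place23_def kd_def)
  then show "(place23 A ** place12 B) $ (i1, i2, i3) $ (j1, j2, j3) =
      (\<Sum>p\<in>UNIV. A $ (i2, i3) $ (p, j3) * B $ (i1, p) $ (j1, j2))"
    by (simp add: kd_sum flip: sum_distrib_left)
  have "place13 A $ (i1, i2, i3) $ (k1, k2, k3) * place23 B $ (k1, k2, k3) $ (j1, j2, j3) =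
      kd i2 k2 * (A $ (i1, i3) $ (k1, k3) * B $ (k2, k3) $ (j2, j3) * kd k1 j1)" for k1 k2 k3
    by (simp add: place13_def place23_def kd_def)
  then show "(place13 A ** place23 B) $ (i1, i2, i3) $ (j1, j2, j3) =
      (\<Sum>p\<in>UNIV. A $ (i1, i3) $ (j1, p) * B $ (i2, p) $ (j2, j3))"
    by (simp add: kd_sum flip: sum_distrib_left sum_distrib_right)
qed

text \<open>An entry of the AYBE with the poles cancelled. The twelve products of a pole with a
  regular part combine in pairs to the six divided differences: those in an x variable come from the
  tensor square of the identity, those in a y variable from P.\<close>

definition AYBE_defect ::
    "('n::finite \<Rightarrow> 'n \<Rightarrow> 'n \<Rightarrow> 'n \<Rightarrow> (2 + 2, 'r::comm_ring_1) mps) \<Rightarrow>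
     'n \<Rightarrow> 'n \<Rightarrow> 'n \<Rightarrow> 'n \<Rightarrow> 'n \<Rightarrow> 'n \<Rightarrow> (3 + 3, 'r) mps" where
  "AYBE_defect s i1 i2 i3 j1 j2 j3 =
     (\<Sum>p\<in>UNIV. ren (vars4 2 1 2 3) (s i1 p i2 j2) * ren (vars4 1 3 1 3) (s p j1 i3 j3))
     - (\<Sum>p\<in>UNIV. ren (vars4 1 3 1 2) (s i2 p i3 j3) * ren (vars4 2 3 2 3) (s i1 j1 p j2))
     + (\<Sum>p\<in>UNIV. ren (vars4 2 3 1 3) (s i1 j1 i3 p) * ren (vars4 1 2 1 2) (s i2 j2 p j3))
     + kd i2 j2 * ddiff (vars4 2 3 1 3) (Inl 1) (Inl 1) (s i1 j1 i3 j3)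
     - kd i1 j2 * ddiff (vars4 1 3 1 2) (Inr 2) (Inr 3) (s i2 j1 i3 j3)
     - kd i3 j3 * ddiff (vars4 2 1 2 3) (Inl 2) (Inl 3) (s i1 j1 i2 j2)
     + kd i3 j1 * ddiff (vars4 1 2 1 2) (Inr 1) (Inr 3) (s i2 j2 i1 j3)
     + kd i2 j3 * ddiff (vars4 2 3 1 3) (Inr 1) (Inr 2) (s i1 j1 i3 j2)
     - kd i1 j1 * ddiff (vars4 1 2 1 2) (Inl 2) (Inl 3) (s i2 j2 i3 j3)"


lemma of_mps_kd: "of_mps (kd i j) = kd i j"
  by (simp add: kd_def of_mps_hom)

text \<open>Skew-symmetry enters through one pair of terms: the two with the pole 1/(y_1 - y_3)
  carry regular parts with opposite order of the tensor factors, and only after exchanging one of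
  them do they form a divided difference.\<close>

lemma AYBE_entry:
  fixes s :: "'n::finite \<Rightarrow> 'n \<Rightarrow> 'n \<Rightarrow> 'n \<Rightarrow> (2 + 2, 'r::comm_ring_1) mps"
  defines "r \<equiv> polar_part + regular_part s"
  assumes skew: "\<forall>i j k l. s k l i j = - ren (vars4 2 1 2 1) (s i j k l)"
  shows "(place12 (at_vars r 2 1 2 3) ** place13 (at_vars r 1 3 1 3)
     - place23 (at_vars r 1 3 1 2) ** place12 (at_vars r 2 3 2 3)
     + place13 (at_vars r 2 3 1 3) ** place23 (at_vars r 1 2 1 2)) $ (i1, i2, i3) $ (j1, j2, j3)
     = of_mps (AYBE_defect s i1 i2 i3 j1 j2 j3)" (is "?L = _")
proof -
  define S :: "3 \<Rightarrow> 3 \<Rightarrow> 3 \<Rightarrow> 3 \<Rightarrow> 'n \<Rightarrow> 'n \<Rightarrow> 'n \<Rightarrow> 'n \<Rightarrow> (3, 'r) mero"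
    where "S a b c d i j k l = of_mps (ren (vars4 a b c d) (s i j k l))" for a b c d i j k l
  have A: "(place12 (at_vars r 2 1 2 3) ** place13 (at_vars r 1 3 1 3)) $ (i1, i2, i3) $ (j1, j2, j3) =
      (\<Sum>p\<in>UNIV. (kd i1 p * (kd i2 j2 * xinv 1 2) + kd i2 p * (kd i1 j2 * yinv 2 3) + S 2 1 2 3 i1 p i2 j2) *
        (kd p j1 * (kd i3 j3 * xinv 3 1) + kd p j3 * (kd i3 j1 * yinv 1 3) + S 1 3 1 3 p j1 i3 j3))"
    unfolding place_products r_def S_def
    by (rule sum.cong) (simp_all add: at_vars_entry mult.left_commute)
  have B: "(place23 (at_vars r 1 3 1 2) ** place12 (at_vars r 2 3 2 3)) $ (i1, i2, i3) $ (j1, j2, j3) =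
      (\<Sum>p\<in>UNIV. (kd i2 p * (kd i3 j3 * xinv 3 1) + kd i3 p * (kd i2 j3 * yinv 1 2) + S 1 3 1 2 i2 p i3 j3) *
        (kd p j2 * (kd i1 j1 * xinv 3 2) + kd p j1 * (kd i1 j2 * yinv 2 3) + S 2 3 2 3 i1 j1 p j2))"
    unfolding place_products r_def S_def
    by (rule sum.cong) (simp_all add: at_vars_entry mult.left_commute)
  have C: "(place13 (at_vars r 2 3 1 3) ** place23 (at_vars r 1 2 1 2)) $ (i1, i2, i3) $ (j1, j2, j3) =
      (\<Sum>p\<in>UNIV. (kd i3 p * (kd i1 j1 * xinv 3 2) + kd i1 p * (kd i3 j1 * yinv 1 3) + S 2 3 1 3 i1 j1 i3 p) *
        (kd p j3 * (kd i2 j2 * xinv 2 1) + kd p j2 * (kd i2 j3 * yinv 1 2) + S 1 2 1 2 i2 j2 p j3))"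
    unfolding place_products r_def S_def
    by (rule sum.cong) (simp_all add: at_vars_entry mult.left_commute)
  have inj: "inj (vars4 2 3 1 (3::3))" "inj (vars4 1 3 1 (2::3))" "inj (vars4 2 1 2 (3::3))"
    "inj (vars4 1 2 1 (2::3))"
    by (rule inj_vars4; simp)+
  have d: "of_mps (ddiff (vars4 2 3 1 3) (Inl 1) (Inl 1) (s i1 j1 i3 j3)) =
      xinv 2 1 * (S 2 3 1 3 i1 j1 i3 j3 - S 1 3 1 3 i1 j1 i3 j3)"
    "of_mps (ddiff (vars4 1 3 1 2) (Inr 2) (Inr 3) (s i2 j1 i3 j3)) =
      yinv 2 3 * (S 1 3 1 2 i2 j1 i3 j3 - S 1 3 1 3 i2 j1 i3 j3)"
    "of_mps (ddiff (vars4 2 1 2 3) (Inl 2) (Inl 3) (s i1 j1 i2 j2)) =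
      xinv 1 3 * (S 2 1 2 3 i1 j1 i2 j2 - S 2 3 2 3 i1 j1 i2 j2)"
    "of_mps (ddiff (vars4 1 2 1 2) (Inr 1) (Inr 3) (s i2 j2 i1 j3)) =
      yinv 1 3 * (S 1 2 1 2 i2 j2 i1 j3 - S 1 2 3 2 i2 j2 i1 j3)"
    "of_mps (ddiff (vars4 2 3 1 3) (Inr 1) (Inr 2) (s i1 j1 i3 j2)) =
      yinv 1 2 * (S 2 3 1 3 i1 j1 i3 j2 - S 2 3 2 3 i1 j1 i3 j2)"
    "of_mps (ddiff (vars4 1 2 1 2) (Inl 2) (Inl 3) (s i2 j2 i3 j3)) =
      xinv 2 3 * (S 1 2 1 2 i2 j2 i3 j3 - S 1 3 1 2 i2 j2 i3 j3)"
    unfolding S_def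
    using inv_ddiff(1)[OF inj(1), of "Inl 1" 2 1 "s i1 j1 i3 j3"]
      inv_ddiff(2)[OF inj(2), of "Inr 2" 2 3 "s i2 j1 i3 j3"]
      inv_ddiff(1)[OF inj(3), of "Inl 2" 1 3 "s i1 j1 i2 j2"]
      inv_ddiff(2)[OF inj(4), of "Inr 1" 1 3 "s i2 j2 i1 j3"]
      inv_ddiff(2)[OF inj(1), of "Inr 1" 1 2 "s i1 j1 i3 j2"]
      inv_ddiff(1)[OF inj(4), of "Inl 2" 2 3 "s i2 j2 i3 j3"]
    unfolding vars4_upd by (simp_all add: range_vars4)
  have sk: "S 2 1 2 3 i1 j3 i2 j2 = - S 1 2 3 2 i2 j2 i1 j3"
    unfolding S_def by (subst skew_vars4[OF skew]) (simp_all add: of_mps_hom)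
  have R: "of_mps (AYBE_defect s i1 i2 i3 j1 j2 j3) =
     (\<Sum>p\<in>UNIV. S 2 1 2 3 i1 p i2 j2 * S 1 3 1 3 p j1 i3 j3)
     - (\<Sum>p\<in>UNIV. S 1 3 1 2 i2 p i3 j3 * S 2 3 2 3 i1 j1 p j2)
     + (\<Sum>p\<in>UNIV. S 2 3 1 3 i1 j1 i3 p * S 1 2 1 2 i2 j2 p j3)
     + kd i2 j2 * (xinv 2 1 * (S 2 3 1 3 i1 j1 i3 j3 - S 1 3 1 3 i1 j1 i3 j3))
     - kd i1 j2 * (yinv 2 3 * (S 1 3 1 2 i2 j1 i3 j3 - S 1 3 1 3 i2 j1 i3 j3))
     - kd i3 j3 * (xinv 1 3 * (S 2 1 2 3 i1 j1 i2 j2 - S 2 3 2 3 i1 j1 i2 j2))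
     + kd i3 j1 * (yinv 1 3 * (S 1 2 1 2 i2 j2 i1 j3 - S 1 2 3 2 i2 j2 i1 j3))
     + kd i2 j3 * (yinv 1 2 * (S 2 3 1 3 i1 j1 i3 j2 - S 2 3 2 3 i1 j1 i3 j2))
     - kd i1 j1 * (xinv 2 3 * (S 1 2 1 2 i2 j2 i3 j3 - S 1 3 1 2 i2 j2 i3 j3))"
    unfolding AYBE_defect_def of_mps_hom of_mps_sum of_mps_kd d
    unfolding S_def by (rule refl)
  have sw: "xinv 2 1 = - (xinv 1 2 :: (3, 'r) mero)" "xinv 1 3 = - (xinv 3 1 :: (3, 'r) mero)"
    "xinv 3 2 = - (xinv 2 3 :: (3, 'r) mero)" "yinv 1 3 = - (yinv 3 1 :: (3, 'r) mero)"
    by (rule inv_swap; simp)+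
  have ar: "xinv 1 2 * xinv 2 3 + xinv 2 3 * xinv 3 1 + xinv 3 1 * xinv 1 2 = (0 :: (3, 'r) mero)"
    "yinv 1 2 * yinv 2 3 + yinv 2 3 * yinv 3 1 + yinv 3 1 * yinv 1 2 = (0 :: (3, 'r) mero)"
    by (rule arnold; simp)+
  \<comment> \<open>The two brackets collect the products of two poles, of identity type in x and of
    permutation type in y.\<close>
  have "?L = of_mps (AYBE_defect s i1 i2 i3 j1 j2 j3) +
      kd i1 j1 * kd i2 j2 * kd i3 j3 *
        (xinv 1 2 * xinv 2 3 + xinv 2 3 * xinv 3 1 + xinv 3 1 * xinv 1 2) -
      kd i1 j2 * kd i2 j3 * kd i3 j1 *
        (yinv 1 2 * yinv 2 3 + yinv 2 3 * yinv 3 1 + yinv 3 1 * yinv 1 2)"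
    unfolding vector_add_component vector_minus_component A B C polar_product R sk sw
    by (simp add: algebra_simps)
  then show ?thesis unfolding ar by simp
qed

lemma general_AYBE_iff:
  fixes s :: "'n::finite \<Rightarrow> 'n \<Rightarrow> 'n \<Rightarrow> 'n \<Rightarrow> (2 + 2, 'r::comm_ring_1) mps"
  assumes "\<forall>i j k l. s k l i j = - ren (vars4 2 1 2 1) (s i j k l)"
  shows "general_AYBE (polar_part + regular_part s) \<longleftrightarrow>
    (\<forall>i1 i2 i3 j1 j2 j3. AYBE_defect s i1 i2 i3 j1 j2 j3 = 0)"
proof -
  have "X = 0 \<longleftrightarrow> (\<forall>i1 i2 i3 j1 j2 j3. X $ (i1, i2, i3) $ (j1, j2, j3) = 0)" for X :: "('n, (3, 'r) mero) mat3"
    by (auto simp: vec_eq_iff)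
  then show ?thesis
    unfolding general_AYBE_def by (simp only: AYBE_entry[OF assms] of_mps_eq_0)
qed

section \<open>Inverting matrices of power series\<close>

definition constant_term :: "(('v::finite, 'r::comm_ring_1) mps) ^ 'n::finite ^ 'n \<Rightarrow> 'r ^ 'n ^ 'n" where
  "constant_term \<phi> = (\<chi> a b. coef (\<phi> $ a $ b) (\<lambda>_. 0))"

definition total :: "('v::finite \<Rightarrow> nat) \<Rightarrow> nat" where
  "total e = (\<Sum>v\<in>UNIV. e v)"

lemma total_diff: "a \<le> e \<Longrightarrow> total e = total a + total (\<lambda>v. e v - a v)"
  by (simp add: total_def le_fun_def flip: sum.distrib)

lemma total_pos: "a \<noteq> (\<lambda>_. 0) \<Longrightarrow> total a > 0"
  by (metis (no_types) total_def sum_eq_0_iff finite UNIV_I gr0I ext)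

lemma coef_mult_0:
  fixes f g :: "('v::finite, 'r::comm_ring_1) mps"
  shows "coef (f * g) (\<lambda>_. 0) = coef f (\<lambda>_. 0) * coef g (\<lambda>_. 0)"
proof -
  have "{a. a \<le> (\<lambda>_. 0 :: nat)} = {\<lambda>_ :: 'v. 0}"
    by (auto simp: le_fun_def)
  then show ?thesis by (simp add: times_mps.rep_eq)
qed

lemma coef_mat_1: "coef ((mat 1 :: (('v::finite, 'r::comm_ring_1) mps) ^ 'n::finite ^ 'n) $ a $ b) e =
    (if e = (\<lambda>_. 0) \<and> a = b then 1 else 0)"
  by (auto simp: mat_def one_mps.rep_eq)

lemma constant_term_mult: "constant_term (\<phi> ** \<psi>) = constant_term \<phi> ** constant_term \<psi>"
  by (simp add: constant_term_def matrix_matrix_mult_def coef_mult_0 vec_eq_iff)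

lemma constant_term_1: "constant_term (mat 1) = mat 1"
  by (simp add: constant_term_def coef_mat_1 vec_eq_iff) (simp add: mat_def)

lemma coef_matrix_mult:
  "coef ((A ** B) $ a $ b) e =
    (\<Sum>c\<in>UNIV. \<Sum>x | x \<le> e. coef (A $ a $ c) x * coef (B $ c $ b) (\<lambda>v. e v - x v))"
  for A B :: "(('v::finite, 'r::comm_ring_1) mps) ^ 'n::finite ^ 'n"
  by (simp add: matrix_matrix_mult_def times_mps.rep_eq)

lemma matrix_diff_distrib:
  fixes A B C :: "'a::comm_ring_1 ^ 'n::finite ^ 'n"
  shows "A ** (B - C) = A ** B - A ** C" "(A - B) ** C = A ** C - B ** C"
    "(A + B) ** C = A ** C + B ** C"
  by (simp_all add: matrix_matrix_mult_def vec_eq_iff algebra_simps sum_subtractf sum.distrib)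

text \<open>The geometric series of N. If N has no constant term, its k-th power starts in degree k,
  so stopping at the total degree of the exponent loses nothing.\<close>

definition neumann :: "(('v::finite, 'r::comm_ring_1) mps) ^ 'n::finite ^ 'n \<Rightarrow> (('v, 'r) mps) ^ 'n ^ 'n" where
  "neumann N = (\<chi> a b. Mps (\<lambda>e. \<Sum>k\<le>total e. coef ((((**) N ^^ k) (mat 1)) $ a $ b) e))"

context
  fixes N :: "(('v::finite, 'r::comm_ring_1) mps) ^ 'n::finite ^ 'n"
  assumes N: "constant_term N = 0"
begin

abbreviation (input) "pw k \<equiv> ((**) N ^^ k) (mat 1)"

lemma pw_comm: "pw k ** N = N ** pw k"
  by (induction k) (simp_all add: matrix_mul_assoc[symmetric])

lemma pw_order: "total e < k \<Longrightarrow> coef (pw k $ a $ b) e = 0"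
proof (induction k arbitrary: e a b)
  case (Suc k)
  have "coef (N $ a $ c) x * coef (pw k $ c $ b) (\<lambda>v. e v - x v) = 0" if "x \<le> e" for c x
  proof (cases "x = (\<lambda>_. 0)")
    case True
    have "constant_term N $ a $ c = 0" using N by simp
    then show ?thesis using True by (simp add: constant_term_def)
  next
    case False
    then have "total (\<lambda>v. e v - x v) < k"
      using total_diff[OF that] total_pos[of x] Suc.prems by simp
    then show ?thesis using Suc.IH by simp
  qed
  then show ?case by (simp add: coef_matrix_mult)
qed simp

lemma neumann_coef:
  assumes "total e \<le> K"
  shows "coef (neumann N $ a $ b) e = coef ((\<Sum>k\<le>K. pw k) $ a $ b) e"
proof -
  have "(\<Sum>k\<le>total e. coef (pw k $ a $ b) e) = (\<Sum>k\<le>K. coef (pw k $ a $ b) e)"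
    by (rule sum.mono_neutral_left) (use assms pw_order in auto)
  then show ?thesis by (simp add: neumann_def sum_component)
qed

lemma telescope:
  "(mat 1 - N) ** (\<Sum>k\<le>K. pw k) = mat 1 - pw (Suc K)"
  "(\<Sum>k\<le>K. pw k) ** (mat 1 - N) = mat 1 - pw (Suc K)"
proof -
  show 1: "(mat 1 - N) ** (\<Sum>k\<le>K. pw k) = mat 1 - pw (Suc K)"
    by (induction K) (simp_all add: matrix_add_ldistrib matrix_diff_distrib)
  have "(\<Sum>k\<le>K. pw k) ** N = N ** (\<Sum>k\<le>K. pw k)"
    by (induction K) (simp_all add: matrix_add_ldistrib matrix_diff_distrib pw_comm matrix_mul_assoc[symmetric])
  then show "(\<Sum>k\<le>K. pw k) ** (mat 1 - N) = mat 1 - pw (Suc K)"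
    using 1 by (simp add: matrix_diff_distrib)
qed

lemma neumann_inverse: "(mat 1 - N) ** neumann N = mat 1" "neumann N ** (mat 1 - N) = mat 1"
proof -
  have le: "total (\<lambda>v. e v - x v) \<le> total e" "total x \<le> total e" if "x \<le> e" for x e :: "'v \<Rightarrow> nat"
    using total_diff[OF that] by simp_all
  have "coef (((mat 1 - N) ** neumann N) $ a $ b) e = coef ((mat 1 :: (('v, 'r) mps) ^ 'n ^ 'n) $ a $ b) e" for a b e
  proof -
    have "coef (((mat 1 - N) ** neumann N) $ a $ b) e =
        coef (((mat 1 - N) ** (\<Sum>k\<le>total e. pw k)) $ a $ b) e"
      unfolding coef_matrix_mult
      by (intro sum.cong refl) (simp only: mem_Collect_eq neumann_coef[where K = "total e"] le)
    then show ?thesis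
      unfolding telescope vector_minus_component coef_simps using pw_order[of e "Suc (total e)"] by simp
  qed
  then show "(mat 1 - N) ** neumann N = mat 1"
    by (simp add: vec_eq_iff mps_eq_iff)
  have "coef ((neumann N ** (mat 1 - N)) $ a $ b) e = coef ((mat 1 :: (('v, 'r) mps) ^ 'n ^ 'n) $ a $ b) e" for a b e
  proof -
    have "coef ((neumann N ** (mat 1 - N)) $ a $ b) e =
        coef (((\<Sum>k\<le>total e. pw k) ** (mat 1 - N)) $ a $ b) e"
      unfolding coef_matrix_mult
      by (intro sum.cong refl) (simp only: mem_Collect_eq neumann_coef[where K = "total e"] le)
    then show ?thesis
      unfolding telescope vector_minus_component coef_simps using pw_order[of e "Suc (total e)"] by simp
  qed
  then show "neumann N ** (mat 1 - N) = mat 1"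
    by (simp add: vec_eq_iff mps_eq_iff)
qed

end

lemma matrix_inverse_unique:
  fixes A B C :: "'a::comm_ring_1 ^ 'n::finite ^ 'n"
  assumes "B ** A = mat 1" "A ** C = mat 1"
  shows "B = C"
proof -
  have "B = B ** (A ** C)" using assms(2) by (simp add: matrix_mul_rid)
  also have "\<dots> = C" using assms(1) by (simp add: matrix_mul_assoc matrix_mul_lid)
  finally show ?thesis .
qed

lemma matrix_eq_mult_inverse:
  fixes U V X Y :: "'a::comm_ring_1 ^ 'n::finite ^ 'n"
  assumes "U ** V = mat 1" "V ** U = mat 1"
  shows "X = Y ** V \<longleftrightarrow> X ** U = Y"
proof
  assume "X = Y ** V"
  then have "X ** U = Y ** (V ** U)" by (simp only: matrix_mul_assoc)
  then show "X ** U = Y" using assms by (simp add: matrix_mul_rid)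
next
  assume "X ** U = Y"
  then have "Y ** V = X ** (U ** V)" by (simp only: matrix_mul_assoc)
  then show "X = Y ** V" using assms by (simp add: matrix_mul_rid)
qed

lemma matrix_inverse_mult:
  fixes A B C D :: "'a::comm_ring_1 ^ 'n::finite ^ 'n"
  assumes "A ** B = mat 1" "C ** D = mat 1"
  shows "(C ** A) ** (B ** D) = mat 1"
proof -
  have "(C ** A) ** (B ** D) = C ** ((A ** B) ** D)" by (simp only: matrix_mul_assoc)
  then show ?thesis using assms by (simp add: matrix_mul_lid)
qed

lemma matrix_inv_eq:
  fixes A B :: "'a::comm_ring_1 ^ 'n::finite ^ 'n"
  assumes "A ** B = mat 1" "B ** A = mat 1"
  shows "matrix_inv A = B"
proof -
  have "A ** matrix_inv A = mat 1 \<and> matrix_inv A ** A = mat 1"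
    unfolding matrix_inv_def by (rule someI[of _ B]) (use assms in simp)
  then show ?thesis using matrix_inverse_unique[of "matrix_inv A" A B] assms by simp
qed

text \<open>Let C be the constant matrix inverse to the constant term. Both products of \<phi> and C
  have constant term 1 and are inverted by geometric series; one yields a right inverse of \<phi>,
  the other a left inverse, and these coincide.\<close>

lemma invertible_constant_term:
  fixes \<phi> :: "(('v::finite, 'r::comm_ring_1) mps) ^ 'n::finite ^ 'n"
  shows "invertible (constant_term \<phi>) \<longleftrightarrow> (\<exists>\<psi>. \<phi> ** \<psi> = mat 1 \<and> \<psi> ** \<phi> = mat 1)"
proof
  assume "\<exists>\<psi>. \<phi> ** \<psi> = mat 1 \<and> \<psi> ** \<phi> = mat 1"
  then show "invertible (constant_term \<phi>)"
    unfolding invertible_def by (metis constant_term_mult constant_term_1)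
next
  assume "invertible (constant_term \<phi>)"
  then obtain B where B: "constant_term \<phi> ** B = mat 1" "B ** constant_term \<phi> = mat 1"
    unfolding invertible_def by blast
  define C :: "(('v, 'r) mps) ^ 'n ^ 'n" where "C = (\<chi> a b. Mps (\<lambda>e. if e = (\<lambda>_. 0) then B $ a $ b else 0))"
  have C: "constant_term C = B" by (simp add: C_def constant_term_def vec_eq_iff)
  have *: "constant_term (mat 1 - X) = 0" if "constant_term X = mat 1" for X :: "(('v, 'r) mps) ^ 'n ^ 'n"
  proof -
    have "constant_term (mat 1 - X) =
        constant_term (mat 1 :: (('v, 'r) mps) ^ 'n ^ 'n) - constant_term X"
      by (simp add: constant_term_def vec_eq_iff)
    then show ?thesis using that by (simp add: constant_term_1)
  qed
  have "constant_term (mat 1 - \<phi> ** C) = 0" "constant_term (mat 1 - C ** \<phi>) = 0"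
    by (intro *; simp add: constant_term_mult C B)+
  note n = neumann_inverse(1)[OF this(1)] neumann_inverse(2)[OF this(2)]
  define R where "R = neumann (mat 1 - \<phi> ** C)"
  define L where "L = neumann (mat 1 - C ** \<phi>)"
  have n': "(\<phi> ** C) ** R = mat 1" "L ** (C ** \<phi>) = mat 1"
    using n by (simp_all add: R_def L_def)
  have R: "\<phi> ** (C ** R) = mat 1"
    unfolding matrix_mul_assoc by (rule n'(1))
  have L: "(L ** C) ** \<phi> = mat 1"
    unfolding matrix_mul_assoc[symmetric] by (rule n'(2))
  have "L ** C = C ** R" by (rule matrix_inverse_unique[OF L R])
  then have "(C ** R) ** \<phi> = mat 1" using L by simp
  then show "\<exists>\<psi>. \<phi> ** \<psi> = mat 1 \<and> \<psi> ** \<phi> = mat 1" using R by blast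
qed

section \<open>The gauge group\<close>

definition vars2 :: "'j \<Rightarrow> 'j \<Rightarrow> 1 + 1 \<Rightarrow> 'j + 'j" where
  "vars2 i j = map_sum (\<lambda>_. i) (\<lambda>_. j)"

lemma inj_vars2: "inj (vars2 i j)"
  unfolding vars2_def by (intro sum.inj_map) (auto simp: inj_def)

lemma all_11: "(\<forall>v :: 1 + 1. P v) \<longleftrightarrow> P (Inl 1) \<and> P (Inr 1)"
proof -
  have "v = Inl 1 \<or> v = Inr 1" for v :: "1 + 1" by (cases v) auto
  then show ?thesis by metis
qed

lemma vars2_simps [simp]: "vars2 i j (Inl a) = Inl i" "vars2 i j (Inr a) = Inr j"
  by (simp_all add: vars2_def)

lemma range_vars2: "range (vars2 i j) = {Inl i, Inr j}"
proof -
  have "vars2 i j v \<in> {Inl i, Inr j}" for v by (cases v) auto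
  moreover have "Inl i \<in> range (vars2 i j)" "Inr j \<in> range (vars2 i j)"
    by (metis rangeI vars2_simps)+
  ultimately show ?thesis by blast
qed

lemma vars2_upd: "(vars2 i j)(Inl 1 := Inl k) = vars2 k j" "(vars2 i j)(Inr 1 := Inr k) = vars2 i k"
  by (simp_all add: fun_eq_iff all_11)

lemma gauge_at_entry: "gauge_at \<phi> i j $ a $ b = of_mps (ren (vars2 i j) (\<phi> $ a $ b))"
  by (simp add: gauge_at_def vars2_def)

lemma gauge_at_mult: "gauge_at (\<phi> ** \<psi>) i j = gauge_at \<phi> i j ** gauge_at \<psi> i j"
  by (simp add: vec_eq_iff gauge_at_entry matrix_matrix_mult_def ren_sum of_mps_sum ren_mult[OF inj_vars2] of_mps_hom)

lemma gauge_at_1: "gauge_at (mat 1 :: ('n::finite, 'r::comm_ring_1) gauge) i j = mat 1"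
proof -
  have "gauge_at (mat 1 :: ('n, 'r) gauge) i j $ a $ b = mat 1 $ a $ b" for a b
    by (simp add: gauge_at_entry mat_def ren_one of_mps_hom)
  then show ?thesis by (simp add: vec_eq_iff)
qed

lemma sum_pairs:
  fixes f :: "'n::finite \<times> 'm::finite \<Rightarrow> 'a::comm_monoid_add"
  shows "(\<Sum>k\<in>UNIV. f k) = (\<Sum>k1\<in>UNIV. \<Sum>k2\<in>UNIV. f (k1, k2))"
  unfolding UNIV_Times_UNIV[symmetric] sum.cartesian_product by (simp add: split_def)

lemma tensor_mat_mult:
  fixes A B C D :: "'s::comm_ring_1 ^ 'n::finite ^ 'n"
  shows "tensor_mat A B ** tensor_mat C D = tensor_mat (A ** C) (B ** D)"
  by (simp add: vec_eq_iff tensor_mat_def matrix_matrix_mult_def sum_pairs sum_product ac_simps)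

lemma tensor_mat_1: "tensor_mat (mat 1) (mat 1) = (mat 1 :: ('n::finite, 's::comm_ring_1) mat2)"
  by (auto simp: vec_eq_iff tensor_mat_def mat_def)

definition gauge_inverses :: "('n::finite, 'r::comm_ring_1) gauge \<Rightarrow> ('n, 'r) gauge \<Rightarrow> bool" where
  "gauge_inverses \<phi> \<psi> \<longleftrightarrow> \<phi> ** \<psi> = mat 1 \<and> \<psi> ** \<phi> = mat 1"

lemma gauge_transform_inverses:
  assumes "gauge_inverses \<phi> \<psi>"
  shows "gauge_transform \<phi> r = tensor_mat (gauge_at \<phi> 1 2) (gauge_at \<phi> 2 1) ** r **
    tensor_mat (gauge_at \<psi> 2 2) (gauge_at \<psi> 1 1)"
proof -
  have "matrix_inv (tensor_mat (gauge_at \<phi> 2 2) (gauge_at \<phi> 1 1)) =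
      tensor_mat (gauge_at \<psi> 2 2) (gauge_at \<psi> 1 1)"
    by (rule matrix_inv_eq)
      (use assms in \<open>simp_all add: tensor_mat_mult gauge_inverses_def tensor_mat_1 gauge_at_1 flip: gauge_at_mult\<close>)
  then show ?thesis by (simp add: gauge_transform_def)
qed

lemma gauge_transform_iff:
  assumes "gauge_inverses \<phi> \<psi>"
  shows "r' = gauge_transform \<phi> r \<longleftrightarrow>
    r' ** tensor_mat (gauge_at \<phi> 2 2) (gauge_at \<phi> 1 1) =
    tensor_mat (gauge_at \<phi> 1 2) (gauge_at \<phi> 2 1) ** r"
proof -
  let ?U = "tensor_mat (gauge_at \<phi> 2 2) (gauge_at \<phi> 1 1)"
    and ?V = "tensor_mat (gauge_at \<psi> 2 2) (gauge_at \<psi> 1 1)"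
  have "?U ** ?V = mat 1" "?V ** ?U = mat 1"
    using assms by (simp_all add: tensor_mat_mult gauge_inverses_def tensor_mat_1 gauge_at_1 flip: gauge_at_mult)
  then show ?thesis
    unfolding gauge_transform_inverses[OF assms] by (rule matrix_eq_mult_inverse)
qed

lemma gauge_transform_mult:
  assumes "gauge_inverses \<phi> \<psi>" "gauge_inverses \<phi>' \<psi>'"
  shows "gauge_transform \<phi>' (gauge_transform \<phi> r) = gauge_transform (\<phi>' ** \<phi>) r"
proof -
  have "gauge_inverses (\<phi>' ** \<phi>) (\<psi> ** \<psi>')"
    using assms unfolding gauge_inverses_def by (simp add: matrix_inverse_mult)
  then show ?thesis
    unfolding gauge_transform_inverses[OF assms(1)] gauge_transform_inverses[OF assms(2)]
    by (simp add: gauge_transform_inverses gauge_at_mult tensor_mat_mult[symmetric])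
       (simp only: matrix_mul_assoc)
qed

lemma gauge_transform_1: "gauge_transform (mat 1) r = r"
  using gauge_transform_inverses[of "mat 1" "mat 1" r]
  by (simp add: gauge_inverses_def gauge_at_1 tensor_mat_1)

lemma gauge_invertible_iff: "invertible (gauge_constant_term \<phi>) \<longleftrightarrow> (\<exists>\<psi>. gauge_inverses \<phi> \<psi>)"
  using invertible_constant_term[of \<phi>]
  by (simp add: gauge_inverses_def constant_term_def gauge_constant_term_def)

lemma gauge_strict_iff: "gauge_strict \<phi> \<longleftrightarrow> constant_term \<phi> = mat 1"
proof
  assume s: "gauge_strict \<phi>"
  have "coef (\<phi> $ a $ b) (\<lambda>_. 0) = mat 1 $ a $ b" for a b
  proof -
    obtain f g where "\<phi> $ a $ b = mat 1 $ a $ b + xv 1 * f + yv 1 * g"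
      using s unfolding gauge_strict_def by blast
    then show ?thesis by (simp add: coef_mvar_mult coef_mat_1) (simp add: mat_def)
  qed
  then show "constant_term \<phi> = mat 1" by (simp add: constant_term_def vec_eq_iff)
next
  assume c: "constant_term \<phi> = mat 1"
  show "gauge_strict \<phi>"
    unfolding gauge_strict_def
  proof (intro allI exI)
    fix a b
    let ?h = "\<phi> $ a $ b"
    have c0: "coef ?h (\<lambda>_. 0) = (if a = b then 1 else 0)"
      using arg_cong[OF c, of "\<lambda>A. A $ a $ b"] by (simp add: constant_term_def mat_def)
    \<comment> \<open>The first witness collects the monomials divisible by x, the second those
      divisible by y but not by x.\<close>
    show "?h = mat 1 $ a $ b + xv 1 * Mps (\<lambda>e. coef ?h (e(Inl 1 := Suc (e (Inl 1))))) +
        yv 1 * Mps (\<lambda>e. if e (Inl 1) = 0 then coef ?h (e(Inr 1 := Suc (e (Inr 1)))) else 0)"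
    proof (rule mps_eqI)
      fix e :: "1 + 1 \<Rightarrow> nat"
      have "e = (\<lambda>_. 0) \<longleftrightarrow> e (Inl 1) = 0 \<and> e (Inr 1) = 0"
        by (simp add: fun_eq_iff all_11)
      then show "coef ?h e = coef (mat 1 $ a $ b + xv 1 * Mps (\<lambda>e. coef ?h (e(Inl 1 := Suc (e (Inl 1))))) +
        yv 1 * Mps (\<lambda>e. if e (Inl 1) = 0 then coef ?h (e(Inr 1 := Suc (e (Inr 1)))) else 0)) e"
        using c0 by (auto simp: coef_mvar_mult coef_mat_1 fun_upd_idem)
    qed
  qed
qed

lemma gauge_strict_invertible: "gauge_strict \<phi> \<Longrightarrow> \<exists>\<psi>. gauge_inverses \<phi> \<psi>"
proof -
  assume "gauge_strict \<phi>"
  then have "constant_term \<phi> = mat 1" by (simp add: gauge_strict_iff)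
  then have "invertible (constant_term \<phi>)" unfolding invertible_def using matrix_mul_lid by metis
  then show ?thesis using invertible_constant_term[of \<phi>] by (simp add: gauge_inverses_def)
qed

text \<open>Orbits under a subgroup P of the gauge group, restricted to S. Keeping P abstract covers
  strict and general equivalence at once.\<close>

lemma equiv_gauge:
  fixes S :: "('n::finite, (2, 'r::comm_ring_1) mero) mat2 set"
  assumes "\<And>\<phi>. P \<phi> \<Longrightarrow> \<exists>\<psi>. gauge_inverses \<phi> \<psi>" "P (mat 1)" "\<And>\<phi> \<psi>. P \<phi> \<Longrightarrow> P \<psi> \<Longrightarrow> P (\<phi> ** \<psi>)"
    "\<And>\<phi> \<psi>. P \<phi> \<Longrightarrow> gauge_inverses \<phi> \<psi> \<Longrightarrow> P \<psi>"
  shows "equiv S {(r, r'). r \<in> S \<and> r' \<in> S \<and> (\<exists>\<phi>. P \<phi> \<and> r' = gauge_transform \<phi> r)}"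
    (is "equiv S ?E")
proof (rule equivI)
  show "?E \<subseteq> S \<times> S" by auto
  show "refl_on S ?E"
    using assms(2) by (auto simp: refl_on_def gauge_transform_1 intro!: exI[of _ "mat 1"])
  show "sym ?E"
  proof (rule symI)
    fix r r' assume "(r, r') \<in> ?E"
    then obtain \<phi> where r: "r \<in> S" "r' \<in> S" "P \<phi>" "r' = gauge_transform \<phi> r" by auto
    obtain \<psi> where \<psi>: "gauge_inverses \<phi> \<psi>" using assms(1) r by blast
    then have "gauge_inverses \<psi> \<phi>" by (simp add: gauge_inverses_def)
    from gauge_transform_mult[OF \<psi> this, of r] \<psi>
    have "gauge_transform \<psi> r' = r"
      by (simp add: gauge_inverses_def gauge_transform_1 r(4))
    then show "(r', r) \<in> ?E" using r assms(4)[OF r(3) \<psi>] by auto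
  qed
  show "trans ?E"
  proof (rule transI)
    fix r r' r'' assume "(r, r') \<in> ?E" "(r', r'') \<in> ?E"
    then obtain \<phi> \<psi> where *: "r \<in> S" "r'' \<in> S" "P \<phi>" "P \<psi>"
      "r'' = gauge_transform \<psi> (gauge_transform \<phi> r)" by auto
    then have "r'' = gauge_transform (\<psi> ** \<phi>) r"
      using assms(1) gauge_transform_mult by blast
    then show "(r, r'') \<in> ?E"
      using assms(3) * by auto
  qed
qed

lemma equiv_AYBE_strict: "equiv AYBE_solutions (AYBE_strict_equiv :: (('n::finite, (2, 'r::comm_ring_1) mero) mat2 \<times> _) set)"
  unfolding AYBE_strict_equiv_def
proof (rule equiv_gauge)
  fix \<phi> \<psi> :: "('n, 'r) gauge"
  assume "gauge_strict \<phi>" "gauge_inverses \<phi> \<psi>"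
  then show "gauge_strict \<psi>"
    using constant_term_mult[of \<phi> \<psi>]
    by (simp add: gauge_strict_iff gauge_inverses_def constant_term_1)
qed (simp_all add: gauge_strict_invertible gauge_strict_iff constant_term_1 constant_term_mult)

lemma equiv_AYBE_general: "equiv AYBE_solutions (AYBE_general_equiv :: (('n::finite, (2, 'r::comm_ring_1) mero) mat2 \<times> _) set)"
  unfolding AYBE_general_equiv_def
proof (rule equiv_gauge)
  show "invertible (gauge_constant_term (mat 1 :: ('n, 'r) gauge))"
    unfolding gauge_invertible_iff gauge_inverses_def by (metis matrix_mul_lid)
  fix \<phi> \<psi> :: "('n, 'r) gauge"
  show "invertible (gauge_constant_term (\<phi> ** \<psi>))"
    if "invertible (gauge_constant_term \<phi>)" "invertible (gauge_constant_term \<psi>)"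
    using that matrix_inverse_mult unfolding gauge_invertible_iff gauge_inverses_def by blast
  show "invertible (gauge_constant_term \<psi>)" if "gauge_inverses \<phi> \<psi>"
    using that unfolding gauge_invertible_iff by (auto simp: gauge_inverses_def)
qed (simp add: gauge_invertible_iff)

text \<open>
  The equation of matrices \<open>r' (\<phi>\<^bsup>x_2\<^esup>\<^bsub>y_2\<^esub> \<otimes> \<phi>\<^bsup>x_1\<^esup>\<^bsub>y_1\<^esub>) = (\<phi>\<^bsup>x_1\<^esup>\<^bsub>y_2\<^esub> \<otimes> \<phi>\<^bsup>x_2\<^esup>\<^bsub>y_1\<^esub>) r\<close>,
  with the poles cancelled.
\<close>

definition gauge_eq ::
    "('n::finite \<Rightarrow> 'n \<Rightarrow> 'n \<Rightarrow> 'n \<Rightarrow> (2 + 2, 'r::comm_ring_1) mps) \<Rightarrow>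
     ('n \<Rightarrow> 'n \<Rightarrow> 'n \<Rightarrow> 'n \<Rightarrow> (2 + 2, 'r) mps) \<Rightarrow> ('n, 'r) gauge \<Rightarrow> bool" where
  "gauge_eq s s' \<phi> \<longleftrightarrow> (\<forall>v u k i.
     (\<Sum>p\<in>UNIV. \<Sum>q\<in>UNIV. s' v p u q * (ren (vars2 2 2) (\<phi> $ p $ k) * ren (vars2 1 1) (\<phi> $ q $ i))) =
     (\<Sum>p\<in>UNIV. \<Sum>q\<in>UNIV. (ren (vars2 1 2) (\<phi> $ v $ p) * ren (vars2 2 1) (\<phi> $ u $ q)) * s p k q i)
     - ddiff (vars2 2 2) (Inl 1) (Inl 1) (\<phi> $ v $ k) * ren (vars2 2 1) (\<phi> $ u $ i)
     + ren (vars2 2 2) (\<phi> $ v $ k) * ddiff (vars2 2 1) (Inl 1) (Inl 1) (\<phi> $ u $ i)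
     - ddiff (vars2 1 1) (Inr 1) (Inr 2) (\<phi> $ v $ i) * ren (vars2 2 1) (\<phi> $ u $ k)
     + ren (vars2 1 1) (\<phi> $ v $ i) * ddiff (vars2 2 1) (Inr 1) (Inr 2) (\<phi> $ u $ k))"

text \<open>Each pole multiplies a difference of two products of gauge entries in which two
  substitutions change. Changing one at a time, as in the Leibniz rule, leaves divided differences
  of single entries.\<close>

lemma gauge_transform_iff_eq:
  fixes \<phi> :: "('n::finite, 'r::comm_ring_1) gauge"
  assumes "gauge_inverses \<phi> \<psi>"
  shows "polar_part + regular_part s' = gauge_transform \<phi> (polar_part + regular_part s) \<longleftrightarrow> gauge_eq s s' \<phi>"
proof -
  define g where "g i j a b = (of_mps (ren (vars2 i j) (\<phi> $ a $ b)) :: (2, 'r) mero)" for i j a b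
  have L: "((polar_part + regular_part s') ** tensor_mat (gauge_at \<phi> 2 2) (gauge_at \<phi> 1 1)) $ (v, u) $ (k, i) =
      xinv 2 1 * (g 2 2 v k * g 1 1 u i) + yinv 1 2 * (g 1 1 v i * g 2 2 u k) +
      (\<Sum>p\<in>UNIV. \<Sum>q\<in>UNIV. of_mps (s' v p u q) * (g 2 2 p k * g 1 1 q i))" for v u k i
  proof -
    have "((polar_part + regular_part s') ** tensor_mat (gauge_at \<phi> 2 2) (gauge_at \<phi> 1 1)) $ (v, u) $ (k, i) =
      (\<Sum>p\<in>UNIV. \<Sum>q\<in>UNIV. kd v p * (kd u q * (xinv 2 1 * (g 2 2 p k * g 1 1 q i))) +
        kd u p * (kd v q * (yinv 1 2 * (g 2 2 p k * g 1 1 q i))) +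
        of_mps (s' v p u q) * (g 2 2 p k * g 1 1 q i))"
      unfolding matrix_matrix_mult_def
      by (simp add: sum_pairs polar_part_entry regular_part_entry tensor_mat_def gauge_at_entry g_def)
         (intro sum.cong refl; simp add: algebra_simps kd_def)
    also have "\<dots> = xinv 2 1 * (g 2 2 v k * g 1 1 u i) + yinv 1 2 * (g 1 1 v i * g 2 2 u k) +
      (\<Sum>p\<in>UNIV. \<Sum>q\<in>UNIV. of_mps (s' v p u q) * (g 2 2 p k * g 1 1 q i))"
      by (simp add: sum.distrib kd_sum mult.commute[of "g 1 1 v i"] flip: sum_distrib_left)
    finally show ?thesis .
  qed
  have R: "(tensor_mat (gauge_at \<phi> 1 2) (gauge_at \<phi> 2 1) ** (polar_part + regular_part s)) $ (v, u) $ (k, i) =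
      xinv 2 1 * (g 1 2 v k * g 2 1 u i) + yinv 1 2 * (g 1 2 v i * g 2 1 u k) +
      (\<Sum>p\<in>UNIV. \<Sum>q\<in>UNIV. (g 1 2 v p * g 2 1 u q) * of_mps (s p k q i))" for v u k i
  proof -
    have "(tensor_mat (gauge_at \<phi> 1 2) (gauge_at \<phi> 2 1) ** (polar_part + regular_part s)) $ (v, u) $ (k, i) =
      (\<Sum>p\<in>UNIV. \<Sum>q\<in>UNIV. kd k p * (kd i q * (xinv 2 1 * (g 1 2 v p * g 2 1 u q))) +
        kd i p * (kd k q * (yinv 1 2 * (g 1 2 v p * g 2 1 u q))) +
        (g 1 2 v p * g 2 1 u q) * of_mps (s p k q i))"
      unfolding matrix_matrix_mult_def
      by (simp add: sum_pairs polar_part_entry regular_part_entry tensor_mat_def gauge_at_entry g_def)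
         (intro sum.cong refl; simp add: algebra_simps kd_def)
    also have "\<dots> = xinv 2 1 * (g 1 2 v k * g 2 1 u i) + yinv 1 2 * (g 1 2 v i * g 2 1 u k) +
      (\<Sum>p\<in>UNIV. \<Sum>q\<in>UNIV. (g 1 2 v p * g 2 1 u q) * of_mps (s p k q i))"
      by (simp add: sum.distrib kd_sum flip: sum_distrib_left)
    finally show ?thesis .
  qed
  have dx: "of_mps (ddiff (vars2 2 j) (Inl 1) (Inl 1) (\<phi> $ a $ b)) = xinv 2 1 * (g 2 j a b - g 1 j a b)" for j a b
    using inv_ddiff(1)[OF inj_vars2, of 2 j "Inl 1" 2 1 "\<phi> $ a $ b"]
    unfolding g_def vars2_upd by (simp add: range_vars2)
  have dy: "of_mps (ddiff (vars2 j 1) (Inr 1) (Inr 2) (\<phi> $ a $ b)) = yinv 1 2 * (g j 1 a b - g j 2 a b)" for j a b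
    using inv_ddiff(2)[OF inj_vars2, of j 1 "Inr 1" 1 2 "\<phi> $ a $ b"]
    unfolding g_def vars2_upd by (simp add: range_vars2)
  have "polar_part + regular_part s' = gauge_transform \<phi> (polar_part + regular_part s) \<longleftrightarrow>
    (\<forall>v u k i. ((polar_part + regular_part s') ** tensor_mat (gauge_at \<phi> 2 2) (gauge_at \<phi> 1 1)) $ (v, u) $ (k, i) =
      (tensor_mat (gauge_at \<phi> 1 2) (gauge_at \<phi> 2 1) ** (polar_part + regular_part s)) $ (v, u) $ (k, i))"
    unfolding gauge_transform_iff[OF assms] by (simp add: vec_eq_iff) 
  also have "\<dots> \<longleftrightarrow> (\<forall>v u k i.
     (\<Sum>p\<in>UNIV. \<Sum>q\<in>UNIV. of_mps (s' v p u q) * (g 2 2 p k * g 1 1 q i)) =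
     (\<Sum>p\<in>UNIV. \<Sum>q\<in>UNIV. (g 1 2 v p * g 2 1 u q) * of_mps (s p k q i))
     - xinv 2 1 * (g 2 2 v k - g 1 2 v k) * g 2 1 u i
     + g 2 2 v k * (xinv 2 1 * (g 2 1 u i - g 1 1 u i))
     - yinv 1 2 * (g 1 1 v i - g 1 2 v i) * g 2 1 u k
     + g 1 1 v i * (yinv 1 2 * (g 2 1 u k - g 2 2 u k)))"
  proof -
    have eqI: "(A = B) = (A' = B')" if "A - B = A' - B'" for A B A' B' :: "(2, 'r) mero"
      using that by (metis eq_iff_diff_eq_0)
    show ?thesis
      unfolding L R by (intro arg_cong[of _ _ All] ext eqI) (simp add: algebra_simps)
  qed
  also have "\<dots> \<longleftrightarrow> gauge_eq s s' \<phi>"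
    unfolding gauge_eq_def of_mps_inject[symmetric] of_mps_hom of_mps_sum dx dy
    unfolding g_def[symmetric] by (rule refl)
  finally show ?thesis .
qed

section \<open>Structures as solutions of the Yang-Baxter equation\<close>

section \<open>The structure constants\<close>

lemma sum_atMost_rev: "(\<Sum>i\<le>n. f (n - i)) = (\<Sum>i\<le>(n::nat). f i)"
  by (rule sum.reindex_bij_witness[of _ "\<lambda>i. n - i" "\<lambda>i. n - i"]) auto

lemma sum_atMost_last: "(\<Sum>i\<le>n. if n - i = 0 then f i else 0) = (f n :: 'a::comm_monoid_add)"
  for n :: nat
proof -
  have "(\<Sum>i\<le>n. if n - i = 0 then f i else 0) = (\<Sum>i\<le>n. if i = n then f i else 0)"
    by (rule sum.cong) auto
  then show ?thesis by simp
qed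

lemma ksgn_0 [simp]: "ksgn 0 p = 1" "ksgn p 0 = 1" "ksgn (- 2) p = 1" "ksgn p (- 2) = 1"
  by (simp_all add: ksgn_def)

lemma psgn_simps [simp]: "psgn 0 = 1" "psgn (- 1) = - 1" "psgn (- 2) = 1"
  by (simp_all add: psgn_def)

lemma replicate_snoc: "replicate i x @ x # v = x # replicate i x @ v"
  by (metis replicate_append_same append.assoc append_Cons append_Nil)

lemma shape_cases:
  "shape h = (ObX, ObY, p) \<longleftrightarrow> p = - 1 \<and> (\<exists>i. h = Theta i)"
  "shape h = (ObY, ObX, p) \<longleftrightarrow> p = 0 \<and> (\<exists>i. h = Eta i)"
  "shape h = (ObX, ObX, p) \<longleftrightarrow> p = - 1 \<and> h = Id ObX \<or> p = 0 \<and> h = Xi ObX"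
  "shape h = (ObY, ObY, p) \<longleftrightarrow> p = - 1 \<and> h = Id ObY \<or> p = 0 \<and> h = Xi ObY"
  by (cases h; auto simp: shape_def)+

context pre_structure
begin

text \<open>The coefficient of x_1^a y_1^b x_2^c y_2^d at the tensor product of e_ij and e_kl. The
  order i j k l is that of the letters eta_i, theta_j, eta_k, theta_l around the cyclic
  word.\<close>

definition S :: "nat \<Rightarrow> nat \<Rightarrow> nat \<Rightarrow> nat \<Rightarrow> 'n \<Rightarrow> 'n \<Rightarrow> 'n \<Rightarrow> 'n \<Rightarrow> 'r" where
  "S a b c d i j k l = pairing (M (map bas (massey_word a b c d l k j))) (bas (Eta i))"

abbreviation Mb :: "'n gen list \<Rightarrow> ('n, 'r) mor" where
  "Mb w \<equiv> M (map bas w)"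

lemma ml: "multilinear_ops M"
  using gr by (rule graded_multilinear)

lemma Mb_shape:
  assumes "w \<noteq> []" "Mb w $ h \<noteq> 0"
  shows "shape h = (src (last w), tgt (hd w), sdeg w + 1)"
  using graded_homog_bas[OF gr assms(1)] assms
  by (auto simp: homog_def tot_shape_def hd_map last_map shape_def)

lemma pot_rotate_word:
  "length (p @ q) \<ge> 2 \<Longrightarrow>
    pot M (map bas (p @ q)) = ksgn (sdeg p) (sdeg q) * pot M (map bas (q @ p))"
proof (induction p arbitrary: q)
  case (Cons c p)
  have "pot M (map bas (c # p @ q)) = ksgn (int (deg c) - 1) (sdeg (p @ q)) * pot M (map bas (p @ q @ [c]))"
    using pot_rotate[OF gr cyc homog_map_bas, of "c # p @ q"] Cons.prems
    by (simp add: shape_def sdeg_def comp_def)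
  also have "pot M (map bas (p @ q @ [c])) = ksgn (sdeg p) (sdeg (q @ [c])) * pot M (map bas (q @ c # p))"
    using Cons.IH[of "q @ [c]"] Cons.prems by simp
  finally show ?case by (simp add: ksgn_def)
qed simp

lemma pot_Eta: "pot M (map bas (Eta i # massey_word a b c d l k j)) = - S a b c d i j k l"
  using pairing_antisym[of "bas (Eta i)"] by (simp add: S_def)

lemma composable_ne: "massey_word a b c d l k j \<noteq> []"
  by (simp add: massey_word_def)

lemma massey_word_ends:
  "src (last (massey_word a b c d l k j)) = ObX" "tgt (hd (massey_word a b c d l k j)) = ObY"
  "sdeg (massey_word a b c d l k j) = - 2"
  by (auto simp: massey_word_def hd_append last_replicate)

lemma Mb_eqI:
  assumes "w \<noteq> []" "\<And>h. shape h = (src (last w), tgt (hd w), sdeg w + 1) \<Longrightarrow> Mb w $ h = x $ h"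
    "\<And>h. shape h \<noteq> (src (last w), tgt (hd w), sdeg w + 1) \<Longrightarrow> x $ h = 0"
  shows "Mb w = x"
  using assms Mb_shape[OF assms(1)] by (metis vec_eq_iff)

text \<open>Here and in the next three lemmas a product is read off by testing it with the dual of
  each possible value and rotating to a word that starts with an eta, whose value is a constant
  \<open>S\<close> up to sign.\<close>

lemma Mb_theta:
  "Mb (massey_word a b c d l k j) = (\<Sum>i\<in>UNIV. (- S a b c d i j k l) *s bas (Theta i))"
proof (rule Mb_eqI)
  fix h :: "'n gen"
  assume "shape h = (src (last (massey_word a b c d l k j)), tgt (hd (massey_word a b c d l k j)),
      sdeg (massey_word a b c d l k j) + 1)"
  then obtain i where h: "h = Theta i"
    by (auto simp: massey_word_ends shape_cases)
  have "Mb (massey_word a b c d l k j) $ h = - S a b c d i j k l"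
    using pot_Eta[of i a b c d l k j] by (simp add: pairing_bas_left h)
  then show "Mb (massey_word a b c d l k j) $ h = (\<Sum>i\<in>UNIV. (- S a b c d i j k l) *s bas (Theta i)) $ h"
    by (simp add: h sum_component if_distrib cong: if_cong)
qed (auto simp: massey_word_ends composable_ne sum_component intro!: sum.neutral, auto simp: shape_def)

lemma Mb_eta:
  "Mb (replicate a (Xi ObX) @ Eta i # replicate d (Xi ObY) @ Theta j # replicate c (Xi ObX) @ Eta k #
      replicate b (Xi ObY)) = (\<Sum>l\<in>UNIV. (- S a b c d i j k l) *s bas (Eta l))" (is "Mb ?w = _")
proof (rule Mb_eqI)
  have w: "src (last ?w) = ObY" "tgt (hd ?w) = ObX" "sdeg ?w = - 1"
    by (auto simp: hd_append last_replicate)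
  show "?w \<noteq> []" by simp
  show "Mb ?w $ h = (\<Sum>l\<in>UNIV. (- S a b c d i j k l) *s bas (Eta l)) $ h"
    if sh: "shape h = (src (last ?w), tgt (hd ?w), sdeg ?w + 1)" for h
  proof -
    obtain l where h: "h = Eta l" using sh unfolding w by (auto simp: shape_cases)
    have "pot M (map bas (Theta l # ?w)) = S a b c d i j k l"
      using pot_rotate_word[of "Theta l # replicate a (Xi ObX)" "Eta i # replicate d (Xi ObY) @ Theta j #
        replicate c (Xi ObX) @ Eta k # replicate b (Xi ObY)"] pot_Eta[of i a b c d l k j]
      by (simp add: massey_word_def ksgn_def)
    then have "Mb ?w $ h = - S a b c d i j k l"
      by (simp add: pairing_bas_left h) (metis minus_minus)
    then show ?thesis
      by (simp add: h sum_component if_distrib cong: if_cong)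
  qed
  show "(\<Sum>l\<in>UNIV. (- S a b c d i j k l) *s bas (Eta l)) $ h = 0"
    if "shape h \<noteq> (src (last ?w), tgt (hd ?w), sdeg ?w + 1)" for h
    using that unfolding w by (auto simp: sum_component shape_def intro!: sum.neutral)
qed

text \<open>The coefficient of the identity is tested by xi. Rotation puts this xi between the
  trailing and the leading run, which merge to length a + e + 1. With \<open>Mb_idY\<close> this is
  the source of two of the six divided differences in the AYBE.\<close>

lemma Mb_idX:
  "Mb (replicate e (Xi ObX) @ Eta i # massey_word a b c d l k j) =
    (- S (Suc (a + e)) b c d i j k l) *s bas (Id ObX)" (is "Mb ?w = _")
proof (rule Mb_eqI)
  have w: "src (last ?w) = ObX" "tgt (hd ?w) = ObX" "sdeg ?w = - 2"
    using massey_word_ends[of a b c d l k j] composable_ne[of a b c d l k j] by (auto simp: hd_append)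
  show "?w \<noteq> []" by simp
  show "Mb ?w $ h = ((- S (Suc (a + e)) b c d i j k l) *s bas (Id ObX)) $ h"
    if "shape h = (src (last ?w), tgt (hd ?w), sdeg ?w + 1)" for h
  proof -
    have h: "h = Id ObX" using that unfolding w by (auto simp: shape_cases)
    have e: "massey_word a b c d l k j @ Xi ObX # replicate e (Xi ObX) = massey_word (Suc (a + e)) b c d l k j"
      by (simp add: massey_word_def replicate_snoc flip: replicate_add)
    have "pot M (map bas (Xi ObX # ?w)) = - S (Suc (a + e)) b c d i j k l"
      using pot_rotate_word[of "Xi ObX # replicate e (Xi ObX)" "Eta i # massey_word a b c d l k j"]
        pot_Eta[of i "Suc (a + e)" b c d l k j] unfolding append_Cons e by simp
    then show ?thesis by (simp add: pairing_bas_left h)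
  qed
  show "((- S (Suc (a + e)) b c d i j k l) *s bas (Id ObX)) $ h = 0"
    if "shape h \<noteq> (src (last ?w), tgt (hd ?w), sdeg ?w + 1)" for h
    using that unfolding w by (auto simp: shape_def)
qed

lemma Mb_idY:
  "Mb (replicate e (Xi ObY) @ Theta j # replicate c (Xi ObX) @ Eta k # replicate b (Xi ObY) @ Theta l #
      replicate a (Xi ObX) @ Eta i # replicate d (Xi ObY)) =
    (- S a b c (Suc (d + e)) i j k l) *s bas (Id ObY)" (is "Mb ?w = _")
proof (rule Mb_eqI)
  have w: "src (last ?w) = ObY" "tgt (hd ?w) = ObY" "sdeg ?w = - 2"
    by (auto simp: hd_append last_replicate)
  show "?w \<noteq> []" by simp
  show "Mb ?w $ h = ((- S a b c (Suc (d + e)) i j k l) *s bas (Id ObY)) $ h"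
    if "shape h = (src (last ?w), tgt (hd ?w), sdeg ?w + 1)" for h
  proof -
    have h: "h = Id ObY" using that unfolding w by (auto simp: shape_cases)
    have "pot M (map bas (Xi ObY # ?w)) = - S a b c (Suc (d + e)) i j k l"
      using pot_rotate_word[of "Xi ObY # replicate e (Xi ObY) @ Theta j # replicate c (Xi ObX) @ Eta k #
          replicate b (Xi ObY) @ Theta l # replicate a (Xi ObX)" "Eta i # replicate d (Xi ObY)"]
        pot_Eta[of i a b c "Suc (d + e)" l k j]
      by (simp add: massey_word_def replicate_snoc replicate_add)
    then show ?thesis by (simp add: pairing_bas_left h)
  qed
  show "((- S a b c (Suc (d + e)) i j k l) *s bas (Id ObY)) $ h = 0"
    if "shape h \<noteq> (src (last ?w), tgt (hd ?w), sdeg ?w + 1)" for h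
    using that unfolding w by (auto simp: shape_def)
qed

lemma Mb_zero:
  assumes "w \<noteq> []" "\<nexists>h :: 'n gen. shape h = (src (last w), tgt (hd w), sdeg w + 1)"
  shows "Mb w = 0"
  using assms Mb_shape[OF assms(1)] by (metis vec_eq_iff zero_index)

lemma Mb_run [simp]: "Mb (replicate i (Xi Z)) = 0"
proof (cases i)
  case (Suc k)
  have "deg h \<noteq> 2" for h :: "'n gen" by (cases h) auto
  then show ?thesis
    by (intro Mb_zero) (use Suc in \<open>auto simp: shape_def\<close>)
qed (use graded_Nil[OF gr] in simp)

lemma Mb_run_theta [simp]: "Mb (replicate d (Xi ObY) @ Theta j # replicate a (Xi ObX)) = 0"
  by (rule Mb_zero) (auto simp: hd_append last_replicate shape_cases)

lemma Mb_run_eta [simp]: "Mb (replicate d (Xi ObX) @ Eta j # replicate a (Xi ObY)) = 0"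
  by (rule Mb_zero) (auto simp: hd_append last_replicate shape_cases)

text \<open>By degree the value is a multiple of xi at Y. That coefficient is its pairing with the
  identity, up to sign, which vanishes from arity 3 on.\<close>

lemma Mb_run_theta_eta:
  "Mb (replicate d (Xi ObY) @ Theta j # replicate c (Xi ObX) @ Eta k # replicate b (Xi ObY)) =
    (if d = 0 \<and> c = 0 \<and> b = 0 then Mb [Theta j, Eta k] else 0)" (is "Mb ?w = _")
proof (cases "d = 0 \<and> c = 0 \<and> b = 0")
  case False
  have w: "src (last ?w) = ObY" "tgt (hd ?w) = ObY" "sdeg ?w = - 1"
    by (auto simp: hd_append last_replicate)
  have "pairing (bas (Id ObY)) (Mb ?w) = 0"
    by (rule pairing_Id_ge3[OF gr cyc un homog_map_bas]) (use False in \<open>auto simp: Suc_le_eq\<close>)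
  then have "Mb ?w $ Xi ObY = 0" by (simp add: pairing_bas_left)
  then have "Mb ?w = 0"
    by (intro Mb_eqI) (simp_all only: w, auto simp: shape_cases)
  then show ?thesis by (simp only: False if_False)
qed simp

lemma Mb_run_eta_theta:
  "Mb (replicate d (Xi ObX) @ Eta j # replicate c (Xi ObY) @ Theta k # replicate b (Xi ObX)) =
    (if d = 0 \<and> c = 0 \<and> b = 0 then Mb [Eta j, Theta k] else 0)" (is "Mb ?w = _")
proof (cases "d = 0 \<and> c = 0 \<and> b = 0")
  case False
  have w: "src (last ?w) = ObX" "tgt (hd ?w) = ObX" "sdeg ?w = - 1"
    by (auto simp: hd_append last_replicate)
  have "pairing (bas (Id ObX)) (Mb ?w) = 0"
    by (rule pairing_Id_ge3[OF gr cyc un homog_map_bas]) (use False in \<open>auto simp: Suc_le_eq\<close>)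
  then have "Mb ?w $ Xi ObX = 0" by (simp add: pairing_bas_left)
  then have "Mb ?w = 0"
    by (intro Mb_eqI) (simp_all only: w, auto simp: shape_cases)
  then show ?thesis by (simp only: False if_False)
qed simp

text \<open>The value would have reduced degree -2, below that of every generator.\<close>

lemma Mb_massey5: "Mb (massey5 a1 b1 a2 b2 a3 b3 i1 j1 i2 j2 i3) = 0"
proof (rule Mb_zero)
  show "massey5 a1 b1 a2 b2 a3 b3 i1 j1 i2 j2 i3 \<noteq> []" by (simp add: massey5_def)
  have "sdeg (massey5 a1 b1 a2 b2 a3 b3 i1 j1 i2 j2 i3) + 1 = - 2"
    by (simp add: massey5_def massey_word_ends)
  then show "\<nexists>h. shape h = (src (last (massey5 a1 b1 a2 b2 a3 b3 i1 j1 i2 j2 i3)),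
      tgt (hd (massey5 a1 b1 a2 b2 a3 b3 i1 j1 i2 j2 i3)), sdeg (massey5 a1 b1 a2 b2 a3 b3 i1 j1 i2 j2 i3) + 1)"
    by (auto simp: shape_def)
qed

lemma Mb_comp: "Mb [Theta j, Eta k] = (- kd j k) *s bas (Xi ObY)" "Mb [Eta j, Theta k] = kd j k *s bas (Xi ObX)"
  using ex by (auto simp: extends_product_def kd_def vec_eq_iff)

section \<open>Summing over the subwords\<close>

context
  fixes H :: "('n, 'r) mor \<Rightarrow> 'n gen list \<Rightarrow> 'b::comm_monoid_add"
  assumes H0 [simp]: "\<And>q. H 0 q = 0"
begin

text \<open>Here \<open>H x q\<close> stands for the contribution of an inner value x followed by
  the letters q. Only two kinds of initial subwords carry a nonzero product: a bare theta eta, and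
  theta eta theta with its runs. The following lemmas do the same for the other letter
  patterns.\<close>

lemma sub_massey:
  "ssum (\<lambda>z q. H (Mb z) q) (massey_word a b c d l k j) =
    (if d = 0 \<and> c = 0 then H (Mb [Theta j, Eta k]) (replicate b (Xi ObY) @ Theta l # replicate a (Xi ObX)) else 0) +
    (\<Sum>i\<le>a. H (Mb (massey_word i b c d l k j)) (replicate (a - i) (Xi ObX)))"
proof -
  define f where "f z q = H (Mb z) q" for z q
  have "ssum f (massey_word a b c d l k j) =
      (\<Sum>i\<le>d. f (replicate i (Xi ObY)) (replicate (d - i) (Xi ObY) @ Theta j # replicate c (Xi ObX) @ Eta k #
        replicate b (Xi ObY) @ Theta l # replicate a (Xi ObX))) +
      ((\<Sum>i\<le>c. f (replicate d (Xi ObY) @ Theta j # replicate i (Xi ObX)) (replicate (c - i) (Xi ObX) @ Eta k #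
        replicate b (Xi ObY) @ Theta l # replicate a (Xi ObX))) +
      ((\<Sum>i\<le>b. f (replicate d (Xi ObY) @ Theta j # replicate c (Xi ObX) @ Eta k # replicate i (Xi ObY))
        (replicate (b - i) (Xi ObY) @ Theta l # replicate a (Xi ObX))) +
      (\<Sum>i\<le>a. f (replicate d (Xi ObY) @ Theta j # replicate c (Xi ObX) @ Eta k # replicate b (Xi ObY) @ Theta l #
        replicate i (Xi ObX)) (replicate (a - i) (Xi ObX)))))"
    by (simp add: massey_word_def ssum_run ssum_replicate)
  also have "(\<Sum>i\<le>d. f (replicate i (Xi ObY)) (replicate (d - i) (Xi ObY) @ Theta j # replicate c (Xi ObX) @ Eta k #
        replicate b (Xi ObY) @ Theta l # replicate a (Xi ObX))) = 0"
    unfolding f_def Mb_run by simp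
  also have "(\<Sum>i\<le>c. f (replicate d (Xi ObY) @ Theta j # replicate i (Xi ObX)) (replicate (c - i) (Xi ObX) @ Eta k #
        replicate b (Xi ObY) @ Theta l # replicate a (Xi ObX))) = 0"
    unfolding f_def Mb_run_theta by simp
  also have "(\<Sum>i\<le>b. f (replicate d (Xi ObY) @ Theta j # replicate c (Xi ObX) @ Eta k # replicate i (Xi ObY))
        (replicate (b - i) (Xi ObY) @ Theta l # replicate a (Xi ObX))) =
      (\<Sum>i\<le>b. if i = 0 then (if d = 0 \<and> c = 0 then H (Mb [Theta j, Eta k])
        (replicate b (Xi ObY) @ Theta l # replicate a (Xi ObX)) else 0) else 0)"
    unfolding f_def Mb_run_theta_eta by (rule sum.cong) auto
  finally show ?thesis by (simp add: f_def massey_word_def)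
qed

lemma sub_theta: "ssum (\<lambda>z q. H (Mb z) q) (replicate b (Xi ObY) @ Theta l # replicate a (Xi ObX)) = 0"
  by (simp only: ssum_run ssum_replicate Mb_run Mb_run_theta H0 sum.neutral_const add_0 append_Nil append_Cons append_assoc)

lemma sub_eta_theta:
  "ssum (\<lambda>z q. H (Mb z) q) (replicate c (Xi ObX) @ Eta k # replicate b (Xi ObY) @ Theta l # replicate a (Xi ObX)) =
    (if c = 0 \<and> b = 0 then H (Mb [Eta k, Theta l]) (replicate a (Xi ObX)) else 0)"
proof -
  have "(\<Sum>i\<le>a. H (Mb (replicate c (Xi ObX) @ Eta k # replicate b (Xi ObY) @ Theta l # replicate i (Xi ObX)))
      (replicate (a - i) (Xi ObX))) =
    (\<Sum>i\<le>a. if i = 0 then (if c = 0 \<and> b = 0 then H (Mb [Eta k, Theta l]) (replicate a (Xi ObX)) else 0) else 0)"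
    unfolding Mb_run_eta_theta by (rule sum.cong) auto
  then show ?thesis
    by (simp add: ssum_run ssum_replicate del: map_append list.map map_replicate if_split)
qed

lemma sub_eta_massey:
  "ssum (\<lambda>z q. H (Mb z) q) (replicate c (Xi ObX) @ Eta i # massey_word a1 b1 a2 b2 l k j) =
    (if c = 0 \<and> b2 = 0 then H (Mb [Eta i, Theta j])
      (replicate a2 (Xi ObX) @ Eta k # replicate b1 (Xi ObY) @ Theta l # replicate a1 (Xi ObX)) else 0) +
    ((\<Sum>m\<le>b1. H (Mb (replicate c (Xi ObX) @ Eta i # replicate b2 (Xi ObY) @ Theta j #
        replicate a2 (Xi ObX) @ Eta k # replicate m (Xi ObY)))
      (replicate (b1 - m) (Xi ObY) @ Theta l # replicate a1 (Xi ObX))) +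
    (\<Sum>m\<le>a1. H (Mb (replicate c (Xi ObX) @ Eta i # massey_word m b1 a2 b2 l k j)) (replicate (a1 - m) (Xi ObX))))"
proof -
  have "(\<Sum>m\<le>a2. H (Mb (replicate c (Xi ObX) @ Eta i # replicate b2 (Xi ObY) @ Theta j # replicate m (Xi ObX)))
      (replicate (a2 - m) (Xi ObX) @ Eta k # replicate b1 (Xi ObY) @ Theta l # replicate a1 (Xi ObX))) =
    (\<Sum>m\<le>a2. if m = 0 then (if c = 0 \<and> b2 = 0 then H (Mb [Eta i, Theta j])
      (replicate a2 (Xi ObX) @ Eta k # replicate b1 (Xi ObY) @ Theta l # replicate a1 (Xi ObX)) else 0) else 0)"
    unfolding Mb_run_eta_theta by (rule sum.cong) auto
  then show ?thesis
    by (simp add: massey_word_def ssum_run ssum_replicate del: map_append list.map map_replicate if_split)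
qed

lemma sub_massey5:
  "ssum (\<lambda>z q. H (Mb z) q) (massey5 a1 b1 a2 b2 a3 b3 i1 j1 i2 j2 i3) =
    (if b3 = 0 \<and> a3 = 0 then H (Mb [Theta i3, Eta j2]) (massey_word a1 b1 a2 b2 i1 j1 i2) else 0) +
    ((\<Sum>m\<le>a2. H (Mb (massey_word m b2 a3 b3 i2 j2 i3))
      (replicate (a2 - m) (Xi ObX) @ Eta j1 # replicate b1 (Xi ObY) @ Theta i1 # replicate a1 (Xi ObX))) +
    (\<Sum>m\<le>b1. H (Mb (replicate b3 (Xi ObY) @ Theta i3 # replicate a3 (Xi ObX) @ Eta j2 #
        replicate b2 (Xi ObY) @ Theta i2 # replicate a2 (Xi ObX) @ Eta j1 # replicate m (Xi ObY)))
      (replicate (b1 - m) (Xi ObY) @ Theta i1 # replicate a1 (Xi ObX))))"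
proof -
  have 1: "(\<Sum>m\<le>b2. H (Mb (replicate b3 (Xi ObY) @ Theta i3 # replicate a3 (Xi ObX) @ Eta j2 # replicate m (Xi ObY)))
      (replicate (b2 - m) (Xi ObY) @ Theta i2 # replicate a2 (Xi ObX) @ Eta j1 # replicate b1 (Xi ObY) @ Theta i1 #
        replicate a1 (Xi ObX))) =
    (\<Sum>m\<le>b2. if m = 0 then (if b3 = 0 \<and> a3 = 0 then H (Mb [Theta i3, Eta j2])
      (massey_word a1 b1 a2 b2 i1 j1 i2) else 0) else 0)"
    unfolding Mb_run_theta_eta by (rule sum.cong) (auto simp: massey_word_def)
  have 2: "Mb (replicate b3 (Xi ObY) @ Theta i3 # replicate a3 (Xi ObX) @ Eta j2 # replicate b2 (Xi ObY) @ Theta i2 #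
      replicate a2 (Xi ObX) @ Eta j1 # replicate b1 (Xi ObY) @ Theta i1 # replicate m (Xi ObX)) = 0" for m
    using Mb_massey5[of m b1 a2 b2 a3 b3 i1 j1 i2 j2 i3] by (simp add: massey5_def massey_word_def)
  from 1 show ?thesis
    by (simp add: massey5_def massey_word_def ssum_run ssum_replicate 2 del: map_append list.map map_replicate if_split)
qed

end

end

section \<open>The \<open>A\<^sub>\<infinity>\<close>-relations as the Yang--Baxter equation\<close>

lemma UNIV_33: "(UNIV :: (3 + 3) set) = {Inl 1, Inl 2, Inl 3, Inr 1, Inr 2, Inr 3}"
proof -
  have "v \<in> {Inl 1, Inl 2, Inl 3, Inr 1, Inr 2, Inr 3}" for v :: "3 + 3"
    using exhaust_3[of "projl v"] exhaust_3[of "projr v"] by (cases v) auto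
  then show ?thesis by blast
qed

lemma all_33: "(\<forall>v :: 3 + 3. P v) \<longleftrightarrow>
    P (Inl 1) \<and> P (Inl 2) \<and> P (Inl 3) \<and> P (Inr 1) \<and> P (Inr 2) \<and> P (Inr 3)"
proof -
  have "(\<forall>v :: 3 + 3. P v) \<longleftrightarrow> (\<forall>v\<in>UNIV. P v)" by simp
  then show ?thesis unfolding UNIV_33 by simp
qed

lemma coef_kd_mult [simp]: "coef (kd i j * f) e = kd i j * coef (f :: ('v::finite, 'r::comm_ring_1) mps) e"
  by (simp add: kd_def)

lemma sum_if_left: "(\<Sum>i\<le>n. if n - i = 0 \<and> P then f i else 0) = (if P then f (n::nat) else 0 :: 'a::comm_monoid_add)"
  using sum_atMost_last[of n f] by (cases P) auto

context pre_structure
begin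

lemma S_skew: "S c d a b k l i j = - S a b c d i j k l"
proof -
  have "pot M (map bas ((Eta i # replicate d (Xi ObY) @ Theta j # replicate c (Xi ObX)) @
      (Eta k # replicate b (Xi ObY) @ Theta l # replicate a (Xi ObX)))) =
    - pot M (map bas ((Eta k # replicate b (Xi ObY) @ Theta l # replicate a (Xi ObX)) @
      (Eta i # replicate d (Xi ObY) @ Theta j # replicate c (Xi ObX))))"
    by (subst pot_rotate_word) (simp_all add: ksgn_def)
  then show ?thesis
    using pot_Eta[of i a b c d l k j] pot_Eta[of k c d a b j i l]
    unfolding massey_word_def append_Cons append_Nil append_assoc by simp
qed

lemma pairing_Mb_massey: "pairing (bas (Eta i)) (Mb (massey_word a b c d l k j)) = - S a b c d i j k l"
  using pot_Eta[of i a b c d l k j] by simp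

lemma pairing_lin_mid:
  "pairing c (M (us @ (\<Sum>i\<in>UNIV. k i *s x i) # vs)) = (\<Sum>i\<in>UNIV. k i * pairing c (M (us @ x (i::'i::finite) # vs)))"
  by (simp add: multilinear_sum[OF ml] multilinear_scale[OF ml] pairing_sum_right)

lemma pairing_scale_mid:
  "pairing c (M (us @ (k *s x) # vs)) = k * pairing c (M (us @ x # vs))"
  by (simp add: multilinear_scale[OF ml])

text \<open>When the inner value is an identity, strict unitality leaves only the binary outer
  product, so all surrounding runs must be empty.\<close>

lemma Mb_id_outer:
  "pairing (bas (Eta v)) (M (map bas (replicate i (Xi ObY)) @ bas (Id ObY) #
      map bas (replicate b (Xi ObY) @ Theta t # replicate a (Xi ObX)))) =
    (if i = 0 \<and> b = 0 \<and> a = 0 then kd v t else 0)"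
  "pairing (bas (Eta v)) (M (map bas (replicate b (Xi ObY) @ Theta t # replicate i (Xi ObX)) @ bas (Id ObX) #
      map bas (replicate a (Xi ObX)))) =
    (if b = 0 \<and> i = 0 \<and> a = 0 then kd v t else 0)"
proof -
  have un': "length as \<noteq> 2 \<Longrightarrow> bas (Id Z) \<in> set as \<Longrightarrow> M as = 0" for as Z
    using un unfolding strictly_unital_ops_def by blast
  have c: "M [bas (Id ObY), bas (Theta t)] = bas (Theta t)" "M [bas (Theta t), bas (Id ObX)] = bas (Theta t)"
    using ex by (simp_all add: extends_product_def)
  show "pairing (bas (Eta v)) (M (map bas (replicate i (Xi ObY)) @ bas (Id ObY) #
      map bas (replicate b (Xi ObY) @ Theta t # replicate a (Xi ObX)))) =
    (if i = 0 \<and> b = 0 \<and> a = 0 then kd v t else 0)"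
  proof (cases "i = 0 \<and> b = 0 \<and> a = 0")
    case False
    then show ?thesis by (subst un'[of _ ObY]) auto
  qed (use c in \<open>simp add: kd_def\<close>)
  show "pairing (bas (Eta v)) (M (map bas (replicate b (Xi ObY) @ Theta t # replicate i (Xi ObX)) @ bas (Id ObX) #
      map bas (replicate a (Xi ObX)))) =
    (if b = 0 \<and> i = 0 \<and> a = 0 then kd v t else 0)"
  proof (cases "b = 0 \<and> i = 0 \<and> a = 0")
    case False
    then show ?thesis by (subst un'[of _ ObX]) auto
  qed (use c in \<open>simp add: kd_def\<close>)
qed

lemma word_merge:
  "replicate e (Xi ObY) @ Xi ObY # massey_word a b c d l k j = massey_word a b c (Suc (e + d)) l k j"
  "replicate e (Xi ObY) @ Theta t # replicate f (Xi ObX) @ Xi ObX # replicate c (Xi ObX) @ Eta k #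
     replicate b (Xi ObY) @ Theta l # replicate a (Xi ObX) = massey_word a b (Suc (f + c)) e l k t"
  "replicate e (Xi ObY) @ Theta t # replicate f (Xi ObX) @ Eta k # replicate g (Xi ObY) @ Xi ObY #
     replicate b (Xi ObY) @ Theta l # replicate a (Xi ObX) = massey_word a (Suc (g + b)) f e l k t"
  "replicate e (Xi ObY) @ Theta t # replicate f (Xi ObX) @ Eta k # replicate g (Xi ObY) @ Theta l #
     replicate h (Xi ObX) @ Xi ObX # replicate a (Xi ObX) = massey_word (Suc (h + a)) g f e l k t"
  "replicate e (Xi ObY) @ Theta t # replicate c (Xi ObX) @ Eta k #
     replicate b (Xi ObY) @ Theta l # replicate a (Xi ObX) = massey_word a b c e l k t"
  by (simp_all add: massey_word_def replicate_snoc replicate_add)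

text \<open>Nine kinds of terms survive: three quadratic ones, with inner letters theta eta theta
  twice and eta theta eta once; four with an inner binary product; two where four letters theta and
  eta are multiplied to an identity.\<close>

lemma insertion_massey5:
  "pairing (bas (Eta v)) (insertion_sum M M (massey5 a1 b1 a2 b2 a3 b3 t1 u1 t2 u2 t3)) =
    (if a3 = 0 then kd t3 u2 * S a1 b1 a2 (Suc (b3 + b2)) v t2 u1 t1 else 0)
    - (\<Sum>i\<le>b3. \<Sum>m\<le>a2. \<Sum>p\<in>UNIV. S m b2 a3 (b3 - i) p t3 u2 t2 * S a1 b1 (a2 - m) i v p u1 t1)
    + (if a1 = 0 then S a2 b2 a3 (Suc (b1 + b3)) u1 t3 u2 t2 * kd v t1 else 0)
    + (if b2 = 0 then kd u2 t2 * S a1 b1 (Suc (a3 + a2)) b3 v t3 u1 t1 else 0)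
    - (\<Sum>i\<le>a3. \<Sum>m\<le>b1. \<Sum>p\<in>UNIV. S (a3 - i) m a2 b2 u2 t2 u1 p * S a1 (b1 - m) i b3 v t3 p t1)
    - (if b3 = 0 then S (Suc (a1 + a3)) b1 a2 b2 u2 t2 u1 t1 * kd v t3 else 0)
    - (if a2 = 0 then kd t2 u1 * S a1 (Suc (b2 + b1)) a3 b3 v t3 u2 t1 else 0)
    + (\<Sum>i\<le>b2. \<Sum>m\<le>a1. \<Sum>p\<in>UNIV. S m b1 a2 (b2 - i) p t2 u1 t1 * S (a1 - m) i a3 b3 v t3 u2 p)
    - (if b1 = 0 then kd u1 t1 * S (Suc (a2 + a1)) b2 a3 b3 v t3 u2 t2 else 0)"
proof -
  define H where "H p x q = psgn (sdeg q) * pairing (bas (Eta v)) (M (map bas p @ x # map bas q))" for p x q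
  have H0: "H p 0 q = 0" for p q
    by (simp add: H_def multilinear_zero[OF ml])
  have Hs: "H p (k *s bas g) q = psgn (sdeg q) * (k * pairing (bas (Eta v)) (Mb (p @ g # q)))" for p k g q
    by (simp add: H_def pairing_scale_mid)
  have Hm: "H p (\<Sum>i\<in>UNIV. k i *s bas (g i)) q =
      psgn (sdeg q) * (\<Sum>i\<in>UNIV. k i * pairing (bas (Eta v)) (Mb (p @ g i # q)))" for p k q and g :: "'n \<Rightarrow> 'n gen"
    by (simp add: H_def pairing_lin_mid)
  have "pairing (bas (Eta v)) (insertion_sum M M (massey5 a1 b1 a2 b2 a3 b3 t1 u1 t2 u2 t3)) =
      ssum (\<lambda>p r. ssum (\<lambda>z q. H p (Mb z) q) r) (massey5 a1 b1 a2 b2 a3 b3 t1 u1 t2 u2 t3)"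
    unfolding insertion_sum_ssum'[where M = M, OF ml graded_Nil[OF gr]] pairing_ssum H_def by simp
  also have "\<dots> =
      (\<Sum>i\<le>b3. ssum (\<lambda>z q. H (replicate i (Xi ObY)) (Mb z) q) (massey5 a1 b1 a2 b2 a3 (b3 - i) t1 u1 t2 u2 t3)) +
      ((\<Sum>i\<le>a3. ssum (\<lambda>z q. H (replicate b3 (Xi ObY) @ Theta t3 # replicate i (Xi ObX)) (Mb z) q)
        (replicate (a3 - i) (Xi ObX) @ Eta u2 # massey_word a1 b1 a2 b2 t1 u1 t2)) +
      ((\<Sum>i\<le>b2. ssum (\<lambda>z q. H (replicate b3 (Xi ObY) @ Theta t3 # replicate a3 (Xi ObX) @ Eta u2 #
          replicate i (Xi ObY)) (Mb z) q) (massey_word a1 b1 a2 (b2 - i) t1 u1 t2)) +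
      ((\<Sum>i\<le>a2. ssum (\<lambda>z q. H (replicate b3 (Xi ObY) @ Theta t3 # replicate a3 (Xi ObX) @ Eta u2 #
          replicate b2 (Xi ObY) @ Theta t2 # replicate i (Xi ObX)) (Mb z) q)
        (replicate (a2 - i) (Xi ObX) @ Eta u1 # replicate b1 (Xi ObY) @ Theta t1 # replicate a1 (Xi ObX))) +
      ((\<Sum>i\<le>b1. ssum (\<lambda>z q. H (replicate b3 (Xi ObY) @ Theta t3 # replicate a3 (Xi ObX) @ Eta u2 #
          replicate b2 (Xi ObY) @ Theta t2 # replicate a2 (Xi ObX) @ Eta u1 # replicate i (Xi ObY)) (Mb z) q)
        (replicate (b1 - i) (Xi ObY) @ Theta t1 # replicate a1 (Xi ObX))) +
      (\<Sum>i\<le>a1. ssum (\<lambda>z q. H (replicate b3 (Xi ObY) @ Theta t3 # replicate a3 (Xi ObX) @ Eta u2 #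
          replicate b2 (Xi ObY) @ Theta t2 # replicate a2 (Xi ObX) @ Eta u1 # replicate b1 (Xi ObY) @ Theta t1 #
          replicate i (Xi ObX)) (Mb z) q) (replicate (a1 - i) (Xi ObX)))))))"
    unfolding massey5_def massey_word_def append_Cons append_Nil append_assoc ssum_run ssum_replicate
    by (simp only: append_Cons append_Nil append_assoc)
  also have "\<dots> =
      ((if a3 = 0 then H (replicate b3 (Xi ObY)) (Mb [Theta t3, Eta u2]) (massey_word a1 b1 a2 b2 t1 u1 t2) else 0) +
      ((\<Sum>i\<le>b3. \<Sum>m\<le>a2. H (replicate i (Xi ObY)) (Mb (massey_word m b2 a3 (b3 - i) t2 u2 t3))
        (replicate (a2 - m) (Xi ObX) @ Eta u1 # replicate b1 (Xi ObY) @ Theta t1 # replicate a1 (Xi ObX))) +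
      (\<Sum>i\<le>b3. \<Sum>m\<le>b1. H (replicate i (Xi ObY)) (Mb (replicate (b3 - i) (Xi ObY) @ Theta t3 # replicate a3 (Xi ObX) @
         Eta u2 # replicate b2 (Xi ObY) @ Theta t2 # replicate a2 (Xi ObX) @ Eta u1 # replicate m (Xi ObY)))
        (replicate (b1 - m) (Xi ObY) @ Theta t1 # replicate a1 (Xi ObX))))) +
      (((if b2 = 0 then H (replicate b3 (Xi ObY) @ Theta t3 # replicate a3 (Xi ObX)) (Mb [Eta u2, Theta t2])
          (replicate a2 (Xi ObX) @ Eta u1 # replicate b1 (Xi ObY) @ Theta t1 # replicate a1 (Xi ObX)) else 0) +
      ((\<Sum>i\<le>a3. \<Sum>m\<le>b1. H (replicate b3 (Xi ObY) @ Theta t3 # replicate i (Xi ObX))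
          (Mb (replicate (a3 - i) (Xi ObX) @ Eta u2 # replicate b2 (Xi ObY) @ Theta t2 #
          replicate a2 (Xi ObX) @ Eta u1 # replicate m (Xi ObY)))
        (replicate (b1 - m) (Xi ObY) @ Theta t1 # replicate a1 (Xi ObX))) +
      (\<Sum>i\<le>a3. \<Sum>m\<le>a1. H (replicate b3 (Xi ObY) @ Theta t3 # replicate i (Xi ObX))
          (Mb (replicate (a3 - i) (Xi ObX) @ Eta u2 # massey_word m b1 a2 b2 t1 u1 t2)) (replicate (a1 - m) (Xi ObX))))) +
      (((if a2 = 0 then H (replicate b3 (Xi ObY) @ Theta t3 # replicate a3 (Xi ObX) @ Eta u2 # replicate b2 (Xi ObY))
          (Mb [Theta t2, Eta u1]) (replicate b1 (Xi ObY) @ Theta t1 # replicate a1 (Xi ObX)) else 0) +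
      (\<Sum>i\<le>b2. \<Sum>m\<le>a1. H (replicate b3 (Xi ObY) @ Theta t3 # replicate a3 (Xi ObX) @ Eta u2 # replicate i (Xi ObY))
          (Mb (massey_word m b1 a2 (b2 - i) t1 u1 t2)) (replicate (a1 - m) (Xi ObX)))) +
      (if b1 = 0 then H (replicate b3 (Xi ObY) @ Theta t3 # replicate a3 (Xi ObX) @ Eta u2 #
          replicate b2 (Xi ObY) @ Theta t2 # replicate a2 (Xi ObX)) (Mb [Eta u1, Theta t1]) (replicate a1 (Xi ObX)) else 0)))"
    unfolding sub_massey5[of "H _", OF H0] sub_eta_massey[of "H _", OF H0] sub_massey[of "H _", OF H0]
      sub_eta_theta[of "H _", OF H0] sub_theta[of "H _", OF H0] ssum_replicate Mb_run H0
      sum.distrib sum_if_left sum.neutral_const add_0_right ..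
  also have "(if a3 = 0 then H (replicate b3 (Xi ObY)) (Mb [Theta t3, Eta u2]) (massey_word a1 b1 a2 b2 t1 u1 t2) else 0) =
      (if a3 = 0 then kd t3 u2 * S a1 b1 a2 (Suc (b3 + b2)) v t2 u1 t1 else 0)"
    unfolding Mb_comp Hs word_merge pairing_Mb_massey massey_word_ends by simp
  also have "(\<Sum>i\<le>b3. \<Sum>m\<le>a2. H (replicate i (Xi ObY)) (Mb (massey_word m b2 a3 (b3 - i) t2 u2 t3))
        (replicate (a2 - m) (Xi ObX) @ Eta u1 # replicate b1 (Xi ObY) @ Theta t1 # replicate a1 (Xi ObX))) =
      - (\<Sum>i\<le>b3. \<Sum>m\<le>a2. \<Sum>p\<in>UNIV. S m b2 a3 (b3 - i) p t3 u2 t2 * S a1 b1 (a2 - m) i v p u1 t1)"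
    unfolding Mb_theta[of _ b2 a3 _ t2 u2 t3] Hm word_merge pairing_Mb_massey by (simp add: sum_negf)
  also have "(\<Sum>i\<le>b3. \<Sum>m\<le>b1. H (replicate i (Xi ObY)) (Mb (replicate (b3 - i) (Xi ObY) @ Theta t3 # replicate a3 (Xi ObX) @
         Eta u2 # replicate b2 (Xi ObY) @ Theta t2 # replicate a2 (Xi ObX) @ Eta u1 # replicate m (Xi ObY)))
        (replicate (b1 - m) (Xi ObY) @ Theta t1 # replicate a1 (Xi ObX))) =
      (if a1 = 0 then S a2 b2 a3 (Suc (b1 + b3)) u1 t3 u2 t2 * kd v t1 else 0)"
  proof -
    \<comment> \<open>The identity survives only if nothing but the last theta is left around it: i
      = 0, m = b1 and a1 = 0. The conditions are nested in the order in which the sums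
      collapse.\<close>
    have "H (replicate i (Xi ObY)) (Mb (replicate (b3 - i) (Xi ObY) @ Theta t3 # replicate a3 (Xi ObX) @
         Eta u2 # replicate b2 (Xi ObY) @ Theta t2 # replicate a2 (Xi ObX) @ Eta u1 # replicate m (Xi ObY)))
        (replicate (b1 - m) (Xi ObY) @ Theta t1 # replicate a1 (Xi ObX)) =
      (if b1 - m = 0 then if i = 0 then if a1 = 0 then S a2 b2 a3 (Suc (m + b3)) u1 t3 u2 t2 * kd v t1 else 0 else 0 else 0)" for i m
      unfolding Mb_idY H_def pairing_scale_mid Mb_id_outer by auto
    then have "(\<Sum>i\<le>b3. \<Sum>m\<le>b1. H (replicate i (Xi ObY)) (Mb (replicate (b3 - i) (Xi ObY) @ Theta t3 # replicate a3 (Xi ObX) @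
         Eta u2 # replicate b2 (Xi ObY) @ Theta t2 # replicate a2 (Xi ObX) @ Eta u1 # replicate m (Xi ObY)))
        (replicate (b1 - m) (Xi ObY) @ Theta t1 # replicate a1 (Xi ObX))) =
      (\<Sum>i\<le>b3. \<Sum>m\<le>b1. if b1 - m = 0 then if i = 0 then if a1 = 0 then S a2 b2 a3 (Suc (m + b3)) u1 t3 u2 t2 * kd v t1 else 0 else 0 else 0)"
      by (simp only:)
    then show ?thesis unfolding sum_atMost_last by (simp del: if_split)
  qed
  also have "(if b2 = 0 then H (replicate b3 (Xi ObY) @ Theta t3 # replicate a3 (Xi ObX)) (Mb [Eta u2, Theta t2])
          (replicate a2 (Xi ObX) @ Eta u1 # replicate b1 (Xi ObY) @ Theta t1 # replicate a1 (Xi ObX)) else 0) =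
      (if b2 = 0 then kd u2 t2 * S a1 b1 (Suc (a3 + a2)) b3 v t3 u1 t1 else 0)"
    unfolding Mb_comp Hs append_Cons append_assoc word_merge pairing_Mb_massey by simp
  also have "(\<Sum>i\<le>a3. \<Sum>m\<le>b1. H (replicate b3 (Xi ObY) @ Theta t3 # replicate i (Xi ObX))
          (Mb (replicate (a3 - i) (Xi ObX) @ Eta u2 # replicate b2 (Xi ObY) @ Theta t2 #
          replicate a2 (Xi ObX) @ Eta u1 # replicate m (Xi ObY)))
        (replicate (b1 - m) (Xi ObY) @ Theta t1 # replicate a1 (Xi ObX))) =
      - (\<Sum>i\<le>a3. \<Sum>m\<le>b1. \<Sum>p\<in>UNIV. S (a3 - i) m a2 b2 u2 t2 u1 p * S a1 (b1 - m) i b3 v t3 p t1)"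
    unfolding Mb_eta Hm append_Cons append_assoc word_merge pairing_Mb_massey by (simp add: sum_negf)
  also have "(\<Sum>i\<le>a3. \<Sum>m\<le>a1. H (replicate b3 (Xi ObY) @ Theta t3 # replicate i (Xi ObX))
          (Mb (replicate (a3 - i) (Xi ObX) @ Eta u2 # massey_word m b1 a2 b2 t1 u1 t2)) (replicate (a1 - m) (Xi ObX))) =
      - (if b3 = 0 then S (Suc (a1 + a3)) b1 a2 b2 u2 t2 u1 t1 * kd v t3 else 0)"
  proof -
    have "H (replicate b3 (Xi ObY) @ Theta t3 # replicate i (Xi ObX))
          (Mb (replicate (a3 - i) (Xi ObX) @ Eta u2 # massey_word m b1 a2 b2 t1 u1 t2)) (replicate (a1 - m) (Xi ObX)) =
      (if a1 - m = 0 then if i = 0 then - (if b3 = 0 then S (Suc (m + a3)) b1 a2 b2 u2 t2 u1 t1 * kd v t3 else 0) else 0 else 0)" for i m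
      unfolding Mb_idX H_def pairing_scale_mid Mb_id_outer by auto
    then have "(\<Sum>i\<le>a3. \<Sum>m\<le>a1. H (replicate b3 (Xi ObY) @ Theta t3 # replicate i (Xi ObX))
          (Mb (replicate (a3 - i) (Xi ObX) @ Eta u2 # massey_word m b1 a2 b2 t1 u1 t2)) (replicate (a1 - m) (Xi ObX))) =
      (\<Sum>i\<le>a3. \<Sum>m\<le>a1. if a1 - m = 0 then if i = 0 then - (if b3 = 0 then S (Suc (m + a3)) b1 a2 b2 u2 t2 u1 t1 * kd v t3 else 0) else 0 else 0)"
      by (simp only:)
    then show ?thesis unfolding sum_atMost_last by (simp del: if_split)
  qed
  also have "(if a2 = 0 then H (replicate b3 (Xi ObY) @ Theta t3 # replicate a3 (Xi ObX) @ Eta u2 # replicate b2 (Xi ObY))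
          (Mb [Theta t2, Eta u1]) (replicate b1 (Xi ObY) @ Theta t1 # replicate a1 (Xi ObX)) else 0) =
      - (if a2 = 0 then kd t2 u1 * S a1 (Suc (b2 + b1)) a3 b3 v t3 u2 t1 else 0)"
    unfolding Mb_comp Hs append_Cons append_assoc word_merge pairing_Mb_massey by simp
  also have "(\<Sum>i\<le>b2. \<Sum>m\<le>a1. H (replicate b3 (Xi ObY) @ Theta t3 # replicate a3 (Xi ObX) @ Eta u2 # replicate i (Xi ObY))
          (Mb (massey_word m b1 a2 (b2 - i) t1 u1 t2)) (replicate (a1 - m) (Xi ObX))) =
      (\<Sum>i\<le>b2. \<Sum>m\<le>a1. \<Sum>p\<in>UNIV. S m b1 a2 (b2 - i) p t2 u1 t1 * S (a1 - m) i a3 b3 v t3 u2 p)"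
    unfolding Mb_theta[of _ b1 a2 _ t1 u1 t2] Hm append_Cons append_assoc word_merge pairing_Mb_massey by simp
  also have "(if b1 = 0 then H (replicate b3 (Xi ObY) @ Theta t3 # replicate a3 (Xi ObX) @ Eta u2 #
          replicate b2 (Xi ObY) @ Theta t2 # replicate a2 (Xi ObX)) (Mb [Eta u1, Theta t1]) (replicate a1 (Xi ObX)) else 0) =
      - (if b1 = 0 then kd u1 t1 * S (Suc (a2 + a1)) b2 a3 b3 v t3 u2 t2 else 0)"
    unfolding Mb_comp Hs append_Cons append_assoc word_merge(4) pairing_Mb_massey by simp
  finally show ?thesis by (simp only: add.assoc diff_conv_add_uminus)
qed

definition ms :: "'n \<Rightarrow> 'n \<Rightarrow> 'n \<Rightarrow> 'n \<Rightarrow> (2 + 2, 'r) mps" where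
  "ms i j k l = massey_series M l k j i"

lemma coef_ms: "coef (ms i j k l) e = S (e (Inl 1)) (e (Inr 1)) (e (Inl 2)) (e (Inr 2)) i j k l"
  by (simp add: ms_def massey_series_def S_def)

lemma massey_r_eq: "massey_r M = polar_part + regular_part ms"
  by (simp add: massey_r_def regular_part_def ms_def split_def vec_eq_iff)

lemma ms_skew: "\<forall>i j k l. ms k l i j = - ren (vars4 2 1 2 1) (ms i j k l)"
proof (intro allI mps_eqI)
  fix i j k l :: 'n and e :: "2 + 2 \<Rightarrow> nat"
  have "range (vars4 2 1 2 (1 :: 2)) = UNIV" unfolding range_vars4 UNIV_22 by auto
  then have "coef (ren (vars4 2 1 2 1) (ms i j k l)) e = coef (ms i j k l) (e \<circ> vars4 2 1 2 1)"
    by (simp add: ren.rep_eq)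
  then show "coef (ms k l i j) e = coef (- ren (vars4 2 1 2 1) (ms i j k l)) e"
    by (simp add: coef_ms S_skew[of "e (Inl 1)"])
qed

text \<open>The second and third vertices along the path of the word carry the labels 3 and 2 in the
  AYBE. Hence \<open>a2\<close> is the exponent of x_3 and \<open>a3\<close> that of x_2, and
  likewise for the y variables.\<close>

lemma coef_AYBE_defect:
  fixes e :: "3 + 3 \<Rightarrow> nat"
  defines "a1 \<equiv> e (Inl 1)" and "a2 \<equiv> e (Inl 3)" and "a3 \<equiv> e (Inl 2)"
    and "b1 \<equiv> e (Inr 1)" and "b2 \<equiv> e (Inr 3)" and "b3 \<equiv> e (Inr 2)"
  shows "coef (AYBE_defect ms i1 i2 i3 j1 j2 j3) e =
     (\<Sum>p\<in>UNIV. \<Sum>i\<le>a1. \<Sum>j\<le>b2. S a3 b3 i j i1 p i2 j2 * S (a1 - i) b1 a2 (b2 - j) p j1 i3 j3)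
     - (\<Sum>p\<in>UNIV. \<Sum>i\<le>a2. \<Sum>j\<le>b3. S a1 b1 i j i2 p i3 j3 * S a3 (b3 - j) (a2 - i) b2 i1 j1 p j2)
     + (\<Sum>p\<in>UNIV. \<Sum>i\<le>a3. \<Sum>j\<le>b1. S i j a2 b2 i1 j1 i3 p * S a1 (b1 - j) (a3 - i) b3 i2 j2 p j3)
     + kd i2 j2 * (if b3 = 0 then S (Suc (a3 + a1)) b1 a2 b2 i1 j1 i3 j3 else 0)
     - kd i1 j2 * (if a3 = 0 then S a1 b1 a2 (Suc (b3 + b2)) i2 j1 i3 j3 else 0)
     - kd i3 j3 * (if b1 = 0 then S a3 b3 (Suc (a1 + a2)) b2 i1 j1 i2 j2 else 0)
     + kd i3 j1 * (if a2 = 0 then S a1 (Suc (b1 + b2)) a3 b3 i2 j2 i1 j3 else 0)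
     + kd i2 j3 * (if a1 = 0 then S a3 (Suc (b1 + b3)) a2 b2 i1 j1 i3 j2 else 0)
     - kd i1 j1 * (if b2 = 0 then S a1 b1 (Suc (a3 + a2)) b3 i2 j2 i3 j3 else 0)"
proof -
  have A: "coef (ren (vars4 2 1 2 3) f * ren (vars4 1 3 1 3) g) e = (\<Sum>i\<le>a1. \<Sum>j\<le>b2.
      coef f (e(Inl 1 := i, Inr 3 := j) \<circ> vars4 2 1 2 3) *
      coef g (e(Inl 1 := a1 - i, Inr 3 := b2 - j) \<circ> vars4 1 3 1 3))" for f g :: "(2 + 2, 'r) mps"
    unfolding a1_def b2_def by (rule coef_ren_mult) (auto simp: range_vars4 UNIV_33)
  have B: "coef (ren (vars4 1 3 1 2) f * ren (vars4 2 3 2 3) g) e = (\<Sum>i\<le>a2. \<Sum>j\<le>b3.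
      coef f (e(Inl 3 := i, Inr 2 := j) \<circ> vars4 1 3 1 2) *
      coef g (e(Inl 3 := a2 - i, Inr 2 := b3 - j) \<circ> vars4 2 3 2 3))" for f g :: "(2 + 2, 'r) mps"
    unfolding a2_def b3_def by (rule coef_ren_mult) (auto simp: range_vars4 UNIV_33)
  have C: "coef (ren (vars4 2 3 1 3) f * ren (vars4 1 2 1 2) g) e = (\<Sum>i\<le>a3. \<Sum>j\<le>b1.
      coef f (e(Inl 2 := i, Inr 1 := j) \<circ> vars4 2 3 1 3) *
      coef g (e(Inl 2 := a3 - i, Inr 1 := b1 - j) \<circ> vars4 1 2 1 2))" for f g :: "(2 + 2, 'r) mps"
    unfolding a3_def b1_def by (rule coef_ren_mult) (auto simp: range_vars4 UNIV_33)
  have D: "coef (ddiff (vars4 2 3 1 3) (Inl 1) (Inl 1) (ms i j k l)) e = (if b3 = 0 then S (Suc (a3 + a1)) b1 a2 b2 i j k l else 0)"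
    "coef (ddiff (vars4 1 3 1 2) (Inr 2) (Inr 3) (ms i j k l)) e = (if a3 = 0 then S a1 b1 a2 (Suc (b3 + b2)) i j k l else 0)"
    "coef (ddiff (vars4 2 1 2 3) (Inl 2) (Inl 3) (ms i j k l)) e = (if b1 = 0 then S a3 b3 (Suc (a1 + a2)) b2 i j k l else 0)"
    "coef (ddiff (vars4 1 2 1 2) (Inr 1) (Inr 3) (ms i j k l)) e = (if a2 = 0 then S a1 (Suc (b1 + b2)) a3 b3 i j k l else 0)"
    "coef (ddiff (vars4 2 3 1 3) (Inr 1) (Inr 2) (ms i j k l)) e = (if a1 = 0 then S a3 (Suc (b1 + b3)) a2 b2 i j k l else 0)"
    "coef (ddiff (vars4 1 2 1 2) (Inl 2) (Inl 3) (ms i j k l)) e = (if b2 = 0 then S a1 b1 (Suc (a3 + a2)) b3 i j k l else 0)" for i j k l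
    by (simp_all add: ddiff_def range_vars4 all_33 coef_ms a1_def a2_def a3_def b1_def b2_def b3_def)
  show ?thesis
    unfolding AYBE_defect_def coef_simps coef_sum coef_kd_mult A B C D
    by (simp add: coef_ms a1_def[symmetric] a2_def[symmetric] a3_def[symmetric] b1_def[symmetric]
        b2_def[symmetric] b3_def[symmetric])
qed

text \<open>The nine kinds of terms match one by one. Where the two sides list the tensor factors in
  opposite order, \<open>S_skew\<close> exchanges them and supplies the sign.\<close>

lemma insertion_AYBE:
  "pairing (bas (Eta v)) (insertion_sum M M
     (massey5 (e (Inl 1)) (e (Inr 1)) (e (Inl 3)) (e (Inr 3)) (e (Inl 2)) (e (Inr 2)) t1 u1 t2 u2 t3)) =
   - coef (AYBE_defect ms u2 v u1 t2 t3 t1) e"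
proof -
  let ?a1 = "e (Inl 1)" and ?a2 = "e (Inl 3)" and ?a3 = "e (Inl 2)"
    and ?b1 = "e (Inr 1)" and ?b2 = "e (Inr 3)" and ?b3 = "e (Inr 2)"
  have A: "(\<Sum>i\<le>?b2. \<Sum>m\<le>?a1. \<Sum>p\<in>UNIV. S m ?b1 ?a2 (?b2 - i) p t2 u1 t1 * S (?a1 - m) i ?a3 ?b3 v t3 u2 p) =
      - (\<Sum>p\<in>UNIV. \<Sum>i\<le>?a1. \<Sum>j\<le>?b2. S ?a3 ?b3 i j u2 p v t3 * S (?a1 - i) ?b1 ?a2 (?b2 - j) p t2 u1 t1)"
  proof -
    have "(\<Sum>i\<le>?b2. \<Sum>m\<le>?a1. \<Sum>p\<in>UNIV. S m ?b1 ?a2 (?b2 - i) p t2 u1 t1 * S (?a1 - m) i ?a3 ?b3 v t3 u2 p) =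
        (\<Sum>i\<le>?b2. \<Sum>m\<le>?a1. \<Sum>p\<in>UNIV. S (?a1 - m) ?b1 ?a2 (?b2 - i) p t2 u1 t1 * S m i ?a3 ?b3 v t3 u2 p)"
      by (rule sum.cong[OF refl], subst sum_atMost_rev[symmetric]) simp
    also have "\<dots> = (\<Sum>p\<in>UNIV. \<Sum>m\<le>?a1. \<Sum>i\<le>?b2. S (?a1 - m) ?b1 ?a2 (?b2 - i) p t2 u1 t1 * S m i ?a3 ?b3 v t3 u2 p)"
      by (subst sum.swap, subst (2) sum.swap, subst sum.swap) (rule refl)
    finally show ?thesis
      by (simp add: S_skew[of _ _ ?a3 ?b3 v t3 u2] sum_negf mult.commute)
  qed
  have B: "(\<Sum>i\<le>?b3. \<Sum>m\<le>?a2. \<Sum>p\<in>UNIV. S m ?b2 ?a3 (?b3 - i) p t3 u2 t2 * S ?a1 ?b1 (?a2 - m) i v p u1 t1) =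
      - (\<Sum>p\<in>UNIV. \<Sum>i\<le>?a2. \<Sum>j\<le>?b3. S ?a1 ?b1 i j v p u1 t1 * S ?a3 (?b3 - j) (?a2 - i) ?b2 u2 t2 p t3)"
  proof -
    have "(\<Sum>i\<le>?b3. \<Sum>m\<le>?a2. \<Sum>p\<in>UNIV. S m ?b2 ?a3 (?b3 - i) p t3 u2 t2 * S ?a1 ?b1 (?a2 - m) i v p u1 t1) =
        (\<Sum>i\<le>?b3. \<Sum>m\<le>?a2. \<Sum>p\<in>UNIV. S (?a2 - m) ?b2 ?a3 (?b3 - i) p t3 u2 t2 * S ?a1 ?b1 m i v p u1 t1)"
      by (rule sum.cong[OF refl], subst sum_atMost_rev[symmetric]) simp
    also have "\<dots> = (\<Sum>p\<in>UNIV. \<Sum>m\<le>?a2. \<Sum>i\<le>?b3. S (?a2 - m) ?b2 ?a3 (?b3 - i) p t3 u2 t2 * S ?a1 ?b1 m i v p u1 t1)"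
      by (subst sum.swap, subst (2) sum.swap, subst sum.swap) (rule refl)
    finally show ?thesis
      by (simp add: S_skew[of _ ?b2 ?a3 _ _ t3 u2 t2] sum_negf mult.commute)
  qed
  have C: "(\<Sum>i\<le>?a3. \<Sum>m\<le>?b1. \<Sum>p\<in>UNIV. S (?a3 - i) m ?a2 ?b2 u2 t2 u1 p * S ?a1 (?b1 - m) i ?b3 v t3 p t1) =
      (\<Sum>p\<in>UNIV. \<Sum>i\<le>?a3. \<Sum>j\<le>?b1. S i j ?a2 ?b2 u2 t2 u1 p * S ?a1 (?b1 - j) (?a3 - i) ?b3 v t3 p t1)"
  proof -
    have "(\<Sum>i\<le>?a3. \<Sum>m\<le>?b1. \<Sum>p\<in>UNIV. S (?a3 - i) m ?a2 ?b2 u2 t2 u1 p * S ?a1 (?b1 - m) i ?b3 v t3 p t1) =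
        (\<Sum>i\<le>?a3. \<Sum>m\<le>?b1. \<Sum>p\<in>UNIV. S i m ?a2 ?b2 u2 t2 u1 p * S ?a1 (?b1 - m) (?a3 - i) ?b3 v t3 p t1)"
      by (subst sum_atMost_rev[symmetric]) simp
    also have "\<dots> = (\<Sum>p\<in>UNIV. \<Sum>i\<le>?a3. \<Sum>j\<le>?b1. S i j ?a2 ?b2 u2 t2 u1 p * S ?a1 (?b1 - j) (?a3 - i) ?b3 v t3 p t1)"
      by (subst (2) sum.swap, subst sum.swap) (rule refl)
    finally show ?thesis .
  qed
  have s1: "S ?a2 ?b2 ?a3 (Suc (?b1 + ?b3)) u1 t3 u2 t2 = - S ?a3 (Suc (?b1 + ?b3)) ?a2 ?b2 u2 t2 u1 t3"
    by (rule S_skew)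
  have s2: "S (Suc (?a2 + ?a1)) ?b2 ?a3 ?b3 v t3 u2 t2 = - S ?a3 ?b3 (Suc (?a2 + ?a1)) ?b2 u2 t2 v t3"
    by (rule S_skew)
  show ?thesis
    unfolding insertion_massey5 coef_AYBE_defect A B C s1 s2
    by (auto simp: add.commute kd_def)
qed

theorem ainf_iff_AYBE:
  "ainf_relations M \<longleftrightarrow> general_AYBE (massey_r M)"
proof -
  have "ainf_relations M \<longleftrightarrow> (\<forall>i1 i2 i3 j1 j2 j3 e. coef (AYBE_defect ms i1 i2 i3 j1 j2 j3) e = 0)"
  proof -
    have "\<exists>e :: 3 + 3 \<Rightarrow> nat. e (Inl 1) = a1 \<and> e (Inr 1) = b1 \<and> e (Inl 3) = a2 \<and> e (Inr 3) = b2 \<and>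
        e (Inl 2) = a3 \<and> e (Inr 2) = b3" for a1 b1 a2 b2 a3 b3
      by (rule exI[of _ "case_sum (\<lambda>i. if i = 1 then a1 else if i = 2 then a3 else a2)
            (\<lambda>i. if i = 1 then b1 else if i = 2 then b3 else b2)"]) simp
    then show ?thesis
      unfolding ainf_relations_iff[OF gr cyc un mi ex]
      by (metis insertion_AYBE neg_equal_0_iff_equal)
  qed
  then show ?thesis
    unfolding massey_r_eq general_AYBE_iff[OF ms_skew] by (simp add: mps_eq_iff)
qed

end

section \<open>Multilinear extension\<close>

fun mext :: "('n gen list \<Rightarrow> ('n::finite, 'r::comm_ring_1) mor) \<Rightarrow> ('n, 'r) ops" where
  "mext B [] = B []"
| "mext B (a # as) = (\<Sum>g\<in>UNIV. a $ g *s mext (\<lambda>gs. B (g # gs)) as)"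

lemma mext_bas [simp]:
  fixes B :: "'n gen list \<Rightarrow> ('n::finite, 'r::comm_ring_1) mor"
  shows "mext B (map bas gs) = B gs"
proof (induction gs arbitrary: B)
  case (Cons g gs)
  have "mext B (map bas (g # gs)) = (\<Sum>h\<in>UNIV. (if h = g then 1 else 0) *s B (h # gs))"
    by (simp add: Cons)
  also have "\<dots> = (\<Sum>h\<in>UNIV. if h = g then B (h # gs) else 0)"
    by (rule sum.cong) (simp_all add: vec_eq_iff)
  finally show ?case by simp
qed simp

lemma multilinear_mext:
  fixes B :: "'n gen list \<Rightarrow> ('n::finite, 'r::comm_ring_1) mor"
  shows "multilinear_ops (mext B)"
  unfolding multilinear_ops_def
proof (intro allI)
  fix us vs :: "('n, 'r) mor list" and a b c
  show "mext B (us @ (c *s a + b) # vs) = c *s mext B (us @ a # vs) + mext B (us @ b # vs)"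
  proof (induction us arbitrary: B)
    case Nil
    then show ?case
      by (simp add: vec_eq_iff sum_component sum.distrib sum_distrib_left algebra_simps)
  next
    case (Cons u us)
    then show ?case
      by (simp add: vec_eq_iff sum_component sum.distrib sum_distrib_left algebra_simps)
  qed
qed

lemma mlin_diff: "mlin A \<Longrightarrow> mlin B \<Longrightarrow> mlin (\<lambda>as. A as - B as)"
  unfolding mlin_def by (simp add: algebra_simps)

lemma multilinear_eqI:
  assumes "multilinear_ops F" "multilinear_ops G" "\<And>gs. F (map bas gs) = G (map bas gs)"
  shows "F = G"
proof
  fix as
  have "F as $ h - G as $ h = 0" for h
    by (rule mlin_zero_all[OF mlin_diff[OF multilinear_mlin[OF assms(1)] multilinear_mlin[OF assms(2)]]])
       (simp add: assms(3))
  then show "F as = G as" by (simp add: vec_eq_iff)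
qed

text \<open>Unitality allows arbitrary arguments beside the identity; expanding all other positions
  reduces it to words of generators.\<close>

lemma mlin_member:
  assumes "mlin A" "bas g \<in> set as" "\<And>gs. length gs = length as \<Longrightarrow> g \<in> set gs \<Longrightarrow> A (map bas gs) = 0"
  shows "A as = 0"
  using assms
proof (induction as arbitrary: A)
  case (Cons a as)
  show ?case
  proof (cases "a = bas g")
    case True
    then show ?thesis
      using mlin_zero_all[OF mlin_Cons[OF Cons.prems(1), of a], of as] Cons.prems(3)[of "g # _"] by simp
  next
    case False
    have "A (bas h # as) = 0" for h
    proof (rule Cons.IH[OF mlin_Cons[OF Cons.prems(1)]])
      show "bas g \<in> set as" using Cons.prems(2) False by auto
      show "A (bas h # map bas gs) = 0" if "length gs = length as" "g \<in> set gs" for gs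
        using Cons.prems(3)[of "h # gs"] that by simp
    qed
    then show ?thesis using mlin_bas[OF Cons.prems(1), of "[]" a as] by simp
  qed
qed simp

section \<open>Structures are determined by their Massey products\<close>

lemma (in pre_structure) pot_sdeg:
  assumes "pot M (map bas w) \<noteq> 0"
  shows "sdeg w = - 2"
proof -
  obtain c v where w: "w = c # v" using assms by (cases w) auto
  have v: "v \<noteq> []" using assms graded_Nil[OF gr] w by auto
  show ?thesis
    using pairing_homog[OF homog_bas[of c, unfolded shape_def]
        graded_homog_bas[OF gr v, unfolded tot_shape_def]] assms w
    by (simp add: sdeg_def shape_def comp_def)
qed

text \<open>The rotation principle with k = 2, applied to equality of the two cyclic functionals.
  Words with an identity have values fixed by the prescribed product or equal to 0; the remaining
  values are coefficients of the regular part.\<close>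

lemma pre_structure_eqI:
  assumes M: "pre_structure (M :: ('n::finite, 'r::comm_ring_1) ops)" and M': "pre_structure M'"
    and r: "massey_r M = massey_r M'"
  shows "M = M'"
proof -
  interpret M: pre_structure M by (rule M)
  interpret M': pre_structure M' by (rule M')
  have ms: "M.ms = M'.ms"
    using r unfolding M.massey_r_eq M'.massey_r_eq regular_part_inject .
  have S: "M.S = M'.S"
  proof (intro ext)
    fix a b c d i j k l
    show "M.S a b c d i j k l = M'.S a b c d i j k l"
      using M.coef_ms[of i j k l "case_sum (\<lambda>i. if i = 1 then a else c) (\<lambda>i. if i = 1 then b else d)"]
        M'.coef_ms[of i j k l "case_sum (\<lambda>i. if i = 1 then a else c) (\<lambda>i. if i = 1 then b else d)"]
      by (simp add: ms)
  qed
  have pot: "pot M (map bas w) = pot M' (map bas w)" if "length w \<ge> 2" for w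
  proof (rule rotation_principle[of "\<lambda>w. pot M (map bas w) = pot M' (map bas w)" 2])
    show "pot M (map bas (c # b # gs)) = pot M' (map bas (c # b # gs))"
      if "pot M (map bas (b # gs @ [c])) = pot M' (map bas (b # gs @ [c]))" for c b gs
      using that M.pot_rotate_word[of "[c]" "b # gs"] M'.pot_rotate_word[of "[c]" "b # gs"] by simp
    show "pot M (map bas (Id Y # gs)) = pot M' (map bas (Id Y # gs))" if ne: "gs \<noteq> []" for Y gs
    proof -
      consider a where "gs = [a]" | a b where "gs = [a, b]" | "length gs \<ge> 3"
        using ne by (cases gs; cases "tl gs"; cases "tl (tl gs)") auto
      then show ?thesis
      proof cases
        case 3
        then show ?thesis
          using pairing_Id_ge3[OF M.gr M.cyc M.un homog_map_bas, of gs Y]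
            pairing_Id_ge3[OF M'.gr M'.cyc M'.un homog_map_bas, of gs Y] by simp
      qed (use M.mi M'.mi M.ex M'.ex in \<open>simp_all add: minimal_ops_def extends_product_def\<close>)
    qed
    show "pot M (map bas w) = pot M' (map bas w)" if "\<not> cyc_composable w" for w
    proof (cases "length w \<ge> 2")
      case True
      then show ?thesis using pot_noncyc[OF M.gr] pot_noncyc[OF M'.gr] that by simp
    next
      case False
      then show ?thesis
        using graded_Nil[OF M.gr] graded_Nil[OF M'.gr] by (cases w; cases "tl w") auto
    qed
    show "pot M (map bas w) = pot M' (map bas w)" if "sdeg w \<noteq> - 2" for w
      using M.pot_sdeg M'.pot_sdeg that by metis
    show "pot M (map bas (Eta i # w)) = pot M' (map bas (Eta i # w))"
      if w: "composable w" "no_id w" "tgt (hd w) = ObY" "src (last w) = ObX" "sdeg w = - 2" for i w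
    proof -
      obtain a b c d l k j where "w = massey_word a b c d l k j"
        using word_YX_2[OF w] .
      then show ?thesis by (simp only: M.pot_Eta M'.pot_Eta S)
    qed
  qed (use that in auto)
  show ?thesis
  proof (rule multilinear_eqI[OF M.ml M'.ml])
    fix gs
    show "M (map bas gs) = M' (map bas gs)"
    proof (cases "gs = []")
      case False
      have "pairing (bas c) (M (map bas gs) - M' (map bas gs)) = 0" for c
        using pot[of "c # gs"] False by (cases gs) auto
      then show ?thesis using pairing_nondeg by (metis eq_iff_diff_eq_0)
    qed (use graded_Nil[OF M.gr] graded_Nil[OF M'.gr] in simp)
  qed
qed

section \<open>Constructing a structure from a series\<close>

text \<open>Reads off the lengths of the runs of xi and the letters separating them, forgetting at
  which object each xi sits. It shows that a word determines its exponents, and later selects among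
  letter patterns.\<close>

fun runs :: "'n gen list \<Rightarrow> nat \<times> ('n gen \<times> nat) list" where
  "runs [] = (0, [])"
| "runs (g # w) = (case g of Xi Z \<Rightarrow> (Suc (fst (runs w)), snd (runs w))
     | _ \<Rightarrow> (0, (g, fst (runs w)) # snd (runs w)))"

lemma runs_replicate [simp]: "runs (replicate d (Xi Z) @ w) = (d + fst (runs w), snd (runs w))"
  by (induction d) auto

lemma runs_replicate' [simp]: "runs (replicate d (Xi Z)) = (d, [])"
  using runs_replicate[of d Z "[]"] by simp

definition cyc_word :: "nat \<Rightarrow> nat \<Rightarrow> nat \<Rightarrow> nat \<Rightarrow> 'n \<Rightarrow> 'n \<Rightarrow> 'n \<Rightarrow> 'n \<Rightarrow> 'n gen list" where
  "cyc_word a b c d i j k l = Eta i # massey_word a b c d l k j"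

lemma cyc_word_inject: "cyc_word a b c d i j k l = cyc_word a' b' c' d' i' j' k' l' \<longleftrightarrow>
    a = a' \<and> b = b' \<and> c = c' \<and> d = d' \<and> i = i' \<and> j = j' \<and> k = k' \<and> l = l'"
proof
  assume "cyc_word a b c d i j k l = cyc_word a' b' c' d' i' j' k' l'"
  from arg_cong[OF this, of runs] show "a = a' \<and> b = b' \<and> c = c' \<and> d = d' \<and> i = i' \<and> j = j' \<and> k = k' \<and> l = l'"
    by (simp add: cyc_word_def massey_word_def)
qed simp

definition is_eta :: "'n gen \<Rightarrow> bool" where
  "is_eta g \<longleftrightarrow> (\<exists>i. g = Eta i)"

lemma is_eta_simps [simp]: "is_eta (Eta i)" "\<not> is_eta (Theta j)" "\<not> is_eta (Xi Z)" "\<not> is_eta (Id Z)"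
  by (simp_all add: is_eta_def)

text \<open>Half a turn: cutting in front of the second eta exchanges (a, b) with (c, d) and (i, j)
  with (k, l).\<close>

lemma cyc_word_split:
  assumes "Eta i # p @ q = cyc_word a b c d i j k l" "\<forall>g\<in>set p. \<not> is_eta g" "q \<noteq> []" "is_eta (hd q)"
  shows "q @ Eta i # p = cyc_word c d a b k l i j"
proof -
  let ?p = "replicate d (Xi ObY) @ Theta j # replicate c (Xi ObX)"
    and ?q = "Eta k # replicate b (Xi ObY) @ Theta l # replicate a (Xi ObX)"
  have "p @ q = ?p @ ?q" using assms(1) by (simp add: cyc_word_def massey_word_def)
  moreover have "takeWhile (\<lambda>g. \<not> is_eta g) (p @ q) = p"
    using assms(2-4) by (cases q) (auto simp: takeWhile_append takeWhile_eq_all_conv[THEN iffD2])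
  moreover have "takeWhile (\<lambda>g. \<not> is_eta g) (?p @ ?q) = ?p"
    by (subst takeWhile_append2) auto
  ultimately have "p = ?p" "q = ?q" by auto
  then show ?thesis by (simp add: cyc_word_def massey_word_def)
qed

lemma composable_massey: "composable (massey_word a b c d i j k)"
  using composable_massey5[of a b c d 0 0 i j k j i] by (simp add: massey5_def composable_Cons massey_word_def)

lemma cyc_word_props: "cyc_composable (cyc_word a b c d i j k l)" "no_id (cyc_word a b c d i j k l)"
  "sdeg (cyc_word a b c d i j k l) = - 2"
proof -
  have ne: "massey_word a b c d l k j \<noteq> []" by (simp add: massey_word_def)
  have ends: "src (last (massey_word a b c d l k j)) = ObX" "tgt (hd (massey_word a b c d l k j)) = ObY"
    by (auto simp: massey_word_def hd_append last_replicate)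
  show "cyc_composable (cyc_word a b c d i j k l)"
    using composable_massey[of a b c d l k j] ne ends by (simp add: cyc_word_def cyc_composable_def composable_Cons)
qed (simp_all add: cyc_word_def massey_word_def)

lemma cyc_composable_append: "cyc_composable (us @ vs) \<Longrightarrow> cyc_composable (vs @ us)"
  using rotate_append[of "\<lambda>w. cyc_composable (us @ vs) \<longrightarrow> cyc_composable w" us vs]
  by (auto simp: cyc_composable_rotate)

locale massey_data =
  fixes T :: "nat \<Rightarrow> nat \<Rightarrow> nat \<Rightarrow> nat \<Rightarrow> 'n::finite \<Rightarrow> 'n \<Rightarrow> 'n \<Rightarrow> 'n \<Rightarrow> 'r::comm_ring_1"
  assumes T_skew: "T c d a b k l i j = - T a b c d i j k l"
begin

text \<open>The values prescribed on words that start with an eta, with the sign of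
  \<open>pot_Eta\<close>. Reading off the parameters with \<open>inv\<close> is legitimate because
  \<open>cyc_word\<close> is injective.\<close>

definition eta_val :: "'n gen list \<Rightarrow> 'r" where
  "eta_val w = (let W = (\<lambda>(a, b, c, d, i, j, k, l). cyc_word a b c d i j k l)
     in if w \<in> range W then - (case inv W w of (a, b, c, d, i, j, k, l) \<Rightarrow> T a b c d i j k l) else 0)"

lemma eta_val: "eta_val (cyc_word a b c d i j k l) = - T a b c d i j k l"
proof -
  let ?W = "\<lambda>(a, b, c, d, i, j, k, l). cyc_word a b c d i j k l :: 'n gen list"
  have "inj ?W" by (rule injI) (simp add: cyc_word_inject split_paired_all)
  then have "inv ?W (?W (a, b, c, d, i, j, k, l)) = (a, b, c, d, i, j, k, l)"
    by (rule inv_f_f)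
  moreover have "?W (a, b, c, d, i, j, k, l) \<in> range ?W" by (rule rangeI)
  ultimately show ?thesis unfolding eta_val_def Let_def prod.case by (simp only: if_True prod.case)
qed

lemma eta_val_nonzero:
  assumes "eta_val w \<noteq> 0"
  obtains a b c d i j k l where "w = cyc_word a b c d i j k l"
proof -
  have "w \<in> range (\<lambda>(a, b, c, d, i, j, k, l). cyc_word a b c d i j k l)"
    using assms by (simp add: eta_val_def Let_def split: if_splits)
  then show thesis using that by (auto simp: image_iff)
qed

text \<open>The candidate for the cyclic functional: rotate until the first eta leads, with the
  Koszul sign. Starting at the other eta gives the same value exactly because T is
  skew-symmetric.\<close>

definition Phi :: "'n gen list \<Rightarrow> 'r" where
  "Phi w = (let p = takeWhile (\<lambda>g. \<not> is_eta g) w; q = dropWhile (\<lambda>g. \<not> is_eta g) w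
     in ksgn (sdeg p) (sdeg q) * eta_val (q @ p))"

lemma Phi_eq:
  assumes "\<forall>g\<in>set p. \<not> is_eta g" "q = [] \<or> is_eta (hd q)"
  shows "Phi (p @ q) = ksgn (sdeg p) (sdeg q) * eta_val (q @ p)"
proof -
  have "takeWhile (\<lambda>g. \<not> is_eta g) (p @ q) = p"
    using assms by (cases q) (auto simp: takeWhile_append takeWhile_eq_all_conv[THEN iffD2])
  moreover from this have "dropWhile (\<lambda>g. \<not> is_eta g) (p @ q) = q"
    by (metis append_same_eq takeWhile_dropWhile_id same_append_eq)
  ultimately show ?thesis by (simp add: Phi_def)
qed

lemma eta_val_no_eta:
  assumes "\<forall>g\<in>set p. \<not> is_eta g"
  shows "eta_val p = 0" "eta_val (c # p) = 0"
proof -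
  have *: "\<exists>g. g \<in> set p \<and> is_eta g" if "c # p = cyc_word a b c' d i j k l" for c a b c' d i j k l
  proof -
    have "p = massey_word a b c' d l k j" using that by (simp add: cyc_word_def)
    then have "Eta k \<in> set p" by (simp add: massey_word_def)
    then show ?thesis by (intro exI[of _ "Eta k"]) simp
  qed
  show "eta_val (c # p) = 0"
  proof (rule ccontr)
    assume "eta_val (c # p) \<noteq> 0"
    then obtain a b c' d i j k l where "c # p = cyc_word a b c' d i j k l" by (rule eta_val_nonzero)
    from *[OF this] show False using assms by blast
  qed
  show "eta_val p = 0"
  proof (rule ccontr)
    assume "eta_val p \<noteq> 0"
    then obtain a b c' d i j k l where "p = cyc_word a b c' d i j k l" by (rule eta_val_nonzero)
    then show False using assms by (auto simp: cyc_word_def)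
  qed
qed

lemma eta_split:
  obtains p q where "w = p @ q" "\<forall>g\<in>set p. \<not> is_eta g" "q = [] \<or> is_eta (hd q)"
proof
  show "w = takeWhile (\<lambda>g. \<not> is_eta g) w @ dropWhile (\<lambda>g. \<not> is_eta g) w" by simp
  show "\<forall>g\<in>set (takeWhile (\<lambda>g. \<not> is_eta g) w). \<not> is_eta g" using set_takeWhileD by fastforce
  show "dropWhile (\<lambda>g. \<not> is_eta g) w = [] \<or> is_eta (hd (dropWhile (\<lambda>g. \<not> is_eta g) w))"
    using hd_dropWhile[of "\<lambda>g. \<not> is_eta g" w] by blast
qed

text \<open>Moving a single \<open>\<eta>\<close> to the end is half a turn of the cyclic word, where the skew-symmetry enters.\<close>

lemma Phi_rotate: "Phi (c # w) = ksgn (int (deg c) - 1) (sdeg w) * Phi (w @ [c])"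
proof -
  obtain p q where w: "w = p @ q" and p: "\<forall>g\<in>set p. \<not> is_eta g" and q: "q = [] \<or> is_eta (hd q)"
    by (rule eta_split)
  show ?thesis
  proof (cases "is_eta c")
    case False
    have 1: "Phi (c # w) = ksgn (int (deg c) - 1 + sdeg p) (sdeg q) * eta_val (q @ c # p)"
      using Phi_eq[of "c # p" q] p q False w by simp
    show ?thesis
    proof (cases "q = []")
      case True
      have "Phi (w @ [c]) = ksgn (sdeg (p @ [c])) (sdeg []) * eta_val ([] @ (p @ [c]))"
        using Phi_eq[of "p @ [c]" "[]"] p False w True by simp
      moreover have "eta_val (p @ [c]) = 0"
        by (rule eta_val_no_eta) (use p False in auto)
      moreover have "eta_val (c # p) = 0" by (rule eta_val_no_eta[OF p])
      ultimately show ?thesis using 1 True by simp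
    next
      case qn: False
      have "Phi (w @ [c]) = ksgn (sdeg p) (sdeg q + (int (deg c) - 1)) * eta_val (q @ c # p)"
        using Phi_eq[of p "q @ [c]"] p q qn w by simp
      moreover have "ksgn (int (deg c) - 1 + sdeg p) (sdeg q) =
          (ksgn (int (deg c) - 1) (sdeg p + sdeg q) * ksgn (sdeg p) (sdeg q + (int (deg c) - 1)) :: 'r)"
        by (cases "even (sdeg p)"; cases "even (sdeg q)"; cases "even (int (deg c) - 1)")
           (simp_all add: ksgn_def)
      ultimately show ?thesis using 1 by (simp add: w mult.assoc)
    qed
  next
    case True
    then obtain i where c: "c = Eta i" by (auto simp: is_eta_def)
    have 1: "Phi (c # w) = eta_val (c # w)"
      using Phi_eq[of "[]" "c # w"] True by simp
    show ?thesis
    proof (cases "q = []")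
      case True
      have "Phi (w @ [c]) = ksgn (sdeg p) (sdeg [c]) * eta_val ([c] @ p)"
        using Phi_eq[of p "[c]"] p w True c by simp
      moreover have "eta_val (c # p) = 0" by (rule eta_val_no_eta[OF p])
      ultimately show ?thesis using 1 True w by simp
    next
      case qn: False
      have 2: "Phi (w @ [c]) = ksgn (sdeg p) (sdeg q) * eta_val (q @ c # p)"
        using Phi_eq[of p "q @ [c]"] p q qn w c by simp
      have "eta_val (c # p @ q) = ksgn (sdeg p) (sdeg q) * eta_val (q @ c # p)"
      proof (cases "eta_val (c # p @ q) = 0 \<and> eta_val (q @ c # p) = 0")
        case False
        have "\<exists>a b c' d j k l. c # p @ q = cyc_word a b c' d i j k l"
        proof (cases "eta_val (c # p @ q) = 0")
          case True
          then obtain a b c' d i' j k l where *: "q @ c # p = cyc_word a b c' d i' j k l"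
            using False eta_val_nonzero by metis
          obtain q' where q': "q = Eta i' # q'" using * qn by (cases q) (auto simp: cyc_word_def)
          have "(\<forall>g\<in>set q'. \<not> is_eta g) \<or> (\<exists>u m v. q' = u @ Eta m # v \<and> (\<forall>g\<in>set u. \<not> is_eta g))"
          proof -
            obtain u v where "q' = u @ v" "\<forall>g\<in>set u. \<not> is_eta g" "v = [] \<or> is_eta (hd v)"
              by (rule eta_split)
            then show ?thesis by (cases v) (auto simp: is_eta_def)
          qed
          then have nq': "\<forall>g\<in>set q'. \<not> is_eta g"
          proof
            assume "\<exists>u m v. q' = u @ Eta m # v \<and> (\<forall>g\<in>set u. \<not> is_eta g)"
            then obtain u m v where u: "q' = u @ Eta m # v" by blast
            \<comment> \<open>A word on which the functional is nonzero contains two etas, and these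
              are already the head of q and c.\<close>
            have "length (filter is_eta (q @ c # p)) = 2"
              unfolding * by (simp add: cyc_word_def massey_word_def)
            then show ?thesis unfolding q' u c by simp
          qed
          have "Eta i' # q' @ (c # p) = cyc_word a b c' d i' j k l" using * q' by simp
          from cyc_word_split[OF this nq'] have "(c # p) @ Eta i' # q' = cyc_word c' d a b k l i' j"
            using c by simp
          then have "c # p @ q = cyc_word c' d a b k l i' j" using q' by simp
          moreover from this have "k = i" using c by (simp add: cyc_word_def)
          ultimately show ?thesis by blast
        next
          case False
          then obtain a b c' d i' j k l where *: "c # p @ q = cyc_word a b c' d i' j k l"
            using eta_val_nonzero by metis
          moreover from this have "i' = i" using c by (simp add: cyc_word_def)
          ultimately show ?thesis by blast
        qed
        then obtain a b c' d j k l where *: "c # p @ q = cyc_word a b c' d i j k l" by blast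
        then have **: "q @ c # p = cyc_word c' d a b k l i j"
          unfolding c using p q qn by (intro cyc_word_split) auto
        have "sdeg p = - 1 \<and> sdeg q = - 1"
        proof -
          have "takeWhile (\<lambda>g. \<not> is_eta g) (p @ q) = p"
            using p q qn by (cases q) (auto simp: takeWhile_append takeWhile_eq_all_conv[THEN iffD2])
          moreover have "takeWhile (\<lambda>g. \<not> is_eta g) (p @ q) = replicate d (Xi ObY) @ Theta j # replicate c' (Xi ObX)"
            using * by (simp add: cyc_word_def massey_word_def takeWhile_append)
          ultimately have "p = replicate d (Xi ObY) @ Theta j # replicate c' (Xi ObX)" by simp
          then have "sdeg p = - 1" by simp
          moreover have "sdeg (c # p @ q) = - 2" unfolding * by (rule cyc_word_props)
          ultimately show ?thesis using c by simp
        qed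
        then show ?thesis unfolding * ** eta_val T_skew[of c' d a b] by (simp add: ksgn_def)
      qed simp
      then show ?thesis using 1 2 w c by simp
    qed
  qed
qed

lemma Phi_nonzero:
  assumes "Phi w \<noteq> 0"
  shows "cyc_composable w \<and> no_id w \<and> sdeg w = - 2"
proof -
  obtain p q where w: "w = p @ q" and p: "\<forall>g\<in>set p. \<not> is_eta g" and q: "q = [] \<or> is_eta (hd q)"
    by (rule eta_split)
  then have "eta_val (q @ p) \<noteq> 0" using assms Phi_eq[OF p q] by auto
  then obtain a b c d i j k l where *: "q @ p = cyc_word a b c d i j k l" by (rule eta_val_nonzero)
  from cyc_word_props[of a b c d i j k l] have "cyc_composable (q @ p)" "no_id (q @ p)" "sdeg (q @ p) = - 2"
    unfolding * by auto
  then show ?thesis using cyc_composable_append[of q p] w by (simp add: add.commute conj_commute)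
qed

text \<open>The components are chosen so that pairing with c gives \<open>Phi (c # w)\<close>. Arity
  2 is separate because the prescribed product is not part of the data T.\<close>

definition basis_op :: "'n gen list \<Rightarrow> ('n, 'r) mor" where
  "basis_op w = (if length w = 2 then comp_bas (w ! 0) (w ! 1) else if length w \<le> 1 then 0
     else (\<chi> h. psgn (int (deg (dual h)) - 1) * Phi (dual h # w)))"

definition op :: "('n, 'r) ops" where
  "op = mext basis_op"

lemma psgn_square [simp]: "psgn p * (psgn p * x) = (x :: 'r)"
  by (simp add: psgn_def)

lemma basis_op_ge3:
  assumes "length w \<ge> 3"
  shows "pairing (bas c) (basis_op w) = Phi (c # w)"
  using assms by (simp add: basis_op_def pairing_bas_left del: dual_simps(4))

lemma comp_bas_props:
  "src g \<noteq> tgt h \<Longrightarrow> comp_bas g h = (0 :: ('n, 'r) mor)"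
  "(comp_bas g h :: ('n, 'r) mor) $ x \<noteq> 0 \<Longrightarrow>
     src x = src h \<and> tgt x = tgt g \<and> deg x = deg g + deg h"
  by (cases g; cases h; auto split: if_splits)+

lemma comp_bas_cyclic:
  assumes "src c = tgt b" "src b = tgt g" "src g = tgt c"
  shows "pairing (bas c) (comp_bas b g) =
    (- 1) ^ ((deg c + 1) * red_deg [b, g]) * (pairing (bas b) (comp_bas g c) :: 'r)"
  using assms
  by (cases c; cases b; cases g; simp add: red_deg_def pairing_bas_left psgn_def)

lemma op_bas [simp]: "op (map bas w) = basis_op w"
  by (simp add: op_def)

lemma multilinear_op: "multilinear_ops op"
  unfolding op_def by (rule multilinear_mext)

text \<open>Cyclicity is \<open>comp_bas_cyclic\<close> in arity 2 and \<open>Phi_rotate\<close>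
  above; composability, degrees and unitality in higher arity all come from
  \<open>Phi_nonzero\<close>.\<close>

lemma pre_structure_op: "pre_structure op"
proof
  show "graded_ops 2 op"
    unfolding graded_ops_def
  proof (intro conjI allI impI multilinear_op)
    fix gs :: "'n gen list"
    have nz: "cyc_composable (dual h # gs) \<and> sdeg (dual h # gs) = - 2"
      if "basis_op gs $ h \<noteq> 0" "length gs > 2" for h
    proof -
      have "Phi (dual h # gs) \<noteq> 0" using that by (auto simp: basis_op_def)
      then show ?thesis using Phi_nonzero by blast
    qed
    show "op (map bas gs) = 0" if "\<not> composable gs"
    proof (cases "length gs = 2")
      case True
      then obtain g h where "gs = [g, h]" by (auto simp: length_Suc_conv numeral_2_eq_2)
      then show ?thesis
        using that comp_bas_props(1)[of g h] unfolding op_bas by (simp add: basis_op_def composable_def)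
    next
      case False
      have "basis_op gs $ h = 0" for h
      proof (rule ccontr)
        assume h: "basis_op gs $ h \<noteq> 0"
        then have "length gs > 2" using False by (auto simp: basis_op_def split: if_splits)
        from nz[OF h this] this that show False
          by (cases gs) (auto simp: cyc_composable_def composable_Cons)
      qed
      then show ?thesis by (simp add: vec_eq_iff)
    qed
    fix h
    assume c: "composable gs" and "op (map bas gs) $ h \<noteq> 0"
    then have h: "basis_op gs $ h \<noteq> 0" by simp
    have "src h = src (last gs) \<and> tgt h = tgt (hd gs) \<and> int (deg h) = sdeg gs + 2"
    proof (cases "length gs = 2")
      case True
      then obtain g g' where "gs = [g, g']" by (auto simp: length_Suc_conv numeral_2_eq_2)
      then show ?thesis using h comp_bas_props(2)[of g g' h] by (simp add: basis_op_def)
    next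
      case False
      then have "length gs > 2" using h by (auto simp: basis_op_def split: if_splits)
      from nz[OF h this] this show ?thesis
        by (cases h; cases gs) (auto simp: cyc_composable_def composable_Cons)
    qed
    then show "src h = src (last gs)" "tgt h = tgt (hd gs)"
      "int (deg h) = (\<Sum>g\<leftarrow>gs. int (deg g)) + 2 - int (length gs)"
      by (simp_all add: sum_deg_eq_sdeg)
  qed
  show "minimal_ops op"
    unfolding minimal_ops_def
  proof
    fix a
    have "op [a] $ h = 0" for h
      by (rule mlin_zero_all[OF multilinear_mlin[OF multilinear_op]]) (simp add: basis_op_def)
    then show "op [a] = 0" by (simp add: vec_eq_iff)
  qed
  show "extends_product op"
    unfolding extends_product_def using op_bas[of "[_, _]"] by (simp add: basis_op_def)
  show "strictly_unital_ops op"
    unfolding strictly_unital_ops_def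
  proof (intro allI impI, elim conjE)
    fix as :: "('n, 'r) mor list" and Z
    assume "length as \<noteq> 2" "bas (Id Z) \<in> set as"
    have "op as $ h = 0" for h
    proof (rule mlin_member[OF multilinear_mlin[OF multilinear_op] \<open>bas (Id Z) \<in> set as\<close>])
      fix gs :: "'n gen list" assume gs: "length gs = length as" "Id Z \<in> set gs"
      have "Phi (c # gs) = 0" for c
        using Phi_nonzero[of "c # gs"] gs(2) by (auto simp: no_id_def)
      then show "op (map bas gs) $ h = 0"
        using gs(1) \<open>length as \<noteq> 2\<close> by (simp add: basis_op_def)
    qed
    then show "op as = 0" by (simp add: vec_eq_iff)
  qed
  show "cyclic_ops op"
    unfolding cyclic_ops_def
  proof (intro allI impI)
    fix c b and gs :: "'n gen list"
    assume cyc: "cyc_composable (c # b # gs)"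
    consider "gs = []" | g where "gs = [g]" | "length gs \<ge> 2"
      by (cases gs; cases "tl gs") auto
    then show "pairing (bas c) (op (map bas (b # gs))) =
      (- 1) ^ ((deg c + 1) * red_deg (b # gs)) * pairing (bas b) (op (map bas (gs @ [c])))"
    proof cases
      case 2
      have "pairing (bas c) (comp_bas b g) = (- 1) ^ ((deg c + 1) * red_deg [b, g]) *
          (pairing (bas b) (comp_bas g c) :: 'r)"
        using cyc unfolding 2 by (intro comp_bas_cyclic) (simp_all add: cyc_composable_def composable_def)
      then show ?thesis unfolding op_bas 2 by (simp add: basis_op_def)
    next
      case 3
      have sg: "(- 1) ^ ((deg c + 1) * red_deg (b # gs)) =
          (ksgn (int (deg c) - 1) (sdeg (b # gs)) :: 'r)"
        using even_red_deg[of "b # gs"] by (auto simp: ksgn_def)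
      show ?thesis
        unfolding op_bas sg using 3 Phi_rotate[of c "b # gs"] by (simp add: basis_op_ge3)
    qed (use op_bas[of "[_]"] in \<open>simp add: basis_op_def\<close>)
  qed
qed

lemma S_op: "pre_structure.S op a b c d i j k l = T a b c d i j k l"
proof -
  interpret pre_structure op by (rule pre_structure_op)
  have "- S a b c d i j k l = Phi (cyc_word a b c d i j k l)"
    unfolding pairing_Mb_massey[symmetric] op_bas
    by (subst basis_op_ge3) (simp_all add: cyc_word_def massey_word_def)
  also have "\<dots> = - T a b c d i j k l"
    using Phi_eq[of "[]" "cyc_word a b c d i j k l"] by (simp add: eta_val) (simp add: cyc_word_def)
  finally show ?thesis by simp
qed

end

lemma pre_structure_exists:
  fixes s :: "'n::finite \<Rightarrow> 'n \<Rightarrow> 'n \<Rightarrow> 'n \<Rightarrow> (2 + 2, 'r::comm_ring_1) mps"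
  assumes skew: "\<forall>i j k l. s k l i j = - ren (vars4 2 1 2 1) (s i j k l)"
  obtains M where "pre_structure M" "massey_r M = polar_part + regular_part s"
proof -
  define mk :: "nat \<Rightarrow> nat \<Rightarrow> nat \<Rightarrow> nat \<Rightarrow> 2 + 2 \<Rightarrow> nat" where
    "mk a b c d = case_sum (\<lambda>i. if i = 1 then a else c) (\<lambda>i. if i = 1 then b else d)" for a b c d
  have mk: "mk (e (Inl 1)) (e (Inr 1)) (e (Inl 2)) (e (Inr 2)) = e" for e
    by (simp add: mk_def fun_eq_iff all_22)
  interpret massey_data "\<lambda>a b c d i j k l. coef (s i j k l) (mk a b c d)"
  proof
    fix a b c d i j k l
    have "range (vars4 2 1 2 (1 :: 2)) = UNIV" unfolding range_vars4 UNIV_22 by auto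
    moreover have "mk c d a b \<circ> vars4 2 1 2 1 = mk a b c d"
      by (simp add: mk_def fun_eq_iff all_22)
    ultimately have "coef (ren (vars4 2 1 2 1) (s i j k l)) (mk c d a b) = coef (s i j k l) (mk a b c d)"
      by (simp add: ren.rep_eq)
    then show "coef (s k l i j) (mk c d a b) = - coef (s i j k l) (mk a b c d)"
      by (subst skew[rule_format]) simp
  qed
  interpret pre_structure op by (rule pre_structure_op)
  have "ms i j k l = s i j k l" for i j k l
    by (rule mps_eqI) (simp add: coef_ms S_op mk)
  then have "ms = s" by (intro ext)
  then show thesis using that[OF pre_structure_op] massey_r_eq by simp
qed

theorem bij_massey_r:
  "bij_betw massey_r (ainf_structures :: ('n::finite, 'r::comm_ring_1) ops set) AYBE_solutions"
proof (rule bij_betwI')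
  show "massey_r M = massey_r M' \<longleftrightarrow> M = M'" if "M \<in> ainf_structures" "M' \<in> ainf_structures"
    for M M' :: "('n, 'r) ops"
    using that pre_structure_eqI[of M M'] by (auto simp: ainf_structures_iff)
  show "massey_r M \<in> AYBE_solutions" if "M \<in> ainf_structures" for M :: "('n, 'r) ops"
  proof -
    interpret pre_structure M using that by (simp add: ainf_structures_iff)
    have "has_polar_form (massey_r M)"
      unfolding has_polar_form_iff using massey_r_eq by blast
    moreover have "skew_symmetric (massey_r M)"
      unfolding massey_r_eq polar_skew by (rule ms_skew)
    moreover have "general_AYBE (massey_r M)"
      using that ainf_iff_AYBE by (simp add: ainf_structures_iff)
    ultimately show ?thesis by (simp add: AYBE_solutions_def)
  qed
  show "\<exists>M\<in>ainf_structures. r = massey_r M" if r: "r \<in> AYBE_solutions" for r :: "('n, (2, 'r) mero) mat2"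
  proof -
    obtain s where s: "r = polar_part + regular_part s"
      using r unfolding AYBE_solutions_def has_polar_form_iff by blast
    have skew: "\<forall>i j k l. s k l i j = - ren (vars4 2 1 2 1) (s i j k l)"
      using r unfolding s polar_skew[symmetric] by (simp add: AYBE_solutions_def)
    obtain M where M: "pre_structure M" "massey_r M = r"
      by (rule pre_structure_exists[OF skew]) (simp add: s)
    interpret pre_structure M by (rule M)
    have "general_AYBE r" using r by (simp add: AYBE_solutions_def)
    then have "M \<in> ainf_structures"
      using M ainf_iff_AYBE by (simp add: ainf_structures_iff)
    then show ?thesis using M(2) by blast
  qed
qed

section \<open>Functors as gauge transformations\<close>

section \<open>The components of a cyclic functor\<close>

lemma sum_atMost_swap: "(\<Sum>m\<le>n. f m (n - m)) = (\<Sum>m\<le>(n::nat). f (n - m) m)"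
  by (rule sum.reindex_bij_witness[of _ "\<lambda>i. n - i" "\<lambda>i. n - i"]) auto

section \<open>The cyclicity relations between the components\<close>

lemma pairing_components:
  fixes x y :: "'n::finite \<Rightarrow> 'r::comm_ring_1"
  shows "pairing (\<Sum>p\<in>UNIV. x p *s bas (Eta p)) (\<Sum>p\<in>UNIV. y p *s bas (Theta p)) = (\<Sum>p\<in>UNIV. x p * y p)"
  "pairing (\<Sum>p\<in>UNIV. y p *s bas (Theta p)) (\<Sum>p\<in>UNIV. x p *s bas (Eta p)) = - (\<Sum>p\<in>UNIV. y p * x p)"
  by (simp_all add: pairing_sum_left pairing_sum_right if_distrib sum_negf mult.commute cong: if_cong)

lemma sum_atMost_one: "(\<Sum>m\<le>n. if m = Suc 0 then f m else 0) = (if n = 0 then 0 else f (Suc 0) :: 'a::comm_monoid_add)"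
proof (cases n)
  case (Suc k)
  then show ?thesis by simp
qed simp

text \<open>The values possible on words with at most one theta and one eta. The cyclic sums are
  needed twice, for a given functor and for the one built from a gauge transformation, hence the
  common locale.\<close>

locale word_components =
  fixes E :: "'n::finite gen list \<Rightarrow> ('n, 'r::comm_ring_1) mor"
    and tc ec :: "'n \<Rightarrow> 'n \<Rightarrow> nat \<Rightarrow> nat \<Rightarrow> 'r"
    and xc yc :: "nat \<Rightarrow> nat \<Rightarrow> nat \<Rightarrow> 'n \<Rightarrow> 'n \<Rightarrow> 'r"
  assumes E_theta: "E (replicate b (Xi ObY) @ Theta j # replicate a (Xi ObX)) = (\<Sum>p\<in>UNIV. tc p j a b *s bas (Theta p))"
    and E_eta: "E (replicate a (Xi ObX) @ Eta j # replicate b (Xi ObY)) = (\<Sum>p\<in>UNIV. ec p j a b *s bas (Eta p))"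
    and E_idX: "E (replicate i (Xi ObX) @ Eta k # replicate b (Xi ObY) @ Theta l # replicate m (Xi ObX)) =
      xc i b m k l *s bas (Id ObX)"
    and E_idY: "E (replicate i (Xi ObY) @ Theta k # replicate b (Xi ObX) @ Eta l # replicate m (Xi ObY)) =
      yc i b m k l *s bas (Id ObY)"
    and E_run: "E (replicate i (Xi Z)) = (if i = 1 then bas (Xi Z) else 0)"
begin

text \<open>A cut contributes if it separates a single xi at one end from a word whose value is an
  identity, or if it falls between the eta and the theta.\<close>

lemma ssum_X:
  "ssum (\<lambda>u v. pairing (E u) (E v)) (replicate i (Xi ObX) @ Eta k # replicate b (Xi ObY) @ Theta l # replicate j (Xi ObX)) =
    (if i = 0 then 0 else xc (i - 1) b j k l) - (if j = 0 then 0 else xc i b (j - 1) k l) +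
    (\<Sum>m\<le>b. \<Sum>p\<in>UNIV. ec p k i m * tc p l j (b - m))" (is "ssum _ ?w = _")
proof -
  have "ssum (\<lambda>u v. pairing (E u) (E v)) ?w =
     (\<Sum>m\<le>i. pairing (E (replicate m (Xi ObX))) (E (replicate (i - m) (Xi ObX) @ Eta k # replicate b (Xi ObY) @
        Theta l # replicate j (Xi ObX)))) +
     ((\<Sum>m\<le>b. pairing (E (replicate i (Xi ObX) @ Eta k # replicate m (Xi ObY)))
        (E (replicate (b - m) (Xi ObY) @ Theta l # replicate j (Xi ObX)))) +
     (\<Sum>m\<le>j. pairing (E (replicate i (Xi ObX) @ Eta k # replicate b (Xi ObY) @ Theta l # replicate m (Xi ObX)))
        (E (replicate (j - m) (Xi ObX)))))"
    unfolding ssum_run ssum_replicate ..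
  moreover have "(\<Sum>m\<le>i. pairing (E (replicate m (Xi ObX))) (E (replicate (i - m) (Xi ObX) @ Eta k # replicate b (Xi ObY) @
        Theta l # replicate j (Xi ObX)))) = (if i = 0 then 0 else xc (i - 1) b j k l)"
  proof -
    have "pairing (E (replicate m (Xi ObX))) (E (replicate (i - m) (Xi ObX) @ Eta k # replicate b (Xi ObY) @
        Theta l # replicate j (Xi ObX))) = (if m = Suc 0 then xc (i - m) b j k l else 0)" for m
      unfolding E_run E_idX by simp
    then show ?thesis by (simp only: sum_atMost_one) simp
  qed
  moreover have "(\<Sum>m\<le>j. pairing (E (replicate i (Xi ObX) @ Eta k # replicate b (Xi ObY) @ Theta l # replicate m (Xi ObX)))
        (E (replicate (j - m) (Xi ObX)))) = - (if j = 0 then 0 else xc i b (j - 1) k l)"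
  proof -
    have "pairing (E (replicate i (Xi ObX) @ Eta k # replicate b (Xi ObY) @ Theta l # replicate (j - m) (Xi ObX)))
        (E (replicate m (Xi ObX))) = (if m = Suc 0 then - xc i b (j - m) k l else 0)" for m
      unfolding E_run E_idX by simp
    then show ?thesis
      unfolding sum_atMost_swap[of "\<lambda>m m'. pairing (E (replicate i (Xi ObX) @ Eta k # replicate b (Xi ObY) @ Theta l #
        replicate m (Xi ObX))) (E (replicate m' (Xi ObX)))"] by (simp only: sum_atMost_one) simp
  qed
  ultimately show ?thesis
    unfolding E_eta E_theta pairing_components by (simp add: algebra_simps)
qed

lemma ssum_Y:
  "ssum (\<lambda>u v. pairing (E u) (E v)) (replicate i (Xi ObY) @ Theta k # replicate b (Xi ObX) @ Eta l # replicate j (Xi ObY)) =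
    (if i = 0 then 0 else yc (i - 1) b j k l) - (if j = 0 then 0 else yc i b (j - 1) k l) -
    (\<Sum>m\<le>b. \<Sum>p\<in>UNIV. tc p k m i * ec p l (b - m) j)" (is "ssum _ ?w = _")
proof -
  have "ssum (\<lambda>u v. pairing (E u) (E v)) ?w =
     (\<Sum>m\<le>i. pairing (E (replicate m (Xi ObY))) (E (replicate (i - m) (Xi ObY) @ Theta k # replicate b (Xi ObX) @
        Eta l # replicate j (Xi ObY)))) +
     ((\<Sum>m\<le>b. pairing (E (replicate i (Xi ObY) @ Theta k # replicate m (Xi ObX)))
        (E (replicate (b - m) (Xi ObX) @ Eta l # replicate j (Xi ObY)))) +
     (\<Sum>m\<le>j. pairing (E (replicate i (Xi ObY) @ Theta k # replicate b (Xi ObX) @ Eta l # replicate m (Xi ObY)))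
        (E (replicate (j - m) (Xi ObY)))))"
    unfolding ssum_run ssum_replicate ..
  moreover have "(\<Sum>m\<le>i. pairing (E (replicate m (Xi ObY))) (E (replicate (i - m) (Xi ObY) @ Theta k # replicate b (Xi ObX) @
        Eta l # replicate j (Xi ObY)))) = (if i = 0 then 0 else yc (i - 1) b j k l)"
  proof -
    have "pairing (E (replicate m (Xi ObY))) (E (replicate (i - m) (Xi ObY) @ Theta k # replicate b (Xi ObX) @
        Eta l # replicate j (Xi ObY))) = (if m = Suc 0 then yc (i - m) b j k l else 0)" for m
      unfolding E_run E_idY by simp
    then show ?thesis by (simp only: sum_atMost_one) simp
  qed
  moreover have "(\<Sum>m\<le>j. pairing (E (replicate i (Xi ObY) @ Theta k # replicate b (Xi ObX) @ Eta l # replicate m (Xi ObY)))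
        (E (replicate (j - m) (Xi ObY)))) = - (if j = 0 then 0 else yc i b (j - 1) k l)"
  proof -
    have "pairing (E (replicate i (Xi ObY) @ Theta k # replicate b (Xi ObX) @ Eta l # replicate (j - m) (Xi ObY)))
        (E (replicate m (Xi ObY))) = (if m = Suc 0 then - yc i b (j - m) k l else 0)" for m
      unfolding E_run E_idY by simp
    then show ?thesis
      unfolding sum_atMost_swap[of "\<lambda>m m'. pairing (E (replicate i (Xi ObY) @ Theta k # replicate b (Xi ObX) @ Eta l #
        replicate m (Xi ObY))) (E (replicate m' (Xi ObY)))"] by (simp only: sum_atMost_one) simp
  qed
  ultimately show ?thesis
    unfolding E_eta E_theta pairing_components by (simp add: algebra_simps sum_negf)
qed

end

context cyclic_map
begin

abbreviation Fb :: "'n gen list \<Rightarrow> ('n, 'r) mor" where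
  "Fb w \<equiv> F (map bas w)"

text \<open>Row and column index come first, then the exponents of x and y; \<open>ge\<close> has
  the same convention. In \<open>hX\<close> and \<open>hY\<close> the first and third arguments are
  the lengths of the two outer runs.\<close>

definition ft :: "'n \<Rightarrow> 'n \<Rightarrow> nat \<Rightarrow> nat \<Rightarrow> 'r" where
  "ft p j a b = Fb (replicate b (Xi ObY) @ Theta j # replicate a (Xi ObX)) $ Theta p"

definition ge :: "'n \<Rightarrow> 'n \<Rightarrow> nat \<Rightarrow> nat \<Rightarrow> 'r" where
  "ge p j a b = Fb (replicate a (Xi ObX) @ Eta j # replicate b (Xi ObY)) $ Eta p"

definition hX :: "nat \<Rightarrow> nat \<Rightarrow> nat \<Rightarrow> 'n \<Rightarrow> 'n \<Rightarrow> 'r" where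
  "hX i b j k l = Fb (replicate i (Xi ObX) @ Eta k # replicate b (Xi ObY) @ Theta l # replicate j (Xi ObX)) $ Id ObX"

definition hY :: "nat \<Rightarrow> nat \<Rightarrow> nat \<Rightarrow> 'n \<Rightarrow> 'n \<Rightarrow> 'r" where
  "hY i b j k l = Fb (replicate i (Xi ObY) @ Theta k # replicate b (Xi ObX) @ Eta l # replicate j (Xi ObY)) $ Id ObY"

lemma Fb_eqI:
  assumes "w \<noteq> []" "\<And>h. shape h = (src (last w), tgt (hd w), sdeg w) \<Longrightarrow> Fb w $ h = x $ h"
    "\<And>h. shape h \<noteq> (src (last w), tgt (hd w), sdeg w) \<Longrightarrow> x $ h = 0"
  shows "Fb w = x"
proof -
  have "Fb w $ h = 0" if "shape h \<noteq> (src (last w), tgt (hd w), sdeg w)" for h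
    using F_homog[OF assms(1)] assms(1) that
    by (auto simp: homog_def tot_shape_def hd_map last_map shape_def)
  then show ?thesis using assms by (metis vec_eq_iff)
qed

lemma Fb_theta:
  "Fb (replicate b (Xi ObY) @ Theta j # replicate a (Xi ObX)) = (\<Sum>p\<in>UNIV. ft p j a b *s bas (Theta p))" (is "Fb ?w = ?x")
proof (rule Fb_eqI)
  have w: "src (last ?w) = ObX" "tgt (hd ?w) = ObY" "sdeg ?w = - 1"
    by (auto simp: hd_append last_replicate)
  show "Fb ?w $ h = ?x $ h" if sh: "shape h = (src (last ?w), tgt (hd ?w), sdeg ?w)" for h
  proof -
    obtain p where "h = Theta p" using sh unfolding w by (auto simp: shape_cases)
    then show ?thesis by (simp add: ft_def sum_component if_distrib cong: if_cong)
  qed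
  show "?x $ h = 0" if "shape h \<noteq> (src (last ?w), tgt (hd ?w), sdeg ?w)" for h
    using that unfolding w by (auto simp: sum_component shape_def intro!: sum.neutral)
qed simp

lemma Fb_eta:
  "Fb (replicate a (Xi ObX) @ Eta j # replicate b (Xi ObY)) = (\<Sum>p\<in>UNIV. ge p j a b *s bas (Eta p))" (is "Fb ?w = ?x")
proof (rule Fb_eqI)
  have w: "src (last ?w) = ObY" "tgt (hd ?w) = ObX" "sdeg ?w = 0"
    by (auto simp: hd_append last_replicate)
  show "Fb ?w $ h = ?x $ h" if sh: "shape h = (src (last ?w), tgt (hd ?w), sdeg ?w)" for h
  proof -
    obtain p where "h = Eta p" using sh unfolding w by (auto simp: shape_cases)
    then show ?thesis by (simp add: ge_def sum_component if_distrib cong: if_cong)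
  qed
  show "?x $ h = 0" if "shape h \<noteq> (src (last ?w), tgt (hd ?w), sdeg ?w)" for h
    using that unfolding w by (auto simp: sum_component shape_def intro!: sum.neutral)
qed simp

lemma Fb_idX:
  "Fb (replicate i (Xi ObX) @ Eta k # replicate b (Xi ObY) @ Theta l # replicate j (Xi ObX)) =
    hX i b j k l *s bas (Id ObX)" (is "Fb ?w = ?x")
proof (rule Fb_eqI)
  have w: "src (last ?w) = ObX" "tgt (hd ?w) = ObX" "sdeg ?w = - 1"
    by (auto simp: hd_append last_replicate)
  show "Fb ?w $ h = ?x $ h" if "shape h = (src (last ?w), tgt (hd ?w), sdeg ?w)" for h
    using that unfolding w by (auto simp: shape_cases hX_def)
  show "?x $ h = 0" if "shape h \<noteq> (src (last ?w), tgt (hd ?w), sdeg ?w)" for h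
    using that unfolding w by (auto simp: shape_def)
qed simp

lemma Fb_idY:
  "Fb (replicate i (Xi ObY) @ Theta k # replicate b (Xi ObX) @ Eta l # replicate j (Xi ObY)) =
    hY i b j k l *s bas (Id ObY)" (is "Fb ?w = ?x")
proof (rule Fb_eqI)
  have w: "src (last ?w) = ObY" "tgt (hd ?w) = ObY" "sdeg ?w = - 1"
    by (auto simp: hd_append last_replicate)
  show "Fb ?w $ h = ?x $ h" if "shape h = (src (last ?w), tgt (hd ?w), sdeg ?w)" for h
    using that unfolding w by (auto simp: shape_cases hY_def)
  show "?x $ h = 0" if "shape h \<noteq> (src (last ?w), tgt (hd ?w), sdeg ?w)" for h
    using that unfolding w by (auto simp: shape_def)
qed simp

lemma Fb_massey: "Fb (massey_word a b c d l k j) = 0"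
proof (rule Fb_eqI)
  fix h :: "'n gen"
  assume "shape h = (src (last (massey_word a b c d l k j)), tgt (hd (massey_word a b c d l k j)),
      sdeg (massey_word a b c d l k j))"
  then have "sdeg (massey_word a b c d l k j) = int (deg h) - 1" by (simp add: shape_def)
  then show "Fb (massey_word a b c d l k j) $ h = 0 $ h"
    by (simp add: massey_word_def)
qed (simp_all add: massey_word_def)

text \<open>By degree the value is a multiple of xi, detected by the identity. It is xi itself for
  one letter since the pairing is preserved, and 0 for more letters by cyclicity. So a block inside
  a run contributes only if it is a single letter.\<close>

lemma Fb_run: "Fb (replicate i (Xi Z)) = (if i = 1 then bas (Xi Z) else 0)"
proof -
  have *: "Fb w = pairing (bas (Id Z)) (Fb w) *s (- bas (Xi Z))"
    if w: "w = replicate i (Xi Z)" "i > 0" for w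
  proof (rule Fb_eqI)
    have e: "src (last w) = Z" "tgt (hd w) = Z" "sdeg w = 0"
      using w by auto
    show "w \<noteq> []" using w by auto
    show "Fb w $ h = (pairing (bas (Id Z)) (Fb w) *s (- bas (Xi Z))) $ h"
      if "shape h = (src (last w), tgt (hd w), sdeg w)" for h
      using that unfolding e by (cases Z) (auto simp: shape_cases pairing_bas_left)
    show "(pairing (bas (Id Z)) (Fb w) *s (- bas (Xi Z))) $ h = 0"
      if "shape h \<noteq> (src (last w), tgt (hd w), sdeg w)" for h
      using that unfolding e by (auto simp: shape_def)
  qed
  consider "i = 0" | "i = 1" | "i \<ge> 2" by linarith
  then show ?thesis
  proof cases
    case 2
    have "pairing (bas (Id Z)) (F [bas (Xi Z)]) = - 1"
      using F_pairing[of "bas (Id Z)" "bas (Xi Z)"] by (simp add: F_Id)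
    then show ?thesis using *[of "[Xi Z]"] 2 by (simp add: vec_eq_iff)
  next
    case 3
    have "pairing (bas (Id Z)) (Fb (replicate i (Xi Z))) = 0"
      by (rule pairing_Id_F) (use 3 in simp)
    then show ?thesis using *[of "replicate i (Xi Z)"] 3 by simp
  qed simp
qed

interpretation components: word_components Fb ft ge hX hY
  by unfold_locales (rule Fb_theta Fb_eta Fb_idX Fb_idY Fb_run)+

text \<open>Cyclicity of F on words from X to X. The right-hand side is the contribution of the word
  of two letters, where the pairing is preserved instead.\<close>

lemma cyclic_X:
  "(if i = 0 then 0 else hX (i - 1) b j k l) - (if j = 0 then 0 else hX i b (j - 1) k l) +
    (\<Sum>m\<le>b. \<Sum>p\<in>UNIV. ge p k i m * ft p l j (b - m)) = (if i = 0 \<and> b = 0 \<and> j = 0 then kd k l else 0)"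
proof -
  let ?w = "replicate i (Xi ObX) @ Eta k # replicate b (Xi ObY) @ Theta l # replicate j (Xi ObX)"
  have "ssum (\<lambda>u v. pairing (Fb u) (Fb v)) ?w = (if i = 0 \<and> b = 0 \<and> j = 0 then kd k l else 0)"
  proof (cases "i = 0 \<and> b = 0 \<and> j = 0")
    case True
    then show ?thesis using F_pairing[of "bas (Eta k)" "bas (Theta l)"] by (simp add: kd_def)
  next
    case False
    then have "length ?w \<ge> 3" by auto
    from F_cyclic_bas[OF this] show ?thesis unfolding ssum_map by (simp only: False if_False)
  qed
  then show ?thesis by (simp only: components.ssum_X)
qed

lemma cyclic_Y:
  "(if i = 0 then 0 else hY (i - 1) b j k l) - (if j = 0 then 0 else hY i b (j - 1) k l) -
    (\<Sum>m\<le>b. \<Sum>p\<in>UNIV. ft p k m i * ge p l (b - m) j) = - (if i = 0 \<and> b = 0 \<and> j = 0 then kd k l else 0)"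
proof -
  let ?w = "replicate i (Xi ObY) @ Theta k # replicate b (Xi ObX) @ Eta l # replicate j (Xi ObY)"
  have "ssum (\<lambda>u v. pairing (Fb u) (Fb v)) ?w = - (if i = 0 \<and> b = 0 \<and> j = 0 then kd k l else 0)"
  proof (cases "i = 0 \<and> b = 0 \<and> j = 0")
    case True
    then show ?thesis using F_pairing[of "bas (Theta k)" "bas (Eta l)"] by (simp add: kd_def)
  next
    case False
    then have "length ?w \<ge> 3" by auto
    from F_cyclic_bas[OF this] show ?thesis unfolding ssum_map by (simp only: False if_False minus_zero)
  qed
  then show ?thesis by (simp only: components.ssum_Y)
qed

section \<open>Evaluating the functor equation\<close>

context
  fixes K :: "('n, 'r) mor list \<Rightarrow> 'r"
  assumes K: "mlin K"
begin

text \<open>By \<open>Fb_run\<close> a contributing decomposition starts with m single letters xi,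
  followed by the block that contains g.\<close>

lemma bsum_run_letter:
  "bsum (\<lambda>bs. K (us @ map Fb bs)) (replicate d (Xi Z) @ g # w) =
    (\<Sum>m\<le>d. ssum (\<lambda>u v. bsum (\<lambda>bs. K (us @ replicate m (bas (Xi Z)) @ Fb (replicate (d - m) (Xi Z) @ g # u) #
      map Fb bs)) v) w)"
proof (induction d arbitrary: us)
  case 0
  show ?case by (subst bsum_Cons) simp_all
next
  case (Suc d)
  have z: "K (us @ Fb (Xi Z # replicate i (Xi Z)) # vs) = (if i = 0 then K ((us @ [bas (Xi Z)]) @ vs) else 0)" for i vs
    using Fb_run[of "Suc i" Z] mlin_zero[OF K] by simp
  have "bsum (\<lambda>bs. K (us @ map Fb bs)) (replicate (Suc d) (Xi Z) @ g # w) =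
      ssum (\<lambda>u v. bsum (\<lambda>bs. K (us @ Fb (Xi Z # u) # map Fb bs)) v) (replicate d (Xi Z) @ g # w)"
    by (subst bsum_Cons) simp_all
  also have "\<dots> = (\<Sum>i\<le>d. bsum (\<lambda>bs. K (us @ Fb (Xi Z # replicate i (Xi Z)) # map Fb bs)) (replicate (d - i) (Xi Z) @ g # w)) +
      ssum (\<lambda>u v. bsum (\<lambda>bs. K (us @ Fb (Xi Z # replicate d (Xi Z) @ g # u) # map Fb bs)) v) w"
    by (rule ssum_run)
  also have "(\<Sum>i\<le>d. bsum (\<lambda>bs. K (us @ Fb (Xi Z # replicate i (Xi Z)) # map Fb bs)) (replicate (d - i) (Xi Z) @ g # w)) =
      (\<Sum>i\<le>d. if i = 0 then bsum (\<lambda>bs. K ((us @ [bas (Xi Z)]) @ map Fb bs)) (replicate d (Xi Z) @ g # w) else 0)"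
    unfolding z by (rule sum.cong) auto
  also have "\<dots> = bsum (\<lambda>bs. K ((us @ [bas (Xi Z)]) @ map Fb bs)) (replicate d (Xi Z) @ g # w)"
    by simp
  also have "\<dots> + ssum (\<lambda>u v. bsum (\<lambda>bs. K (us @ Fb (Xi Z # replicate d (Xi Z) @ g # u) # map Fb bs)) v) w =
      (\<Sum>m\<le>Suc d. ssum (\<lambda>u v. bsum (\<lambda>bs. K (us @ replicate m (bas (Xi Z)) @ Fb (replicate (Suc d - m) (Xi Z) @ g # u) #
      map Fb bs)) v) w)"
    unfolding Suc sum.atMost_Suc_shift by (simp add: add.commute)
  finally show ?case .
qed

lemma bsum_run: "bsum (\<lambda>bs. K (us @ map Fb bs)) (replicate d (Xi Z)) = K (us @ replicate d (bas (Xi Z)))"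
proof (induction d arbitrary: us)
  case (Suc d)
  have z: "K (us @ Fb (Xi Z # replicate i (Xi Z)) # vs) = (if i = 0 then K ((us @ [bas (Xi Z)]) @ vs) else 0)" for i vs
    using Fb_run[of "Suc i" Z] mlin_zero[OF K] by simp
  have "bsum (\<lambda>bs. K (us @ map Fb bs)) (replicate (Suc d) (Xi Z)) =
      ssum (\<lambda>u v. bsum (\<lambda>bs. K (us @ Fb (Xi Z # u) # map Fb bs)) v) (replicate d (Xi Z))"
    by (subst bsum_Cons) simp_all
  also have "\<dots> = (\<Sum>i\<le>d. bsum (\<lambda>bs. K (us @ Fb (Xi Z # replicate i (Xi Z)) # map Fb bs)) (replicate (d - i) (Xi Z)))"
    by (rule ssum_replicate)
  also have "\<dots> = (\<Sum>i\<le>d. if i = 0 then bsum (\<lambda>bs. K ((us @ [bas (Xi Z)]) @ map Fb bs)) (replicate d (Xi Z)) else 0)"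
    unfolding z by (rule sum.cong) auto
  also have "\<dots> = K (us @ replicate (Suc d) (bas (Xi Z)))"
    using Suc[of "us @ [bas (Xi Z)]"] by simp
  finally show ?case .
qed simp

lemma bsum_theta:
  "bsum (\<lambda>bs. K (us @ map Fb bs)) (replicate b (Xi ObY) @ Theta l # replicate a (Xi ObX)) =
    (\<Sum>m\<le>b. \<Sum>n\<le>a. K (us @ replicate m (bas (Xi ObY)) @ Fb (replicate (b - m) (Xi ObY) @ Theta l # replicate n (Xi ObX)) #
      replicate (a - n) (bas (Xi ObX))))"
  unfolding bsum_run_letter ssum_replicate
  using bsum_run[of "us @ replicate _ (bas (Xi ObY)) @ [Fb _]"]
  by (simp del: map_append list.map map_replicate)

lemma bsum_eta_theta:
  "bsum (\<lambda>bs. K (us @ map Fb bs)) (replicate c (Xi ObX) @ Eta k # replicate b (Xi ObY) @ Theta l # replicate a (Xi ObX)) =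
    (\<Sum>m\<le>c. (\<Sum>n\<le>b. bsum (\<lambda>bs. K ((us @ replicate m (bas (Xi ObX)) @ [Fb (replicate (c - m) (Xi ObX) @ Eta k # replicate n (Xi ObY))]) @
      map Fb bs)) (replicate (b - n) (Xi ObY) @ Theta l # replicate a (Xi ObX))) +
    (\<Sum>n\<le>a. K (us @ replicate m (bas (Xi ObX)) @ Fb (replicate (c - m) (Xi ObX) @ Eta k # replicate b (Xi ObY) @ Theta l #
      replicate n (Xi ObX)) # replicate (a - n) (bas (Xi ObX)))))"
proof -
  have "bsum (\<lambda>bs. K (us @ map Fb bs)) (replicate c (Xi ObX) @ Eta k # replicate b (Xi ObY) @ Theta l # replicate a (Xi ObX)) =
    (\<Sum>m\<le>c. ssum (\<lambda>u v. bsum (\<lambda>bs. K (us @ replicate m (bas (Xi ObX)) @ Fb (replicate (c - m) (Xi ObX) @ Eta k # u) #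
      map Fb bs)) v) (replicate b (Xi ObY) @ Theta l # replicate a (Xi ObX)))"
    by (rule bsum_run_letter)
  then show ?thesis
    unfolding ssum_run ssum_replicate
    using bsum_run[of "us @ replicate _ (bas (Xi ObX)) @ [Fb _]"]
    by (simp del: map_append list.map map_replicate)
qed

text \<open>No block containing both thetas appears: its value would have reduced degree -2.\<close>

lemma bsum_massey:
  "bsum (\<lambda>bs. K (us @ map Fb bs)) (massey_word a b c d l k j) =
    (\<Sum>m\<le>d. (\<Sum>n\<le>c. bsum (\<lambda>bs. K ((us @ replicate m (bas (Xi ObY)) @ [Fb (replicate (d - m) (Xi ObY) @ Theta j # replicate n (Xi ObX))]) @
      map Fb bs)) (replicate (c - n) (Xi ObX) @ Eta k # replicate b (Xi ObY) @ Theta l # replicate a (Xi ObX))) +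
    (\<Sum>n\<le>b. bsum (\<lambda>bs. K ((us @ replicate m (bas (Xi ObY)) @ [Fb (replicate (d - m) (Xi ObY) @ Theta j # replicate c (Xi ObX) @
      Eta k # replicate n (Xi ObY))]) @ map Fb bs)) (replicate (b - n) (Xi ObY) @ Theta l # replicate a (Xi ObX))))"
proof -
  have z: "Fb (replicate m (Xi ObY) @ Theta j # replicate c (Xi ObX) @ Eta k # replicate b (Xi ObY) @ Theta l # replicate n (Xi ObX)) = 0" for m n
    using Fb_massey[of n b c m l k j] by (simp add: massey_word_def)
  have z': "K (us @ vs @ 0 # ws) = 0" for vs ws
    using mlin_zero[OF K, of "us @ vs"] by simp
  have "bsum (\<lambda>bs. K (us @ map Fb bs)) (massey_word a b c d l k j) =
    (\<Sum>m\<le>d. ssum (\<lambda>u v. bsum (\<lambda>bs. K (us @ replicate m (bas (Xi ObY)) @ Fb (replicate (d - m) (Xi ObY) @ Theta j # u) #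
      map Fb bs)) v) (replicate c (Xi ObX) @ Eta k # replicate b (Xi ObY) @ Theta l # replicate a (Xi ObX)))"
    unfolding massey_word_def append_Cons append_Nil by (rule bsum_run_letter)
  then show ?thesis
    unfolding ssum_run ssum_replicate z z' by (simp del: map_append list.map map_replicate)
qed

end

end

lemma sum_nat_UNIV_swap:
  "(\<Sum>i\<le>(m::nat). \<Sum>p\<in>(UNIV :: 'n::finite set). f i p) = (\<Sum>p\<in>UNIV. \<Sum>i\<le>m. f i p :: 'a::comm_monoid_add)"
  by (rule sum.swap)

lemma mlin_lincomb:
  "mlin K \<Longrightarrow> K (us @ (\<Sum>p\<in>UNIV. x p *s y (p::'i::finite)) # vs) = (\<Sum>p\<in>UNIV. x p * K (us @ y p # vs))"
  by (simp add: mlin_sum mlin_scale)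

text \<open>Brings the sums over block boundaries into the order in which the coefficients of a
  product of four series are expanded.\<close>

lemma sum_reorder:
  fixes f :: "nat \<Rightarrow> nat \<Rightarrow> nat \<Rightarrow> nat \<Rightarrow> nat \<Rightarrow> nat \<Rightarrow> nat \<Rightarrow> nat \<Rightarrow> nat \<Rightarrow> nat \<Rightarrow> 'a::comm_monoid_add"
  shows "(\<Sum>m\<le>d. \<Sum>n\<le>c. \<Sum>m2\<le>c - n. \<Sum>n2\<le>b. \<Sum>m3\<le>b - n2. \<Sum>n3\<le>a.
      f m (d - m) n m2 (c - n - m2) n2 m3 (b - n2 - m3) n3 (a - n3)) =
    (\<Sum>m\<le>c. \<Sum>n\<le>d. \<Sum>m'\<le>m. \<Sum>n'\<le>b. \<Sum>a'\<le>a. \<Sum>b'\<le>n'.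
      f n (d - n) (c - m) m' (m - m') (b - n') b' (n' - b') (a - a') a')"
proof -
  have "(\<Sum>m\<le>d. \<Sum>n\<le>c. \<Sum>m2\<le>c - n. \<Sum>n2\<le>b. \<Sum>m3\<le>b - n2. \<Sum>n3\<le>a.
      f m (d - m) n m2 (c - n - m2) n2 m3 (b - n2 - m3) n3 (a - n3)) =
    (\<Sum>m\<le>d. \<Sum>n\<le>c. \<Sum>m2\<le>n. \<Sum>n2\<le>b. \<Sum>m3\<le>b - n2. \<Sum>n3\<le>a.
      f m (d - m) (c - n) m2 (n - m2) n2 m3 (b - n2 - m3) n3 (a - n3))"
    by (rule sum.cong[OF refl],
        rule sum_atMost_swap[of "\<lambda>n n'. \<Sum>m2\<le>n'. \<Sum>n2\<le>b. \<Sum>m3\<le>b - n2. \<Sum>n3\<le>a. f _ _ n m2 (n' - m2) n2 m3 (b - n2 - m3) n3 (a - n3)"])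
  also have "\<dots> = (\<Sum>n\<le>c. \<Sum>m\<le>d. \<Sum>m2\<le>n. \<Sum>n2\<le>b. \<Sum>m3\<le>b - n2. \<Sum>n3\<le>a.
      f m (d - m) (c - n) m2 (n - m2) n2 m3 (b - n2 - m3) n3 (a - n3))"
    by (rule sum.swap)
  also have "\<dots> = (\<Sum>n\<le>c. \<Sum>m\<le>d. \<Sum>m2\<le>n. \<Sum>n2\<le>b. \<Sum>m3\<le>n2. \<Sum>n3\<le>a.
      f m (d - m) (c - n) m2 (n - m2) (b - n2) m3 (n2 - m3) n3 (a - n3))"
    by (rule sum.cong[OF refl], rule sum.cong[OF refl], rule sum.cong[OF refl], 
        rule sum_atMost_swap[of "\<lambda>n2 n2'. \<Sum>m3\<le>n2'. \<Sum>n3\<le>a. f _ _ _ _ _ n2 m3 (n2' - m3) n3 (a - n3)"])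
  also have "\<dots> = (\<Sum>n\<le>c. \<Sum>m\<le>d. \<Sum>m2\<le>n. \<Sum>n2\<le>b. \<Sum>n3\<le>a. \<Sum>m3\<le>n2.
      f m (d - m) (c - n) m2 (n - m2) (b - n2) m3 (n2 - m3) n3 (a - n3))"
    by (rule sum.cong[OF refl], rule sum.cong[OF refl], rule sum.cong[OF refl], rule sum.cong[OF refl], rule sum.swap)
  also have "\<dots> = (\<Sum>n\<le>c. \<Sum>m\<le>d. \<Sum>m2\<le>n. \<Sum>n2\<le>b. \<Sum>n3\<le>a. \<Sum>m3\<le>n2.
      f m (d - m) (c - n) m2 (n - m2) (b - n2) m3 (n2 - m3) (a - n3) n3)"
    by (rule sum.cong[OF refl], rule sum.cong[OF refl], rule sum.cong[OF refl], rule sum.cong[OF refl], 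
        rule sum_atMost_swap[of "\<lambda>n3 n3'. \<Sum>m3\<le>_. f _ _ _ _ _ _ m3 (_ - m3) n3 n3'"])
  finally show ?thesis .
qed

lemma coef_mult_vars2:
  fixes f :: "(2 + 2, 'r::comm_ring_1) mps"
  shows "coef (f * ren (vars2 i j) g) e = (\<Sum>m\<le>e (Inl i). \<Sum>n\<le>e (Inr j).
    coef f (e(Inl i := m, Inr j := n)) * coef g (e(Inl i := e (Inl i) - m, Inr j := e (Inr j) - n) \<circ> vars2 i j))"
  using coef_ren_mult[of id "vars2 i j" "Inl i" "Inr j" f g e] by (simp add: range_vars2)

lemma coef_mult_11:
  fixes f g :: "(1 + 1, 'r::comm_ring_1) mps"
  shows "coef (f * g) e = (\<Sum>m\<le>e (Inl 1). \<Sum>n\<le>e (Inr 1).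
    coef f (e(Inl 1 := m, Inr 1 := n)) * coef g (e(Inl 1 := e (Inl 1) - m, Inr 1 := e (Inr 1) - n)))"
proof -
  have "UNIV = {Inl 1 :: 1 + 1, Inr 1}" using all_11[of "\<lambda>v. v \<in> {Inl 1, Inr 1}"] by auto
  then show ?thesis
    using coef_ren_mult[of "id :: 1 + 1 \<Rightarrow> 1 + 1" id "Inl 1" "Inr 1" f g e] by simp
qed

context cyclic_map
begin

lemma M'_theta_comp:
  "M' (replicate m (bas (Xi ObY)) @ bas (Theta p) # replicate m2 (bas (Xi ObX)) @ bas (Id ObX) # replicate e (bas (Xi ObX))) $ Theta v =
    (if m = 0 then if m2 = 0 then if e = 0 then kd v p else 0 else 0 else 0)"
  "M' (replicate m (bas (Xi ObY)) @ bas (Id ObY) # replicate m3 (bas (Xi ObY)) @ bas (Theta p) # replicate e (bas (Xi ObX))) $ Theta v =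
    (if m = 0 then if m3 = 0 then if e = 0 then kd v p else 0 else 0 else 0)"
proof -
  have z: "length as \<noteq> 2 \<Longrightarrow> bas (Id Z) \<in> set as \<Longrightarrow> M' as = 0" for as Z
    using M'.un unfolding strictly_unital_ops_def by blast
  have c: "M' [bas (Id ObY), bas (Theta t)] = bas (Theta t)" "M' [bas (Theta t), bas (Id ObX)] = bas (Theta t)" for t
    using M'.ex by (simp_all add: extends_product_def)
  show "M' (replicate m (bas (Xi ObY)) @ bas (Theta p) # replicate m2 (bas (Xi ObX)) @ bas (Id ObX) # replicate e (bas (Xi ObX))) $ Theta v =
    (if m = 0 then if m2 = 0 then if e = 0 then kd v p else 0 else 0 else 0)"
  proof (cases "m = 0 \<and> m2 = 0 \<and> e = 0")
    case False
    then show ?thesis by (subst z[of _ ObX]) auto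
  qed (use c in \<open>simp add: kd_def\<close>)
  show "M' (replicate m (bas (Xi ObY)) @ bas (Id ObY) # replicate m3 (bas (Xi ObY)) @ bas (Theta p) # replicate e (bas (Xi ObX))) $ Theta v =
    (if m = 0 then if m3 = 0 then if e = 0 then kd v p else 0 else 0 else 0)"
  proof (cases "m = 0 \<and> m3 = 0 \<and> e = 0")
    case False
    then show ?thesis by (subst z[of _ ObY]) auto
  qed (use c in \<open>simp add: kd_def\<close>)
qed

lemma M'_massey:
  "M' (replicate m (bas (Xi ObY)) @ bas (Theta p) # replicate m2 (bas (Xi ObX)) @ bas (Eta q) #
     replicate m3 (bas (Xi ObY)) @ bas (Theta r) # replicate e (bas (Xi ObX))) $ Theta v = - M'.S e m3 m2 m v p q r"
  using arg_cong[OF M'.Mb_theta[of e m3 m2 m r q p], of "\<lambda>x. x $ Theta v"]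
  by (simp add: massey_word_def sum_component if_distrib cong: if_cong)

text \<open>Either theta, eta and theta lie in three blocks, or the eta shares a block with one
  theta. In the latter case that block has an identity as value and only the binary product with the
  other theta survives.\<close>

lemma L_massey:
  "L (massey_word a b c d l k j) $ Theta v =
    - (\<Sum>p\<in>UNIV. \<Sum>q\<in>UNIV. \<Sum>r\<in>UNIV. \<Sum>m\<le>c. \<Sum>n\<le>d. \<Sum>m'\<le>m. \<Sum>n'\<le>b. \<Sum>a'\<le>a. \<Sum>b'\<le>n'.
        ft p j (c - m) (d - n) * (ge q k (m - m') (b - n') * (ft r l (a - a') (n' - b') * M'.S a' b' m' n v p q r)))
    + (\<Sum>n\<le>c. ft v j n d * hX (c - n) b a k l) + (\<Sum>n\<le>b. hY d c n j k * ft v l a (b - n))"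
proof -
  define K where "K as = M' as $ Theta v" for as
  have mK: "mlin K" unfolding K_def by (rule multilinear_mlin[OF M'.ml])
  have L: "L w $ Theta v = bsum (\<lambda>bs. K ([] @ map Fb bs)) w" for w
    unfolding L_def by (subst bsum_hom[of "\<lambda>x. x $ Theta v"]) (simp_all add: K_def)
  have k1: "K (((([] @ replicate m (bas (Xi ObY)) @ [Fb (replicate m1 (Xi ObY) @ Theta j # replicate n (Xi ObX))]) @
      replicate m2 (bas (Xi ObX)) @ [Fb (replicate r2 (Xi ObX) @ Eta k # replicate n2 (Xi ObY))]) @
      replicate m3 (bas (Xi ObY)) @ Fb (replicate r3 (Xi ObY) @ Theta l # replicate n3 (Xi ObX)) # replicate e (bas (Xi ObX)))) =
    - (\<Sum>p\<in>UNIV. \<Sum>q\<in>UNIV. \<Sum>r\<in>UNIV. ft p j n m1 * (ge q k r2 n2 * (ft r l n3 r3 * M'.S e m3 m2 m v p q r)))"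
    for m m1 n m2 r2 n2 m3 r3 n3 e
  proof -
    have lc1: "K (replicate m (bas (Xi ObY)) @ bas (Theta p) # replicate m2 (bas (Xi ObX)) @ (\<Sum>q\<in>UNIV. x q *s bas (Eta q)) # vs) =
        (\<Sum>q\<in>UNIV. x q * K (replicate m (bas (Xi ObY)) @ bas (Theta p) # replicate m2 (bas (Xi ObX)) @ bas (Eta q) # vs))"
      for p vs and x :: "'n \<Rightarrow> 'r"
      using mlin_lincomb[OF mK, of "replicate m (bas (Xi ObY)) @ bas (Theta p) # replicate m2 (bas (Xi ObX))" x "\<lambda>q. bas (Eta q)" vs]
      by (simp only: append_assoc append_Cons)
    have lc2: "K (replicate m (bas (Xi ObY)) @ bas (Theta p) # replicate m2 (bas (Xi ObX)) @ bas (Eta q) #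
          replicate m3 (bas (Xi ObY)) @ (\<Sum>r\<in>UNIV. x r *s bas (Theta r)) # vs) =
        (\<Sum>r\<in>UNIV. x r * K (replicate m (bas (Xi ObY)) @ bas (Theta p) # replicate m2 (bas (Xi ObX)) @ bas (Eta q) #
          replicate m3 (bas (Xi ObY)) @ bas (Theta r) # vs))"
      for p q vs and x :: "'n \<Rightarrow> 'r"
      using mlin_lincomb[OF mK, of "replicate m (bas (Xi ObY)) @ bas (Theta p) # replicate m2 (bas (Xi ObX)) @ bas (Eta q) # replicate m3 (bas (Xi ObY))"
          x "\<lambda>r. bas (Theta r)" vs]
      by (simp only: append_assoc append_Cons)
    have "K (((([] @ replicate m (bas (Xi ObY)) @ [Fb (replicate m1 (Xi ObY) @ Theta j # replicate n (Xi ObX))]) @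
      replicate m2 (bas (Xi ObX)) @ [Fb (replicate r2 (Xi ObX) @ Eta k # replicate n2 (Xi ObY))]) @
      replicate m3 (bas (Xi ObY)) @ Fb (replicate r3 (Xi ObY) @ Theta l # replicate n3 (Xi ObX)) # replicate e (bas (Xi ObX)))) =
      (\<Sum>p\<in>UNIV. ft p j n m1 * (\<Sum>q\<in>UNIV. ge q k r2 n2 * (\<Sum>r\<in>UNIV. ft r l n3 r3 *
        K (replicate m (bas (Xi ObY)) @ bas (Theta p) # replicate m2 (bas (Xi ObX)) @ bas (Eta q) #
          replicate m3 (bas (Xi ObY)) @ bas (Theta r) # replicate e (bas (Xi ObX))))))"
      unfolding Fb_theta Fb_eta append_Nil append_assoc append_Cons mlin_lincomb[OF mK] lc1 lc2 ..
    then show ?thesis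
      unfolding K_def M'_massey by (simp add: sum_negf sum_distrib_left)
  qed
  have k2: "K (([] @ replicate m (bas (Xi ObY)) @ [Fb (replicate m1 (Xi ObY) @ Theta j # replicate n (Xi ObX))]) @
      replicate m2 (bas (Xi ObX)) @ Fb (replicate r2 (Xi ObX) @ Eta k # replicate b (Xi ObY) @ Theta l # replicate n2 (Xi ObX)) #
      replicate e (bas (Xi ObX))) =
      (if e = 0 then if m2 = 0 then if m = 0 then ft v j n m1 * hX r2 b n2 k l else 0 else 0 else 0)"
    for m m1 n m2 r2 n2 e
  proof -
    have "K (([] @ replicate m (bas (Xi ObY)) @ [Fb (replicate m1 (Xi ObY) @ Theta j # replicate n (Xi ObX))]) @
      replicate m2 (bas (Xi ObX)) @ Fb (replicate r2 (Xi ObX) @ Eta k # replicate b (Xi ObY) @ Theta l # replicate n2 (Xi ObX)) #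
      replicate e (bas (Xi ObX))) =
      (\<Sum>p\<in>UNIV. ft p j n m1 * (hX r2 b n2 k l *
        K (replicate m (bas (Xi ObY)) @ bas (Theta p) # replicate m2 (bas (Xi ObX)) @ bas (Id ObX) # replicate e (bas (Xi ObX)))))"
      unfolding Fb_theta Fb_idX append_Nil append_assoc append_Cons mlin_lincomb[OF mK]
      using mlin_scale[OF mK, of "replicate m (bas (Xi ObY)) @ bas (Theta _) # replicate m2 (bas (Xi ObX))"]
      by (simp only: append_Nil append_assoc append_Cons)
    also have "\<dots> = (\<Sum>p\<in>UNIV. kd v p * (if e = 0 then if m2 = 0 then if m = 0 then ft p j n m1 * hX r2 b n2 k l else 0 else 0 else 0))"
      unfolding K_def M'_theta_comp by (rule sum.cong) auto
    finally show ?thesis unfolding kd_sum .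
  qed
  have k3: "K (([] @ replicate m (bas (Xi ObY)) @ [Fb (replicate m1 (Xi ObY) @ Theta j # replicate c (Xi ObX) @ Eta k # replicate n (Xi ObY))]) @
      replicate m3 (bas (Xi ObY)) @ Fb (replicate r3 (Xi ObY) @ Theta l # replicate n3 (Xi ObX)) # replicate e (bas (Xi ObX))) =
      (if e = 0 then if m3 = 0 then if m = 0 then hY m1 c n j k * ft v l n3 r3 else 0 else 0 else 0)"
    for m m1 n m3 r3 n3 e
  proof -
    have "K (([] @ replicate m (bas (Xi ObY)) @ [Fb (replicate m1 (Xi ObY) @ Theta j # replicate c (Xi ObX) @ Eta k # replicate n (Xi ObY))]) @
      replicate m3 (bas (Xi ObY)) @ Fb (replicate r3 (Xi ObY) @ Theta l # replicate n3 (Xi ObX)) # replicate e (bas (Xi ObX))) =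
      hY m1 c n j k * (\<Sum>p\<in>UNIV. ft p l n3 r3 *
        K (replicate m (bas (Xi ObY)) @ bas (Id ObY) # replicate m3 (bas (Xi ObY)) @ bas (Theta p) # replicate e (bas (Xi ObX))))"
      unfolding Fb_theta Fb_idY append_Nil append_assoc append_Cons mlin_scale[OF mK]
      using mlin_lincomb[OF mK, of "replicate m (bas (Xi ObY)) @ bas (Id ObY) # replicate m3 (bas (Xi ObY))"
          "\<lambda>p. ft p l n3 r3" "\<lambda>p. bas (Theta p)" "replicate e (bas (Xi ObX))"]
      by (simp only: append_Nil append_assoc append_Cons)
    also have "\<dots> = (\<Sum>p\<in>UNIV. kd v p * (if e = 0 then if m3 = 0 then if m = 0 then hY m1 c n j k * ft p l n3 r3 else 0 else 0 else 0))"
      unfolding K_def M'_theta_comp sum_distrib_left by (rule sum.cong) auto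
    finally show ?thesis unfolding kd_sum .
  qed
  have z: "(\<Sum>i\<le>n. if i = 0 then f i else 0) = (f 0 :: 'r)" for n :: nat and f by simp
  have z': "(\<Sum>m\<le>n. if P then f m else 0) = (if P then (\<Sum>m\<le>n. f m) else 0 :: 'r)" for n :: nat and f P
    by simp
  have "L (massey_word a b c d l k j) $ Theta v =
    (\<Sum>m\<le>d. (\<Sum>n\<le>c. \<Sum>m2\<le>c - n. (\<Sum>n2\<le>b. \<Sum>m3\<le>b - n2. \<Sum>n3\<le>a.
        - (\<Sum>p\<in>UNIV. \<Sum>q\<in>UNIV. \<Sum>r\<in>UNIV. ft p j n (d - m) * (ge q k (c - n - m2) n2 * (ft r l n3 (b - n2 - m3) *
          M'.S (a - n3) m3 m2 m v p q r)))) +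
      (\<Sum>n2\<le>a. if a - n2 = 0 then if m2 = 0 then if m = 0 then ft v j n (d - m) * hX (c - n - m2) b n2 k l else 0 else 0 else 0)) +
     (\<Sum>n\<le>b. \<Sum>m3\<le>b - n. \<Sum>n3\<le>a. if a - n3 = 0 then if m3 = 0 then if m = 0 then
        hY (d - m) c n j k * ft v l n3 (b - n - m3) else 0 else 0 else 0))"
    unfolding L bsum_massey[OF mK] bsum_eta_theta[OF mK] bsum_theta[OF mK] k1 k2 k3 ..
  also have "\<dots> = - (\<Sum>m\<le>d. \<Sum>n\<le>c. \<Sum>m2\<le>c - n. \<Sum>n2\<le>b. \<Sum>m3\<le>b - n2. \<Sum>n3\<le>a.
        \<Sum>p\<in>UNIV. \<Sum>q\<in>UNIV. \<Sum>r\<in>UNIV. ft p j n (d - m) * (ge q k (c - n - m2) n2 * (ft r l n3 (b - n2 - m3) *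
          M'.S (a - n3) m3 m2 m v p q r))) +
      (\<Sum>m\<le>d. \<Sum>n\<le>c. \<Sum>m2\<le>c - n. if m2 = 0 then if m = 0 then ft v j n (d - m) * hX (c - n - m2) b a k l else 0 else 0) +
      (\<Sum>m\<le>d. \<Sum>n\<le>b. \<Sum>m3\<le>b - n. if m3 = 0 then if m = 0 then hY (d - m) c n j k * ft v l a (b - n - m3) else 0 else 0)"
    unfolding sum_atMost_last sum.distrib sum_negf by (simp only: add.assoc)
  also have "\<dots> = - (\<Sum>m\<le>d. \<Sum>n\<le>c. \<Sum>m2\<le>c - n. \<Sum>n2\<le>b. \<Sum>m3\<le>b - n2. \<Sum>n3\<le>a.
        \<Sum>p\<in>UNIV. \<Sum>q\<in>UNIV. \<Sum>r\<in>UNIV. ft p j n (d - m) * (ge q k (c - n - m2) n2 * (ft r l n3 (b - n2 - m3) *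
          M'.S (a - n3) m3 m2 m v p q r))) +
      (\<Sum>n\<le>c. ft v j n d * hX (c - n) b a k l) + (\<Sum>n\<le>b. hY d c n j k * ft v l a (b - n))"
    unfolding z z' by (simp only: diff_zero)
  also have "(\<Sum>m\<le>d. \<Sum>n\<le>c. \<Sum>m2\<le>c - n. \<Sum>n2\<le>b. \<Sum>m3\<le>b - n2. \<Sum>n3\<le>a.
        \<Sum>p\<in>UNIV. \<Sum>q\<in>UNIV. \<Sum>r\<in>UNIV. ft p j n (d - m) * (ge q k (c - n - m2) n2 * (ft r l n3 (b - n2 - m3) *
          M'.S (a - n3) m3 m2 m v p q r))) =
     (\<Sum>p\<in>UNIV. \<Sum>q\<in>UNIV. \<Sum>r\<in>UNIV. \<Sum>m\<le>d. \<Sum>n\<le>c. \<Sum>m2\<le>c - n. \<Sum>n2\<le>b. \<Sum>m3\<le>b - n2. \<Sum>n3\<le>a.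
        ft p j n (d - m) * (ge q k (c - n - m2) n2 * (ft r l n3 (b - n2 - m3) * M'.S (a - n3) m3 m2 m v p q r)))"
    by (simp only: sum_nat_UNIV_swap)
  also have "\<dots> = (\<Sum>p\<in>UNIV. \<Sum>q\<in>UNIV. \<Sum>r\<in>UNIV. \<Sum>m\<le>c. \<Sum>n\<le>d. \<Sum>m'\<le>m. \<Sum>n'\<le>b. \<Sum>a'\<le>a. \<Sum>b'\<le>n'.
        ft p j (c - m) (d - n) * (ge q k (m - m') (b - n') * (ft r l (a - a') (n' - b') * M'.S a' b' m' n v p q r)))"
    by (rule sum.cong[OF refl], rule sum.cong[OF refl], rule sum.cong[OF refl], 
        rule sum_reorder[where f = "\<lambda>m dm n m2 r2 n2 m3 r3 n3 an. ft _ j n dm * (ge _ k r2 n2 * (ft _ l n3 r3 * M'.S an m3 m2 m v _ _ _))"])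
  finally show ?thesis .
qed

text \<open>The two inner binary products lengthen a run by one xi; an inner theta eta theta
  collapses to a theta, on which F is again given by \<open>ft\<close>.\<close>

lemma I_massey:
  "I (massey_word a b c d l k j) $ Theta v =
    (if c = 0 then kd j k * ft v l a (Suc (d + b)) else 0)
    - (\<Sum>i\<le>d. \<Sum>m\<le>a. \<Sum>p\<in>UNIV. M.S m b c (d - i) p j k l * ft v p (a - m) i)
    + (if b = 0 then kd k l * ft v j (Suc (c + a)) d else 0)"
proof -
  define H where "H p x q = psgn (sdeg q) * F (map bas p @ x # map bas q) $ Theta v" for p x q
  have H0: "H p 0 q = 0" for p q
    by (simp add: H_def multilinear_zero[OF Fml])
  have Hs: "H p (t *s bas g) q = psgn (sdeg q) * (t * Fb (p @ g # q) $ Theta v)" for p t g q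
    by (simp add: H_def multilinear_scale[OF Fml])
  have Hm: "H p (\<Sum>i\<in>UNIV. t i *s bas (g i)) q =
      psgn (sdeg q) * (\<Sum>i\<in>UNIV. t i * Fb (p @ g i # q) $ Theta v)" for p t q and g :: "'n \<Rightarrow> 'n gen"
    by (simp add: H_def multilinear_sum[OF Fml] multilinear_scale[OF Fml] sum_component)
  have ftw: "Fb (replicate b (Xi ObY) @ Theta t # replicate a (Xi ObX)) $ Theta v = ft v t a b" for a b t
    by (simp add: ft_def)
  have m1: "replicate e (Xi ObY) @ Xi ObY # replicate b (Xi ObY) @ w = replicate (Suc (e + b)) (Xi ObY) @ w" for e b w
    by (simp add: replicate_add replicate_snoc)
  have m2: "replicate e (Xi ObX) @ Xi ObX # replicate b (Xi ObX) = replicate (Suc (e + b)) (Xi ObX)" for e b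
    by (simp add: replicate_add replicate_snoc)
  have "I (massey_word a b c d l k j) $ Theta v =
      ssum (\<lambda>p r. ssum (\<lambda>z q. H p (M.Mb z) q) r) (massey_word a b c d l k j)"
    unfolding insertion_sum_ssum'[where M = M, OF Fml graded_Nil[OF M.gr]] H_def
    by (subst ssum_hom[of "\<lambda>x. x $ Theta v"], simp, subst ssum_hom[of "\<lambda>x. x $ Theta v"]) simp_all
  also have "\<dots> =
      (\<Sum>i\<le>d. ssum (\<lambda>z q. H (replicate i (Xi ObY)) (M.Mb z) q) (massey_word a b c (d - i) l k j)) +
      ((\<Sum>i\<le>c. ssum (\<lambda>z q. H (replicate d (Xi ObY) @ Theta j # replicate i (Xi ObX)) (M.Mb z) q)
        (replicate (c - i) (Xi ObX) @ Eta k # replicate b (Xi ObY) @ Theta l # replicate a (Xi ObX))) +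
      ((\<Sum>i\<le>b. ssum (\<lambda>z q. H (replicate d (Xi ObY) @ Theta j # replicate c (Xi ObX) @ Eta k # replicate i (Xi ObY)) (M.Mb z) q)
        (replicate (b - i) (Xi ObY) @ Theta l # replicate a (Xi ObX))) +
      (\<Sum>i\<le>a. ssum (\<lambda>z q. H (replicate d (Xi ObY) @ Theta j # replicate c (Xi ObX) @ Eta k # replicate b (Xi ObY) @ Theta l #
        replicate i (Xi ObX)) (M.Mb z) q) (replicate (a - i) (Xi ObX)))))"
    unfolding massey_word_def append_Cons append_Nil append_assoc ssum_run ssum_replicate
    by (simp only: append_Cons append_Nil append_assoc)
  also have "\<dots> = ((if c = 0 then H (replicate d (Xi ObY)) (M.Mb [Theta j, Eta k]) (replicate b (Xi ObY) @ Theta l # replicate a (Xi ObX)) else 0) +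
      (\<Sum>i\<le>d. \<Sum>m\<le>a. H (replicate i (Xi ObY)) (M.Mb (massey_word m b c (d - i) l k j)) (replicate (a - m) (Xi ObX)))) +
      (if b = 0 then H (replicate d (Xi ObY) @ Theta j # replicate c (Xi ObX)) (M.Mb [Eta k, Theta l]) (replicate a (Xi ObX)) else 0)"
    unfolding M.sub_massey[of "H _", OF H0] M.sub_eta_theta[of "H _", OF H0] M.sub_theta[of "H _", OF H0]
      ssum_replicate M.Mb_run H0 sum.distrib sum_if_left sum.neutral_const add_0_right ..
  finally show ?thesis
    unfolding M.Mb_comp M.Mb_theta Hs Hm append_Cons append_assoc m1 m2 ftw by (simp add: sum_negf)
qed

section \<open>The functor equation as a gauge equation\<close>

definition phi :: "('n, 'r) gauge" where
  "phi = (\<chi> p j. Mps (\<lambda>e. ft p j (e (Inl 1)) (e (Inr 1))))"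

definition gam :: "('n, 'r) gauge" where
  "gam = (\<chi> p j. Mps (\<lambda>e. ge p j (e (Inl 1)) (e (Inr 1))))"

text \<open>Generating series in the variables of the runs involved: those at X_2, Y_1 and X_1 here,
  those at Y_2, X_2 and Y_1 in \<open>HY\<close>.\<close>

definition HX :: "'n \<Rightarrow> 'n \<Rightarrow> (2 + 2, 'r) mps" where
  "HX k l = Mps (\<lambda>e. if e (Inr 2) = 0 then hX (e (Inl 2)) (e (Inr 1)) (e (Inl 1)) k l else 0)"

definition HY :: "'n \<Rightarrow> 'n \<Rightarrow> (2 + 2, 'r) mps" where
  "HY j k = Mps (\<lambda>e. if e (Inl 1) = 0 then hY (e (Inr 2)) (e (Inl 2)) (e (Inr 1)) j k else 0)"

abbreviation "ph i j p k \<equiv> ren (vars2 i j) (phi $ p $ k)"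
abbreviation "ga i j p k \<equiv> ren (vars2 i j) (gam $ p $ k)"

text \<open>The generating series of the defect of the functor equation on the words theta eta
  theta, by \<open>coef_FE\<close>. The transposed inverse \<open>gam\<close> appears through the
  block with the eta.\<close>

definition FE :: "'n \<Rightarrow> 'n \<Rightarrow> 'n \<Rightarrow> 'n \<Rightarrow> (2 + 2, 'r) mps" where
  "FE v j k l =
    - (\<Sum>p\<in>UNIV. \<Sum>q\<in>UNIV. \<Sum>r\<in>UNIV. M'.ms v p q r * ph 1 1 r l * ga 2 1 q k * ph 2 2 p j)
    + HX k l * ph 2 2 v j + HY j k * ph 1 1 v l
    - kd j k * ddiff (vars2 1 1) (Inr 1) (Inr 2) (phi $ v $ l)
    + (\<Sum>p\<in>UNIV. M.ms p j k l * ph 1 2 v p)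
    - kd k l * ddiff (vars2 2 2) (Inl 1) (Inl 1) (phi $ v $ j)"

lemma coef_phi: "coef (phi $ p $ j) e = ft p j (e (Inl 1)) (e (Inr 1))"
  by (simp add: phi_def)

lemma coef_gam: "coef (gam $ p $ j) e = ge p j (e (Inl 1)) (e (Inr 1))"
  by (simp add: gam_def)

lemma coef_FE:
  "coef (FE v j k l) e = D (massey_word (e (Inl 1)) (e (Inr 1)) (e (Inl 2)) (e (Inr 2)) l k j) $ Theta v"
proof -
  let ?a = "e (Inl 1)" and ?b = "e (Inr 1)" and ?c = "e (Inl 2)" and ?d = "e (Inr 2)"
  have 1: "coef (M'.ms v p q r * ph 1 1 r l * ga 2 1 q k * ph 2 2 p j) e =
      (\<Sum>m\<le>?c. \<Sum>n\<le>?d. \<Sum>m'\<le>m. \<Sum>n'\<le>?b. \<Sum>a'\<le>?a. \<Sum>b'\<le>n'.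
        ft p j (?c - m) (?d - n) * (ge q k (m - m') (?b - n') * (ft r l (?a - a') (n' - b') * M'.S a' b' m' n v p q r)))" for p q r
    unfolding coef_mult_vars2 by (simp add: coef_phi coef_gam M'.coef_ms sum_distrib_left sum_distrib_right mult_ac)
  have 2: "coef (HX k l * ph 2 2 v j) e = (\<Sum>n\<le>?c. ft v j n ?d * hX (?c - n) ?b ?a k l)"
  proof -
    have "coef (HX k l * ph 2 2 v j) e = (\<Sum>m\<le>?c. \<Sum>n\<le>?d. if n = 0 then hX m ?b ?a k l * ft v j (?c - m) ?d else 0)"
      unfolding coef_mult_vars2 by (intro sum.cong refl) (simp add: coef_phi HX_def)
    also have "\<dots> = (\<Sum>m\<le>?c. hX m ?b ?a k l * ft v j (?c - m) ?d)" by simp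
    also have "\<dots> = (\<Sum>m\<le>?c. hX (?c - m) ?b ?a k l * ft v j m ?d)"
      by (rule sum_atMost_swap)
    finally show ?thesis by (simp add: mult.commute)
  qed
  have 3: "coef (HY j k * ph 1 1 v l) e = (\<Sum>n\<le>?b. hY ?d ?c n j k * ft v l ?a (?b - n))"
  proof -
    have "coef (HY j k * ph 1 1 v l) e = (\<Sum>m\<le>?a. if m = 0 then (\<Sum>n\<le>?b. hY ?d ?c n j k * ft v l ?a (?b - n)) else 0)"
      unfolding coef_mult_vars2 by (intro sum.cong refl) (simp add: coef_phi HY_def)
    then show ?thesis by simp
  qed
  have 4: "coef (ddiff (vars2 1 1) (Inr 1) (Inr 2) (phi $ v $ l)) e = (if ?c = 0 then ft v l ?a (Suc (?d + ?b)) else 0)"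
    by (simp add: ddiff_def range_vars2 all_22 coef_phi add.commute)
  have 5: "coef (ddiff (vars2 2 2) (Inl 1) (Inl 1) (phi $ v $ j)) e = (if ?b = 0 then ft v j (Suc (?c + ?a)) ?d else 0)"
    by (simp add: ddiff_def range_vars2 all_22 coef_phi)
  have 6: "coef (M.ms p j k l * ph 1 2 v p) e = (\<Sum>i\<le>?d. \<Sum>m\<le>?a. M.S m ?b ?c (?d - i) p j k l * ft v p (?a - m) i)" for p
  proof -
    have "coef (M.ms p j k l * ph 1 2 v p) e = (\<Sum>m\<le>?a. \<Sum>n\<le>?d. M.S m ?b ?c n p j k l * ft v p (?a - m) (?d - n))"
      unfolding coef_mult_vars2 by (simp add: coef_phi M.coef_ms)
    also have "\<dots> = (\<Sum>m\<le>?a. \<Sum>n\<le>?d. M.S m ?b ?c (?d - n) p j k l * ft v p (?a - m) n)"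
      by (rule sum.cong[OF refl]) (rule sum_atMost_swap)
    also have "\<dots> = (\<Sum>i\<le>?d. \<Sum>m\<le>?a. M.S m ?b ?c (?d - i) p j k l * ft v p (?a - m) i)"
      by (rule sum.swap)
    finally show ?thesis .
  qed
  have 7: "(\<Sum>i\<le>?d. \<Sum>m\<le>?a. \<Sum>p\<in>UNIV. M.S m ?b ?c (?d - i) p j k l * ft v p (?a - m) i) =
      (\<Sum>p\<in>UNIV. \<Sum>i\<le>?d. \<Sum>m\<le>?a. M.S m ?b ?c (?d - i) p j k l * ft v p (?a - m) i)"
    by (simp only: sum_nat_UNIV_swap)
  show ?thesis
    unfolding FE_def coef_simps coef_sum coef_kd_mult 1 2 3 4 5 6 D_eq vector_minus_component L_massey I_massey 7
    by (simp add: kd_def)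
qed

lemma D_massey_zero:
  "D (massey_word a b c d l k j) = 0 \<longleftrightarrow> (\<forall>v. D (massey_word a b c d l k j) $ Theta v = 0)"
proof
  let ?w = "massey_word a b c d l k j"
  assume *: "\<forall>v. D ?w $ Theta v = 0"
  have "D ?w $ h = 0" for h
  proof (rule ccontr)
    assume h: "D ?w $ h \<noteq> 0"
    have "shape h = (ObX, ObY, - 1)"
      using D_homog[of ?w] h by (auto simp: homog_def tot_shape_def M.composable_ne hd_map last_map shape_def M.massey_word_ends)
    then show False using * h by (auto simp: shape_cases)
  qed
  then show "D ?w = 0" by (simp add: vec_eq_iff)
qed simp

lemma functor_relations_iff_FE: "functor_relations M M' F \<longleftrightarrow> (\<forall>v j k l. FE v j k l = 0)"
proof
  assume "functor_relations M M' F"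
  then have "D (massey_word a b c d l k j) = 0" for a b c d l k j
    using composable_massey[of a b c d l k j] by (simp add: functor_relations_iff_defect)
  then show "\<forall>v j k l. FE v j k l = 0"
    by (simp add: mps_eq_iff coef_FE)
next
  assume FE: "\<forall>v j k l. FE v j k l = 0"
  have "D (massey_word a b c d l k j) $ Theta v = 0" for a b c d l k j v
    using coef_FE[of v j k l "case_sum (\<lambda>i. if i = 1 then a else c) (\<lambda>i. if i = 1 then b else d)"] FE by simp
  then have "D (massey_word a b c d l k j) = 0" for a b c d l k j
    by (simp add: D_massey_zero)
  then show "functor_relations M M' F"
    unfolding functor_relations_iff by simp
qed

end

lemma sum_telescope_antidiagonal:
  fixes f :: "nat \<Rightarrow> nat \<Rightarrow> 'a::ab_group_add"
  shows "(\<Sum>i\<le>N. (if i = 0 then 0 else f (i - 1) (N - i)) - (if N - i = 0 then 0 else f i (N - i - 1))) = 0"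
proof (cases N)
  case (Suc M)
  have "(\<Sum>i\<le>N. if i = 0 then 0 else f (i - 1) (N - i)) = (\<Sum>i\<le>M. f i (M - i))"
    unfolding Suc sum.atMost_Suc_shift by simp
  moreover have "(\<Sum>i\<le>N. if N - i = 0 then 0 else f i (N - i - 1)) = (\<Sum>i\<le>M. f i (M - i))"
    unfolding Suc sum.atMost_Suc by (simp add: Suc_diff_le)
  ultimately show ?thesis by (simp only: sum_subtractf diff_self)
qed simp

lemma sum_gen_Theta:
  assumes "\<And>g :: 'n::finite gen. \<forall>t. g \<noteq> Theta t \<Longrightarrow> f g = (0 :: 'a::comm_monoid_add)"
  shows "(\<Sum>g\<in>UNIV. f g) = (\<Sum>t\<in>UNIV. f (Theta t))"
proof -
  have "(\<Sum>g\<in>UNIV. f g) = (\<Sum>g\<in>range Theta. f g)"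
    by (rule sum.mono_neutral_right) (use assms in auto)
  also have "\<dots> = (\<Sum>t\<in>UNIV. f (Theta t))"
    by (rule sum.reindex[unfolded comp_def]) (simp add: inj_def)
  finally show ?thesis .
qed

lemma coef_kd: "coef (kd i j :: ('v::finite, 'r::comm_ring_1) mps) e = (if e = (\<lambda>_. 0) then kd i j else 0)"
  by (simp add: kd_def one_mps.rep_eq)

lemma sum_mult_kd_contract:
  fixes A B x :: "'n::finite \<Rightarrow> 'n \<Rightarrow> 'a::comm_ring_1"
  assumes "\<And>p q. (\<Sum>k\<in>UNIV. A p k * B k q) = kd p q"
  shows "(\<Sum>k\<in>UNIV. A p k * (\<Sum>q\<in>UNIV. B k q * y q)) = y p"
proof -
  have "(\<Sum>k\<in>UNIV. A p k * (\<Sum>q\<in>UNIV. B k q * y q)) = (\<Sum>q\<in>UNIV. (\<Sum>k\<in>UNIV. A p k * B k q) * y q)"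
    unfolding sum_distrib_left sum_distrib_right by (subst sum.swap) (simp only: mult.assoc)
  then show ?thesis by (simp only: assms kd_sum)
qed

context cyclic_map
begin

text \<open>Multiplication by x_2 - x_1 produces exactly the two index shifts in
  \<open>cyclic_X\<close>, so \<open>HX\<close> measures how far the matrices of theta and eta at
  different x are from being inverse to each other.\<close>

lemma HX_mult:
  "(xv 2 - xv 1) * HX k l = kd k l - (\<Sum>p\<in>UNIV. ga 2 1 p k * ph 1 1 p l)"
proof (rule mps_eqI)
  fix e :: "2 + 2 \<Rightarrow> nat"
  let ?a = "e (Inl 1)" and ?b = "e (Inr 1)" and ?c = "e (Inl 2)" and ?d = "e (Inr 2)"
  have 1: "coef (ga 2 1 p k * ph 1 1 p l) e = (if ?d = 0 then \<Sum>m\<le>?b. ge p k ?c m * ft p l ?a (?b - m) else 0)" for p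
  proof -
    have "coef (ga 2 1 p k * ph 1 1 p l) e =
        (\<Sum>m\<le>?a. if m = 0 then if ?d = 0 then \<Sum>n\<le>?b. ge p k ?c n * ft p l ?a (?b - n) else 0 else 0)"
      unfolding coef_mult_vars2 by (intro sum.cong refl) (simp add: coef_phi coef_gam ren.rep_eq range_vars2 all_22)
    then show ?thesis by simp
  qed
  have 2: "(\<Sum>p\<in>UNIV. \<Sum>m\<le>?b. ge p k ?c m * ft p l ?a (?b - m)) = (\<Sum>m\<le>?b. \<Sum>p\<in>UNIV. ge p k ?c m * ft p l ?a (?b - m))"
    by (rule sum.swap)
  have L: "coef ((xv 2 - xv 1) * HX k l) e = (if ?d = 0 then
      (if ?c = 0 then 0 else hX (?c - 1) ?b ?a k l) - (if ?a = 0 then 0 else hX ?c ?b (?a - 1) k l) else 0)"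
    by (simp add: left_diff_distrib coef_mvar_mult HX_def)
  have e0: "e = (\<lambda>_. 0) \<longleftrightarrow> ?d = 0 \<and> ?c = 0 \<and> ?b = 0 \<and> ?a = 0"
    by (auto simp: fun_eq_iff all_22)
  have R: "coef (kd k l - (\<Sum>p\<in>UNIV. ga 2 1 p k * ph 1 1 p l)) e =
      (if ?d = 0 \<and> ?c = 0 \<and> ?b = 0 \<and> ?a = 0 then kd k l else 0) -
      (if ?d = 0 then \<Sum>m\<le>?b. \<Sum>p\<in>UNIV. ge p k ?c m * ft p l ?a (?b - m) else 0)"
    by (simp add: coef_sum coef_kd 1 2 e0)
  have eq: "x - y + s = t \<Longrightarrow> x - y = t - s" for x y s t :: 'r
    by (simp add: algebra_simps)
  show "coef ((xv 2 - xv 1) * HX k l) e = coef (kd k l - (\<Sum>p\<in>UNIV. ga 2 1 p k * ph 1 1 p l)) e"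
    unfolding L R eq[OF cyclic_X] by (cases "?d = 0") (simp_all only: simp_thms if_True if_False diff_self)
qed

lemma HY_mult:
  "(yv 2 - yv 1) * HY j k = (\<Sum>p\<in>UNIV. ph 2 2 p j * ga 2 1 p k) - kd j k"
proof (rule mps_eqI)
  fix e :: "2 + 2 \<Rightarrow> nat"
  let ?a = "e (Inl 1)" and ?b = "e (Inr 1)" and ?c = "e (Inl 2)" and ?d = "e (Inr 2)"
  have 1: "coef (ph 2 2 p j * ga 2 1 p k) e = (if ?a = 0 then \<Sum>m\<le>?c. ft p j m ?d * ge p k (?c - m) ?b else 0)" for p
  proof -
    have "coef (ph 2 2 p j * ga 2 1 p k) e =
        (\<Sum>m\<le>?c. \<Sum>n\<le>?b. if n = 0 then if ?a = 0 then ft p j m ?d * ge p k (?c - m) ?b else 0 else 0)"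
      unfolding coef_mult_vars2 by (intro sum.cong refl) (simp add: coef_phi coef_gam ren.rep_eq range_vars2 all_22)
    then show ?thesis by simp
  qed
  have 2: "(\<Sum>p\<in>UNIV. \<Sum>m\<le>?c. ft p j m ?d * ge p k (?c - m) ?b) = (\<Sum>m\<le>?c. \<Sum>p\<in>UNIV. ft p j m ?d * ge p k (?c - m) ?b)"
    by (rule sum.swap)
  have L: "coef ((yv 2 - yv 1) * HY j k) e = (if ?a = 0 then
      (if ?d = 0 then 0 else hY (?d - 1) ?c ?b j k) - (if ?b = 0 then 0 else hY ?d ?c (?b - 1) j k) else 0)"
    by (simp add: left_diff_distrib coef_mvar_mult HY_def)
  have e0: "e = (\<lambda>_. 0) \<longleftrightarrow> ?a = 0 \<and> ?d = 0 \<and> ?c = 0 \<and> ?b = 0"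
    by (auto simp: fun_eq_iff all_22)
  have R: "coef ((\<Sum>p\<in>UNIV. ph 2 2 p j * ga 2 1 p k) - kd j k) e =
      (if ?a = 0 then \<Sum>m\<le>?c. \<Sum>p\<in>UNIV. ft p j m ?d * ge p k (?c - m) ?b else 0) -
      (if ?a = 0 \<and> ?d = 0 \<and> ?c = 0 \<and> ?b = 0 then kd j k else 0)"
    by (simp add: coef_sum coef_kd 1 2 e0)
  have eq: "x - y - s = - t \<Longrightarrow> x - y = s - t" for x y s t :: 'r
    by (simp add: algebra_simps)
  show "coef ((yv 2 - yv 1) * HY j k) e = coef ((\<Sum>p\<in>UNIV. ph 2 2 p j * ga 2 1 p k) - kd j k) e"
    unfolding L R eq[OF cyclic_Y] by (cases "?a = 0") (simp_all only: simp_thms if_True if_False diff_self)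
qed

text \<open>The relation with both x variables equal: summing \<open>cyclic_X\<close> over i + j
  fixed makes the unknown multiples of the identity telescope away.\<close>

lemma gam_phi: "transpose gam ** phi = mat 1"
proof -
  have "coef ((transpose gam ** phi) $ k $ l) e = coef (mat 1 $ k $ l :: (1 + 1, 'r) mps) e" for k l e
  proof -
    let ?a = "e (Inl 1)" and ?b = "e (Inr 1)"
    have e0: "e = (\<lambda>_. 0) \<longleftrightarrow> ?a = 0 \<and> ?b = 0"
      by (auto simp: fun_eq_iff all_11)
    have "coef ((transpose gam ** phi) $ k $ l) e =
        (\<Sum>p\<in>UNIV. \<Sum>m\<le>?a. \<Sum>n\<le>?b. ge p k m n * ft p l (?a - m) (?b - n))"
      by (simp add: matrix_matrix_mult_def transpose_def coef_sum coef_mult_11 coef_phi coef_gam)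
    also have "\<dots> = (\<Sum>m\<le>?a. \<Sum>n\<le>?b. \<Sum>p\<in>UNIV. ge p k m n * ft p l (?a - m) (?b - n))"
      by (simp only: sum_nat_UNIV_swap)
    also have "\<dots> = (\<Sum>m\<le>?a. ((if m = 0 then 0 else hX (m - 1) ?b (?a - m) k l) -
        (if ?a - m = 0 then 0 else hX m ?b (?a - m - 1) k l)) +
        (\<Sum>n\<le>?b. \<Sum>p\<in>UNIV. ge p k m n * ft p l (?a - m) (?b - n)))"
      unfolding sum.distrib sum_telescope_antidiagonal[of "\<lambda>i j. hX i ?b j k l"] by simp
    also have "\<dots> = (\<Sum>m\<le>?a. if m = 0 \<and> ?b = 0 \<and> ?a - m = 0 then kd k l else 0)"
      unfolding cyclic_X ..
    also have "\<dots> = (if ?a = 0 \<and> ?b = 0 then kd k l else 0)"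
    proof (cases "?a = 0")
      case False
      then show ?thesis by (intro trans[OF sum.neutral]) auto
    qed simp
    also have "\<dots> = coef (mat 1 $ k $ l :: (1 + 1, 'r) mps) e"
      unfolding coef_mat_1 e0 by (auto simp: kd_def)
    finally show ?thesis .
  qed
  then show ?thesis by (intro vec_eq_iff[THEN iffD2] allI mps_eqI)
qed

text \<open>Cyclicity alone gives a left inverse. Preimages of the theta_p under the linear part of
  F give a right inverse of the constant term, so \<open>phi\<close> is invertible and its left
  inverse is two-sided.\<close>

lemma gauge_inverses_phi: "gauge_inverses phi (transpose gam)"
proof -
  have "\<forall>p. \<exists>a. F [a] = bas (Theta p)" 
  proof
    show "\<exists>a. F [a] = bas (Theta p)" for p using surjD[OF Fsurj, of "bas (Theta p)"] by (auto intro: sym)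
  qed
  then obtain a where a: "F [a p] = bas (Theta p)" for p
    unfolding choice_iff by blast
  define B where "B = (\<chi> j p. a p $ Theta j)"
  have z: "F [bas g] $ Theta v = 0" if "\<forall>t. g \<noteq> Theta t" for g v
  proof (rule ccontr)
    assume "F [bas g] $ Theta v \<noteq> 0"
    then have "shape (Theta v) = (src g, tgt g, int (deg g) - 1)"
      using F1_homog[of g] unfolding homog_def by blast
    then show False using that by (cases g) (auto simp: shape_def)
  qed
  have ml: "mlin (\<lambda>as. F as $ Theta v)" for v
    by (rule multilinear_mlin[OF Fml])
  have "F [a p] $ Theta v = (\<Sum>j\<in>UNIV. ft v j 0 0 * a p $ Theta j)" for p v
  proof -
    have "F [a p] $ Theta v = (\<Sum>g\<in>UNIV. a p $ g * F [bas g] $ Theta v)"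
      using mlin_bas[OF ml[of v], of "[]" "a p" "[]"] by simp
    also have "\<dots> = (\<Sum>j\<in>UNIV. a p $ Theta j * F [bas (Theta j)] $ Theta v)"
      by (rule sum_gen_Theta) (simp add: z)
    finally show ?thesis by (simp add: ft_def mult.commute)
  qed
  then have "(\<Sum>j\<in>UNIV. ft v j 0 0 * a p $ Theta j) = bas (Theta p) $ Theta v" for p v
    by (simp only: a)
  then have "constant_term phi ** B = mat 1"
    by (simp add: vec_eq_iff matrix_matrix_mult_def constant_term_def coef_phi B_def mat_def bas_def axis_def)
  moreover have left: "constant_term (transpose gam) ** constant_term phi = mat 1"
    by (simp only: constant_term_mult[symmetric] gam_phi constant_term_1)
  ultimately have "constant_term phi ** constant_term (transpose gam) = mat 1"
    by (simp only: matrix_inverse_unique[OF left])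
  with left have "invertible (constant_term phi)"
    unfolding invertible_def by blast
  then obtain \<psi> where "phi ** \<psi> = mat 1" "\<psi> ** phi = mat 1"
    by (auto simp: invertible_constant_term)
  then show ?thesis
    unfolding gauge_inverses_def using matrix_inverse_unique[OF gam_phi, of \<psi>] by simp
qed

lemma ren_mat_1: "ren (vars2 i j) ((mat 1 :: ('n, 'r) gauge) $ p $ q) = (kd p q :: (2 + 2, 'r) mps)"
  by (simp add: mat_def kd_def ren_one)

lemma ph_ga: "(\<Sum>k\<in>UNIV. ph (i::2) j p k * ga i j q k) = kd p q"
proof -
  have "ren (vars2 i j) ((phi ** transpose gam) $ p $ q) = (\<Sum>k\<in>UNIV. ph i j p k * ga i j q k)"
    by (simp add: matrix_matrix_mult_def transpose_def ren_sum ren_mult[OF inj_vars2])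
  then show ?thesis using gauge_inverses_phi by (simp add: gauge_inverses_def ren_mat_1)
qed

lemma ga_ph: "(\<Sum>k\<in>UNIV. ga (i::2) j k p * ph i j k q) = kd p q"
proof -
  have "ren (vars2 i j) ((transpose gam ** phi) $ p $ q) = (\<Sum>k\<in>UNIV. ga i j k p * ph i j k q)"
    by (simp add: matrix_matrix_mult_def transpose_def ren_sum ren_mult[OF inj_vars2])
  then show ?thesis by (simp add: gam_phi ren_mat_1)
qed

text \<open>Contracting with \<open>phi\<close> at (x_2, y_1) cancels the transposed inverse in
  \<open>HX_mult\<close>; what remains is a difference of two substitutions, and x_2 - x_1 can be
  cancelled because it is not a zero divisor.\<close>

lemma ph_HX: "(\<Sum>k\<in>UNIV. ph 2 1 u k * HX k l) = ddiff (vars2 2 1) (Inl 1) (Inl 1) (phi $ u $ l)"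
proof -
  have "(xv 2 - xv 1) * (\<Sum>k\<in>UNIV. ph 2 1 u k * HX k l) = (\<Sum>k\<in>UNIV. ph 2 1 u k * ((xv 2 - xv 1) * HX k l))"
    by (simp add: sum_distrib_left mult_ac)
  also have "\<dots> = ph 2 1 u l - (\<Sum>k\<in>UNIV. ph 2 1 u k * (\<Sum>p\<in>UNIV. ga 2 1 p k * ph 1 1 p l))"
    by (simp only: HX_mult right_diff_distrib sum_subtractf kd_sum)
  also have "\<dots> = ph 2 1 u l - ph 1 1 u l"
    by (simp only: sum_mult_kd_contract[of "ph 2 1" "\<lambda>k q. ga 2 1 q k", OF ph_ga])
  also have "\<dots> = (xv 2 - xv 1) * ddiff (vars2 2 1) (Inl 1) (Inl 1) (phi $ u $ l)"
    using ddiff_mult[of "vars2 (2::2) 1" "Inl 1" "Inl 1" "phi $ u $ l"] by (simp add: inj_vars2 range_vars2 vars2_upd)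
  finally have "(xv 2 - xv 1) * ((\<Sum>k\<in>UNIV. ph 2 1 u k * HX k l) - ddiff (vars2 2 1) (Inl 1) (Inl 1) (phi $ u $ l)) = 0"
    by (simp add: right_diff_distrib)
  then show ?thesis by (auto dest!: mvar_diff_cancel[rotated])
qed

lemma ph_HY: "(\<Sum>k\<in>UNIV. ph 2 1 u k * HY j k) = ddiff (vars2 2 1) (Inr 1) (Inr 2) (phi $ u $ j)"
proof -
  have "(yv 2 - yv 1) * (\<Sum>k\<in>UNIV. ph 2 1 u k * HY j k) = (\<Sum>k\<in>UNIV. ph 2 1 u k * ((yv 2 - yv 1) * HY j k))"
    by (simp add: sum_distrib_left mult_ac)
  also have "\<dots> = (\<Sum>k\<in>UNIV. ph 2 1 u k * (\<Sum>p\<in>UNIV. ga 2 1 p k * ph 2 2 p j)) - (\<Sum>k\<in>UNIV. ph 2 1 u k * kd j k)"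
    by (simp only: HY_mult right_diff_distrib sum_subtractf mult.commute[of "ph 2 2 _ j"])
  also have "\<dots> = ph 2 2 u j - ph 2 1 u j"
    using kd_sum(1)[of j "\<lambda>k. ph (2::2) 1 u k"] by (simp only: sum_mult_kd_contract[of "ph 2 1" "\<lambda>k q. ga 2 1 q k", OF ph_ga] mult.commute)
  also have "\<dots> = (yv 2 - yv 1) * ddiff (vars2 2 1) (Inr 1) (Inr 2) (phi $ u $ j)"
    using ddiff_mult[of "vars2 (2::2) 1" "Inr 2" "Inr 1" "phi $ u $ j"]
    by (simp add: inj_vars2 range_vars2 vars2_upd algebra_simps)
  finally have "(yv 2 - yv 1) * ((\<Sum>k\<in>UNIV. ph 2 1 u k * HY j k) - ddiff (vars2 2 1) (Inr 1) (Inr 2) (phi $ u $ j)) = 0"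
    by (simp add: right_diff_distrib)
  then show ?thesis by (auto dest!: mvar_diff_cancel[rotated])
qed

text \<open>\<open>FE\<close> contracted over the index of the eta with \<open>phi\<close> at (x_2,
  y_1). This removes the inverse matrix and leaves the gauge equation without poles.\<close>

definition GE :: "'n \<Rightarrow> 'n \<Rightarrow> 'n \<Rightarrow> 'n \<Rightarrow> (2 + 2, 'r) mps" where
  "GE v u j l =
    - (\<Sum>p\<in>UNIV. \<Sum>q\<in>UNIV. M'.ms v p u q * (ph 2 2 p j * ph 1 1 q l))
    + ph 2 2 v j * ddiff (vars2 2 1) (Inl 1) (Inl 1) (phi $ u $ l)
    + ph 1 1 v l * ddiff (vars2 2 1) (Inr 1) (Inr 2) (phi $ u $ j)
    - ddiff (vars2 1 1) (Inr 1) (Inr 2) (phi $ v $ l) * ph 2 1 u j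
    + (\<Sum>p\<in>UNIV. \<Sum>q\<in>UNIV. (ph 1 2 v p * ph 2 1 u q) * M.ms p j q l)
    - ddiff (vars2 2 2) (Inl 1) (Inl 1) (phi $ v $ j) * ph 2 1 u l"

lemma gauge_eq_iff_GE: "gauge_eq M.ms M'.ms phi \<longleftrightarrow> (\<forall>v u j l. GE v u j l = 0)"
proof -
  have "x = y - t1 + t2 - t3 + t4 \<longleftrightarrow> - x + t2 + t4 - t3 + y - t1 = 0" for x y t1 t2 t3 t4 :: "(2 + 2, 'r) mps"
    by (auto simp: algebra_simps)
  then show ?thesis unfolding gauge_eq_def GE_def by presburger
qed

lemma ph_FE: "(\<Sum>k\<in>UNIV. ph 2 1 u k * FE v j k l) = GE v u j l"
proof -
  have 1: "(\<Sum>k\<in>UNIV. ph 2 1 u k * (\<Sum>p\<in>UNIV. \<Sum>q\<in>UNIV. \<Sum>r\<in>UNIV. M'.ms v p q r * ph 1 1 r l * ga 2 1 q k * ph 2 2 p j)) =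
      (\<Sum>p\<in>UNIV. \<Sum>q\<in>UNIV. M'.ms v p u q * (ph 2 2 p j * ph 1 1 q l))"
  proof -
    have "(\<Sum>k\<in>UNIV. ph 2 1 u k * (\<Sum>p\<in>UNIV. \<Sum>q\<in>UNIV. \<Sum>r\<in>UNIV. M'.ms v p q r * ph 1 1 r l * ga 2 1 q k * ph 2 2 p j)) =
      (\<Sum>k\<in>UNIV. ph 2 1 u k * (\<Sum>q\<in>UNIV. ga 2 1 q k * (\<Sum>p\<in>UNIV. \<Sum>r\<in>UNIV. M'.ms v p q r * (ph 2 2 p j * ph 1 1 r l))))"
    proof (rule sum.cong[OF refl], rule arg_cong[of _ _ "\<lambda>x. ph 2 1 u _ * x"])
      fix k
      have "(\<Sum>p\<in>UNIV. \<Sum>q\<in>UNIV. \<Sum>r\<in>UNIV. M'.ms v p q r * ph 1 1 r l * ga 2 1 q k * ph 2 2 p j) =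
        (\<Sum>q\<in>UNIV. \<Sum>p\<in>UNIV. \<Sum>r\<in>UNIV. M'.ms v p q r * ph 1 1 r l * ga 2 1 q k * ph 2 2 p j)"
        by (rule sum.swap)
      then show "(\<Sum>p\<in>UNIV. \<Sum>q\<in>UNIV. \<Sum>r\<in>UNIV. M'.ms v p q r * ph 1 1 r l * ga 2 1 q k * ph 2 2 p j) =
        (\<Sum>q\<in>UNIV. ga 2 1 q k * (\<Sum>p\<in>UNIV. \<Sum>r\<in>UNIV. M'.ms v p q r * (ph 2 2 p j * ph 1 1 r l)))"
        by (simp add: sum_distrib_left mult_ac)
    qed
    then show ?thesis by (simp only: sum_mult_kd_contract[of "ph 2 1" "\<lambda>k q. ga 2 1 q k", OF ph_ga])
  qed
  have 2: "(\<Sum>k\<in>UNIV. ph 2 1 u k * (\<Sum>p\<in>UNIV. M.ms p j k l * ph 1 2 v p)) =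
      (\<Sum>p\<in>UNIV. \<Sum>q\<in>UNIV. (ph 1 2 v p * ph 2 1 u q) * M.ms p j q l)"
    unfolding sum_distrib_left by (subst sum.swap) (simp add: mult_ac)
  have 3: "(\<Sum>k\<in>UNIV. ph 2 1 u k * (HX k l * ph 2 2 v j)) = ph 2 2 v j * ddiff (vars2 2 1) (Inl 1) (Inl 1) (phi $ u $ l)"
    unfolding ph_HX[symmetric] sum_distrib_left by (simp add: mult_ac)
  have 4: "(\<Sum>k\<in>UNIV. ph 2 1 u k * (HY j k * ph 1 1 v l)) = ph 1 1 v l * ddiff (vars2 2 1) (Inr 1) (Inr 2) (phi $ u $ j)"
    unfolding ph_HY[symmetric] sum_distrib_left by (simp add: mult_ac)
  have 5: "(\<Sum>k\<in>UNIV. ph 2 1 u k * (kd i k * x)) = x * ph 2 1 u i" for i and x :: "(2 + 2, 'r) mps"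
    using kd_sum(1)[of i "\<lambda>k. x * ph 2 1 u k"] by (simp add: mult_ac)
  have 6: "(\<Sum>k\<in>UNIV. ph 2 1 u k * (kd k i * x)) = x * ph 2 1 u i" for i and x :: "(2 + 2, 'r) mps"
    using kd_sum(2)[of "\<lambda>k. x * ph 2 1 u k" i] by (simp add: mult_ac)
  show ?thesis
    unfolding FE_def GE_def by (simp only: distrib_left right_diff_distrib mult_minus_right sum.distrib sum_subtractf sum_negf 1 2 3 4 5 6)
qed

text \<open>The contraction is undone by the transposed inverse, so no information is lost.\<close>

lemma FE_zero_iff_GE: "(\<forall>v j k l. FE v j k l = 0) \<longleftrightarrow> (\<forall>v u j l. GE v u j l = 0)"
proof
  assume "\<forall>v j k l. FE v j k l = 0"
  then show "\<forall>v u j l. GE v u j l = 0" unfolding ph_FE[symmetric] by simp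
next
  assume GE: "\<forall>v u j l. GE v u j l = 0"
  have "FE v j k l = (\<Sum>u\<in>UNIV. ga 2 1 u k * GE v u j l)" for v j k l
    unfolding ph_FE[symmetric]
    using sum_mult_kd_contract[of "\<lambda>k u. ga 2 1 u k" "ph 2 1" k "\<lambda>k. FE v j k l", OF ga_ph] by simp
  then show "\<forall>v j k l. FE v j k l = 0" using GE by simp
qed

theorem functor_relations_iff_gauge:
  "functor_relations M M' F \<longleftrightarrow> massey_r M' = gauge_transform phi (massey_r M)"
  unfolding M.massey_r_eq M'.massey_r_eq gauge_transform_iff_eq[OF gauge_inverses_phi]
    functor_relations_iff_FE FE_zero_iff_GE gauge_eq_iff_GE ..

end

section \<open>Constructing a functor from a gauge transformation\<close>

lemma sum_gen_Eta:
  assumes "\<And>g :: 'n::finite gen. \<forall>t. g \<noteq> Eta t \<Longrightarrow> f g = (0 :: 'a::comm_monoid_add)"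
  shows "(\<Sum>g\<in>UNIV. f g) = (\<Sum>t\<in>UNIV. f (Eta t))"
proof -
  have "(\<Sum>g\<in>UNIV. f g) = (\<Sum>g\<in>range Eta. f g)"
    by (rule sum.mono_neutral_right) (use assms in auto)
  also have "\<dots> = (\<Sum>t\<in>UNIV. f (Eta t))"
    by (rule sum.reindex[unfolded comp_def]) (simp add: inj_def)
  finally show ?thesis .
qed

lemma composable_run:
  "composable (replicate d (Xi Z) @ g # w) \<longleftrightarrow> composable (g # w) \<and> (d = 0 \<or> tgt g = Z)"
proof (induction d)
  case (Suc d)
  have "tgt (hd (replicate d (Xi Z) @ g # w)) = (if d = 0 then tgt g else Z)" by (cases d) auto
  then show ?case using Suc by (auto simp: composable_Cons)
qed simp

lemma composable_replicate: "composable (replicate d (Xi Z)) \<longleftrightarrow> d > 0"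
proof (induction d)
  case (Suc d)
  then show ?case by (cases d) (simp_all add: composable_Cons)
qed (simp add: composable_def)

lemma composable_Cons_run:
  "composable (g # replicate d (Xi Z)) \<longleftrightarrow> d = 0 \<or> src g = Z"
  by (cases d) (auto simp: composable_Cons composable_replicate)

lemma composable_Cons_run_Cons:
  "composable (g # replicate d (Xi Z) @ h # w) \<longleftrightarrow>
    composable (h # w) \<and> (d = 0 \<or> tgt h = Z) \<and> src g = (if d = 0 then tgt h else Z)"
proof -
  have "tgt (hd (replicate d (Xi Z) @ h # w)) = (if d = 0 then tgt h else Z)" by (cases d) auto
  then show ?thesis using composable_run[of d Z h w] by (auto simp: composable_Cons)
qed

text \<open>
  Solves \<open>p (i - 1) j - p i (j - 1) = q i j\<close>, with value \<open>0\<close> at negative indices, when the antidiagonal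
  sums of \<open>q\<close> vanish.
\<close>

definition tail_sum :: "(nat \<Rightarrow> nat \<Rightarrow> 'a::ab_group_add) \<Rightarrow> nat \<Rightarrow> nat \<Rightarrow> 'a" where
  "tail_sum q i j = (\<Sum>s\<le>j. q (Suc i + s) (j - s))"

text \<open>The recursion holds for every q up to the antidiagonal sum, which enters only at i =
  0.\<close>

lemma tail_sum_diff:
  "(if i = 0 then 0 else tail_sum q (i - 1) j) - (if j = 0 then 0 else tail_sum q i (j - 1)) =
    q i j - (if i = 0 then \<Sum>s\<le>j. q s (j - s) else 0)"
proof -
  have *: "(\<Sum>s\<le>j. q (i + s) (j - s)) = q i j + (if j = 0 then 0 else tail_sum q i (j - 1))"
  proof (cases j)
    case (Suc n)
    show ?thesis unfolding Suc sum.atMost_Suc_shift by (simp add: tail_sum_def)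
  qed simp
  show ?thesis
  proof (cases i)
    case 0
    then show ?thesis using * by simp
  next
    case (Suc n)
    have "tail_sum q n j = q i j + (if j = 0 then 0 else tail_sum q i (j - 1))"
      using * by (simp only: tail_sum_def Suc)
    then show ?thesis by (simp add: Suc)
  qed
qed

lemma ssum_inner:
  assumes "\<And>u. f u [] = 0" "\<And>v. f [] v = (0 :: 'a::comm_monoid_add)"
  shows "ssum f w = (\<Sum>l = 1..length w - 1. f (take l w) (drop l w))"
  unfolding ssum_conv_sum
proof (rule sum.mono_neutral_right)
  show "\<forall>i\<in>{..length w} - {1..length w - 1}. f (take i w) (drop i w) = 0"
  proof
    fix i assume "i \<in> {..length w} - {1..length w - 1}"
    then have "i = 0 \<or> i = length w" by auto
    then show "f (take i w) (drop i w) = 0" using assms by auto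
  qed
qed auto

locale gauge_pair =
  fixes \<phi> \<psi> :: "('n::finite, 'r::comm_ring_1) gauge"
  assumes inverses: "gauge_inverses \<phi> \<psi>"
begin

definition tc :: "'n \<Rightarrow> 'n \<Rightarrow> nat \<Rightarrow> nat \<Rightarrow> 'r" where
  "tc p j a b = coef (\<phi> $ p $ j) (case_sum (\<lambda>_. a) (\<lambda>_. b))"

definition ec :: "'n \<Rightarrow> 'n \<Rightarrow> nat \<Rightarrow> nat \<Rightarrow> 'r" where
  "ec p j a b = coef (\<psi> $ j $ p) (case_sum (\<lambda>_. a) (\<lambda>_. b))"

lemma ec_tc:
  "(\<Sum>m\<le>a. \<Sum>n\<le>b. \<Sum>p\<in>UNIV. ec p k m n * tc p l (a - m) (b - n)) = (if a = 0 \<and> b = 0 then kd k l else 0)"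
proof -
  let ?e = "case_sum (\<lambda>_. a) (\<lambda>_. b) :: 1 + 1 \<Rightarrow> nat"
  have upd: "?e(Inl 1 := m, Inr 1 := n) = case_sum (\<lambda>_. m) (\<lambda>_. n)" for m n
    by (simp add: fun_eq_iff all_11)
  have "coef ((\<psi> ** \<phi>) $ k $ l) ?e = (\<Sum>p\<in>UNIV. \<Sum>m\<le>a. \<Sum>n\<le>b. ec p k m n * tc p l (a - m) (b - n))"
    by (simp add: matrix_matrix_mult_def coef_sum coef_mult_11 upd ec_def tc_def)
  also have "\<dots> = (\<Sum>m\<le>a. \<Sum>n\<le>b. \<Sum>p\<in>UNIV. ec p k m n * tc p l (a - m) (b - n))"
    by (simp only: sum_nat_UNIV_swap)
  finally show ?thesis
    using inverses by (auto simp: gauge_inverses_def coef_mat_1 fun_eq_iff all_11 kd_def)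
qed

lemma tc_ec_0: "(\<Sum>j\<in>UNIV. tc v j 0 0 * ec p j 0 0) = kd v p"
proof -
  have e: "case_sum (\<lambda>_. 0) (\<lambda>_. 0) = (\<lambda>_ :: 1 + 1. 0 :: nat)" by (simp add: fun_eq_iff all_11)
  have "coef ((\<phi> ** \<psi>) $ v $ p) (\<lambda>_. 0) = (\<Sum>j\<in>UNIV. tc v j 0 0 * ec p j 0 0)"
    by (simp add: matrix_matrix_mult_def coef_sum coef_mult_0 ec_def tc_def e)
  then show ?thesis
    using inverses by (simp add: gauge_inverses_def coef_mat_1 kd_def)
qed

text \<open>Solves the cyclicity relation for words from X to X by summing along antidiagonals. The
  total over an antidiagonal is right because the product of \<psi> and \<phi> is the identity
  matrix.\<close>

definition xc :: "nat \<Rightarrow> nat \<Rightarrow> nat \<Rightarrow> 'n \<Rightarrow> 'n \<Rightarrow> 'r" where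
  "xc i b j k l = - tail_sum (\<lambda>i j. \<Sum>m\<le>b. \<Sum>p\<in>UNIV. ec p k i m * tc p l j (b - m)) i j"

definition yc :: "nat \<Rightarrow> nat \<Rightarrow> nat \<Rightarrow> 'n \<Rightarrow> 'n \<Rightarrow> 'r" where
  "yc i b j k l = tail_sum (\<lambda>i j. \<Sum>m\<le>b. \<Sum>p\<in>UNIV. tc p k m i * ec p l (b - m) j) i j"

lemma xc_rel:
  "(if i = 0 then 0 else xc (i - 1) b j k l) - (if j = 0 then 0 else xc i b (j - 1) k l) +
    (\<Sum>m\<le>b. \<Sum>p\<in>UNIV. ec p k i m * tc p l j (b - m)) = (if i = 0 \<and> b = 0 \<and> j = 0 then kd k l else 0)"
proof -
  let ?q = "\<lambda>i j. \<Sum>m\<le>b. \<Sum>p\<in>UNIV. ec p k i m * tc p l j (b - m)"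
  have "(if i = 0 then 0 else xc (i - 1) b j k l) - (if j = 0 then 0 else xc i b (j - 1) k l) =
      - ((if i = 0 then 0 else tail_sum ?q (i - 1) j) - (if j = 0 then 0 else tail_sum ?q i (j - 1)))"
    by (simp add: xc_def)
  also have "\<dots> = - (?q i j - (if i = 0 then (if j = 0 \<and> b = 0 then kd k l else 0) else 0))"
    unfolding tail_sum_diff ec_tc ..
  finally show ?thesis by simp
qed

lemma yc_rel:
  "(if i = 0 then 0 else yc (i - 1) b j k l) - (if j = 0 then 0 else yc i b (j - 1) k l) -
    (\<Sum>m\<le>b. \<Sum>p\<in>UNIV. tc p k m i * ec p l (b - m) j) = - (if i = 0 \<and> b = 0 \<and> j = 0 then kd k l else 0)"
proof -
  let ?q = "\<lambda>i j. \<Sum>m\<le>b. \<Sum>p\<in>UNIV. tc p k m i * ec p l (b - m) j"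
  have "(\<Sum>s\<le>j. ?q s (j - s)) = (\<Sum>m\<le>b. \<Sum>s\<le>j. \<Sum>p\<in>UNIV. tc p k m s * ec p l (b - m) (j - s))"
    by (rule sum.swap)
  also have "\<dots> = (\<Sum>m\<le>b. \<Sum>s\<le>j. \<Sum>p\<in>UNIV. tc p k (b - m) s * ec p l m (j - s))"
    by (rule sum_atMost_swap[of "\<lambda>m m'. \<Sum>s\<le>j. \<Sum>p\<in>UNIV. tc p k m s * ec p l m' (j - s)"])
  also have "\<dots> = (\<Sum>m\<le>b. \<Sum>s\<le>j. \<Sum>p\<in>UNIV. tc p k (b - m) (j - s) * ec p l m s)"
    by (rule sum.cong[OF refl], rule sum_atMost_swap[of "\<lambda>s s'. \<Sum>p\<in>UNIV. tc p k (b - _) s * ec p l _ s'"])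
  also have "\<dots> = (\<Sum>m\<le>b. \<Sum>s\<le>j. \<Sum>p\<in>UNIV. ec p l m s * tc p k (b - m) (j - s))"
    by (simp only: mult.commute)
  also have "\<dots> = (if j = 0 \<and> b = 0 then kd k l else 0)"
    unfolding ec_tc by (auto simp: kd_def)
  finally have q: "(\<Sum>s\<le>j. ?q s (j - s)) = (if j = 0 \<and> b = 0 then kd k l else 0)" .
  have "(if i = 0 then 0 else yc (i - 1) b j k l) - (if j = 0 then 0 else yc i b (j - 1) k l) =
      ?q i j - (if i = 0 then (if j = 0 \<and> b = 0 then kd k l else 0) else 0)"
    unfolding yc_def tail_sum_diff q ..
  then show ?thesis by simp
qed

abbreviation "word_T b j a \<equiv> replicate b (Xi ObY) @ Theta j # replicate a (Xi ObX)"
abbreviation "word_E a j b \<equiv> replicate a (Xi ObX) @ Eta j # replicate b (Xi ObY)"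
abbreviation "word_X i k b l j \<equiv> replicate i (Xi ObX) @ Eta k # replicate b (Xi ObY) @ Theta l # replicate j (Xi ObX)"
abbreviation "word_Y i k b l j \<equiv> replicate i (Xi ObY) @ Theta k # replicate b (Xi ObX) @ Eta l # replicate j (Xi ObY)"

text \<open>The first argument is the output of \<open>runs\<close> and supplies the parameters. As
  it forgets the objects of the runs, the word is compared with the intended one; every other word
  gets 0.\<close>

fun val :: "nat \<times> ('n gen \<times> nat) list \<Rightarrow> 'n gen list \<Rightarrow> ('n, 'r) mor" where
  "val (i, []) w = (if w = [Xi ObX] then bas (Xi ObX) else if w = [Xi ObY] then bas (Xi ObY) else 0)"
| "val (i, [(Id Z, j)]) w = (if w = [Id Z] then bas (Id Z) else 0)"
| "val (i, [(Theta k, j)]) w = (if w = word_T i k j then (\<Sum>p\<in>UNIV. tc p k j i *s bas (Theta p)) else 0)"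
| "val (i, [(Eta k, j)]) w = (if w = word_E i k j then (\<Sum>p\<in>UNIV. ec p k i j *s bas (Eta p)) else 0)"
| "val (i, [(Eta k, b), (Theta l, j)]) w = (if w = word_X i k b l j then xc i b j k l *s bas (Id ObX) else 0)"
| "val (i, [(Theta k, b), (Eta l, j)]) w = (if w = word_Y i k b l j then yc i b j k l *s bas (Id ObY) else 0)"
| "val _ w = 0"

definition fb :: "'n gen list \<Rightarrow> ('n, 'r) mor" where
  "fb w = val (runs w) w"

lemma fb_Nil [simp]: "fb [] = 0"
  by (simp add: fb_def)

lemma fb_Id [simp]: "fb [Id Z] = bas (Id Z)"
  by (simp add: fb_def)

sublocale word_components fb tc ec xc yc
proof unfold_locales
  have "replicate i (Xi Z) = [Xi Z'] \<longleftrightarrow> i = 1 \<and> Z = Z'" for i Z and Z'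
    by (cases i) auto
  then show "fb (replicate i (Xi Z)) = (if i = 1 then bas (Xi Z) else 0)" for i Z
    by (cases Z) (auto simp: fb_def)
qed (simp_all add: fb_def)

lemma fb_nonzero:
  assumes "fb w \<noteq> 0"
  obtains (id) Z where "w = [Id Z]" | (xi) Z where "w = [Xi Z]"
  | (theta) b j a where "w = word_T b j a" | (eta) a j b where "w = word_E a j b"
  | (idX) i k b l j where "w = word_X i k b l j" | (idY) i k b l j where "w = word_Y i k b l j"
proof -
  have "val r w \<noteq> 0 \<Longrightarrow> (\<exists>Z. w = [Id Z]) \<or> (\<exists>Z. w = [Xi Z]) \<or> (\<exists>b j a. w = word_T b j a) \<or> (\<exists>a j b. w = word_E a j b) \<or>
    (\<exists>i k b l j. w = word_X i k b l j) \<or> (\<exists>i k b l j. w = word_Y i k b l j)" for r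
    by (induction r w rule: val.induct) (simp_all only: val.simps split: if_split_asm, blast+)
  from this[of "runs w"] show thesis using that assms unfolding fb_def by blast
qed

definition ends :: "'n gen list \<Rightarrow> obj \<times> obj \<times> int" where
  "ends w = (src (last w), tgt (hd w), sdeg w)"

lemma word_ends:
  "ends (word_T b j a) = (ObX, ObY, - 1)" "ends (word_E a j b) = (ObY, ObX, 0)"
  "ends (word_X a j b l m) = (ObX, ObX, - 1)" "ends (word_Y a j b l m) = (ObY, ObY, - 1)"
  "ends [Id Z] = (Z, Z, - 1)" "ends [Xi Z] = (Z, Z, 0)"
  by (auto simp: ends_def hd_append last_replicate)

lemma word_composable:
  "composable (word_T b j a)" "composable (word_E a j b)"
  "composable (word_X a j b l m)" "composable (word_Y a j b l m)" "composable [g]"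
  by (simp_all add: composable_run composable_Cons_run composable_Cons_run_Cons, simp add: composable_Cons)

lemma fb_composable: "fb w \<noteq> 0 \<Longrightarrow> composable w"
  by (erule fb_nonzero) (simp_all only: word_composable)

lemma homog_lincomb:
  assumes "\<And>p. shape (f p) = \<sigma>"
  shows "homog (\<Sum>p\<in>(UNIV :: 'n set). x p *s bas (f p)) \<sigma>"
  unfolding homog_def
proof (intro allI impI)
  fix h assume "(\<Sum>p\<in>(UNIV :: 'n set). x p *s bas (f p)) $ h \<noteq> 0"
  then obtain p where "x p * bas (f p) $ h \<noteq> 0"
    by (auto simp: sum_component elim: sum.not_neutral_contains_not_neutral)
  then show "shape h = \<sigma>" using assms[of p] by (auto simp: bas_def axis_def split: if_splits)
qed

lemma homog_scale_bas: "shape g = \<sigma> \<Longrightarrow> homog (y *s bas g) \<sigma>" "shape g = \<sigma> \<Longrightarrow> homog (bas g) \<sigma>"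
  by (auto simp: homog_def bas_def axis_def split: if_splits)

lemma fb_homog:
  assumes "fb w \<noteq> 0"
  shows "homog (fb w) (ends w)"
  using assms
proof (cases rule: fb_nonzero)
  case (xi Z)
  show ?thesis unfolding xi word_ends E_run[of 1 Z, simplified] by (rule homog_scale_bas) (simp add: shape_def)
next
  case (id Z)
  show ?thesis unfolding id word_ends fb_Id by (rule homog_scale_bas) (simp add: shape_def)
next
  case theta
  show ?thesis unfolding theta word_ends E_theta by (rule homog_lincomb) (simp add: shape_def)
next
  case eta
  show ?thesis unfolding eta word_ends E_eta by (rule homog_lincomb) (simp add: shape_def)
next
  case idX
  show ?thesis unfolding idX word_ends E_idX by (rule homog_scale_bas) (simp add: shape_def)
next
  case idY
  show ?thesis unfolding idY word_ends E_idY by (rule homog_scale_bas) (simp add: shape_def)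
qed

definition gfun :: "('n, 'r) ops" where
  "gfun = mext fb"

lemma functor_bas [simp]: "gfun (map bas w) = fb w"
  by (simp add: gfun_def)

lemma graded_functor: "graded_ops 1 gfun"
  unfolding graded_ops_def
proof (intro conjI allI impI)
  show "multilinear_ops gfun" unfolding gfun_def by (rule multilinear_mext)
  show "gfun (map bas gs) = 0" if "\<not> composable gs" for gs
    using that fb_composable by auto
  fix gs h assume "gfun (map bas gs) $ h \<noteq> 0"
  then have h: "fb gs $ h \<noteq> 0" by simp
  then have "fb gs \<noteq> 0" by auto
  from fb_homog[OF this] h have "shape h = (src (last gs), tgt (hd gs), sdeg gs)"
    by (simp add: homog_def ends_def)
  then show "src h = src (last gs)" "tgt h = tgt (hd gs)" "int (deg h) = (\<Sum>g\<leftarrow>gs. int (deg g)) + 1 - int (length gs)"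
    by (simp_all add: shape_def sum_deg_eq_sdeg)
qed

lemma functor_unary: "gfun [a] = (\<Sum>g\<in>UNIV. a $ g *s fb [g])"
  by (simp add: gfun_def)

lemma unital_functor_functor: "unital_functor gfun"
  unfolding unital_functor_def
proof (intro conjI allI impI)
  show "gfun [bas (Id Z)] = bas (Id Z)" for Z
    using functor_bas[of "[Id Z]"] by simp
  fix as :: "('n, 'r) mor list" and Z
  assume as: "length as \<ge> 2 \<and> bas (Id Z) \<in> set as"
  have "fb gs = 0" if "length gs = length as" "Id Z \<in> set gs" for gs
  proof (rule ccontr)
    assume "fb gs \<noteq> 0"
    then show False by (cases rule: fb_nonzero) (use that as in auto)
  qed
  then have z: "gfun (map bas gs) $ h = 0" if "length gs = length as" "Id Z \<in> set gs" for gs h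
    using that by simp
  have "gfun as $ h = 0" for h
  proof (rule mlin_member[where A = "\<lambda>as. gfun as $ h" and g = "Id Z"])
    show "mlin (\<lambda>as. gfun as $ h)"
      by (rule multilinear_mlin[OF graded_multilinear[OF graded_functor]])
    show "bas (Id Z) \<in> set as" using as by (rule conjunct2)
  qed (rule z)
  then show "gfun as = 0" by (simp add: vec_eq_iff)
qed

lemma fb_letters:
  "fb [Xi Z] = bas (Xi Z)" "fb [Theta j] = (\<Sum>p\<in>UNIV. tc p j 0 0 *s bas (Theta p))"
  "fb [Eta j] = (\<Sum>p\<in>UNIV. ec p j 0 0 *s bas (Eta p))"
  using E_run[of 1 Z] E_theta[of 0 j 0] E_eta[of 0 j 0] by simp_all

lemma pairing_fb_letters: "pairing (fb [g]) (fb [h]) = pairing_bas g h"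
proof -
  have 1: "(\<Sum>p\<in>UNIV. ec p k 0 0 * tc p l 0 0) = kd k l" for k l
    using ec_tc[of k l 0 0] by simp
  have 2: "(\<Sum>p\<in>UNIV. tc p l 0 0 * ec p k 0 0) = kd k l" for k l
    using 1[of k l] by (simp only: mult.commute)
  have z: "pairing (\<Sum>p\<in>UNIV. x p *s bas (f p)) (bas g) = 0" "pairing (bas g) (\<Sum>p\<in>UNIV. x p *s bas (f p)) = 0"
    "pairing (\<Sum>p\<in>UNIV. x p *s bas (f p)) (\<Sum>p\<in>UNIV. y p *s bas (f p)) = 0"
    if "\<forall>p. pairing_bas (f p) g = (0 :: 'r)" "\<forall>p. pairing_bas g (f p) = (0 :: 'r)" "\<forall>p q. pairing_bas (f p) (f q) = (0 :: 'r)"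
    for f :: "'n \<Rightarrow> 'n gen" and g and x y :: "'n \<Rightarrow> 'r"
    using that by (simp_all add: pairing_sum_left pairing_sum_right)
  show ?thesis
    by (cases g; cases h)
       (simp_all add: fb_letters pairing_components 1 2 z[where f = Theta] z[where f = Eta] z(3)[where f = Theta and g = "Id ObX"]
          z(3)[where f = Eta and g = "Id ObX"], auto simp: kd_def)
qed

lemma pairing_functor: "pairing (gfun [a]) (gfun [b]) = pairing a b"
proof -
  have "pairing (gfun [a]) (gfun [b]) = (\<Sum>h\<in>UNIV. \<Sum>g\<in>UNIV. a $ g * b $ h * pairing_bas g h)"
    by (simp add: functor_unary pairing_sum_left pairing_sum_right pairing_fb_letters sum_distrib_left mult_ac)
  also have "\<dots> = pairing a b"
    unfolding pairing_def by (rule sum.swap)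
  finally show ?thesis .
qed

lemma word_concat:
  "word_T b j a @ word_E a' k b' = word_Y b j (a + a') k b'"
  "word_E a j b @ word_T b' k a' = word_X a j (b + b') k a'"
  "[Xi ObX] @ word_X i k b l j' = word_X (Suc i) k b l j'"
  "word_X i k b l j' @ [Xi ObX] = word_X i k b l (Suc j')"
  "[Xi ObY] @ word_Y i k b l j' = word_Y (Suc i) k b l j'"
  "word_Y i k b l j' @ [Xi ObY] = word_Y i k b l (Suc j')"
  by (simp_all add: replicate_add replicate_append_same)

text \<open>By sources, targets and the total -1, only a xi with an identity-valued word or a theta
  word with an eta word can pair. Their concatenations are the words for which \<open>xc_rel\<close>
  and \<open>yc_rel\<close> hold.\<close>

lemma pairing_fb_nonzero:
  assumes "pairing (fb u) (fb v) \<noteq> 0" "length (u @ v) \<ge> 3"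
  shows "(\<exists>i k b l j. u @ v = word_X i k b l j) \<or> (\<exists>i k b l j. u @ v = word_Y i k b l j)"
proof -
  have u: "fb u \<noteq> 0" and v: "fb v \<noteq> 0" using assms(1) by auto
  have *: "fst (ends u) = fst (snd (ends v)) \<and> fst (snd (ends u)) = fst (ends v) \<and>
      snd (snd (ends u)) + snd (snd (ends v)) = - 1"
    using pairing_homog[OF fb_homog[OF u, unfolded ends_def] fb_homog[OF v, unfolded ends_def] assms(1)]
    by (simp add: ends_def)
  from u show ?thesis
  proof (cases rule: fb_nonzero)
    case id
    from v show ?thesis
    proof (cases rule: fb_nonzero)
      case xi
      show ?thesis using assms(2) unfolding id xi by simp
    qed (rule FalseE, use * in \<open>simp add: id word_ends\<close>)+
  next
    case (xi Z)
    from v show ?thesis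
    proof (cases rule: fb_nonzero)
      case id
      show ?thesis using assms(2) unfolding id xi by simp
    next
      case idX
      have Z: "Z = ObX" using * unfolding xi idX word_ends by simp
      show ?thesis unfolding idX xi Z word_concat by blast
    next
      case idY
      have Z: "Z = ObY" using * unfolding xi idY word_ends by simp
      show ?thesis unfolding idY xi Z word_concat by blast
    qed (rule FalseE, use * in \<open>simp add: xi word_ends\<close>)+
  next
    case theta
    from v show ?thesis
    proof (cases rule: fb_nonzero)
      case eta
      show ?thesis unfolding theta eta word_concat by blast
    qed (rule FalseE, use * in \<open>simp add: theta word_ends\<close>)+
  next
    case eta
    from v show ?thesis
    proof (cases rule: fb_nonzero)
      case theta
      show ?thesis unfolding theta eta word_concat by blast
    qed (rule FalseE, use * in \<open>simp add: eta word_ends\<close>)+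
  next
    case idX
    from v show ?thesis
    proof (cases rule: fb_nonzero)
      case (xi Z)
      have Z: "Z = ObX" using * unfolding idX xi word_ends by simp
      show ?thesis unfolding idX xi Z word_concat by blast
    qed (rule FalseE, use * in \<open>simp add: idX word_ends\<close>)+
  next
    case idY
    from v show ?thesis
    proof (cases rule: fb_nonzero)
      case (xi Z)
      have Z: "Z = ObY" using * unfolding idY xi word_ends by simp
      show ?thesis unfolding idY xi Z word_concat by blast
    qed (rule FalseE, use * in \<open>simp add: idY word_ends\<close>)+
  qed
qed

lemma cyclic_functor_functor: "cyclic_functor gfun"
  unfolding cyclic_functor_def
proof (intro conjI allI impI)
  show "pairing (gfun [a]) (gfun [b]) = pairing a b" for a b
    by (rule pairing_functor)
  fix w :: "'n gen list"
  assume w: "cyc_composable w \<and> length w \<ge> 3"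
  have "ssum (\<lambda>u v. pairing (fb u) (fb v)) w = 0"
  proof (rule ccontr)
    assume nz: "\<not> ?thesis"
    then obtain u v where "u @ v = w" "pairing (fb u) (fb v) \<noteq> 0"
      using ssum_neutral[of w "\<lambda>u v. pairing (fb u) (fb v)"] by blast
    then have "(\<exists>i k b l j. w = word_X i k b l j) \<or> (\<exists>i k b l j. w = word_Y i k b l j)"
      using pairing_fb_nonzero[of u v] w by blast
    then show False
    proof (elim disjE exE)
      fix i k b l j assume X: "w = word_X i k b l j"
      then have "\<not> (i = 0 \<and> b = 0 \<and> j = 0)" using w by auto
      then show False using nz unfolding X ssum_X xc_rel by (simp only: if_False simp_thms)
    next
      fix i k b l j assume Y: "w = word_Y i k b l j"
      then have "\<not> (i = 0 \<and> b = 0 \<and> j = 0)" using w by auto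
      then show False using nz unfolding Y ssum_Y yc_rel by (simp only: if_False simp_thms minus_zero)
    qed
  qed
  then show "(\<Sum>l = 1..length w - 1. pairing (gfun (map bas (take l w))) (gfun (map bas (drop l w)))) = 0"
    by (subst (asm) ssum_inner) simp_all
qed

lemma functor_component:
  "gfun [a] $ Id Z = a $ Id Z" "gfun [a] $ Xi Z = a $ Xi Z"
  "gfun [a] $ Theta v = (\<Sum>j\<in>UNIV. a $ Theta j * tc v j 0 0)"
  "gfun [a] $ Eta v = (\<Sum>j\<in>UNIV. a $ Eta j * ec v j 0 0)"
proof -
  have c: "gfun [a] $ h = (\<Sum>g\<in>UNIV. a $ g * fb [g] $ h)" for h
    by (simp add: functor_unary sum_component)
  have I: "fb [g] $ Id Z = (if g = Id Z then 1 else 0)" "fb [g] $ Xi Z = (if g = Xi Z then 1 else 0)" for g Z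
    by (cases g; auto simp: fb_letters bas_def axis_def sum_component)+
  show "gfun [a] $ Id Z = a $ Id Z" "gfun [a] $ Xi Z = a $ Xi Z"
    unfolding c I by (simp_all add: if_distrib cong: if_cong)
  have T: "fb [g] $ Theta v = (case g of Theta j \<Rightarrow> tc v j 0 0 | _ \<Rightarrow> 0)" for g
    by (cases g) (auto simp: fb_letters bas_def axis_def sum_component if_distrib cong: if_cong)
  have E: "fb [g] $ Eta v = (case g of Eta j \<Rightarrow> ec v j 0 0 | _ \<Rightarrow> 0)" for g
    by (cases g) (auto simp: fb_letters bas_def axis_def sum_component if_distrib cong: if_cong)
  show "gfun [a] $ Theta v = (\<Sum>j\<in>UNIV. a $ Theta j * tc v j 0 0)"
    unfolding c T by (subst sum_gen_Theta) (auto split: gen.split)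
  show "gfun [a] $ Eta v = (\<Sum>j\<in>UNIV. a $ Eta j * ec v j 0 0)"
    unfolding c E by (subst sum_gen_Eta) (auto split: gen.split)
qed

lemma bij_functor: "bij (\<lambda>a. gfun [a])"
proof (rule bijI)
  show "inj (\<lambda>a. gfun [a])"
  proof (rule injI)
    fix a b assume "gfun [a] = gfun [b]"
    then have eq: "pairing c a = pairing c b" for c by (metis pairing_functor)
    have "pairing (bas c) (a - b) = 0" for c
      using eq[of "bas c"] by (simp add: pairing_bas_left right_diff_distrib)
    then have "a - b = 0" by (rule pairing_nondeg)
    then show "a = b" by simp
  qed
  show "surj (\<lambda>a. gfun [a])"
  proof (rule surjI)
    fix x :: "('n, 'r) mor"
    \<comment> \<open>The preimage uses the inverse constant terms: thetas are transformed by \<phi>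
      and hence need \<psi>, while for etas, transformed by the transpose of \<psi>, it is the other
      way round.\<close>
    let ?a = "\<chi> g. case g of Theta j \<Rightarrow> \<Sum>p\<in>UNIV. ec p j 0 0 * x $ Theta p
      | Eta j \<Rightarrow> \<Sum>p\<in>UNIV. tc p j 0 0 * x $ Eta p | _ \<Rightarrow> x $ g"
    have 1: "(\<Sum>j\<in>UNIV. (\<Sum>p\<in>UNIV. ec p j 0 0 * x $ Theta p) * tc v j 0 0) = x $ Theta v" for v
    proof -
      have "(\<Sum>j\<in>UNIV. (\<Sum>p\<in>UNIV. ec p j 0 0 * x $ Theta p) * tc v j 0 0) =
          (\<Sum>p\<in>UNIV. (\<Sum>j\<in>UNIV. tc v j 0 0 * ec p j 0 0) * x $ Theta p)"
        unfolding sum_distrib_right by (subst sum.swap) (simp add: mult_ac)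
      then show ?thesis by (simp only: tc_ec_0 kd_sum)
    qed
    have 2: "(\<Sum>j\<in>UNIV. (\<Sum>p\<in>UNIV. tc p j 0 0 * x $ Eta p) * ec v j 0 0) = x $ Eta v" for v
    proof -
      have "(\<Sum>j\<in>UNIV. (\<Sum>p\<in>UNIV. tc p j 0 0 * x $ Eta p) * ec v j 0 0) =
          (\<Sum>p\<in>UNIV. x $ Eta p * (\<Sum>j\<in>UNIV. tc p j 0 0 * ec v j 0 0))"
        unfolding sum_distrib_right sum_distrib_left by (subst sum.swap) (simp add: mult_ac)
      then show ?thesis by (simp only: tc_ec_0 kd_sum)
    qed
    have "gfun [?a] $ h = x $ h" for h
      by (cases h) (simp_all add: functor_component 1 2)
    then show "gfun [?a] = x" by (simp add: vec_eq_iff)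
  qed
qed

lemma functor_strict:
  assumes "constant_term \<phi> = mat 1"
  shows "gfun [a] = a"
proof -
  have e: "case_sum (\<lambda>_. 0) (\<lambda>_. 0) = (\<lambda>_ :: 1 + 1. 0 :: nat)" by (simp add: fun_eq_iff all_11)
  have "constant_term (\<phi> ** \<psi>) = mat 1"
    using inverses by (simp add: gauge_inverses_def constant_term_1)
  then have \<psi>: "constant_term \<psi> = mat 1"
    by (simp add: constant_term_mult assms matrix_mul_lid)
  have "tc p j 0 0 = kd j p" for p j
    using arg_cong[OF assms, of "\<lambda>A. A $ p $ j"] by (auto simp: tc_def e constant_term_def mat_def kd_def)
  moreover have "ec p j 0 0 = kd j p" for p j
    using arg_cong[OF \<psi>, of "\<lambda>A. A $ j $ p"] by (auto simp: ec_def e constant_term_def mat_def kd_def)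
  ultimately have "gfun [a] $ h = a $ h" for h
    by (cases h) (simp_all only: functor_component kd_sum)
  then show ?thesis by (simp add: vec_eq_iff)
qed

lemma cyclic_map_functor: "pre_structure M \<Longrightarrow> pre_structure M' \<Longrightarrow> cyclic_map M M' gfun"
  unfolding cyclic_map_def cyclic_map_axioms_def
  using graded_functor unital_functor_functor cyclic_functor_functor bij_functor by (simp add: bij_is_surj)

lemma phi_functor:
  fixes M M' :: "('n, 'r) ops"
  assumes "pre_structure M" "pre_structure M'"
  shows "cyclic_map.phi gfun = \<phi>"
proof -
  interpret F: cyclic_map M M' gfun by (rule cyclic_map_functor[OF assms])
  have e: "case_sum (\<lambda>_. e (Inl 1)) (\<lambda>_. e (Inr 1)) = e" for e :: "1 + 1 \<Rightarrow> nat"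
    by (simp add: fun_eq_iff all_11)
  have "F.ft p j a b = tc p j a b" for p j a b
    unfolding F.ft_def functor_bas E_theta by (simp add: sum_component bas_def axis_def if_distrib cong: if_cong)
  then show ?thesis
    by (simp add: vec_eq_iff mps_eq_iff F.coef_phi tc_def e)
qed

end

section \<open>The bijection on equivalence classes\<close>

text \<open>R is the pullback of S along the bijection f, so it inherits being an equivalence
  relation and the classes correspond. The last claim says that the map on classes is induced by f
  on representatives.\<close>

lemma quotient_bij:
  assumes f: "bij_betw f A B" and S: "equiv B S" and R: "R = {(a, b). a \<in> A \<and> b \<in> A \<and> (f a, f b) \<in> S}"
  shows "equiv A R" "bij_betw (\<lambda>C. S `` (f ` C)) (A // R) (B // S)"
    and "\<And>a. a \<in> A \<Longrightarrow> S `` (f ` (R `` {a})) = S `` {f a}"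
proof -
  have fA: "a \<in> A \<Longrightarrow> f a \<in> B" for a using f by (auto simp: bij_betw_def)
  have surj: "y \<in> B \<Longrightarrow> \<exists>a\<in>A. y = f a" for y using f by (auto simp: bij_betw_def)
  have sub: "(y, z) \<in> S \<Longrightarrow> y \<in> B \<and> z \<in> B" for y z using equiv_type[OF S] by blast
  have sym: "(y, z) \<in> S \<Longrightarrow> (z, y) \<in> S" for y z
    using S by (meson equivE symE)
  have trans: "(y, z) \<in> S \<Longrightarrow> (z, x) \<in> S \<Longrightarrow> (y, x) \<in> S" for x y z
    using S by (meson equivE transE)
  have refl: "y \<in> B \<Longrightarrow> (y, y) \<in> S" for y
    using S by (meson equivE refl_onD)
  show equiv: "equiv A R"
    by (rule equivI) (auto simp: R refl_on_def sym_def trans_def intro: refl fA sym trans)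
  show cls: "S `` (f ` (R `` {a})) = S `` {f a}" if a: "a \<in> A" for a
  proof
    show "S `` (f ` (R `` {a})) \<subseteq> S `` {f a}"
      using trans by (auto simp: R)
    show "S `` {f a} \<subseteq> S `` (f ` (R `` {a}))"
      using refl[OF fA[OF a]] a by (auto simp: R)
  qed
  show "bij_betw (\<lambda>C. S `` (f ` C)) (A // R) (B // S)"
    unfolding bij_betw_def
  proof
    show "inj_on (\<lambda>C. S `` (f ` C)) (A // R)"
    proof (rule inj_onI)
      fix C D assume "C \<in> A // R" "D \<in> A // R" and eq: "S `` (f ` C) = S `` (f ` D)"
      then obtain a b where ab: "a \<in> A" "C = R `` {a}" "b \<in> A" "D = R `` {b}"
        by (auto elim!: quotientE)
      then have "S `` {f a} = S `` {f b}" using eq cls by simp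
      then have "(f a, f b) \<in> S" using refl[OF fA[OF ab(3)]] by auto
      then have "(a, b) \<in> R" using ab by (simp add: R)
      then show "C = D" unfolding ab by (rule equiv_class_eq[OF equiv])
    qed
    show "(\<lambda>C. S `` (f ` C)) ` (A // R) = B // S"
    proof
      show "(\<lambda>C. S `` (f ` C)) ` (A // R) \<subseteq> B // S"
        using fA cls by (auto elim!: quotientE intro!: quotientI)
      show "B // S \<subseteq> (\<lambda>C. S `` (f ` C)) ` (A // R)"
      proof
        fix D assume "D \<in> B // S"
        then obtain y where "y \<in> B" "D = S `` {y}" by (auto elim: quotientE)
        then obtain a where "a \<in> A" "D = S `` {f a}" using surj by blast
        then show "D \<in> (\<lambda>C. S `` (f ` C)) ` (A // R)"
          using cls quotientI[of a A R] by (metis image_eqI)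
      qed
    qed
  qed
qed

lemma cyclic_equivalence_map:
  assumes "M \<in> ainf_structures" "M' \<in> ainf_structures" "cyclic_equivalence M M' F"
  shows "cyclic_map M M' F"
  using assms by (auto simp: cyclic_map_def cyclic_map_axioms_def ainf_structures_iff cyclic_equivalence_def bij_is_surj)

lemma gauge_functor:
  fixes M M' :: "('n::finite, 'r::comm_ring_1) ops"
  assumes "M \<in> ainf_structures" "M' \<in> ainf_structures" "gauge_inverses \<phi> \<psi>"
    and "massey_r M' = gauge_transform \<phi> (massey_r M)"
  shows "cyclic_equivalence M M' (gauge_pair.gfun \<phi> \<psi>)"
proof -
  interpret gauge_pair \<phi> \<psi> by unfold_locales (rule assms)
  have pre: "pre_structure M" "pre_structure M'"
    using assms by (simp_all add: ainf_structures_iff)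
  show ?thesis
    using assms(4) graded_functor unital_functor_functor cyclic_functor_functor bij_functor
      cyclic_map.functor_relations_iff_gauge[OF cyclic_map_functor[OF pre]]
    by (simp add: cyclic_equivalence_def phi_functor[OF pre])
qed

lemma cyclic_equivalence_iff:
  fixes M M' :: "('n::finite, 'r::comm_ring_1) ops"
  assumes "M \<in> ainf_structures" "M' \<in> ainf_structures"
  shows "(\<exists>F. cyclic_equivalence M M' F) \<longleftrightarrow>
    (\<exists>\<phi>. invertible (gauge_constant_term \<phi>) \<and> massey_r M' = gauge_transform \<phi> (massey_r M))"
proof
  assume "\<exists>F. cyclic_equivalence M M' F"
  then obtain F where F: "cyclic_equivalence M M' F" by blast
  interpret cyclic_map M M' F by (rule cyclic_equivalence_map[OF assms F])
  have "invertible (gauge_constant_term phi)"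
    using gauge_inverses_phi by (auto simp: gauge_invertible_iff)
  moreover have "massey_r M' = gauge_transform phi (massey_r M)"
    using F functor_relations_iff_gauge by (simp add: cyclic_equivalence_def)
  ultimately show "\<exists>\<phi>. invertible (gauge_constant_term \<phi>) \<and> massey_r M' = gauge_transform \<phi> (massey_r M)"
    by blast
next
  assume "\<exists>\<phi>. invertible (gauge_constant_term \<phi>) \<and> massey_r M' = gauge_transform \<phi> (massey_r M)"
  then obtain \<phi> \<psi> where "gauge_inverses \<phi> \<psi>" "massey_r M' = gauge_transform \<phi> (massey_r M)"
    by (auto simp: gauge_invertible_iff)
  from gauge_functor[OF assms this] show "\<exists>F. cyclic_equivalence M M' F" by blast
qed

text \<open>If the linear part of F is the identity, \<open>phi\<close> has constant term 1.
  Conversely constant term 1 of \<phi> forces the same for its inverse, so the constructed functor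
  fixes the etas as well as the thetas.\<close>

lemma strict_cyclic_equivalence_iff:
  fixes M M' :: "('n::finite, 'r::comm_ring_1) ops"
  assumes "M \<in> ainf_structures" "M' \<in> ainf_structures"
  shows "(\<exists>F. cyclic_equivalence M M' F \<and> (\<forall>a. F [a] = a)) \<longleftrightarrow>
    (\<exists>\<phi>. gauge_strict \<phi> \<and> massey_r M' = gauge_transform \<phi> (massey_r M))"
proof
  assume "\<exists>F. cyclic_equivalence M M' F \<and> (\<forall>a. F [a] = a)"
  then obtain F where F: "cyclic_equivalence M M' F" and id: "\<And>a. F [a] = a" by blast
  interpret cyclic_map M M' F by (rule cyclic_equivalence_map[OF assms F])
  have "constant_term phi = mat 1"
    by (simp add: vec_eq_iff constant_term_def coef_phi ft_def id bas_def axis_def mat_def)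
  then have "gauge_strict phi" by (simp add: gauge_strict_iff)
  moreover have "massey_r M' = gauge_transform phi (massey_r M)"
    using F functor_relations_iff_gauge by (simp add: cyclic_equivalence_def)
  ultimately show "\<exists>\<phi>. gauge_strict \<phi> \<and> massey_r M' = gauge_transform \<phi> (massey_r M)"
    by blast
next
  assume "\<exists>\<phi>. gauge_strict \<phi> \<and> massey_r M' = gauge_transform \<phi> (massey_r M)"
  then obtain \<phi> where \<phi>: "gauge_strict \<phi>" and r: "massey_r M' = gauge_transform \<phi> (massey_r M)" by blast
  then obtain \<psi> where inv: "gauge_inverses \<phi> \<psi>" using gauge_strict_invertible by blast
  interpret gauge_pair \<phi> \<psi> by unfold_locales (rule inv)
  have "gfun [a] = a" for a
    using \<phi> functor_strict by (simp add: gauge_strict_iff)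
  then show "\<exists>F. cyclic_equivalence M M' F \<and> (\<forall>a. F [a] = a)"
    using gauge_functor[OF assms inv r] by blast
qed

lemma ainf_equiv_massey:
  "(ainf_equiv :: (('n::finite, 'r::comm_ring_1) ops \<times> _) set) = {(M, M'). M \<in> ainf_structures \<and> M' \<in> ainf_structures \<and>
    (massey_r M, massey_r M') \<in> AYBE_general_equiv}"
  "(ainf_strict_equiv :: (('n::finite, 'r::comm_ring_1) ops \<times> _) set) = {(M, M'). M \<in> ainf_structures \<and> M' \<in> ainf_structures \<and>
    (massey_r M, massey_r M') \<in> AYBE_strict_equiv}"
proof -
  have r: "massey_r M \<in> AYBE_solutions" if "M \<in> ainf_structures" for M :: "('n, 'r) ops"
    using bij_massey_r that by (auto simp: bij_betw_def)
  have "(M, M') \<in> ainf_equiv \<longleftrightarrow> (massey_r M, massey_r M') \<in> AYBE_general_equiv"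
    "(M, M') \<in> ainf_strict_equiv \<longleftrightarrow> (massey_r M, massey_r M') \<in> AYBE_strict_equiv"
    if "M \<in> ainf_structures" "M' \<in> ainf_structures" for M M' :: "('n, 'r) ops"
    using that by (simp_all add: ainf_equiv_def ainf_strict_equiv_def AYBE_general_equiv_def AYBE_strict_equiv_def r
      cyclic_equivalence_iff strict_cyclic_equivalence_iff)
  moreover have "(ainf_equiv :: (('n, 'r) ops \<times> _) set) \<subseteq> ainf_structures \<times> ainf_structures"
    "(ainf_strict_equiv :: (('n, 'r) ops \<times> _) set) \<subseteq> ainf_structures \<times> ainf_structures"
    by (auto simp: ainf_equiv_def ainf_strict_equiv_def)
  ultimately show
    "(ainf_equiv :: (('n, 'r) ops \<times> _) set) = {(M, M'). M \<in> ainf_structures \<and> M' \<in> ainf_structures \<and>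
      (massey_r M, massey_r M') \<in> AYBE_general_equiv}"
    "(ainf_strict_equiv :: (('n, 'r) ops \<times> _) set) = {(M, M'). M \<in> ainf_structures \<and> M' \<in> ainf_structures \<and>
      (massey_r M, massey_r M') \<in> AYBE_strict_equiv}"
    by blast+
qed

theorem theoremA:
  fixes scale :: "'k::field \<Rightarrow> 'r::comm_ring_1 \<Rightarrow> 'r"
  assumes "vector_space scale"
    and "\<And>c a b. scale c (a * b) = scale c a * b"
  shows "equiv ainf_structures (ainf_strict_equiv :: (('n::finite, 'r) ops \<times> _) set) \<and>
    equiv AYBE_solutions (AYBE_strict_equiv :: (('n, (2, 'r) mero) mat2 \<times> _) set) \<and>
    (\<forall>M :: ('n, 'r) ops. M \<in> ainf_structures \<longrightarrow>
      AYBE_strict_equiv `` (massey_r ` (ainf_strict_equiv `` {M})) =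
      AYBE_strict_equiv `` {massey_r M}) \<and>
    bij_betw (\<lambda>C :: ('n, 'r) ops set. AYBE_strict_equiv `` (massey_r ` C))
      (ainf_structures // ainf_strict_equiv) (AYBE_solutions // AYBE_strict_equiv) \<and>
    equiv ainf_structures (ainf_equiv :: (('n, 'r) ops \<times> _) set) \<and>
    equiv AYBE_solutions (AYBE_general_equiv :: (('n, (2, 'r) mero) mat2 \<times> _) set) \<and>
    (\<forall>M M' :: ('n, 'r) ops. M \<in> ainf_structures \<longrightarrow> M' \<in> ainf_structures \<longrightarrow>
      ((M, M') \<in> ainf_equiv \<longleftrightarrow> (massey_r M, massey_r M') \<in> AYBE_general_equiv)) \<and>
    bij_betw (\<lambda>C :: ('n, 'r) ops set. AYBE_general_equiv `` (massey_r ` C))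
      (ainf_structures // ainf_equiv) (AYBE_solutions // AYBE_general_equiv)"
proof (intro conjI allI impI)
  note s = quotient_bij[OF bij_massey_r equiv_AYBE_strict ainf_equiv_massey(2)]
  note g = quotient_bij[OF bij_massey_r equiv_AYBE_general ainf_equiv_massey(1)]
  show "equiv ainf_structures (ainf_strict_equiv :: (('n, 'r) ops \<times> _) set)"
    "bij_betw (\<lambda>C :: ('n, 'r) ops set. AYBE_strict_equiv `` (massey_r ` C))
      (ainf_structures // ainf_strict_equiv) (AYBE_solutions // AYBE_strict_equiv)"
    by (rule s)+
  show "AYBE_strict_equiv `` (massey_r ` (ainf_strict_equiv `` {M})) = AYBE_strict_equiv `` {massey_r M}"
    if "M \<in> ainf_structures" for M :: "('n, 'r) ops"
    using that by (rule s(3))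
  show "equiv ainf_structures (ainf_equiv :: (('n, 'r) ops \<times> _) set)"
    "bij_betw (\<lambda>C :: ('n, 'r) ops set. AYBE_general_equiv `` (massey_r ` C))
      (ainf_structures // ainf_equiv) (AYBE_solutions // AYBE_general_equiv)"
    by (rule g)+
  show "(M, M') \<in> ainf_equiv \<longleftrightarrow> (massey_r M, massey_r M') \<in> AYBE_general_equiv"
    if "M \<in> ainf_structures" "M' \<in> ainf_structures" for M M' :: "('n, 'r) ops"
    using that by (simp add: ainf_equiv_massey)
qed (rule equiv_AYBE_strict equiv_AYBE_general)+

end
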